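(* Let $k$ be a field of characteristic zero, let $0<p<q$ be relatively prime integers, let $V$ be the affine toric surface over $k$ defined by the cone $\sigma$ generated by $(1,0)$ and $(p,q)$, with zero-dimensional orbit $O$, and let $(b_1,\dots,b_s)$ be the entries of the Hirzebruch–Jung continued fraction of $q/(q-p)$. The minimal toric resolution of $V$ factors into a sequence of blow-ups of zero-dimensional orbits, as follows. (1) The blow-up of $V$ at $O$ is the toric modification corresponding to the subdivision $\Sigma$ of $\sigma$ obtained by inserting $v_1$, $v_s$, and all $v_i$ ($1<i<s$) with $b_i\neq2$. (2) The singularities of this blow-up are rational double points of type $A_c$, one for each maximal sequence of consecutive $2$'s in $(b_2,\dots,b_{s-1})$, where $c$ is the length of the sequence. In particular the blow-up of $O$ is a resolution if and only if all $b_i$ with $i\ne1,s$ are different from $2$. (3) Each such singularity of type $A_c$ is resolved by blowing up the zero-dimensional orbit corresponding to the associated singular cone (which inserts two vectors, or one if $c=1$) and repeating this procedure on the remaining singularity, using $\lceil c/2\rceil$ blow-ups in total; after doing this for all singularities one obtains the minimal resolution of $V$.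
   Context: The lattice is $N=\mathbb{Z}^2$. Hirzebruch–Jung continued fraction: $q/(q-p)=b_1-1/(b_2-1/(\cdots-1/b_s))$ with all $b_i\ge2$ integers. Put $v_0=(1,0)$, $v_1=(1,1)$, and $v_{j+1}=b_jv_j-v_{j-1}$ for $1\le j\le s$, so $v_{s+1}=(p,q)$. The minimal resolution of $V$ is the toric modification given by the subdivision of $\sigma$ by the rays through $v_1,\dots,v_s$. A cone is simple if it is generated by part of a $\mathbb{Z}$-basis of $N$; a singular cone is one that is not simple. *)

theory Defs
  imports
    "HOL-Analysis.Analysis"
    "HOL-Computational_Algebra.Computational_Algebra"
    "HOL-Algebra.Ring_Divisibility"
    "HOL-Algebra.Ideal_Product"
    "HOL-Algebra.QuotRing"
begin

section \<open>Local rings\<close>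

definition ring_of :: "'a::comm_ring_1 set \<Rightarrow> 'a ring" where
  "ring_of A = \<lparr>carrier = A, mult = (*), one = 1, zero = 0, add = (+)\<rparr>"

definition nonunits :: "('a, 'b) ring_scheme \<Rightarrow> 'a set" where
  "nonunits R = carrier R - Units R"

definition local_ring :: "('a, 'b) ring_scheme \<Rightarrow> bool" where
  "local_ring R \<longleftrightarrow> cring R \<and> ideal (nonunits R) R"

definition krull_dim :: "('a, 'b) ring_scheme \<Rightarrow> enat" where
  "krull_dim R = (SUP n\<in>{n. \<exists>P :: nat \<Rightarrow> 'a set.
     (\<forall>i\<le>n. primeideal (P i) R) \<and> (\<forall>i<n. P i \<subset> P (Suc i))}. enat n)"

definition regular_local_ring :: "('a, 'b) ring_scheme \<Rightarrow> bool" where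
  "regular_local_ring R \<longleftrightarrow> noetherian_ring R \<and> local_ring R \<and>
     (\<exists>S\<subseteq>carrier R. finite S \<and> enat (card S) = krull_dim R \<and> genideal R S = nonunits R)"

fun ideal_pow :: "('a, 'b) ring_scheme \<Rightarrow> 'a set \<Rightarrow> nat \<Rightarrow> 'a set" where
  "ideal_pow R I 0 = carrier R"
| "ideal_pow R I (Suc n) = ideal_prod R I (ideal_pow R I n)"

text \<open>The \<open>I\<close>-adic completion, the inverse limit of the rings \<open>R / I^n\<close>. The transition maps send
  a coset to the unique coset containing it.\<close>

definition completion :: "('a, 'b) ring_scheme \<Rightarrow> 'a set \<Rightarrow> (nat \<Rightarrow> 'a set) ring" where
  "completion R I = (let Q = (\<lambda>n. R Quot ideal_pow R I n) in
     \<lparr>carrier = {f. \<forall>n. f n \<in> carrier (Q n) \<and> f (Suc n) \<subseteq> f n},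
      mult = (\<lambda>f g n. f n \<otimes>\<^bsub>Q n\<^esub> g n), one = (\<lambda>n. \<one>\<^bsub>Q n\<^esub>),
      zero = (\<lambda>n. \<zero>\<^bsub>Q n\<^esub>), add = (\<lambda>f g n. f n \<oplus>\<^bsub>Q n\<^esub> g n)\<rparr>)"


section \<open>Birational models\<close>

text \<open>
  All schemes occurring here are integral and separated, and birational to the torus, so they share
  the function field \<open>K = k(x, y)\<close>, the fraction field of \<open>k[x][y]\<close>. Such a scheme is represented
  by the set of its local rings, regarded as subrings of \<open>K\<close> (Zariski's models, Chevalley's schemes;
  EGA I, section 8). The points are the local rings, and two such schemes are equal as sets if and
  only if the identity of \<open>K\<close> induces an isomorphism between them. In particular, two modifications
  of the same scheme are isomorphic over it if and only if they are equal.
\<close>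

type_synonym 'k ratfun = "'k poly poly fract"

definition const :: "'k::field \<Rightarrow> 'k ratfun" where
  "const a = Fraction_Field.Fract [:[:a:]:] 1"

definition coord_x :: "'k::field ratfun" where
  "coord_x = Fraction_Field.Fract [:[:0, 1:]:] 1"

definition coord_y :: "'k::field ratfun" where
  "coord_y = Fraction_Field.Fract [:0, 1:] 1"

definition k_subalgebra :: "'k::field ratfun set \<Rightarrow> bool" where
  "k_subalgebra A \<longleftrightarrow> range const \<subseteq> A \<and> (\<forall>a\<in>A. \<forall>b\<in>A. a + b \<in> A \<and> a * b \<in> A)"

definition localization :: "'k::field ratfun set \<Rightarrow> 'k ratfun set \<Rightarrow> 'k ratfun set" where
  "localization A P = {a / s | a s. a \<in> A \<and> s \<in> A - P}"

definition Spec :: "'k::field ratfun set \<Rightarrow> 'k ratfun set set" where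
  "Spec A = {localization A P | P. primeideal P (ring_of A)}"

definition dominates :: "'k::field ratfun set \<Rightarrow> 'k ratfun set \<Rightarrow> bool" where
  "dominates S R \<longleftrightarrow> R \<subseteq> S \<and> nonunits (ring_of R) \<subseteq> nonunits (ring_of S)"

definition of_finite_type :: "'k::field ratfun set set \<Rightarrow> bool" where
  "of_finite_type X \<longleftrightarrow> (\<exists>\<A>. finite \<A> \<and> X = (\<Union>A\<in>\<A>. Spec A) \<and>
     (\<forall>A\<in>\<A>. (\<exists>F. finite F \<and> A = k_subalgebra hull F) \<and>
        (\<forall>z. \<exists>a\<in>A. \<exists>s\<in>A - {0}. z = a / s)))"

definition valuation_ring :: "'k::field ratfun set \<Rightarrow> bool" where
  "valuation_ring W \<longleftrightarrow> k_subalgebra W \<and> (\<forall>z. z \<in> W \<or> inverse z \<in> W)"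

text \<open>The identity of \<open>K\<close> induces a proper birational morphism from \<open>X\<close> to \<open>Y\<close>; separatedness and
  universal closedness are expressed by the valuative criterion, for which valuation rings of the
  function field suffice here.\<close>

definition modification :: "'k::field ratfun set set \<Rightarrow> 'k ratfun set set \<Rightarrow> bool" where
  "modification X Y \<longleftrightarrow> of_finite_type X \<and> of_finite_type Y \<and>
     (\<forall>S\<in>X. \<exists>R\<in>Y. dominates S R) \<and>
     (\<forall>W R. valuation_ring W \<and> R \<in> Y \<and> dominates W R \<longrightarrow> (\<exists>!S. S \<in> X \<and> dominates W S))"

definition singular_points :: "'k::field ratfun set set \<Rightarrow> 'k ratfun set set" where
  "singular_points X = {R \<in> X. \<not> regular_local_ring (ring_of R)}"

definition resolution :: "'k::field ratfun set set \<Rightarrow> 'k ratfun set set \<Rightarrow> bool" where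
  "resolution X Y \<longleftrightarrow> modification X Y \<and> singular_points X = {}"

text \<open>Blow-up along the ideal sheaf with stalks \<open>I R\<close>. Over the spectrum of the local ring \<open>R\<close> the
  scheme Proj of the Rees algebra of \<open>J = I R\<close> is covered by the spectra of the rings \<open>R[J/f]\<close>,
  for \<open>f\<close> in \<open>J\<close> nonzero.\<close>

definition blowup :: "('k::field ratfun set \<Rightarrow> 'k ratfun set) \<Rightarrow> 'k ratfun set set \<Rightarrow> 'k ratfun set set" where
  "blowup I X = (\<Union>R\<in>X. \<Union>f\<in>I R - {0}. Spec (k_subalgebra hull (R \<union> {g / f | g. g \<in> I R})))"

text \<open>Blow-up at a closed point.\<close>

definition blowup_at :: "'k::field ratfun set set \<Rightarrow> 'k ratfun set \<Rightarrow> 'k ratfun set set" where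
  "blowup_at X P = blowup (\<lambda>R. if R = P then nonunits (ring_of R) else R) X"

definition blowups :: "'k::field ratfun set set \<Rightarrow> 'k ratfun set list \<Rightarrow> 'k ratfun set set" where
  "blowups X Ps = foldl blowup_at X Ps"

text \<open>Rational double point of type \<open>A_c\<close>: the completed local ring is isomorphic, as a
  \<open>k\<close>-algebra, to \<open>k[[x, y, z]] / (x y - z^(c+1))\<close>. The power series ring is the iterated one
  \<open>k[[x]][[y]][[z]]\<close>.\<close>

definition A_equation :: "nat \<Rightarrow> 'k::field fps fps fps" where
  "A_equation c = fps_const (fps_const fps_X) * fps_const fps_X - fps_X ^ (c + 1)"

definition rdp_type_A :: "nat \<Rightarrow> 'k::field ratfun set \<Rightarrow> bool" where
  "rdp_type_A c P \<longleftrightarrow> 1 \<le> c \<and> local_ring (ring_of P) \<and>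
     (let R = ring_of P; m = nonunits R;
          S = ring_of (UNIV :: 'k fps fps fps set); J = genideal S {A_equation c}
      in \<exists>h\<in>ring_iso (completion R m) (S Quot J).
           \<forall>a. h (\<lambda>n. ideal_pow R m n +>\<^bsub>R\<^esub> const a)
                 = J +>\<^bsub>S\<^esub> fps_const (fps_const (fps_const a)))"


section \<open>Toric surfaces\<close>

definition real_vec :: "int \<times> int \<Rightarrow> real \<times> real" where
  "real_vec u = (of_int (fst u), of_int (snd u))"

definition cone_of :: "(int \<times> int) set \<Rightarrow> (real \<times> real) set" where
  "cone_of F = convex_cone hull (real_vec ` F)"

definition lattice_basis :: "int \<times> int \<Rightarrow> int \<times> int \<Rightarrow> bool" where
  "lattice_basis u w \<longleftrightarrow>
     (\<forall>z. \<exists>!(a, b). z = (a * fst u + b * fst w, a * snd u + b * snd w))"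

definition simple_cone :: "(real \<times> real) set \<Rightarrow> bool" where
  "simple_cone \<tau> \<longleftrightarrow> (\<exists>u w F. lattice_basis u w \<and> F \<subseteq> {u, w} \<and> \<tau> = cone_of F)"

text \<open>For a finite set \<open>G\<close> of primitive vectors in a strongly convex cone, containing generators of
  that cone: the subdivision of the cone with the elements of \<open>G\<close> as ray generators. Its
  two-dimensional cones are spanned by the pairs of neighbouring elements of \<open>G\<close>.\<close>

definition fan_of :: "(int \<times> int) set \<Rightarrow> (real \<times> real) set set" where
  "fan_of G = {cone_of F | F. F \<subseteq> G \<and> finite F \<and> card F \<le> 2 \<and> (\<forall>u\<in>G. real_vec u \<in> cone_of F \<longrightarrow> u \<in> F)}"

definition dual_semigroup :: "(real \<times> real) set \<Rightarrow> (int \<times> int) set" where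
  "dual_semigroup \<tau> = {m. \<forall>u\<in>\<tau>. real_vec m \<bullet> u \<ge> 0}"

definition character :: "int \<times> int \<Rightarrow> 'k::field ratfun" where
  "character m = coord_x powi fst m * coord_y powi snd m"

definition toric_algebra :: "(real \<times> real) set \<Rightarrow> 'k::field ratfun set" where
  "toric_algebra \<tau> = k_subalgebra hull (character ` dual_semigroup \<tau>)"

definition affine_toric :: "(real \<times> real) set \<Rightarrow> 'k::field ratfun set set" where
  "affine_toric \<tau> = Spec (toric_algebra \<tau>)"

definition toric_variety :: "(real \<times> real) set set \<Rightarrow> 'k::field ratfun set set" where
  "toric_variety \<Sigma> = (\<Union>\<tau>\<in>\<Sigma>. affine_toric \<tau>)"

text \<open>The generic point of the orbit of \<open>\<tau>\<close>, whose ideal is generated by the characters in the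
  dual semigroup that are not invertible. For a two-dimensional cone the orbit is this point.\<close>

definition orbit_point :: "(real \<times> real) set \<Rightarrow> 'k::field ratfun set" where
  "orbit_point \<tau> = localization (toric_algebra \<tau>)
     (genideal (ring_of (toric_algebra \<tau>))
        (character ` {m \<in> dual_semigroup \<tau>. - m \<notin> dual_semigroup \<tau>}))"


section \<open>Hirzebruch--Jung data\<close>

fun hj_fraction :: "int list \<Rightarrow> rat" where
  "hj_fraction [] = 0"
| "hj_fraction [b] = of_int b"
| "hj_fraction (b # b' # bs) = of_int b - 1 / hj_fraction (b' # bs)"

definition hj_expansion :: "int list \<Rightarrow> rat \<Rightarrow> bool" where
  "hj_expansion b r \<longleftrightarrow> b \<noteq> [] \<and> (\<forall>e\<in>set b. 2 \<le> e) \<and> hj_fraction b = r"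

text \<open>The entries are numbered from 1.\<close>

definition entry :: "int list \<Rightarrow> nat \<Rightarrow> int" where
  "entry b i = b ! (i - 1)"

fun hj_vec :: "int list \<Rightarrow> nat \<Rightarrow> int \<times> int" where
  "hj_vec b 0 = (1, 0)"
| "hj_vec b (Suc 0) = (1, 1)"
| "hj_vec b (Suc (Suc j)) =
     (entry b (Suc j) * fst (hj_vec b (Suc j)) - fst (hj_vec b j),
      entry b (Suc j) * snd (hj_vec b (Suc j)) - snd (hj_vec b j))"

text \<open>The maximal sequences of consecutive 2's in \<open>(b_2, ..., b_(s-1))\<close>, as pairs of the
  first index and the length.\<close>

definition two_runs :: "int list \<Rightarrow> (nat \<times> nat) set" where
  "two_runs b = {(i, c). 1 \<le> c \<and> 2 \<le> i \<and> i + c \<le> length b \<and>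
     (\<forall>l\<in>{i..<i + c}. entry b l = 2) \<and>
     (i = 2 \<or> entry b (i - 1) \<noteq> 2) \<and> (i + c = length b \<or> entry b (i + c) \<noteq> 2)}"

text \<open>The singular cone remaining from the run \<open>(i, c)\<close> when the first \<open>j\<close> and the last \<open>j\<close>
  vectors of the run have been inserted.\<close>

definition run_cone :: "int list \<Rightarrow> nat \<times> nat \<Rightarrow> nat \<Rightarrow> (real \<times> real) set" where
  "run_cone b r j = (case r of (i, c) \<Rightarrow> cone_of {hj_vec b (i + j - 1), hj_vec b (i + c - j)})"

definition run_steps :: "nat \<times> nat \<Rightarrow> nat" where
  "run_steps r = nat \<lceil>real (snd r) / 2\<rceil>"

definition run_centres :: "int list \<Rightarrow> nat \<times> nat \<Rightarrow> 'k::field ratfun set list" where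
  "run_centres b r = map (\<lambda>j. orbit_point (run_cone b r j)) [0..<run_steps r]"

definition run_indices :: "nat \<times> nat \<Rightarrow> nat set" where
  "run_indices r = {fst r..<fst r + snd r}"

end

theory Submission imports Defs begin

text \<open>
  A local subring \<open>T\<close> of the function field is a point of \<open>Spec A\<close> if and only if \<open>A\<close> is contained
  in \<open>T\<close> and every element of \<open>T\<close> is a quotient of elements of \<open>A\<close> whose denominator is a unit of
  \<open>T\<close>; points of a toric surface are therefore recognised by testing which characters they contain.

  The vectors \<open>v_0, ..., v_(s+1)\<close> form a chain: neighbours are lattice bases, and
  \<open>v_(j-1) + v_(j+1) = b_j v_j\<close> with \<open>b_j >= 2\<close>. For a cone spanned by \<open>v_l\<close> and \<open>v_r\<close> the charts of
  the blow-up of its closed orbit are given by the vertices of the Newton polygon of the nonzero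
  elements of the dual monoid. A vertex is constant on a maximal part of the cone, and the vertices
  for \<open>v_(j-1), v_j\<close> and \<open>v_j, v_(j+1)\<close> differ exactly when \<open>b_j\<close> is not \<open>2\<close> or \<open>v_j\<close> is next
  to the boundary of the cone. So every such blow-up inserts the first and the last vector of the
  cone and those with \<open>b_j\<close> different from \<open>2\<close>; in particular a run of 2's loses one vector at each end.

  If all \<open>b_j\<close> strictly between \<open>l\<close> and \<open>r\<close> equal \<open>2\<close>, the dual monoid is generated by \<open>x, y, z\<close>
  with \<open>x + y = d z\<close>, \<open>d = r - l\<close>. Evaluating truncated power series at the three characters
  identifies the completed local ring with \<open>k[[x, y, z]] / (x y - z^d)\<close>. For \<open>d >= 2\<close> the three
  characters are independent modulo the square of the maximal ideal, while the dimension is at most 2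
  because the chart is finite over \<open>k[x, y]\<close>; for \<open>d = 1\<close> the chart is a plane, and its points are
  regular because every prime ideal of \<open>k[x, y]\<close> is locally generated by as many elements as its height.
\<close>

section \<open>Subrings\<close>

text \<open>The obstacle is that \<open>blowup\<close> is not toric by construction: its charts are
  generated over a local ring by quotients \<open>g / f\<close> with \<open>f\<close> an arbitrary
  nonunit. Locality of the points repairs this. Writing \<open>f\<close> as a combination of
  characters presents 1 as a sum of terms \<open>r * character h / f\<close> in the local ring
  \<open>T\<close>, so one term is a unit, and the maximal ideal of the centre becomes principal in
  \<open>T\<close>, generated by a character. From there only the submonoid of exponents whose
  characters lie in \<open>T\<close> matters. The number 2 is special because the pairing with
  \<open>v_j\<close> obeys the recursion of the chain: for entries at least 2 it is convex where
  nonnegative, and along a run of 2's it is affine, so a vertex with value 1 at two successive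
  vectors has value 1 along the whole run. Singularity is tested at all points, closed or not, over
  a field that need not be algebraically closed; regularity is therefore derived from a description
  of all primes of \<open>k[x][y]\<close> by their contraction to \<open>k[x]\<close>.\<close>

definition subring_set :: "'a::comm_ring_1 set \<Rightarrow> bool" where
  "subring_set A \<longleftrightarrow> 1 \<in> A \<and> (\<forall>a\<in>A. \<forall>b\<in>A. a - b \<in> A \<and> a * b \<in> A)"

lemma subring_setD:
  assumes "subring_set A"
  shows "0 \<in> A" "1 \<in> A" "a \<in> A \<Longrightarrow> b \<in> A \<Longrightarrow> a + b \<in> A"
    "a \<in> A \<Longrightarrow> b \<in> A \<Longrightarrow> a - b \<in> A" "a \<in> A \<Longrightarrow> b \<in> A \<Longrightarrow> a * b \<in> A" "a \<in> A \<Longrightarrow> - a \<in> A"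
    "a \<in> A \<Longrightarrow> a ^ n \<in> A"
proof -
  show 0: "0 \<in> A" "1 \<in> A" using assms unfolding subring_set_def by (metis diff_self, blast)
  show m: "a \<in> A \<Longrightarrow> b \<in> A \<Longrightarrow> a * b \<in> A" for a b using assms unfolding subring_set_def by blast
  show neg: "a \<in> A \<Longrightarrow> - a \<in> A" for a using assms 0 unfolding subring_set_def by (metis diff_0)
  show "a \<in> A \<Longrightarrow> b \<in> A \<Longrightarrow> a + b \<in> A" for a b
    using assms neg unfolding subring_set_def by (metis diff_minus_eq_add)
  show "a \<in> A \<Longrightarrow> b \<in> A \<Longrightarrow> a - b \<in> A" using assms unfolding subring_set_def by blast
  show "a \<in> A \<Longrightarrow> a ^ n \<in> A" by (induction n) (use 0 m in auto)
qed

lemma subring_set_sum: "subring_set A \<Longrightarrow> (\<And>i. i \<in> I \<Longrightarrow> f i \<in> A) \<Longrightarrow> sum f I \<in> A"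
  by (induction I rule: infinite_finite_induct) (auto simp: subring_setD)

lemma ring_of_simps [simp]:
  "carrier (ring_of A) = A" "x \<otimes>\<^bsub>ring_of A\<^esub> y = x * y" "x \<oplus>\<^bsub>ring_of A\<^esub> y = x + y"
  "\<one>\<^bsub>ring_of A\<^esub> = 1" "\<zero>\<^bsub>ring_of A\<^esub> = 0"
  by (simp_all add: ring_of_def)

lemma cring_ring_of: "subring_set A \<Longrightarrow> cring (ring_of A)"
proof (rule cringI)
  assume A: "subring_set A"
  show "abelian_group (ring_of A)"
  proof (rule abelian_groupI)
    fix x assume "x \<in> carrier (ring_of A)"
    then have "- x \<in> carrier (ring_of A) \<and> - x \<oplus>\<^bsub>ring_of A\<^esub> x = \<zero>\<^bsub>ring_of A\<^esub>"
      using A by (simp add: subring_setD)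
    then show "\<exists>y\<in>carrier (ring_of A). y \<oplus>\<^bsub>ring_of A\<^esub> x = \<zero>\<^bsub>ring_of A\<^esub>" by blast
  qed (use A in \<open>auto simp: subring_setD algebra_simps\<close>)
  show "comm_monoid (ring_of A)"
    by (rule comm_monoidI) (use A in \<open>auto simp: subring_setD algebra_simps\<close>)
qed (auto simp: algebra_simps)

lemma ring_ring_of: "subring_set A \<Longrightarrow> ring (ring_of A)"
  using cring_ring_of cring_def by blast

lemma a_inv_ring_of: "subring_set A \<Longrightarrow> x \<in> A \<Longrightarrow> \<ominus>\<^bsub>ring_of A\<^esub> x = - x"
  by (rule abelian_group.minus_equality)
    (use cring_ring_of[of A] in \<open>auto simp: cring_def ring_def subring_setD\<close>)

text \<open>Set-level counterpart of the library's \<open>ideal\<close> for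
  \<open>ring_of A\<close>. Closure under negation comes from multiplication by -1, an element of
  \<open>A\<close> whenever \<open>A\<close> is a subring.\<close>

definition ideal_in :: "'a::comm_ring_1 set \<Rightarrow> 'a set \<Rightarrow> bool" where
  "ideal_in I A \<longleftrightarrow> I \<subseteq> A \<and> 0 \<in> I \<and> (\<forall>x\<in>I. \<forall>y\<in>I. x + y \<in> I) \<and> (\<forall>a\<in>A. \<forall>x\<in>I. a * x \<in> I)"

definition prime_in :: "'a::comm_ring_1 set \<Rightarrow> 'a set \<Rightarrow> bool" where
  "prime_in P A \<longleftrightarrow> ideal_in P A \<and> 1 \<notin> P \<and> (\<forall>a\<in>A. \<forall>b\<in>A. a * b \<in> P \<longrightarrow> a \<in> P \<or> b \<in> P)"

lemma ideal_ring_of_iff: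
  assumes A: "subring_set A"
  shows "ideal I (ring_of A) \<longleftrightarrow> ideal_in I A"
proof
  assume I: "ideal I (ring_of A)"
  interpret ideal I "ring_of A" by fact
  show "ideal_in I A"
    unfolding ideal_in_def
    using additive_subgroup.a_subset[OF is_additive_subgroup] additive_subgroup.zero_closed[OF is_additive_subgroup]
      additive_subgroup.a_closed[OF is_additive_subgroup] I_l_closed by auto
next
  assume I: "ideal_in I A"
  have neg: "- x \<in> I" if "x \<in> I" for x
  proof -
    have "(-1) * x \<in> I" using I that A unfolding ideal_in_def by (meson subring_setD(2,6))
    then show ?thesis by simp
  qed
  show "ideal I (ring_of A)"
  proof (rule idealI)
    show "ring (ring_of A)" using A by (rule ring_ring_of)
    show "subgroup I (add_monoid (ring_of A))"
    proof (rule group.subgroupI)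
      show "Group.group (add_monoid (ring_of A))"
        using ring_ring_of[OF A] by (simp add: ring_def abelian_group_def abelian_group_axioms_def comm_group_def)
      show "I \<subseteq> carrier (add_monoid (ring_of A))" "I \<noteq> {}" using I by (auto simp: ideal_in_def)
      show "inv\<^bsub>add_monoid (ring_of A)\<^esub> a \<in> I" if "a \<in> I" for a
        using a_inv_ring_of[OF A, of a] neg[OF that] that I by (auto simp: ideal_in_def a_inv_def)
      show "a \<otimes>\<^bsub>add_monoid (ring_of A)\<^esub> b \<in> I" if "a \<in> I" "b \<in> I" for a b
        using that I by (auto simp: ideal_in_def)
    qed
  next
    fix a x assume "a \<in> I" "x \<in> carrier (ring_of A)"
    then have "x * a \<in> I" using I by (auto simp: ideal_in_def)
    then show "x \<otimes>\<^bsub>ring_of A\<^esub> a \<in> I" "a \<otimes>\<^bsub>ring_of A\<^esub> x \<in> I" by (simp_all add: mult.commute)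
  qed
qed

lemma primeideal_ring_of_iff:
  assumes A: "subring_set A"
  shows "primeideal P (ring_of A) \<longleftrightarrow> prime_in P A"
proof
  assume P: "primeideal P (ring_of A)"
  interpret primeideal P "ring_of A" by fact
  have id: "ideal_in P A" using ideal_ring_of_iff[OF A] is_ideal by blast
  have "1 \<notin> P" using I_notcarr one_imp_carrier by auto
  then show "prime_in P A" unfolding prime_in_def using id I_prime by auto
next
  assume P: "prime_in P A"
  show "primeideal P (ring_of A)"
  proof (rule primeidealI)
    show "ideal P (ring_of A)" using P A by (simp add: ideal_ring_of_iff prime_in_def)
    show "carrier (ring_of A) \<noteq> P" using P A by (auto simp: prime_in_def subring_setD)
  qed (use P cring_ring_of[OF A] in \<open>auto simp: prime_in_def\<close>)
qed

lemma genideal_ring_of: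
  assumes A: "subring_set A" and S: "S \<subseteq> A"
  shows "ideal_in (genideal (ring_of A) S) A" "S \<subseteq> genideal (ring_of A) S"
    "ideal_in J A \<Longrightarrow> S \<subseteq> J \<Longrightarrow> genideal (ring_of A) S \<subseteq> J"
  using ring.genideal_ideal[OF ring_ring_of[OF A], of S] ring.genideal_self[OF ring_ring_of[OF A], of S]
    ring.genideal_minimal[OF ring_ring_of[OF A], of J S] S
  by (auto simp: ideal_ring_of_iff[OF A])

lemma genideal_ring_of_eqI:
  assumes A: "subring_set A" and "S \<subseteq> I" "ideal_in I A"
    "\<And>J. ideal_in J A \<Longrightarrow> S \<subseteq> J \<Longrightarrow> I \<subseteq> J"
  shows "genideal (ring_of A) S = I"
proof -
  have "S \<subseteq> A" using assms unfolding ideal_in_def by blast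
  then show ?thesis
    using genideal_ring_of[OF A, of S] assms by blast
qed

lemma ideal_inD:
  assumes "ideal_in I A"
  shows "0 \<in> I" "x \<in> I \<Longrightarrow> y \<in> I \<Longrightarrow> x + y \<in> I" "a \<in> A \<Longrightarrow> x \<in> I \<Longrightarrow> a * x \<in> I"
    "a \<in> A \<Longrightarrow> x \<in> I \<Longrightarrow> x * a \<in> I" "x \<in> I \<Longrightarrow> x \<in> A"
  using assms by (auto simp: ideal_in_def mult.commute)

lemma ideal_in_sum: "ideal_in I A \<Longrightarrow> (\<And>i. i \<in> J \<Longrightarrow> f i \<in> I) \<Longrightarrow> sum f J \<in> I"
  by (induction J rule: infinite_finite_induct) (auto simp: ideal_inD)

lemma ideal_in_minus: "subring_set A \<Longrightarrow> ideal_in I A \<Longrightarrow> x \<in> I \<Longrightarrow> - x \<in> I"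
  using ideal_inD(3)[of I A "-1" x] by (simp add: subring_setD)

lemma ideal_in_diff: "subring_set A \<Longrightarrow> ideal_in I A \<Longrightarrow> x \<in> I \<Longrightarrow> y \<in> I \<Longrightarrow> x - y \<in> I"
  using ideal_inD(2)[of I A x "-y"] ideal_in_minus[of A I y] by simp

section \<open>Subalgebras of the function field and their spectra\<close>

lemma const_0 [simp]: "const 0 = 0" and const_1 [simp]: "const 1 = 1"
  by (simp_all add: const_def Zero_fract_def One_fract_def pCons_one)

lemma const_add: "const (a + b) = const a + const b"
  by (simp add: const_def)

lemma const_mult: "const (a * b) = const a * const b"
  by (simp add: const_def)

lemma const_minus: "const (- a) = - const a"
  by (simp add: const_def)

lemma const_sum: "const (sum f I) = (\<Sum>i\<in>I. const (f i))"
  by (induction I rule: infinite_finite_induct) (auto simp: const_add)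

lemma const_eq_0_iff [simp]: "const a = 0 \<longleftrightarrow> a = 0"
  by (simp add: const_def Zero_fract_def eq_fract)

lemma const_inverse: "const (inverse a) = inverse (const a)"
  by (cases "a = 0") (metis const_0 inverse_zero, metis const_1 const_eq_0_iff const_mult inverse_unique right_inverse)

lemma k_subalgebraD:
  assumes "k_subalgebra A"
  shows "const c \<in> A" "0 \<in> A" "1 \<in> A" "a \<in> A \<Longrightarrow> b \<in> A \<Longrightarrow> a + b \<in> A"
    "a \<in> A \<Longrightarrow> b \<in> A \<Longrightarrow> a - b \<in> A" "a \<in> A \<Longrightarrow> b \<in> A \<Longrightarrow> a * b \<in> A" "a \<in> A \<Longrightarrow> - a \<in> A"
    "a \<in> A \<Longrightarrow> a ^ n \<in> A"
proof -
  show c: "const c \<in> A" for c using assms unfolding k_subalgebra_def by blast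
  show 0: "0 \<in> A" using c[of 0] by simp
  show 1: "1 \<in> A" using c[of 1] by simp
  show add: "a \<in> A \<Longrightarrow> b \<in> A \<Longrightarrow> a + b \<in> A" for a b using assms unfolding k_subalgebra_def by blast
  show m: "a \<in> A \<Longrightarrow> b \<in> A \<Longrightarrow> a * b \<in> A" for a b using assms unfolding k_subalgebra_def by blast
  show neg: "a \<in> A \<Longrightarrow> - a \<in> A" for a using m[OF c[of "-1"], of a] by (simp add: const_minus)
  show "a \<in> A \<Longrightarrow> b \<in> A \<Longrightarrow> a - b \<in> A" using add[of a "-b"] neg[of b] by simp
  show "a \<in> A \<Longrightarrow> a ^ n \<in> A" by (induction n) (use 1 m in auto)
qed

lemma subring_set_k_subalgebra: "k_subalgebra A \<Longrightarrow> subring_set A"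
  by (simp add: subring_set_def k_subalgebraD)

lemma k_subalgebra_Inter: "(\<And>A. A \<in> \<A> \<Longrightarrow> k_subalgebra A) \<Longrightarrow> k_subalgebra (\<Inter>\<A>)"
  unfolding k_subalgebra_def by blast

lemma k_subalgebra_hull: "k_subalgebra (k_subalgebra hull S)"
  unfolding hull_def by (rule k_subalgebra_Inter) blast

definition units_in :: "'a::field set \<Rightarrow> 'a set" where
  "units_in T = {t \<in> T. t \<noteq> 0 \<and> inverse t \<in> T}"

lemma Units_ring_of: "Units (ring_of A) = units_in (A :: 'a::field set)"
proof (intro Set.set_eqI iffI)
  fix x assume "x \<in> Units (ring_of A)"
  then obtain y where y: "x \<in> A" "y \<in> A" "x * y = 1" unfolding Units_def by auto
  then have "inverse x = y" "x \<noteq> 0" by (auto intro: inverse_unique)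
  then show "x \<in> units_in A" using y by (simp add: units_in_def)
next
  fix x assume "x \<in> units_in A"
  then show "x \<in> Units (ring_of A)" unfolding Units_def units_in_def by (auto intro!: bexI[of _ "inverse x"])
qed

lemma nonunits_ring_of: "nonunits (ring_of A) = A - units_in (A :: 'a::field set)"
  by (simp add: nonunits_def Units_ring_of)

lemma units_in_mono: "R \<subseteq> T \<Longrightarrow> units_in R \<subseteq> units_in T"
  by (auto simp: units_in_def)

lemma units_in_mult: "k_subalgebra T \<Longrightarrow> x \<in> units_in T \<Longrightarrow> y \<in> units_in T \<Longrightarrow> x * y \<in> units_in T"
  by (auto simp: units_in_def k_subalgebraD)

lemma units_in_power: "k_subalgebra T \<Longrightarrow> x \<in> units_in T \<Longrightarrow> x ^ n \<in> units_in T"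
  by (auto simp: units_in_def k_subalgebraD simp flip: power_inverse)

lemma units_in_inverse: "x \<in> units_in T \<Longrightarrow> inverse x \<in> units_in T"
  by (auto simp: units_in_def)

lemma units_in_divide: "k_subalgebra T \<Longrightarrow> x \<in> T \<Longrightarrow> y \<in> units_in T \<Longrightarrow> x / y \<in> T"
  by (simp add: units_in_def k_subalgebraD divide_inverse)

lemma units_in_multD:
  assumes T: "k_subalgebra T" and xy: "x \<in> T" "y \<in> T" "x * y \<in> units_in T"
  shows "x \<in> units_in T"
proof -
  have "x \<noteq> 0" "y \<noteq> 0" and i: "inverse (x * y) \<in> T" using xy by (auto simp: units_in_def)
  then have "y * inverse (x * y) = inverse x" by (simp add: field_simps)
  moreover have "y * inverse (x * y) \<in> T" using T i xy by (intro k_subalgebraD)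
  ultimately have "inverse x \<in> T" by metis
  then show ?thesis using xy \<open>x \<noteq> 0\<close> by (simp add: units_in_def)
qed

lemma units_in_const: "k_subalgebra T \<Longrightarrow> c \<noteq> 0 \<Longrightarrow> const c \<in> units_in T"
  by (simp add: units_in_def k_subalgebraD flip: const_inverse)

text \<open>Locality in contrapositive form. It is used to extract a unit summand from a sum equal
  to 1.\<close>

definition local_subalgebra :: "'k::field ratfun set \<Rightarrow> bool" where
  "local_subalgebra T \<longleftrightarrow> k_subalgebra T \<and>
     (\<forall>x\<in>T. \<forall>y\<in>T. x + y \<in> units_in T \<longrightarrow> x \<in> units_in T \<or> y \<in> units_in T)"

definition fractions_over :: "'k::field ratfun set \<Rightarrow> 'k ratfun set \<Rightarrow> bool" where
  "fractions_over T A \<longleftrightarrow> A \<subseteq> T \<and> (\<forall>t\<in>T. \<exists>a\<in>A. \<exists>s\<in>A \<inter> units_in T. t = a / s)"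

lemma ideal_in_nonunits:
  assumes T: "local_subalgebra T" shows "ideal_in (T - units_in T) T"
proof -
  have k: "k_subalgebra T" using T by (simp add: local_subalgebra_def)
  have "a * x \<notin> units_in T" if "a \<in> T" "x \<in> T" "x \<notin> units_in T" for a x
    using units_in_multD[OF k that(2,1)] that by (auto simp: mult.commute)
  moreover have "0 \<notin> units_in T" by (simp add: units_in_def)
  ultimately show ?thesis
    using T k unfolding ideal_in_def local_subalgebra_def by (auto simp: k_subalgebraD(2,4,6)[OF k])
qed

lemma local_ring_ring_of: "local_subalgebra T \<Longrightarrow> local_ring (ring_of T)"
  unfolding local_ring_def
  by (metis cring_ring_of ideal_in_nonunits ideal_ring_of_iff local_subalgebra_def nonunits_ring_of subring_set_k_subalgebra)

text \<open>The centre of \<open>T\<close> on the affine scheme of \<open>A\<close>: the contraction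
  of the maximal ideal of \<open>T\<close>.\<close>

lemma prime_in_center:
  assumes T: "local_subalgebra T" and A: "k_subalgebra A" "A \<subseteq> T"
  shows "prime_in (A - units_in T) A"
proof -
  have k: "k_subalgebra T" using T by (simp add: local_subalgebra_def)
  have id: "ideal_in (T - units_in T) T" using T by (rule ideal_in_nonunits)
  have "ideal_in (A - units_in T) A"
    unfolding ideal_in_def
  proof (intro conjI ballI)
    fix x y assume x: "x \<in> A - units_in T"
    then have x': "x \<in> T - units_in T" using A by blast
    show "x + y \<in> A - units_in T" if "y \<in> A - units_in T"
      using ideal_inD(2)[OF id x', of y] that x A by (auto simp: k_subalgebraD)
    show "y * x \<in> A - units_in T" if "y \<in> A"
      using ideal_inD(3)[OF id _ x', of y] that x A by (auto simp: k_subalgebraD)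
  qed (use A in \<open>auto simp: units_in_def k_subalgebraD\<close>)
  moreover have "1 \<in> units_in T" using k by (simp add: units_in_def k_subalgebraD)
  ultimately show ?thesis
    unfolding prime_in_def using A k by (auto intro: units_in_mult)
qed

text \<open>Cross-multiplication in the function field: if \<open>a / s\<close> has inverse
  \<open>c / d\<close>, then \<open>s * d = c * a\<close> lies outside the prime
  \<open>P\<close>.\<close>

lemma units_in_localization:
  assumes A: "k_subalgebra A" and P: "prime_in P A" and ats: "a \<in> A" "s \<in> A - P"
  shows "a / s \<in> units_in (localization A P) \<longleftrightarrow> a \<notin> P"
proof
  have s0: "s \<noteq> 0" using P ats unfolding prime_in_def ideal_in_def by auto
  assume "a / s \<in> units_in (localization A P)"
  then have a0: "a \<noteq> 0" and "s / a \<in> localization A P" by (auto simp: units_in_def)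
  then obtain c d where cd: "c \<in> A" "d \<in> A - P" "s / a = c / d" unfolding localization_def by blast
  have d0: "d \<noteq> 0" using P cd unfolding prime_in_def ideal_in_def by auto
  have "s * d = c * a" using cd(3) a0 d0 by (simp add: field_simps)
  moreover have "s * d \<notin> P" using P ats cd unfolding prime_in_def by blast
  ultimately show "a \<notin> P" using P cd unfolding prime_in_def ideal_in_def by metis
next
  assume a: "a \<notin> P"
  have 0: "a \<noteq> 0" "s \<noteq> 0" using a P ats unfolding prime_in_def ideal_in_def by auto
  have "a / s \<in> localization A P" "s / a \<in> localization A P"
    using a ats unfolding localization_def by blast+
  then show "a / s \<in> units_in (localization A P)" using 0 by (simp add: units_in_def)
qed

lemma localization_props:
  assumes A: "k_subalgebra A" and P: "prime_in P A"
  shows "local_subalgebra (localization A P)" "fractions_over (localization A P) A"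
    "A \<inter> units_in (localization A P) = A - P"
proof -
  let ?T = "localization A P"
  have sub: "a \<in> ?T" if "a \<in> A" for a
  proof -
    have "a = a / 1 \<and> a \<in> A \<and> 1 \<in> A - P" using that A P by (simp add: k_subalgebraD prime_in_def)
    then show ?thesis unfolding localization_def by blast
  qed
  have rep: "\<exists>a s. t = a / s \<and> a \<in> A \<and> s \<in> A - P \<and> s \<noteq> 0" if "t \<in> ?T" for t
    using that P unfolding localization_def prime_in_def ideal_in_def by blast
  have mem: "a / s \<in> ?T" if "a \<in> A" "s \<in> A - P" for a s
    using that unfolding localization_def by blast
  have mP: "s * s' \<in> A - P" if "s \<in> A - P" "s' \<in> A - P" for s s'
    using that A P unfolding prime_in_def by (auto simp: k_subalgebraD)
  have "k_subalgebra ?T"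
    unfolding k_subalgebra_def
  proof (intro conjI ballI)
    show "range const \<subseteq> ?T" using sub A by (auto simp: k_subalgebraD)
    fix x y assume "x \<in> ?T" "y \<in> ?T"
    then obtain a s c d where *: "x = a / s" "y = c / d" "a \<in> A" "s \<in> A - P" "c \<in> A" "d \<in> A - P" "s \<noteq> 0" "d \<noteq> 0"
      using rep by meson
    then have "x + y = (a * d + c * s) / (s * d)" "x * y = (a * c) / (s * d)" by (simp_all add: add_frac_eq)
    then show "x + y \<in> ?T" "x * y \<in> ?T"
      using mem[of "a * d + c * s" "s * d"] mem[of "a * c" "s * d"] mP[of s d] * A by (auto simp: k_subalgebraD)
  qed
  moreover have "x \<in> units_in ?T \<or> y \<in> units_in ?T" if xy: "x \<in> ?T" "y \<in> ?T" "x + y \<in> units_in ?T" for x y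
  proof -
    obtain a s c d where *: "x = a / s" "y = c / d" "a \<in> A" "s \<in> A - P" "c \<in> A" "d \<in> A - P" "s \<noteq> 0" "d \<noteq> 0"
      using rep xy(1,2) by meson
    then have "x + y = (a * d + c * s) / (s * d)" by (simp add: field_simps)
    then have "a * d + c * s \<notin> P"
      using xy(3) units_in_localization[OF A P, of "a * d + c * s" "s * d"] * A mP[of s d] by (auto simp: k_subalgebraD)
    then have "a \<notin> P \<or> c \<notin> P" using P * unfolding prime_in_def ideal_in_def by (metis Diff_iff mult.commute)
    then show ?thesis using units_in_localization[OF A P] * by blast
  qed
  ultimately show "local_subalgebra ?T" unfolding local_subalgebra_def by blast
  show u: "A \<inter> units_in ?T = A - P"
    using units_in_localization[OF A P, of _ 1] A P by (auto simp: k_subalgebraD prime_in_def)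
  show "fractions_over ?T A"
    unfolding fractions_over_def u using sub rep by blast
qed

lemma localization_center:
  assumes "fractions_over T A" "k_subalgebra T"
  shows "localization A (A - units_in T) = T"
  using assms unfolding fractions_over_def localization_def
  by (auto simp: units_in_divide subset_iff) blast

lemma Spec_iff:
  assumes A: "k_subalgebra A"
  shows "T \<in> Spec A \<longleftrightarrow> local_subalgebra T \<and> fractions_over T A"
proof
  assume "T \<in> Spec A"
  then obtain P where "prime_in P A" "T = localization A P"
    unfolding Spec_def using primeideal_ring_of_iff[OF subring_set_k_subalgebra[OF A]] by blast
  then show "local_subalgebra T \<and> fractions_over T A" using localization_props[OF A] by blast
next
  assume T: "local_subalgebra T \<and> fractions_over T A"
  then have "prime_in (A - units_in T) A"
    using prime_in_center[of T A] A by (simp add: fractions_over_def)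
  moreover have "T = localization A (A - units_in T)"
    using localization_center T by (metis local_subalgebra_def)
  ultimately show "T \<in> Spec A"
    unfolding Spec_def using primeideal_ring_of_iff[OF subring_set_k_subalgebra[OF A]] by blast
qed

lemma SpecD:
  assumes A: "k_subalgebra A" and T: "T \<in> Spec A"
  shows "k_subalgebra T" "A \<subseteq> T" "local_subalgebra T" "fractions_over T A"
  using T unfolding Spec_iff[OF A] by (auto simp: local_subalgebra_def fractions_over_def)

lemma fractions_over_mono: "fractions_over T A \<Longrightarrow> A \<subseteq> B \<Longrightarrow> B \<subseteq> T \<Longrightarrow> fractions_over T B"
  unfolding fractions_over_def by blast

text \<open>The fractions over \<open>A\<close> with denominators that are units of \<open>T\<close> form a subalgebra, so it is
  enough to express generators of \<open>T\<close> or of an intermediate algebra as such fractions.\<close>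

definition fraction_set :: "'k::field ratfun set \<Rightarrow> 'k ratfun set \<Rightarrow> 'k ratfun set" where
  "fraction_set T A = {a / s | a s. a \<in> A \<and> s \<in> A \<inter> units_in T}"

lemma fraction_set_props:
  assumes A: "k_subalgebra A" "A \<subseteq> T" and T: "k_subalgebra T"
  shows "k_subalgebra (fraction_set T A)" "A \<subseteq> fraction_set T A" "fraction_set T A \<subseteq> T"
    "x \<in> fraction_set T A \<Longrightarrow> x \<in> units_in T \<Longrightarrow> inverse x \<in> fraction_set T A"
    "fractions_over T A \<longleftrightarrow> fraction_set T A = T"
proof -
  let ?F = "fraction_set T A"
  have mem: "a / s \<in> ?F" if "a \<in> A" "s \<in> A \<inter> units_in T" for a s
    using that unfolding fraction_set_def by blast
  have one: "1 \<in> A \<inter> units_in T" using A T by (simp add: units_in_def k_subalgebraD)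
  show sub: "A \<subseteq> ?F" using mem[OF _ one] by auto
  show FT: "?F \<subseteq> T" unfolding fraction_set_def using A T by (auto simp: units_in_divide subset_iff)
  show "k_subalgebra ?F"
    unfolding k_subalgebra_def
  proof (intro conjI ballI)
    show "range const \<subseteq> ?F" using sub A by (auto simp: k_subalgebraD)
    fix x y assume "x \<in> ?F" "y \<in> ?F"
    then obtain a s c d where *: "x = a / s" "y = c / d" "a \<in> A" "s \<in> A \<inter> units_in T" "c \<in> A" "d \<in> A \<inter> units_in T" "s \<noteq> 0" "d \<noteq> 0"
      unfolding fraction_set_def units_in_def by blast
    then have "x + y = (a * d + c * s) / (s * d)" "x * y = (a * c) / (s * d)" by (simp_all add: add_frac_eq)
    then show "x + y \<in> ?F" "x * y \<in> ?F"
      using mem[of "a * d + c * s" "s * d"] mem[of "a * c" "s * d"] * A T by (auto simp: k_subalgebraD units_in_mult)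
  qed
  show "inverse x \<in> ?F" if x: "x \<in> ?F" "x \<in> units_in T"
  proof -
    obtain a s where *: "x = a / s" "a \<in> A" "s \<in> A \<inter> units_in T" using x(1) unfolding fraction_set_def by blast
    then have "a = x * s" by (simp add: units_in_def)
    then have "a \<in> units_in T" using that * T units_in_mult by blast
    then show ?thesis using mem[of s a] * by simp
  qed
  show "fractions_over T A \<longleftrightarrow> ?F = T"
    using FT A unfolding fractions_over_def fraction_set_def by blast
qed

text \<open>Transitivity of localisation: the numerator and the inverse of the denominator of an
  element of \<open>T\<close> both land in \<open>fraction_set T A\<close>, which is closed under
  products.\<close>

lemma fractions_over_trans:
  assumes B: "fractions_over T B" and T: "k_subalgebra T" and A: "k_subalgebra A" "A \<subseteq> T"
    and "B \<subseteq> fraction_set T A"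
  shows "fractions_over T A"
proof -
  note F = fraction_set_props[OF A T]
  have "t \<in> fraction_set T A" if t: "t \<in> T" for t
  proof -
    obtain a s where *: "a \<in> B" "s \<in> B \<inter> units_in T" "t = a / s"
      using B[unfolded fractions_over_def, THEN conjunct2, rule_format, OF t] by blast
    then have "a \<in> fraction_set T A" "inverse s \<in> fraction_set T A"
      using subsetD[OF assms(5)] F(4)[of s] by blast+
    then show ?thesis using *(3) F(1) by (simp add: k_subalgebraD divide_inverse)
  qed
  then show ?thesis using F(3,5) by blast
qed

text \<open>Blow-ups are glued over the spectra of local rings; this returns their points to the
  original affine chart, as generisations of \<open>R\<close>.\<close>

lemma Spec_trans:
  assumes A: "k_subalgebra A" and R: "R \<in> Spec A" and T: "T \<in> Spec R"
  shows "T \<in> Spec A"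
proof -
  note R' = SpecD[OF A R] note T' = SpecD[OF R'(1) T]
  have "R \<subseteq> fraction_set T A"
    using R'(4) units_in_mono[OF T'(2)] unfolding fractions_over_def fraction_set_def by blast
  then show ?thesis
    unfolding Spec_iff[OF A] using fractions_over_trans[OF T'(4) T'(1) A] R' T' by blast
qed

lemma Spec_self: "local_subalgebra R \<Longrightarrow> R \<in> Spec R"
proof -
  assume R: "local_subalgebra R"
  then have k: "k_subalgebra R" by (simp add: local_subalgebra_def)
  have "1 \<in> R \<inter> units_in R" using k by (simp add: units_in_def k_subalgebraD)
  then have "\<exists>a\<in>R. \<exists>s\<in>R \<inter> units_in R. t = a / s" if "t \<in> R" for t
    using that by (metis div_by_1)
  then show ?thesis using R unfolding Spec_iff[OF k] fractions_over_def by blast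
qed

lemma dominates_iff: "dominates S R \<longleftrightarrow> R \<subseteq> S \<and> R \<inter> units_in S \<subseteq> units_in R"
  unfolding dominates_def nonunits_ring_of by (auto simp: units_in_def)

text \<open>A denominator that is a unit of \<open>T\<close> is a unit of \<open>W\<close>, hence a
  unit of \<open>T'\<close> because \<open>W\<close> dominates \<open>T'\<close>; so fractions
  transfer in both directions. With \<open>W = T\<close> this gives uniqueness of the point at a
  vertex, with a valuation ring it gives separatedness.\<close>

lemma dominates_eqI:
  assumes "T \<in> Spec A" "T' \<in> Spec A'" "k_subalgebra A" "k_subalgebra A'"
    and "A \<subseteq> T'" "A' \<subseteq> T" "dominates W T" "dominates W T'"
  shows "T = T'"
proof -
  have "S \<subseteq> S'" if h: "S \<in> Spec B" "k_subalgebra B" "B \<subseteq> S'" "dominates W S" "dominates W S'" "k_subalgebra S'" for S S' B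
  proof
    fix t assume "t \<in> S"
    then obtain a s where *: "t = a / s" "a \<in> B" "s \<in> B \<inter> units_in S"
      using SpecD(4)[OF h(2,1)] unfolding fractions_over_def by blast
    have "s \<in> units_in W" using * h(4) units_in_mono unfolding dominates_iff by blast
    then have "s \<in> units_in S'" using * h(3,5) unfolding dominates_iff by blast
    then show "t \<in> S'" using * h by (auto simp: units_in_divide subset_iff)
  qed
  from this[of T A T'] this[of T' A' T] show ?thesis using assms by (meson SpecD(1) subset_antisym)
qed

text \<open>Exponents and rays are pairs used as single vectors; quantifiers over them must not be
  broken into coordinates.\<close>

declare split_paired_All [simp del] split_paired_Ex [simp del]

section \<open>Characters and monomial algebras\<close>

text \<open>The duality pairing between exponents of characters and vectors of N; both lattices are
  coded as integer pairs.\<close>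

definition pr :: "int \<times> int \<Rightarrow> int \<times> int \<Rightarrow> int" where
  "pr m u = fst m * fst u + snd m * snd u"

lemma pr_simps [simp]: "pr 0 u = 0" "pr m 0 = 0" "pr (- m) u = - pr m u" "pr m (- u) = - pr m u"
  and pr_add: "pr (m + n) u = pr m u + pr n u" "pr m (u + w) = pr m u + pr m w"
  and pr_diff: "pr (m - n) u = pr m u - pr n u" "pr m (u - w) = pr m u - pr m w"
  by (simp_all add: pr_def algebra_simps)

lemma coord_nonzero [simp]: "coord_x \<noteq> 0" "coord_y \<noteq> 0"
  by (simp_all add: coord_x_def coord_y_def Zero_fract_def eq_fract)

lemma character_0 [simp]: "character 0 = 1"
  by (simp add: character_def)

lemma character_nonzero [simp]: "character m \<noteq> 0"
  by (simp add: character_def power_int_eq_0_iff)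

lemma character_add: "character (m + n) = character m * character n"
  by (simp add: character_def power_int_add)

lemma character_minus: "character (- m) = inverse (character m)"
  by (simp add: character_def power_int_minus)

lemma character_diff: "character (m - n) = character m / character n"
  using character_add[of m "- n"] by (simp add: character_minus divide_inverse)

definition scale :: "nat \<Rightarrow> int \<times> int \<Rightarrow> int \<times> int" where
  "scale n m = (int n * fst m, int n * snd m)"

lemma character_scale: "character (scale n m) = character m ^ n"
  unfolding character_def scale_def
  by (simp add: power_mult_distrib mult.commute[of "int n"] power_int_mult)

lemma pr_scale: "pr (scale n m) u = int n * pr m u"
  by (simp add: pr_def scale_def algebra_simps)

definition lau :: "(int \<times> int \<Rightarrow> 'k::field) \<Rightarrow> 'k ratfun" where
  "lau \<phi> = (\<Sum>m | \<phi> m \<noteq> 0. const (\<phi> m) * character m)"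

definition mon_alg :: "(int \<times> int) set \<Rightarrow> 'k::field ratfun set" where
  "mon_alg \<Gamma> = {lau \<phi> | \<phi>. finite {m. \<phi> m \<noteq> 0} \<and> {m. \<phi> m \<noteq> 0} \<subseteq> \<Gamma>}"

text \<open>Coefficients of a Laurent polynomial seen as a rational function. The choice is
  determined only on \<open>mon_alg UNIV\<close>, by \<open>lau_inj\<close>; hence the recurring
  side condition.\<close>

definition cf :: "'k::field ratfun \<Rightarrow> int \<times> int \<Rightarrow> 'k" where
  "cf z = (SOME \<phi>. finite {m. \<phi> m \<noteq> 0} \<and> lau \<phi> = z)"

lemma lau_superset:
  assumes "finite S" "{m. \<phi> m \<noteq> 0} \<subseteq> S"
  shows "lau \<phi> = (\<Sum>m\<in>S. const (\<phi> m) * character m)"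
  unfolding lau_def using assms by (intro sum.mono_neutral_left) auto

abbreviation emb :: "'k::field poly poly \<Rightarrow> 'k ratfun" where
  "emb p \<equiv> Fraction_Field.Fract p 1"

lemma emb_sum: "(\<Sum>i\<in>S. emb (f i)) = emb (sum f S)"
  by (induction S rule: infinite_finite_induct) (auto simp: Zero_fract_def)

lemma emb_monom: "emb (Polynomial.monom (Polynomial.monom c i) j) = const c * coord_x ^ i * coord_y ^ j"
proof -
  have pw: "emb p ^ n = emb (p ^ n)" for p :: "'a poly poly" and n
    by (induction n) (auto simp: One_fract_def)
  have "Polynomial.monom (Polynomial.monom c i) j = [:[:c:]:] * [:[:0, 1:]:] ^ i * [:0, 1:] ^ j"
  proof -
    have "Polynomial.monom c i = [:c:] * [:0, 1:] ^ i" by (simp add: monom_altdef)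
    then have "Polynomial.monom (Polynomial.monom c i) j = [:[:c:] * [:0, 1:] ^ i:] * [:0, 1:] ^ j" by (simp add: monom_altdef)
    also have "[:[:c:] * [:0, 1:] ^ i:] = [:[:c:]:] * [:[:0, 1:]:] ^ i"
    proof -
      have "[:q ^ i:] = [:q:] ^ i" for q :: "'a poly"
      proof (induction i)
        case (Suc i)
        have "[:q ^ Suc i:] = [:q:] * [:q ^ i:]" by simp
        then show ?case by (simp only: Suc power_Suc)
      qed (simp add: one_pCons)
      moreover have "[:[:c:] * r:] = [:[:c:]:] * [:r:]" for r by simp
      ultimately show ?thesis by (simp only:)
    qed
    finally show ?thesis .
  qed
  then show ?thesis unfolding const_def coord_x_def coord_y_def pw by simp
qed

text \<open>Linear independence of characters: multiplication by a high power of both coordinates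
  clears the negative exponents, and the claim becomes a comparison of polynomial
  coefficients.\<close>

lemma lau_eq_0:
  assumes fin: "finite {m. \<phi> m \<noteq> 0}" and 0: "lau \<phi> = 0"
  shows "\<phi> = (\<lambda>_. 0)"
proof
  fix m0
  \<comment> \<open>\<open>m0\<close> is added so that the bound \<open>N\<close> covers it too; its
    shifted exponent is then a pair of naturals at which the coefficient can be read.\<close>
  let ?S = "insert m0 {m. \<phi> m \<noteq> 0}"
  have finS: "finite ?S" using fin by simp
  obtain N :: nat where N: "\<And>m. m \<in> ?S \<Longrightarrow> \<bar>fst m\<bar> + \<bar>snd m\<bar> \<le> int N"
  proof -
    have "\<forall>m\<in>?S. \<bar>fst m\<bar> + \<bar>snd m\<bar> \<le> int (\<Sum>m\<in>?S. nat (\<bar>fst m\<bar> + \<bar>snd m\<bar>))"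
    proof
      fix m assume "m \<in> ?S"
      then have "nat (\<bar>fst m\<bar> + \<bar>snd m\<bar>) \<le> (\<Sum>m\<in>?S. nat (\<bar>fst m\<bar> + \<bar>snd m\<bar>))"
        using finS by (intro member_le_sum) auto
      then show "\<bar>fst m\<bar> + \<bar>snd m\<bar> \<le> int (\<Sum>m\<in>?S. nat (\<bar>fst m\<bar> + \<bar>snd m\<bar>))" by linarith
    qed
    then show ?thesis using that by blast
  qed
  define a where "a m = nat (fst m + int N)" for m :: "int \<times> int"
  define b where "b m = nat (snd m + int N)" for m :: "int \<times> int"
  let ?c = "coord_x ^ N * coord_y ^ N :: 'a ratfun"
  have eq: "?c * character m = coord_x ^ a m * coord_y ^ b m" if "m \<in> ?S" for m
  proof -
    have ab: "int (a m) = fst m + int N" "int (b m) = snd m + int N"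
      using N[OF that] by (auto simp: a_def b_def)
    have "coord_x ^ a m = (coord_x powi fst m * coord_x ^ N :: 'a ratfun)"
      "coord_y ^ b m = (coord_y powi snd m * coord_y ^ N :: 'a ratfun)"
      using power_int_add[of "coord_x :: 'a ratfun" "fst m" "int N"] power_int_add[of "coord_y :: 'a ratfun" "snd m" "int N"]
      by (simp_all flip: ab)
    then show ?thesis by (simp add: character_def)
  qed
  have "0 = ?c * lau \<phi>" using 0 by simp
  also have "lau \<phi> = (\<Sum>m\<in>?S. const (\<phi> m) * character m)" using finS by (intro lau_superset) auto
  also have "?c * \<dots> = (\<Sum>m\<in>?S. const (\<phi> m) * (?c * character m))" by (simp add: sum_distrib_left mult_ac)
  also have "\<dots> = (\<Sum>m\<in>?S. emb (Polynomial.monom (Polynomial.monom (\<phi> m) (a m)) (b m)))"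
  proof (intro sum.cong refl)
    fix m assume "m \<in> ?S"
    then show "const (\<phi> m) * (?c * character m) = emb (Polynomial.monom (Polynomial.monom (\<phi> m) (a m)) (b m))"
      by (subst eq) (simp_all only: emb_monom mult.assoc)
  qed
  also have "\<dots> = emb (\<Sum>m\<in>?S. Polynomial.monom (Polynomial.monom (\<phi> m) (a m)) (b m))" by (rule emb_sum)
  finally have "(\<Sum>m\<in>?S. Polynomial.monom (Polynomial.monom (\<phi> m) (a m)) (b m)) = 0" by (simp add: Zero_fract_def eq_fract)
  then have "Polynomial.coeff (Polynomial.coeff (\<Sum>m\<in>?S. Polynomial.monom (Polynomial.monom (\<phi> m) (a m)) (b m)) (b m0)) (a m0) = 0" by simp
  also have "Polynomial.coeff (Polynomial.coeff (\<Sum>m\<in>?S. Polynomial.monom (Polynomial.monom (\<phi> m) (a m)) (b m)) (b m0)) (a m0) =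
     (\<Sum>m\<in>?S. if m = m0 then \<phi> m else 0)"
    unfolding coeff_sum
  proof (rule sum.cong[OF refl])
    fix m assume m: "m \<in> ?S"
    have "a m = a m0 \<and> b m = b m0 \<longleftrightarrow> m = m0"
      using N[OF m] N[of m0] by (auto simp: a_def b_def prod_eq_iff)
    then show "Polynomial.coeff (Polynomial.coeff (Polynomial.monom (Polynomial.monom (\<phi> m) (a m)) (b m)) (b m0)) (a m0) = (if m = m0 then \<phi> m else 0)"
      by auto
  qed
  also have "\<dots> = \<phi> m0" using finS by simp
  finally show "\<phi> m0 = 0" .
qed

lemma lau_add:
  assumes "finite {m. \<phi> m \<noteq> 0}" "finite {m. \<psi> m \<noteq> 0}"
  shows "lau (\<lambda>m. \<phi> m + \<psi> m) = lau \<phi> + lau \<psi>"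
proof -
  let ?S = "{m. \<phi> m \<noteq> 0} \<union> {m. \<psi> m \<noteq> 0}"
  have "finite ?S" using assms by simp
  then have "lau \<phi> = (\<Sum>m\<in>?S. const (\<phi> m) * character m)" "lau \<psi> = (\<Sum>m\<in>?S. const (\<psi> m) * character m)"
    "lau (\<lambda>m. \<phi> m + \<psi> m) = (\<Sum>m\<in>?S. const (\<phi> m + \<psi> m) * character m)"
    by (intro lau_superset; auto)+
  then show ?thesis by (simp add: const_add distrib_right sum.distrib)
qed

lemma lau_shift:
  assumes "finite {m. \<phi> m \<noteq> 0}"
  shows "lau (\<lambda>m. c * \<phi> (m - n)) = const c * character n * lau \<phi>"
proof -
  let ?S = "{m. \<phi> m \<noteq> 0}"
  have "lau (\<lambda>m. c * \<phi> (m - n)) = (\<Sum>m\<in>(\<lambda>m. m + n) ` ?S. const (c * \<phi> (m - n)) * character m)"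
  proof (intro lau_superset subsetI)
    fix m assume "m \<in> {m. c * \<phi> (m - n) \<noteq> 0}"
    then show "m \<in> (\<lambda>m. m + n) ` ?S" by (intro image_eqI[of _ _ "m - n"]) auto
  qed (use assms in simp)
  also have "\<dots> = (\<Sum>m\<in>?S. const (c * \<phi> m) * character (m + n))"
    by (subst sum.reindex) (auto simp: inj_on_def)
  also have "\<dots> = const c * character n * lau \<phi>"
    by (simp add: lau_def const_mult character_add sum_distrib_left mult_ac)
  finally show ?thesis .
qed

lemma lau_inj:
  assumes "finite {m. \<phi> m \<noteq> 0}" "finite {m. \<psi> m \<noteq> 0}" "lau \<phi> = lau \<psi>"
  shows "\<phi> = \<psi>"
proof -
  have n: "lau (\<lambda>m. - \<psi> m) = - lau \<psi>"
    using lau_shift[OF assms(2), of "-1" 0] by (simp add: const_minus)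
  have f: "finite {m. - \<psi> m \<noteq> 0}" using assms(2) by simp
  have "lau (\<lambda>m. \<phi> m + - \<psi> m) = 0" using lau_add[OF assms(1) f] n assms(3) by simp
  moreover have "finite {m. \<phi> m + - \<psi> m \<noteq> 0}"
    by (rule finite_subset[OF _ finite_UnI[OF assms(1,2)]]) auto
  ultimately have "(\<lambda>m. \<phi> m + - \<psi> m) = (\<lambda>_. 0)" using lau_eq_0[of "\<lambda>m. \<phi> m + - \<psi> m"] by simp
  then show ?thesis by (auto simp: fun_eq_iff)
qed

lemma cf_lau: "finite {m. \<phi> m \<noteq> 0} \<Longrightarrow> cf (lau \<phi>) = \<phi>"
  unfolding cf_def by (rule some_equality) (auto intro: lau_inj)

lemma mon_alg_cf:
  assumes "z \<in> mon_alg \<Gamma>"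
  shows "finite {m. cf z m \<noteq> 0}" "lau (cf z) = z" "cf z m \<noteq> 0 \<Longrightarrow> m \<in> \<Gamma>"
  using assms by (auto simp: mon_alg_def cf_lau)

lemma mon_alg_iff: "z \<in> mon_alg \<Gamma> \<longleftrightarrow> z \<in> mon_alg UNIV \<and> (\<forall>m. cf z m \<noteq> 0 \<longrightarrow> m \<in> \<Gamma>)"
proof
  assume z: "z \<in> mon_alg UNIV \<and> (\<forall>m. cf z m \<noteq> 0 \<longrightarrow> m \<in> \<Gamma>)"
  then have "z = lau (cf z)" "finite {m. cf z m \<noteq> 0}" using mon_alg_cf(1,2)[of z UNIV] by simp_all
  then show "z \<in> mon_alg \<Gamma>" unfolding mon_alg_def using z by blast
next
  assume z: "z \<in> mon_alg \<Gamma>"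
  then have "z \<in> mon_alg UNIV" unfolding mon_alg_def by blast
  then show "z \<in> mon_alg UNIV \<and> (\<forall>m. cf z m \<noteq> 0 \<longrightarrow> m \<in> \<Gamma>)" using mon_alg_cf(3)[OF z] by blast
qed

lemma mon_algI: "z \<in> mon_alg UNIV \<Longrightarrow> (\<And>m. cf z m \<noteq> 0 \<Longrightarrow> m \<in> \<Gamma>) \<Longrightarrow> z \<in> mon_alg \<Gamma>"
  using mon_alg_iff by blast

lemma mon_alg_UNIV: "z \<in> mon_alg \<Gamma> \<Longrightarrow> z \<in> mon_alg UNIV"
  using mon_alg_iff by blast

lemma mon_alg_expand:
  assumes "z \<in> mon_alg \<Gamma>" shows "z = (\<Sum>m | cf z m \<noteq> 0. const (cf z m) * character m)"
  using mon_alg_cf(2)[OF assms] by (simp add: lau_def)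

lemma cf_add:
  assumes "z \<in> mon_alg UNIV" "w \<in> mon_alg UNIV"
  shows "z + w \<in> mon_alg UNIV" "cf (z + w) = (\<lambda>m. cf z m + cf w m)"
proof -
  note z = mon_alg_cf[OF assms(1)] and w = mon_alg_cf[OF assms(2)]
  have f: "finite {m. cf z m + cf w m \<noteq> 0}" by (rule finite_subset[OF _ finite_UnI[OF z(1) w(1)]]) auto
  have e: "z + w = lau (\<lambda>m. cf z m + cf w m)" using lau_add[OF z(1) w(1)] z w by simp
  show "z + w \<in> mon_alg UNIV" unfolding mon_alg_def e using f by blast
  show "cf (z + w) = (\<lambda>m. cf z m + cf w m)" unfolding e using f by (rule cf_lau)
qed

lemma cf_shift:
  assumes "z \<in> mon_alg UNIV"
  shows "const c * character n * z \<in> mon_alg UNIV" "cf (const c * character n * z) = (\<lambda>m. c * cf z (m - n))"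
proof -
  note z = mon_alg_cf[OF assms]
  have f: "finite {m. c * cf z (m - n) \<noteq> 0}"
  proof (rule finite_subset[OF subsetI finite_imageI[OF z(1), of "\<lambda>m. m + n"]])
    fix m assume "m \<in> {m. c * cf z (m - n) \<noteq> 0}"
    then show "m \<in> (\<lambda>m. m + n) ` {m. cf z m \<noteq> 0}" by (intro image_eqI[of _ _ "m - n"]) auto
  qed
  have e: "const c * character n * z = lau (\<lambda>m. c * cf z (m - n))" using lau_shift[OF z(1)] z by simp
  show "const c * character n * z \<in> mon_alg UNIV" unfolding mon_alg_def e using f by blast
  show "cf (const c * character n * z) = (\<lambda>m. c * cf z (m - n))" unfolding e using f by (rule cf_lau)
qed

lemma cf_0 [simp]: "cf (0 :: 'a::field ratfun) = (\<lambda>_. 0)"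
  and zero_mon_alg [simp]: "(0 :: 'a ratfun) \<in> mon_alg \<Gamma>"
proof -
  have 0: "lau (\<lambda>_. 0 :: 'a) = 0" by (simp add: lau_def)
  then show "cf 0 = (\<lambda>_. 0 :: 'a)" using cf_lau[of "\<lambda>_. 0 :: 'a"] by simp
  show "0 \<in> (mon_alg \<Gamma> :: 'a ratfun set)" unfolding mon_alg_def using 0
    by (intro CollectI exI[of _ "\<lambda>_. 0"]) auto
qed

lemma cf_1: "cf (1 :: 'a::field ratfun) = (\<lambda>m. if m = 0 then 1 else 0)"
  and one_mon_alg: "(1 :: 'a ratfun) \<in> mon_alg UNIV"
proof -
  have s: "{m. (if m = 0 then 1 else 0 :: 'a) \<noteq> 0} = {0}" by auto
  have 1: "lau (\<lambda>m. if m = 0 then 1 else 0) = (1 :: 'a ratfun)"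
    unfolding lau_def by (subst s) simp
  show "cf 1 = (\<lambda>m. if m = 0 then 1 else 0 :: 'a)"
    using cf_lau[of "\<lambda>m. if m = 0 then 1 else 0 :: 'a"] s 1 by simp
  show "1 \<in> (mon_alg UNIV :: 'a ratfun set)" unfolding mon_alg_def using s 1
    by (intro CollectI exI[of _ "\<lambda>m. if m = 0 then 1 else 0"]) auto
qed

lemma cf_monomial:
  "const c * character n \<in> mon_alg UNIV" "cf (const c * character n) = (\<lambda>m. if m = n then c else 0)"
  using cf_shift[OF one_mon_alg, of c n] by (auto simp: cf_1 fun_eq_iff)

lemma cf_character: "character n \<in> mon_alg UNIV" "cf (character n) = (\<lambda>m. if m = n then 1 else 0)"
  using cf_monomial[of 1 n] by simp_all

lemma cf_const: "const c \<in> mon_alg UNIV" "cf (const c) = (\<lambda>m. if m = 0 then c else 0)"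
  using cf_monomial[of c 0] by simp_all

lemma cf_sum:
  assumes "\<And>i. i \<in> I \<Longrightarrow> f i \<in> mon_alg UNIV"
  shows "sum f I \<in> mon_alg UNIV \<and> cf (sum f I) = (\<lambda>m. \<Sum>i\<in>I. cf (f i) m)"
  using assms by (induction I rule: infinite_finite_induct) (auto simp: cf_add)

lemma cf_mult:
  assumes z: "z \<in> mon_alg UNIV" and w: "w \<in> mon_alg UNIV"
  shows "z * w \<in> mon_alg UNIV" "cf (z * w) m = (\<Sum>n | cf z n \<noteq> 0. cf z n * cf w (m - n))"
proof -
  have "z * w = (\<Sum>n | cf z n \<noteq> 0. const (cf z n) * character n * w)"
    by (subst mon_alg_expand[OF z]) (simp add: sum_distrib_right)
  moreover note cf_sum[of "{n. cf z n \<noteq> 0}" "\<lambda>n. const (cf z n) * character n * w"]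
  ultimately show "z * w \<in> mon_alg UNIV" "cf (z * w) m = (\<Sum>n | cf z n \<noteq> 0. cf z n * cf w (m - n))"
    using cf_shift[OF w] by auto
qed

lemma cf_mult_ne:
  assumes "z \<in> mon_alg UNIV" "w \<in> mon_alg UNIV" "cf (z * w) m \<noteq> 0"
  obtains n n' where "cf z n \<noteq> 0" "cf w n' \<noteq> 0" "m = n + n'"
proof -
  have "\<exists>n. cf z n \<noteq> 0 \<and> cf z n * cf w (m - n) \<noteq> 0"
    using assms(3) unfolding cf_mult(2)[OF assms(1,2)] by (metis (mono_tags, lifting) mem_Collect_eq sum.neutral)
  then obtain n where "cf z n \<noteq> 0" "cf w (m - n) \<noteq> 0" by auto
  then show ?thesis using that[of n "m - n"] by simp
qed

lemma cf_uminus: "z \<in> mon_alg UNIV \<Longrightarrow> cf (- z) = (\<lambda>m. - cf z m)"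
  using cf_shift(2)[of z "-1" 0] by (simp add: const_minus)

lemma mon_alg_subset:
  fixes A :: "'a::field ratfun set"
  assumes "k_subalgebra A" "character ` \<Gamma> \<subseteq> A"
  shows "mon_alg \<Gamma> \<subseteq> A"
proof
  fix z :: "'a ratfun" assume z: "z \<in> mon_alg \<Gamma>"
  show "z \<in> A"
    by (subst mon_alg_expand[OF z], rule subring_set_sum[OF subring_set_k_subalgebra[OF assms(1)]])
      (use mon_alg_cf(3)[OF z] assms(2) k_subalgebraD(1,6)[OF assms(1)] in blast)
qed

lemma character_mon_alg_iff: "character m \<in> (mon_alg \<Gamma> :: 'a::field ratfun set) \<longleftrightarrow> m \<in> \<Gamma>"
proof
  assume "character m \<in> (mon_alg \<Gamma> :: 'a ratfun set)"
  then show "m \<in> \<Gamma>" using mon_alg_cf(3)[of "character m :: 'a ratfun" \<Gamma> m] by (simp add: cf_character(2))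
next
  assume m: "m \<in> \<Gamma>"
  show "character m \<in> (mon_alg \<Gamma> :: 'a ratfun set)"
  proof (rule mon_algI[OF cf_character(1)])
    fix n assume "cf (character m :: 'a ratfun) n \<noteq> 0"
    then show "n \<in> \<Gamma>" using m by (simp add: cf_character(2) split: if_splits)
  qed
qed

lemma mon_alg_mono: "\<Gamma> \<subseteq> \<Gamma>' \<Longrightarrow> mon_alg \<Gamma> \<subseteq> mon_alg \<Gamma>'"
  unfolding mon_alg_def by blast

definition submonoid :: "(int \<times> int) set \<Rightarrow> bool" where
  "submonoid \<Gamma> \<longleftrightarrow> 0 \<in> \<Gamma> \<and> (\<forall>m\<in>\<Gamma>. \<forall>n\<in>\<Gamma>. m + n \<in> \<Gamma>)"

lemma submonoid_scale: "submonoid \<Gamma> \<Longrightarrow> m \<in> \<Gamma> \<Longrightarrow> scale n m \<in> \<Gamma>"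
proof (induction n)
  case 0 then show ?case by (simp add: scale_def submonoid_def zero_prod_def)
next
  case (Suc n)
  have "scale (Suc n) m = scale n m + m" by (simp add: scale_def prod_eq_iff algebra_simps)
  then show ?case using Suc by (simp add: submonoid_def)
qed

lemma k_subalgebra_mon_alg:
  assumes "submonoid \<Gamma>" shows "k_subalgebra (mon_alg \<Gamma>)"
  unfolding k_subalgebra_def
proof (intro conjI ballI subsetI)
  fix x :: "'a ratfun" assume "x \<in> range const"
  then show "x \<in> mon_alg \<Gamma>"
  proof
    fix c :: 'a assume "x = const c"
    show ?thesis unfolding \<open>x = const c\<close>
    proof (rule mon_algI[OF cf_const(1)])
      fix m assume "cf (const c) m \<noteq> 0"
      then show "m \<in> \<Gamma>" using assms by (simp add: cf_const(2) submonoid_def split: if_splits)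
    qed
  qed
next
  fix a b :: "'a ratfun" assume ab: "a \<in> mon_alg \<Gamma>" "b \<in> mon_alg \<Gamma>"
  note ab' = ab[THEN mon_alg_UNIV]
  show "a + b \<in> mon_alg \<Gamma>"
  proof (rule mon_algI)
    fix m assume "cf (a + b) m \<noteq> 0"
    then have "cf a m \<noteq> 0 \<or> cf b m \<noteq> 0" by (auto simp: cf_add(2)[OF ab'])
    then show "m \<in> \<Gamma>" using mon_alg_cf(3)[OF ab(1)] mon_alg_cf(3)[OF ab(2)] by blast
  qed (rule cf_add(1)[OF ab'])
  show "a * b \<in> mon_alg \<Gamma>"
  proof (rule mon_algI)
    fix m assume "cf (a * b) m \<noteq> 0"
    then obtain n n' where "cf a n \<noteq> 0" "cf b n' \<noteq> 0" "m = n + n'" using cf_mult_ne[OF ab'] by blast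
    then show "m \<in> \<Gamma>" using mon_alg_cf(3)[OF ab(1)] mon_alg_cf(3)[OF ab(2)] assms by (simp add: submonoid_def)
  qed (rule cf_mult(1)[OF ab'])
qed

lemma hull_characters:
  assumes "submonoid \<Gamma>" shows "k_subalgebra hull (character ` \<Gamma>) = mon_alg \<Gamma>"
proof (rule hull_unique)
  show "character ` \<Gamma> \<subseteq> mon_alg \<Gamma>" by (auto simp: character_mon_alg_iff)
  show "k_subalgebra (mon_alg \<Gamma>)" using assms by (rule k_subalgebra_mon_alg)
qed (rule mon_alg_subset)

lemma submonoid_dual_semigroup: "submonoid (dual_semigroup \<tau>)"
proof -
  have "real_vec (m + n) = real_vec m + real_vec n" for m n by (simp add: real_vec_def)
  then show ?thesis
    by (auto simp: submonoid_def dual_semigroup_def inner_add_left) (simp add: real_vec_def zero_prod_def[symmetric])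
qed

lemma toric_algebra_eq: "toric_algebra \<tau> = mon_alg (dual_semigroup \<tau>)"
  unfolding toric_algebra_def by (rule hull_characters[OF submonoid_dual_semigroup])

section \<open>Pointed monoids and the local ring at the vertex\<close>

text \<open>Pairing with \<open>w\<close> grades the monoid algebra with only constants in degree 0.
  In the applications \<open>w\<close> is the sum of the two ray generators, an interior vector of
  the cone.\<close>

definition pointed :: "int \<times> int \<Rightarrow> (int \<times> int) set \<Rightarrow> bool" where
  "pointed w \<Gamma> \<longleftrightarrow> submonoid \<Gamma> \<and> (\<forall>m\<in>\<Gamma>. m \<noteq> 0 \<longrightarrow> pr m w > 0)"

definition aug :: "(int \<times> int) set \<Rightarrow> 'k::field ratfun set" where
  "aug \<Gamma> = {a \<in> mon_alg \<Gamma>. cf a 0 = 0}"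

definition vertex_ring :: "(int \<times> int) set \<Rightarrow> 'k::field ratfun set" where
  "vertex_ring \<Gamma> = localization (mon_alg \<Gamma>) (aug \<Gamma>)"

lemma pointed_submonoid: "pointed w \<Gamma> \<Longrightarrow> submonoid \<Gamma>"
  by (simp add: pointed_def)

lemma pointed_sum_0: "pointed w \<Gamma> \<Longrightarrow> m \<in> \<Gamma> \<Longrightarrow> n \<in> \<Gamma> \<Longrightarrow> m + n = 0 \<Longrightarrow> m = 0 \<and> n = 0"
proof -
  assume p: "pointed w \<Gamma>" and mn: "m \<in> \<Gamma>" "n \<in> \<Gamma>" "m + n = 0"
  have "pr m w + pr n w = 0" using mn(3) pr_add(1)[of m n w] by simp
  then show ?thesis using p mn unfolding pointed_def
    by (metis add.right_neutral add_0 add_pos_pos less_irrefl)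
qed

text \<open>In a pointed monoid 0 is a sum of two elements only trivially, so taking the constant
  term is multiplicative; this is evaluation at the vertex.\<close>

lemma cf_mult_0:
  assumes p: "pointed w \<Gamma>" and ab: "a \<in> mon_alg \<Gamma>" "b \<in> mon_alg \<Gamma>"
  shows "cf (a * b) 0 = cf a 0 * cf b 0"
proof -
  note ab' = ab[THEN mon_alg_UNIV]
  have "cf a n * cf b (0 - n) = 0" if "n \<noteq> 0" for n
    using pointed_sum_0[OF p, of n "- n"] mon_alg_cf(3)[OF ab(1), of n] mon_alg_cf(3)[OF ab(2), of "- n"] that
    by auto
  then have "cf (a * b) 0 = (\<Sum>n\<in>{n. cf a n \<noteq> 0}. if n = 0 then cf a 0 * cf b 0 else 0)"
    unfolding cf_mult(2)[OF ab'] by (intro sum.cong) auto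
  also have "\<dots> = cf a 0 * cf b 0" using mon_alg_cf(1)[OF ab(1)] by (simp add: sum.delta)
  finally show ?thesis .
qed

lemma prime_in_aug:
  assumes p: "pointed w \<Gamma>" shows "prime_in (aug \<Gamma>) (mon_alg \<Gamma>)"
  unfolding prime_in_def ideal_in_def aug_def
  using k_subalgebraD[OF k_subalgebra_mon_alg[OF pointed_submonoid[OF p]]]
  by (auto simp: cf_mult_0[OF p] cf_add mon_alg_UNIV cf_1)

lemma aug_sum:
  assumes "a \<in> aug \<Gamma>"
  shows "a = (\<Sum>m | cf a m \<noteq> 0. const (cf a m) * character m)" "finite {m. cf a m \<noteq> 0}"
    "{m. cf a m \<noteq> 0} \<subseteq> \<Gamma> - {0}"
  using mon_alg_expand[of a \<Gamma>] mon_alg_cf[of a \<Gamma>] assms by (auto simp: aug_def)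

lemma aug_mon_alg: "a \<in> aug \<Gamma> \<Longrightarrow> a \<in> mon_alg (\<Gamma> - {0})"
  by (rule mon_algI) (use aug_sum(3)[of a \<Gamma>] mon_alg_UNIV[of a \<Gamma>] in \<open>unfold aug_def, blast+\<close>)

lemma genideal_aug:
  assumes p: "pointed w \<Gamma>"
  shows "genideal (ring_of (mon_alg \<Gamma> :: 'a::field ratfun set)) (character ` (\<Gamma> - {0})) = aug \<Gamma>"
proof (rule genideal_ring_of_eqI)
  have k: "k_subalgebra (mon_alg \<Gamma> :: 'a ratfun set)" using p by (intro k_subalgebra_mon_alg pointed_submonoid)
  then show "subring_set (mon_alg \<Gamma> :: 'a ratfun set)" by (rule subring_set_k_subalgebra)
  show "character ` (\<Gamma> - {0}) \<subseteq> (aug \<Gamma> :: 'a ratfun set)" by (auto simp: aug_def character_mon_alg_iff cf_character)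
  show "ideal_in (aug \<Gamma>) (mon_alg \<Gamma> :: 'a ratfun set)" using prime_in_aug[OF p, where ?'a = 'a] by (simp add: prime_in_def)
  fix J :: "'a ratfun set" assume J: "ideal_in J (mon_alg \<Gamma>)" "character ` (\<Gamma> - {0}) \<subseteq> J"
  show "aug \<Gamma> \<subseteq> J"
  proof
    fix a :: "'a ratfun" assume a: "a \<in> aug \<Gamma>"
    show "a \<in> J"
      by (subst aug_sum(1)[OF a], rule ideal_in_sum[OF J(1)])
        (use aug_sum(3)[OF a] J(2) k_subalgebraD(1)[OF k] ideal_inD(3)[OF J(1)] in blast)
  qed
qed

text \<open>In a pointed monoid no nonzero \<open>m\<close> has its negative as a companion, so the
  noninvertible characters are exactly the nontrivial ones.\<close>

lemma orbit_point_eq: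
  assumes p: "pointed w (dual_semigroup \<tau>)"
  shows "orbit_point \<tau> = vertex_ring (dual_semigroup \<tau>)"
proof -
  have "{m \<in> dual_semigroup \<tau>. - m \<notin> dual_semigroup \<tau>} = dual_semigroup \<tau> - {0}"
  proof (intro Set.set_eqI iffI)
    fix m assume "m \<in> {m \<in> dual_semigroup \<tau>. - m \<notin> dual_semigroup \<tau>}"
    then show "m \<in> dual_semigroup \<tau> - {0}" by (metis (mono_tags, lifting) Diff_iff mem_Collect_eq minus_zero singletonD)
  next
    fix m assume "m \<in> dual_semigroup \<tau> - {0}"
    then show "m \<in> {m \<in> dual_semigroup \<tau>. - m \<notin> dual_semigroup \<tau>}"
      using pointed_sum_0[OF p, of m "- m"] by auto
  qed
  then show ?thesis
    unfolding orbit_point_def vertex_ring_def toric_algebra_eq by (simp add: genideal_aug[OF p])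
qed

lemma vertex_ring_props:
  assumes p: "pointed w \<Gamma>"
  shows "local_subalgebra (vertex_ring \<Gamma>)" "vertex_ring \<Gamma> \<in> Spec (mon_alg \<Gamma>)" "k_subalgebra (vertex_ring \<Gamma>)"
    "mon_alg \<Gamma> \<inter> units_in (vertex_ring \<Gamma>) = mon_alg \<Gamma> - aug \<Gamma>" "mon_alg \<Gamma> \<subseteq> vertex_ring \<Gamma>"
proof -
  note k = k_subalgebra_mon_alg[OF pointed_submonoid[OF p]]
  note l = localization_props[OF k prime_in_aug[OF p], folded vertex_ring_def]
  show "local_subalgebra (vertex_ring \<Gamma>)" "mon_alg \<Gamma> \<inter> units_in (vertex_ring \<Gamma>) = mon_alg \<Gamma> - aug \<Gamma>"
    using l by blast+
  show "vertex_ring \<Gamma> \<in> Spec (mon_alg \<Gamma>)" using Spec_iff[OF k] l by blast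
  then show "k_subalgebra (vertex_ring \<Gamma>)" "mon_alg \<Gamma> \<subseteq> vertex_ring \<Gamma>" using SpecD[OF k] by blast+
qed

lemma vertex_ring_rep:
  assumes p: "pointed w \<Gamma>" and t: "t \<in> vertex_ring \<Gamma>"
  obtains a s where "t = a / s" "a \<in> mon_alg \<Gamma>" "s \<in> mon_alg \<Gamma>" "cf s 0 \<noteq> 0" "s \<noteq> 0"
    "s \<in> units_in (vertex_ring \<Gamma>)"
proof -
  obtain a s where as: "a \<in> mon_alg \<Gamma>" "s \<in> mon_alg \<Gamma> - aug \<Gamma>" "t = a / s"
    using t unfolding vertex_ring_def localization_def by blast
  then show ?thesis using that[of a s] vertex_ring_props(4)[OF p] by (force simp: aug_def)
qed

lemma character_vertex_ring_iff:
  assumes p: "pointed w \<Gamma>"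
  shows "character m \<in> (vertex_ring \<Gamma> :: 'a::field ratfun set) \<longleftrightarrow> m \<in> \<Gamma>"
proof
  assume "character m \<in> (vertex_ring \<Gamma> :: 'a ratfun set)"
  then obtain a s :: "'a ratfun" where *: "character m = a / s" "a \<in> mon_alg \<Gamma>" "s \<in> mon_alg \<Gamma>" "cf s 0 \<noteq> 0" "s \<noteq> 0"
    by (rule vertex_ring_rep[OF p]) blast
  then have "a = character m * s" by (simp add: field_simps)
  then have "cf a m = cf s 0" using cf_shift(2)[OF mon_alg_UNIV[OF *(3)], of 1 m] by simp
  then show "m \<in> \<Gamma>" using mon_alg_cf(3)[OF *(2), of m] * by simp
next
  assume "m \<in> \<Gamma>"
  then show "character m \<in> (vertex_ring \<Gamma> :: 'a ratfun set)" using vertex_ring_props(5)[OF p] character_mon_alg_iff by blast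
qed

lemma character_not_unit:
  assumes "pointed w \<Gamma>" "m \<in> \<Gamma>" "m \<noteq> 0"
  shows "character m \<notin> units_in (vertex_ring \<Gamma>)"
proof -
  have "character m \<in> aug \<Gamma>" using assms by (simp add: aug_def character_mon_alg_iff cf_character)
  then show ?thesis using vertex_ring_props(4)[OF assms(1)] by (auto simp: aug_def)
qed

text \<open>The form in which nonunits enter the blow-up: the unit denominator is absorbed into the
  coefficients \<open>r g\<close>, and only characters remain.\<close>

lemma nonunit_vertex_ring:
  assumes p: "pointed w \<Gamma>" and t: "t \<in> vertex_ring \<Gamma> - units_in (vertex_ring \<Gamma>)"
  obtains r S where "finite S" "S \<subseteq> \<Gamma> - {0}" "\<And>g. g \<in> S \<Longrightarrow> r g \<in> vertex_ring \<Gamma>" "t = (\<Sum>g\<in>S. r g * character g)"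
proof -
  note v = vertex_ring_props[OF p]
  obtain a s where as: "t = a / s" "a \<in> mon_alg \<Gamma>" "s \<in> mon_alg \<Gamma>" "s \<in> units_in (vertex_ring \<Gamma>)"
    using t vertex_ring_rep[OF p] by (metis DiffD1)
  have "a \<notin> units_in (vertex_ring \<Gamma>)"
    using t as units_in_mult[OF v(3), of a "inverse s"] units_in_inverse by (auto simp: divide_inverse)
  then have a: "a \<in> aug \<Gamma>" using v(4) as by blast
  have "t = (\<Sum>g | cf a g \<noteq> 0. (const (cf a g) / s) * character g)"
    unfolding as(1) by (subst aug_sum(1)[OF a]) (simp add: sum_divide_distrib)
  moreover have "const (cf a g) / s \<in> vertex_ring \<Gamma>" for g
    using v(3) as(4) by (intro units_in_divide k_subalgebraD(1))
  ultimately show ?thesis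
    using that[of "{g. cf a g \<noteq> 0}" "\<lambda>g. const (cf a g) / s"] aug_sum(2,3)[OF a] by blast
qed

text \<open>An element outside \<open>aug \<Gamma>\<close> is a nonzero constant plus an element of \<open>aug \<Gamma>\<close>; so the local
  rings over the vertex are those in which no nontrivial character of \<open>\<Gamma>\<close> is a unit.\<close>

lemma vertex_ring_subset:
  fixes T :: "'a::field ratfun set"
  assumes p: "pointed w \<Gamma>" and T: "local_subalgebra T" "mon_alg \<Gamma> \<subseteq> T"
    and n: "\<And>g. g \<in> \<Gamma> - {0} \<Longrightarrow> character g \<notin> units_in T"
  shows "vertex_ring \<Gamma> \<subseteq> T"
    "x \<in> vertex_ring \<Gamma> \<Longrightarrow> x \<notin> units_in (vertex_ring \<Gamma>) \<Longrightarrow> x \<notin> units_in T"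
proof -
  have k: "k_subalgebra T" using T by (simp add: local_subalgebra_def)
  note id = ideal_in_nonunits[OF T(1)]
  have aug: "a \<in> T - units_in T" if a: "a \<in> aug \<Gamma>" for a
  proof (subst aug_sum(1)[OF a], rule ideal_in_sum[OF id], rule ideal_inD(3)[OF id])
    fix g assume "g \<in> {m. cf a m \<noteq> 0}"
    then have "g \<in> \<Gamma> - {0}" using aug_sum(3)[OF a] by blast
    then show "character g \<in> T - units_in T" using n[of g] T(2) character_mon_alg_iff by blast
  qed (rule k_subalgebraD(1)[OF k])
  have unit: "s \<in> units_in T" if s: "s \<in> mon_alg \<Gamma>" "cf s 0 \<noteq> 0" for s
  proof -
    have m: "const (cf s 0) \<in> mon_alg \<Gamma>" "s - const (cf s 0) \<in> mon_alg \<Gamma>"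
      using k_subalgebraD[OF k_subalgebra_mon_alg[OF pointed_submonoid[OF p]]] s(1) by blast+
    have "cf (s - const (cf s 0)) 0 = 0"
      using cf_add(2)[of s "- const (cf s 0)"] cf_const(1)[of "- cf s 0"] cf_const(2)[of "- cf s 0"]
        mon_alg_UNIV[OF s(1)] by (simp add: const_minus)
    then have "s - const (cf s 0) \<in> T - units_in T" using aug m(2) by (simp add: aug_def)
    moreover have "s \<in> T - units_in T \<Longrightarrow> const (cf s 0) \<in> T - units_in T"
      using calculation ideal_in_diff[OF subring_set_k_subalgebra[OF k] id, of s "s - const (cf s 0)"] by simp
    ultimately show ?thesis using units_in_const[OF k s(2)] s(1) T(2) by blast
  qed
  show sub: "vertex_ring \<Gamma> \<subseteq> T"
  proof
    fix t :: "'a ratfun" assume "t \<in> vertex_ring \<Gamma>"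
    then obtain a s where "t = a / s" "a \<in> mon_alg \<Gamma>" "s \<in> mon_alg \<Gamma>" "cf s 0 \<noteq> 0"
      by (rule vertex_ring_rep[OF p]) blast
    then show "t \<in> T" using unit T(2) k by (auto simp: units_in_divide subset_iff)
  qed
  assume x: "x \<in> vertex_ring \<Gamma>" "x \<notin> units_in (vertex_ring \<Gamma>)"
  then obtain r S where S: "finite S" "S \<subseteq> \<Gamma> - {0}" "\<And>g. g \<in> S \<Longrightarrow> r g \<in> vertex_ring \<Gamma>" "x = (\<Sum>g\<in>S. r g * character g)"
    using nonunit_vertex_ring[OF p, of x] by blast
  have "x \<in> T - units_in T"
    unfolding S(4)
  proof (rule ideal_in_sum[OF id], rule ideal_inD(3)[OF id])
    fix g assume g: "g \<in> S"
    show "r g \<in> T" using S(3)[OF g] sub by blast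
    show "character g \<in> T - units_in T" using n[of g] g S(2) T(2) character_mon_alg_iff by blast
  qed
  then show "x \<notin> units_in T" by blast
qed

lemma mon_alg_mult:
  assumes us: "u \<in> mon_alg G" "s \<in> mon_alg H" and K: "\<And>g h. g \<in> G \<Longrightarrow> h \<in> H \<Longrightarrow> g + h \<in> K"
  shows "u * s \<in> mon_alg K"
proof (rule mon_algI)
  note us' = us[THEN mon_alg_UNIV]
  show "u * s \<in> mon_alg UNIV" using cf_mult(1)[OF us'] .
  fix k assume "cf (u * s) k \<noteq> 0"
  then obtain g h where "cf u g \<noteq> 0" "cf s h \<noteq> 0" "k = g + h" by (rule cf_mult_ne[OF us'])
  then show "k \<in> K" using K mon_alg_cf(3) us by blast
qed

lemma mon_alg_add:
  assumes us: "u \<in> mon_alg G" "s \<in> mon_alg G" shows "u + s \<in> mon_alg G"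
proof (rule mon_algI)
  note us' = us[THEN mon_alg_UNIV]
  show "u + s \<in> mon_alg UNIV" using cf_add(1)[OF us'] .
  fix k assume "cf (u + s) k \<noteq> 0"
  then have "cf u k \<noteq> 0 \<or> cf s k \<noteq> 0" using cf_add(2)[OF us'] by auto
  then show "k \<in> G" using mon_alg_cf(3) us by blast
qed

lemma vertex_ring_nonunit_rep:
  assumes p: "pointed w \<Gamma>" and t: "t \<in> vertex_ring \<Gamma> - units_in (vertex_ring \<Gamma>)"
  shows "\<exists>u s. t = u / s \<and> u \<in> aug \<Gamma> \<and> s \<in> mon_alg \<Gamma> \<and> cf s 0 \<noteq> 0"
proof -
  note V = vertex_ring_props[OF p]
  obtain u s where us: "t = u / s" "u \<in> mon_alg \<Gamma>" "s \<in> mon_alg \<Gamma>" "cf s 0 \<noteq> 0" "s \<in> units_in (vertex_ring \<Gamma>)"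
    using t by (elim DiffE, elim vertex_ring_rep[OF p]) blast
  have "u \<in> aug \<Gamma>"
  proof (rule ccontr)
    assume "u \<notin> aug \<Gamma>"
    then have "u \<in> units_in (vertex_ring \<Gamma>)" using V(4) us(2) by blast
    then have "t \<in> units_in (vertex_ring \<Gamma>)" using us units_in_mult[OF V(3) _ units_in_inverse] by (simp add: divide_inverse)
    then show False using t by blast
  qed
  then show ?thesis using us by blast
qed

text \<open>The residue field at the vertex is \<open>k\<close>: the value of \<open>a / s\<close>
  there is the quotient of the constant terms.\<close>

lemma vertex_ring_residue:
  assumes p: "pointed w \<Gamma>" and t: "t \<in> vertex_ring \<Gamma>"
  shows "\<exists>c. t - const c \<in> vertex_ring \<Gamma> - units_in (vertex_ring \<Gamma>)"
proof -
  note V = vertex_ring_props[OF p] and kA = k_subalgebra_mon_alg[OF pointed_submonoid[OF p]]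
  let ?T = "vertex_ring \<Gamma>"
  let ?m = "?T - units_in ?T"
  have idm: "ideal_in ?m ?T" by (rule ideal_in_nonunits[OF V(1)])
  obtain a s where as: "t = a / s" "a \<in> mon_alg \<Gamma>" "s \<in> mon_alg \<Gamma>" "cf s 0 \<noteq> 0" "s \<in> units_in ?T"
    using t by (elim vertex_ring_rep[OF p]) blast
  define c where "c = cf a 0 / cf s 0"
  have cs2: "- const c \<in> mon_alg \<Gamma>" by (rule k_subalgebraD(7)[OF kA k_subalgebraD(1)[OF kA]])
  then have cs: "- const c * s \<in> mon_alg \<Gamma>" "- const c \<in> mon_alg \<Gamma>" using k_subalgebraD(6)[OF kA cs2 as(3)] by blast+
  have "cf (a + - const c * s) 0 = 0"
    using cf_add(2)[OF mon_alg_UNIV[OF as(2)] mon_alg_UNIV[OF cs(1)]] cf_mult_0[OF p cs(2) as(3)]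
      cf_uminus[OF cf_const(1), of c] cf_const(2)[of c] as(4) by (simp add: c_def)
  then have "a + - const c * s \<in> aug \<Gamma>"
    unfolding aug_def using k_subalgebraD(4)[OF kA as(2) cs(1)] by blast
  then have "a + - const c * s \<in> ?m" using V(4,5) by (auto simp: aug_def)
  moreover have "t - const c = (a + - const c * s) * inverse s" using as(5) as(1) by (simp add: units_in_def field_simps)
  moreover have "inverse s \<in> ?T" using as(5) by (simp add: units_in_def)
  ultimately have "t - const c \<in> ?m" using ideal_inD(4)[OF idm, of "inverse s"] by metis
  then show ?thesis by blast
qed

section \<open>Chains of lattice vectors\<close>

definition dt :: "int \<times> int \<Rightarrow> int \<times> int \<Rightarrow> int" where
  "dt u w = fst u * snd w - snd u * fst w"

text \<open>A normal of the ray through \<open>u\<close>: the pairing with \<open>w\<close> is the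
  determinant of \<open>u\<close> and \<open>w\<close>. For \<open>l < r\<close> the edges of the
  dual cone of \<open>v l\<close>, \<open>v r\<close> are spanned by \<open>nn (v l)\<close> and
  \<open>- nn (v r)\<close>.\<close>

definition nn :: "int \<times> int \<Rightarrow> int \<times> int" where
  "nn u = (- snd u, fst u)"

definition smul :: "int \<Rightarrow> int \<times> int \<Rightarrow> int \<times> int" where
  "smul k m = (k * fst m, k * snd m)"

lemma pr_nn: "pr (nn u) w = dt u w"
  by (simp add: pr_def nn_def dt_def)

lemma dt_self [simp]: "dt u u = 0" and dt_swap: "dt w u = - dt u w"
  by (simp_all add: dt_def)

lemma pr_smul: "pr (smul k m) u = k * pr m u"
  by (simp add: pr_def smul_def algebra_simps)

lemma smul_simps: "smul 0 m = 0" "smul 1 m = m" "smul (j + k) m = smul j m + smul k m"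
  by (simp_all add: smul_def prod_eq_iff algebra_simps)

lemma submonoid_smul: "submonoid S \<Longrightarrow> m \<in> S \<Longrightarrow> 0 \<le> k \<Longrightarrow> smul k m \<in> S"
  using submonoid_scale[of S m "nat k"] by (simp add: scale_def smul_def)

lemma submonoid_add: "submonoid S \<Longrightarrow> m \<in> S \<Longrightarrow> n \<in> S \<Longrightarrow> m + n \<in> S"
  by (simp add: submonoid_def)

text \<open>Cramer's rule on the exponent side; for determinant 1 the two normals are the lattice
  basis dual to \<open>w\<close>, \<open>u\<close>. The next lemma is the version for vectors of
  N.\<close>

lemma cramer: "smul (dt u w) m = smul (pr m w) (nn u) + smul (pr m u) (- nn w)"
  by (simp add: smul_def dt_def pr_def nn_def prod_eq_iff algebra_simps)

lemma cramer': "smul (dt u w) m = smul (dt m w) u + smul (dt u m) w"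
  by (simp add: smul_def dt_def prod_eq_iff algebra_simps)

lemma smul_eqD: "smul k m = smul k n \<Longrightarrow> k \<noteq> 0 \<Longrightarrow> m = n"
  by (simp add: smul_def prod_eq_iff)

lemma eq_if_pr_eq:
  assumes "dt u w \<noteq> 0" "pr m u = pr n u" "pr m w = pr n w" shows "m = n"
  using cramer[of u w m] cramer[of u w n] assms by (metis smul_eqD)

definition dual2 :: "int \<times> int \<Rightarrow> int \<times> int \<Rightarrow> (int \<times> int) set" where
  "dual2 u w = {m. 0 \<le> pr m u \<and> 0 \<le> pr m w}"

lemma submonoid_dual2: "submonoid (dual2 u w)"
  by (auto simp: submonoid_def dual2_def pr_add)

lemma pointed_dual2: "dt u w \<noteq> 0 \<Longrightarrow> pointed (u + w) (dual2 u w)"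
  unfolding pointed_def
proof (intro conjI ballI impI submonoid_dual2)
  fix m assume d: "dt u w \<noteq> 0" and m: "m \<in> dual2 u w" "m \<noteq> 0"
  have "\<not> (pr m u = 0 \<and> pr m w = 0)" using eq_if_pr_eq[OF d, of m 0] m by auto
  then show "0 < pr m (u + w)" using m by (auto simp: dual2_def pr_add)
qed

text \<open>Adjacent indices stand for the two-dimensional cones of the subdivision with rays
  \<open>v j\<close>, \<open>j\<close> in \<open>I\<close>.\<close>

definition adjacent_in :: "nat set \<Rightarrow> nat \<Rightarrow> nat \<Rightarrow> bool" where
  "adjacent_in I a b \<longleftrightarrow> a \<in> I \<and> b \<in> I \<and> a < b \<and> (\<forall>j\<in>I. j \<le> a \<or> b \<le> j)"

locale chain =
  fixes v :: "nat \<Rightarrow> int \<times> int" and e :: "nat \<Rightarrow> int" and N :: nat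
  assumes det1: "i < N \<Longrightarrow> dt (v i) (v (Suc i)) = 1"
    and rec: "Suc i < N \<Longrightarrow> v (Suc (Suc i)) = smul (e (Suc i)) (v (Suc i)) - v i"
    and e2: "0 < i \<Longrightarrow> i < N \<Longrightarrow> 2 \<le> e i"
begin

lemma pr_rec: "Suc i < N \<Longrightarrow> pr m (v (Suc (Suc i))) = e (Suc i) * pr m (v (Suc i)) - pr m (v i)"
  unfolding rec by (simp add: pr_def smul_def algebra_simps)

text \<open>Since the entries are at least 2, the sequence of pairings is convex wherever it is
  nonnegative; once nonnegative and nondecreasing it stays so. The next lemma is the mirror
  image.\<close>

lemma mono_forward:
  assumes "0 \<le> pr m (v i)" "pr m (v i) \<le> pr m (v (Suc i))" "i \<le> j" "j < N"
  shows "0 \<le> pr m (v j) \<and> pr m (v j) \<le> pr m (v (Suc j))"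
  using assms(3,4)
proof (induction j rule: dec_induct)
  case base then show ?case using assms by simp
next
  case (step j)
  have j: "0 \<le> pr m (v j)" "pr m (v j) \<le> pr m (v (Suc j))" using step by auto
  have "2 * pr m (v (Suc j)) \<le> e (Suc j) * pr m (v (Suc j))"
    using e2[of "Suc j"] step.prems j by (intro mult_right_mono) auto
  then show ?case using pr_rec[of j m] step.prems j by auto
qed

lemma mono_backward:
  assumes "0 \<le> pr m (v (Suc i))" "pr m (v (Suc i)) \<le> pr m (v i)" "j \<le> i" "i < N"
  shows "0 \<le> pr m (v (Suc j)) \<and> pr m (v (Suc j)) \<le> pr m (v j)"
  using assms(3)
proof (induction j rule: inc_induct)
  case base then show ?case using assms by simp
next
  case (step j)
  have j: "0 \<le> pr m (v (Suc (Suc j)))" "pr m (v (Suc (Suc j))) \<le> pr m (v (Suc j))" "Suc j < N"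
    using step assms(4) by auto
  have "2 * pr m (v (Suc j)) \<le> e (Suc j) * pr m (v (Suc j))"
    using e2[of "Suc j"] j by (intro mult_right_mono) auto
  then show ?case using pr_rec[of j m] j by auto
qed

lemma forward_nonneg:
  assumes "0 \<le> pr m (v i)" "pr m (v i) \<le> pr m (v (Suc i))" "i \<le> j" "j \<le> N" "i < N"
  shows "pr m (v i) \<le> pr m (v j)"
  using assms(3,4)
proof (induction j rule: dec_induct)
  case (step j)
  then show ?case using mono_forward[OF assms(1,2), of j] by auto
qed simp

lemma backward_nonneg:
  assumes "0 \<le> pr m (v (Suc i))" "pr m (v (Suc i)) \<le> pr m (v i)" "j \<le> i" "i < N"
  shows "pr m (v (Suc i)) \<le> pr m (v j)"
  using assms(3)
proof (induction j rule: inc_induct)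
  case base then show ?case using assms by simp
next
  case (step j)
  then show ?case using mono_backward[OF assms(1,2) _ assms(4), of j] by auto
qed

text \<open>For fixed \<open>i\<close> the determinants start with 0, 1 and continue convexly, so
  every increment is at least 1. The induction has to carry the increment along with the
  bound.\<close>

lemma dt_pos:
  assumes "i < j" "j \<le> N" shows "int (j - i) \<le> dt (v i) (v j)"
proof -
  have "int (j - i) \<le> pr (nn (v i)) (v j) \<and> 1 \<le> pr (nn (v i)) (v j) - pr (nn (v i)) (v (j - 1))"
    using assms
  proof (induction j rule: less_induct)
    case (less j)
    show ?case
    proof (cases "j = Suc i")
      case True
      then show ?thesis using det1[of i] less.prems by (simp add: pr_nn)
    next
      case False
      then obtain k where k: "j = Suc (Suc k)" "i \<le> k" "i < Suc k" "Suc k < N"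
        using less.prems by (metis Suc_lessI Suc_le_eq less_antisym less_imp_Suc_add less_Suc_eq_le)
      have IH: "int (Suc k - i) \<le> pr (nn (v i)) (v (Suc k))" "1 \<le> pr (nn (v i)) (v (Suc k)) - pr (nn (v i)) (v k)"
        using less.IH[of "Suc k"] k by auto
      have "2 * pr (nn (v i)) (v (Suc k)) \<le> e (Suc k) * pr (nn (v i)) (v (Suc k))"
        using e2[of "Suc k"] k IH by (intro mult_right_mono) auto
      moreover have "pr (nn (v i)) (v j) = e (Suc k) * pr (nn (v i)) (v (Suc k)) - pr (nn (v i)) (v k)"
        using pr_rec[of k "nn (v i)"] k by simp
      moreover have "int (j - i) = int (Suc k - i) + 1" "j - 1 = Suc k" using k by auto
      ultimately show ?thesis using IH by (intro conjI; simp only:; linarith)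
    qed
  qed
  then show ?thesis by (simp add: pr_nn)
qed

lemma dt_pos': "i < j \<Longrightarrow> j \<le> N \<Longrightarrow> 0 < dt (v i) (v j)"
  using dt_pos[of i j] by simp

lemma dt_sgn: "i \<le> N \<Longrightarrow> j \<le> N \<Longrightarrow> 0 \<le> dt (v i) (v j) \<longleftrightarrow> i \<le> j"
  using dt_pos'[of i j] dt_pos'[of j i] dt_swap[of "v i" "v j"] by (cases i j rule: linorder_cases) auto

lemma v_inj: "i \<le> N \<Longrightarrow> j \<le> N \<Longrightarrow> v i = v j \<Longrightarrow> i = j"
  using dt_pos'[of i j] dt_pos'[of j i] by (cases i j rule: linorder_cases) auto

abbreviation Gam :: "nat \<Rightarrow> nat \<Rightarrow> (int \<times> int) set" where
  "Gam l r \<equiv> dual2 (v l) (v r)"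

lemma pointed_Gam: "l < r \<Longrightarrow> r \<le> N \<Longrightarrow> pointed (v l + v r) (Gam l r)"
  using dt_pos'[of l r] by (intro pointed_dual2) auto

lemma between: "smul (dt (v l) (v r)) (v j) = smul (dt (v j) (v r)) (v l) + smul (dt (v l) (v j)) (v r)"
  by (rule cramer')

lemma pr_between:
  "dt (v l) (v r) * pr m (v j) = dt (v j) (v r) * pr m (v l) + dt (v l) (v j) * pr m (v r)"
  by (simp add: pr_def dt_def algebra_simps)

lemma Gam_between:
  assumes m: "m \<in> Gam l r" and "l \<le> j" "j \<le> r" "r \<le> N" "l < r"
  shows "0 \<le> pr m (v j)"
proof -
  have "0 \<le> dt (v j) (v r) * pr m (v l) + dt (v l) (v j) * pr m (v r)"
    using assms dt_sgn[of j r] dt_sgn[of l j] by (auto simp: dual2_def)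
  then have "0 \<le> dt (v l) (v r) * pr m (v j)" using pr_between[of l r m j] by simp
  then show ?thesis using dt_pos'[of l r] assms by (simp add: zero_le_mult_iff)
qed

text \<open>The lower bound that the vertices \<open>mu\<close> attain; it is why subtracting
  \<open>mu\<close> from a nonzero exponent keeps the pairings with the chart's rays
  nonnegative.\<close>

lemma Gam_between_pos:
  assumes m: "m \<in> Gam l r" "m \<noteq> 0" and j: "l < j" "j < r" "r \<le> N"
  shows "1 \<le> pr m (v j)"
proof -
  have d: "0 < dt (v j) (v r)" "0 < dt (v l) (v j)" "0 < dt (v l) (v r)" using dt_pos' j by auto
  have nz: "pr m (v l) \<noteq> 0 \<or> pr m (v r) \<noteq> 0" using eq_if_pr_eq[of "v l" "v r" m 0] d m by auto
  have ge: "0 \<le> pr m (v l)" "0 \<le> pr m (v r)" using m by (auto simp: dual2_def)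
  have "0 < dt (v j) (v r) * pr m (v l) + dt (v l) (v j) * pr m (v r)"
    using nz ge d by (metis add_nonneg_pos add_pos_nonneg less_le mult_nonneg_nonneg mult_pos_pos order.strict_implies_order)
  then have "0 < dt (v l) (v r) * pr m (v j)" using pr_between[of l r m j] by simp
  then show ?thesis using d(3) by (simp add: zero_less_mult_iff)
qed

lemma Gam_mono: "l \<le> a \<Longrightarrow> a < b \<Longrightarrow> b \<le> r \<Longrightarrow> r \<le> N \<Longrightarrow> Gam l r \<subseteq> Gam a b"
  using Gam_between[of _ l r a] Gam_between[of _ l r b] by (auto simp: dual2_def)

text \<open>It is enough to test the two edge generators of the dual cone: the signs of their
  pairings are signs of determinants, which order the indices.\<close>

lemma Gam_subsetD:
  assumes "Gam l r \<subseteq> Gam a b" "l < r" "r \<le> N" "a < b" "b \<le> N"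
  shows "l \<le> a \<and> b \<le> r"
proof -
  have "nn (v l) \<in> Gam l r" "- nn (v r) \<in> Gam l r"
    using dt_pos'[of l r] dt_swap[of "v r" "v l"] assms by (auto simp: dual2_def pr_nn)
  then have "nn (v l) \<in> Gam a b" "- nn (v r) \<in> Gam a b" using assms by auto
  then have "0 \<le> dt (v l) (v a)" "0 \<le> dt (v b) (v r)"
    using dt_swap[of "v b" "v r"] by (auto simp: dual2_def pr_nn)
  then show ?thesis using dt_sgn assms by auto
qed

text \<open>The vertices of the Newton polygon of \<open>Gam l r - {0}\<close>: on the cone spanned by \<open>v i\<close> and
  \<open>v (Suc i)\<close>, the support function is given by \<open>mu l r i\<close>.\<close>

definition mu :: "nat \<Rightarrow> nat \<Rightarrow> nat \<Rightarrow> int \<times> int" where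
  "mu l r i = (if i = l then nn (v l) else if Suc i = r then - nn (v r) else nn (v i) - nn (v (Suc i)))"

text \<open>These are the smallest values that a nonzero element of \<open>Gam l r\<close> can take,
  0 on the boundary rays and 1 inside. The two vectors form a basis, so the values determine
  \<open>mu l r i\<close>.\<close>

lemma mu_values:
  assumes "l \<le> i" "i < r" "Suc l < r" "r \<le> N"
  shows "pr (mu l r i) (v i) = (if i = l then 0 else 1)" "pr (mu l r i) (v (Suc i)) = (if Suc i = r then 0 else 1)"
proof -
  have d: "dt (v i) (v (Suc i)) = 1" "dt (v (Suc i)) (v i) = - 1" using det1[of i] dt_swap[of "v i" "v (Suc i)"] assms by auto
  show "pr (mu l r i) (v i) = (if i = l then 0 else 1)" "pr (mu l r i) (v (Suc i)) = (if Suc i = r then 0 else 1)"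
    using assms d by (auto simp: mu_def pr_nn pr_diff)
qed

text \<open>The values at the two neighbours do not decrease outwards, so convexity propagates
  nonnegativity to both ends of the cone.\<close>

lemma mu_Gam:
  assumes "l \<le> i" "i < r" "Suc l < r" "r \<le> N"
  shows "mu l r i \<in> Gam l r - {0}"
proof -
  note V = mu_values[OF assms]
  have "0 \<le> pr (mu l r i) (v r)"
  proof (cases "Suc i = r")
    case False
    then show ?thesis using forward_nonneg[of "mu l r i" i r] V assms by (auto split: if_splits)
  qed (use V in auto)
  moreover have "0 \<le> pr (mu l r i) (v l)"
  proof (cases "i = l")
    case False
    then show ?thesis using backward_nonneg[of "mu l r i" i l] V assms by (auto split: if_splits)
  qed (use V in auto)
  moreover have "mu l r i \<noteq> 0" using V assms by (auto split: if_splits)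
  ultimately show ?thesis by (simp add: dual2_def)
qed

text \<open>The old rays \<open>l\<close> and \<open>r\<close> are included so that the cones of the
  refinement are its adjacent pairs. \<open>Suc l\<close> and \<open>r - 1\<close> coincide when
  only one vector lies inside.\<close>

definition Ins :: "nat \<Rightarrow> nat \<Rightarrow> nat set" where
  "Ins l r = {l, Suc l, r - 1, r} \<union> {i. l < i \<and> i < r \<and> e i \<noteq> 2}"

lemma adjacent_Ins:
  assumes "adjacent_in (Ins l r) a b" "Suc l < r"
  shows "l \<le> a" "a < b" "b \<le> r" "\<And>j. a < j \<Longrightarrow> j < b \<Longrightarrow> e j = 2"
    "Suc a < b \<Longrightarrow> Suc l \<le> a \<and> Suc b \<le> r" "a = l \<or> a = Suc l \<or> a = r - 1 \<or> e a \<noteq> 2"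
    "b = r \<or> Suc b = r \<or> b = Suc l \<or> e b \<noteq> 2"
proof -
  have h: "a \<in> Ins l r" "b \<in> Ins l r" "a < b" and nb: "\<And>j. j \<in> Ins l r \<Longrightarrow> j \<le> a \<or> b \<le> j"
    using assms by (auto simp: adjacent_in_def)
  show r1: "l \<le> a" "a < b" "b \<le> r" using h assms(2) by (auto simp: Ins_def)
  show "e j = 2" if "a < j" "j < b" for j using nb[of j] that r1 by (auto simp: Ins_def)
  show "Suc l \<le> a \<and> Suc b \<le> r" if "Suc a < b"
    using nb[of "Suc l"] nb[of "r - 1"] that r1 assms(2) by (auto simp: Ins_def)
  show "a = l \<or> a = Suc l \<or> a = r - 1 \<or> e a \<noteq> 2" using h r1 by (auto simp: Ins_def)
  show "b = r \<or> Suc b = r \<or> b = Suc l \<or> e b \<noteq> 2" using h r1 assms(2) by (auto simp: Ins_def)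
qed

text \<open>For an entry 2 the recursion says that second differences vanish, so every pairing is an
  arithmetic progression along the run.\<close>

lemma run_linear:
  assumes "\<And>j. a < j \<Longrightarrow> j < b \<Longrightarrow> e j = 2" "a \<le> j" "j \<le> b" "a < b" "b \<le> N"
  shows "pr m (v j) = pr m (v a) + int (j - a) * (pr m (v (Suc a)) - pr m (v a))"
  using assms(2,3)
proof (induction j rule: less_induct)
  case (less j)
  consider "j = a" | "j = Suc a" | k where "j = Suc (Suc k)" "a \<le> k" "Suc k < b"
  proof -
    assume h: "j = a \<Longrightarrow> thesis" "j = Suc a \<Longrightarrow> thesis"
      "\<And>k. j = Suc (Suc k) \<Longrightarrow> a \<le> k \<Longrightarrow> Suc k < b \<Longrightarrow> thesis"
    have "j = Suc (Suc (j - 2)) \<and> a \<le> j - 2 \<and> Suc (j - 2) < b" if "j \<noteq> a" "j \<noteq> Suc a"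
      using that less.prems by auto
    then show thesis using h by blast
  qed
  then show ?case
  proof cases
    case 3
    have "e (Suc k) = 2" using assms(1)[of "Suc k"] 3 by auto
    then have "pr m (v j) = 2 * pr m (v (Suc k)) - pr m (v k)" using pr_rec[of k m] 3 assms by auto
    moreover have "int (j - a) = int (k - a) + 2" "int (Suc k - a) = int (k - a) + 1" using 3 by auto
    ultimately show ?thesis using less.IH[of k] less.IH[of "Suc k"] 3 by (simp add: algebra_simps)
  qed auto
qed

text \<open>One vertex serves a whole cone of the refinement: value 1 at two consecutive vectors
  forces value 1 along the run, and each step's vertex is determined by these values.\<close>

lemma mu_run:
  assumes ad: "adjacent_in (Ins l r) a b" and lr: "Suc l < r" "r \<le> N"
  shows "a \<le> j \<Longrightarrow> j < b \<Longrightarrow> mu l r j = mu l r a"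
    "pr (mu l r a) (v b) = (if b = r then 0 else 1)" "pr (mu l r a) (v a) = (if a = l then 0 else 1)"
    "Suc a < b \<Longrightarrow> a \<le> j \<Longrightarrow> j \<le> b \<Longrightarrow> pr (mu l r a) (v j) = 1"
proof -
  note A = adjacent_Ins[OF ad lr(1)]
  note V = mu_values[of l _ r]
  show 4: "pr (mu l r a) (v j) = 1" if "Suc a < b" "a \<le> j" "j \<le> b" for j
    using run_linear[of a b j "mu l r a"] V[of a] A that lr by (auto split: if_splits)
  show "pr (mu l r a) (v b) = (if b = r then 0 else 1)"
  proof (cases "Suc a < b")
    case False
    then have "b = Suc a" using A by auto
    then show ?thesis using V[of a] A lr by auto
  qed (use 4[of b] A in auto)
  show "pr (mu l r a) (v a) = (if a = l then 0 else 1)" using V[of a] A lr by auto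
  show "mu l r j = mu l r a" if "a \<le> j" "j < b"
  proof (cases "j = a")
    case False
    then have *: "Suc a < b" using that by auto
    show ?thesis
      by (rule eq_if_pr_eq[of "v j" "v (Suc j)"])
        (use 4[OF *, of j] 4[OF *, of "Suc j"] V[of j] det1[of j] A(1-3) A(5)[OF *] that lr False in auto)
  qed simp
qed

lemma chart_ge:
  assumes ad: "adjacent_in (Ins l r) a b" and lr: "Suc l < r" "r \<le> N" and g: "g \<in> Gam l r - {0}"
  shows "g - mu l r a \<in> Gam a b"
proof -
  note A = adjacent_Ins[OF ad lr(1)] and M = mu_run[OF ad lr]
  have "pr (mu l r a) (v a) \<le> pr g (v a)"
    using M(3) Gam_between[of g l r a] Gam_between_pos[of g l r a] A g lr by auto
  moreover have "pr (mu l r a) (v b) \<le> pr g (v b)"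
    using M(2) Gam_between[of g l r b] Gam_between_pos[of g l r b] A g lr by auto
  ultimately show ?thesis by (simp add: dual2_def pr_diff)
qed

text \<open>\<open>S\<close> is left abstract because it is later the set of exponents whose
  characters lie in some ring. The dual monoid of the chart is generated by its two edge normals
  together with the vertex, and the normals are recovered as differences
  \<open>g - mu l r a\<close>.\<close>

lemma chart_generated:
  assumes ad: "adjacent_in (Ins l r) a b" and lr: "Suc l < r" "r \<le> N"
    and S: "submonoid S" "Gam l r \<subseteq> S" "\<And>g. g \<in> Gam l r - {0} \<Longrightarrow> g - mu l r a \<in> S"
  shows "Gam a b \<subseteq> S"
proof -
  note A = adjacent_Ins[OF ad lr(1)] and M = mu_run[OF ad lr]
  let ?m = "mu l r a"
  have V: "pr ?m (v a) = (if a = l then 0 else 1)" "pr ?m (v (Suc a)) = (if Suc a = r then 0 else 1)"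
    using mu_values[of l a r] A lr by auto
  have dab: "dt (v a) (v (Suc a)) = 1" "dt (v b) (v (b - 1)) = - 1"
    using det1[of a] det1[of "b - 1"] dt_swap[of "v (b - 1)" "v b"] A lr by auto
  have na: "nn (v a) \<in> S"
  proof (cases "a = l")
    case True
    have "nn (v a) \<in> Gam l r" using dt_pos'[of l r] lr True by (auto simp: dual2_def pr_nn)
    then show ?thesis using S by auto
  next
    case al: False
    \<comment> \<open>The numerator with \<open>nn (v a) = ?g - ?m\<close>. At the vector preceding
      \<open>v a\<close> it takes the value \<open>e a - 2\<close>, or \<open>e a - 1\<close> if
      \<open>Suc a = r\<close>. If that vector is not \<open>v l\<close>, membership of
      \<open>a\<close> in \<open>Ins l r\<close> makes the value at least 1, and convexity carries
      it to \<open>v l\<close>.\<close>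
    let ?g = "nn (v a) + ?m"
    have g1: "pr ?g (v a) = 1" "pr ?g (v (Suc a)) = (if Suc a = r then 1 else 2)"
      using V dab al by (auto simp: pr_add pr_nn)
    then have "1 \<le> pr ?g (v r)" using forward_nonneg[of ?g a r] A lr by auto
    moreover have "0 \<le> pr ?g (v l)"
    proof -
      obtain k where k: "a = Suc k" using al A by (cases a) auto
      have "Suc k < N" using A lr k by auto
      then have rk: "pr ?g (v k) = e a - pr ?g (v (Suc a))" using pr_rec[of k ?g] k g1 by auto
      have ea: "2 \<le> e a" using e2[of a] k A lr by auto
      show ?thesis
      proof (cases "k = l")
        case True
        then show ?thesis using rk ea g1 by auto
      next
        case False
        then have "a = r - 1 \<or> e a \<noteq> 2" using A(6) k A(1) al by auto
        then have "1 \<le> pr ?g (v k)" using rk ea g1 A lr by auto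
        moreover have "l \<le> k" "k < N" using al k A(1-3) lr by auto
        ultimately have "1 \<le> pr ?g (v l)" using backward_nonneg[of ?g k l] g1(1) k by simp
        then show ?thesis by simp
      qed
    qed
    moreover have "?g \<noteq> 0" using g1 by auto
    ultimately have "?g \<in> Gam l r - {0}" by (simp add: dual2_def)
    then show ?thesis using S(3)[of ?g] by simp
  qed
  have nb: "- nn (v b) \<in> S"
  proof (cases "b = r")
    case True
    have "- nn (v b) \<in> Gam l r" using dt_pos'[of l r] dt_swap[of "v r" "v l"] lr True by (auto simp: dual2_def pr_nn)
    then show ?thesis using S by auto
  next
    case False
    let ?g = "- nn (v b) + ?m"
    obtain k where k: "b = Suc k" using A by (cases b) auto
    have mk: "pr ?m (v k) = (if k = l then 0 else 1)"
      using M(4)[of k] V A k by (cases "Suc a < b") (auto simp: less_Suc_eq)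
    have g1: "pr ?g (v b) = 1" "pr ?g (v k) = (if k = l then 1 else 2)"
      using M(2) mk dab k False by (auto simp: pr_add pr_diff pr_nn)
    then have "1 \<le> pr ?g (v l)" using backward_nonneg[of ?g k l] A lr k by (auto split: if_splits)
    moreover have "0 \<le> pr ?g (v r)"
    proof -
      have "Suc k < N" using A lr k False by auto
      then have rk: "pr ?g (v (Suc b)) = e b - pr ?g (v k)" using pr_rec[of k ?g] k g1 by auto
      have eb: "2 \<le> e b" using e2[of b] k A lr False by auto
      show ?thesis
      proof (cases "Suc b = r")
        case True
        then show ?thesis using rk eb g1 by (auto split: if_splits)
      next
        case nr: False
        then have "b = Suc l \<or> e b \<noteq> 2" using A(7) False by auto
        then have "1 \<le> pr ?g (v (Suc b))" using rk eb g1 k by (auto split: if_splits)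
        moreover have "b < N" "b \<le> r" using False A(3) lr by auto
        ultimately have "1 \<le> pr ?g (v r)" using forward_nonneg[of ?g b r] g1(1) lr by simp
        then show ?thesis by simp
      qed
    qed
    moreover have "?g \<noteq> 0" using g1 by auto
    ultimately have "?g \<in> Gam l r - {0}" by (simp add: dual2_def)
    then show ?thesis using S(3)[of ?g] by simp
  qed
  show ?thesis
  proof
    fix m assume m: "m \<in> Gam a b"
    show "m \<in> S"
    proof (cases "Suc a < b")
      case False
      then have "b = Suc a" using A by auto
      then have "m = smul (pr m (v b)) (nn (v a)) + smul (pr m (v a)) (- nn (v b))"
        using cramer[of "v a" "v b" m] dab by (simp add: smul_simps)
      then show ?thesis
        using submonoid_add[OF S(1) submonoid_smul[OF S(1) na] submonoid_smul[OF S(1) nb]] m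
        by (metis (no_types, lifting) dual2_def mem_Collect_eq)
    next
      case True
      \<comment> \<open>The slope of \<open>m\<close> along the run, where \<open>?m\<close> is
        constantly 1. Subtracting the smaller end value times \<open>?m\<close> leaves a multiple of
        the normal at that end.\<close>
      define d where "d = pr m (v (Suc a)) - pr m (v a)"
      have lin: "pr m (v j) = pr m (v a) + int (j - a) * d" if "a \<le> j" "j \<le> b" for j
        using run_linear[of a b j m] that A lr unfolding d_def by auto
      have m1: "pr ?m (v j) = 1" if "a \<le> j" "j \<le> b" for j using M(4) True that by blast
      have mS: "?m \<in> S" using mu_Gam[of l a r] A lr S(2) by auto
      have ge: "0 \<le> pr m (v a)" "0 \<le> pr m (v b)" using m by (auto simp: dual2_def)
      show ?thesis
      proof (cases "0 \<le> d")
        case d: True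
        have "m = smul (pr m (v a)) ?m + smul d (nn (v a))"
          by (rule eq_if_pr_eq[of "v a" "v (Suc a)"])
            (use m1[of a] m1[of "Suc a"] True dab in \<open>auto simp: pr_add pr_smul pr_nn d_def\<close>)
        then show ?thesis
          using submonoid_add[OF S(1) submonoid_smul[OF S(1) mS ge(1)] submonoid_smul[OF S(1) na d]] by metis
      next
        case d: False
        have bd: "pr m (v (b - 1)) = pr m (v b) - d"
        proof -
          have "a \<le> b - 1" using True by linarith
          then show ?thesis using lin[of b] lin[of "b - 1"] True by (simp add: algebra_simps of_nat_diff)
        qed
        have "m = smul (pr m (v b)) ?m + smul (- d) (- nn (v b))"
          by (rule eq_if_pr_eq[of "v b" "v (b - 1)"])
            (use m1[of b] m1[of "b - 1"] True dab bd in \<open>auto simp: pr_add pr_smul pr_nn\<close>)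
        then show ?thesis
          using submonoid_add[OF S(1) submonoid_smul[OF S(1) mS ge(2)] submonoid_smul[OF S(1) nb, of "- d"]] d
          by (metis linorder_le_cases neg_0_le_iff_le)
      qed
    qed
  qed
qed

text \<open>Every \<open>g\<close> dominates a rational point of an edge of the Newton polygon: a positive multiple
  of \<open>g\<close> is a sum of as many vertices of the edge and an element of \<open>Gam l r\<close>.\<close>

lemma newton_vertex:
  assumes lr: "Suc l < r" "r \<le> N" and g: "g \<in> Gam l r - {0}"
    and S: "submonoid S" "Gam l r \<subseteq> S" "\<And>h. h \<in> Gam l r - {0} \<Longrightarrow> h - g \<in> S"
  shows "\<exists>i. l \<le> i \<and> i < r \<and> g - mu l r i \<in> S"
proof -
  \<comment> \<open>The sign of \<open>D i\<close> says on which side of the line through 0 and the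
    vertex \<open>mu l r i\<close> the exponent \<open>g\<close> lies; the first change to positive
    brackets \<open>g\<close> between two consecutive vertices.\<close>
  define D where "D i = dt (mu l r i) g" for i
  have ge: "0 \<le> pr g (v l)" "0 \<le> pr g (v r)" using g by (auto simp: dual2_def)
  show ?thesis
  proof (cases "\<exists>i. l \<le> i \<and> i < r \<and> 0 < D i")
    case False
    \<comment> \<open>Without a positive value, the last one, \<open>pr g (v r)\<close>, must be 0,
      so \<open>g\<close> is a positive multiple of the last vertex.\<close>
    define k where "k = r - 1"
    have k: "r = Suc k" "l < k" "k < N" using lr by (auto simp: k_def)
    have mk: "mu l r k = - nn (v r)" using k by (simp add: mu_def)
    have "D k = pr g (v r)" unfolding D_def mk by (simp add: dt_def nn_def pr_def algebra_simps)
    then have 0: "pr g (v r) = 0" using False k ge by force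
    have "g = smul (pr g (v k)) (mu l r k)"
      using cramer[of "v k" "v r" g] det1[of k] k 0 mk by (simp add: smul_simps)
    also have "\<dots> = smul (pr g (v k) - 1) (mu l r k) + mu l r k"
      using smul_simps(3)[of "pr g (v k) - 1" 1] by (simp add: smul_simps)
    finally have "g - mu l r k = smul (pr g (v k) - 1) (mu l r k)" by (metis add_diff_cancel_right')
    moreover have "1 \<le> pr g (v k)" using Gam_between_pos[of g l r k] g k lr by auto
    moreover have "mu l r k \<in> S" using mu_Gam[of l k r] k lr S(2) by auto
    ultimately show ?thesis using submonoid_smul[OF S(1), of "mu l r k" "pr g (v k) - 1"] k by (intro exI[of _ k]) auto
  next
    case True
    define i where "i = (LEAST i. l \<le> i \<and> i < r \<and> 0 < D i)"
    have i: "l \<le> i" "i < r" "0 < D i" using LeastI_ex[OF True] unfolding i_def by auto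
    have "D l = - pr g (v l)" by (simp add: D_def mu_def dt_def nn_def pr_def algebra_simps)
    then have "i \<noteq> l" using i ge by auto
    then obtain k where k: "i = Suc k" "l \<le> k" using i by (cases i) auto
    have Dk: "D k \<le> 0" using not_less_Least[of k "\<lambda>i. l \<le> i \<and> i < r \<and> 0 < D i"] k i unfolding i_def[symmetric] by auto
    \<comment> \<open>Cramer's rule in the basis of the two bracketing vertices. Both have value 1
      at \<open>v i\<close>, so \<open>K * pr g (v i)\<close> equals the sum
      \<open>D i - D k\<close> of the two weights.\<close>
    define K where "K = dt (mu l r i) (mu l r k)"
    have eq: "smul K g = smul (- D k) (mu l r i) + smul (D i) (mu l r k)"
      unfolding K_def D_def using cramer'[of "mu l r i" "mu l r k" g] dt_swap[of g "mu l r k"] by simp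
    have "pr (mu l r i) (v i) = 1" "pr (mu l r k) (v i) = 1"
      using mu_values[of l i r] mu_values[of l k r] i k lr by auto
    then have K: "K * pr g (v i) = D i - D k"
      using arg_cong[OF eq, of "\<lambda>m. pr m (v i)"] by (simp add: pr_add pr_smul)
    have gi: "1 \<le> pr g (v i)" using Gam_between_pos[of g l r i] g i k lr by auto
    have "0 < K * pr g (v i)" using K i Dk by auto
    then have K0: "0 < K" using gi by (simp add: zero_less_mult_iff)
    \<comment> \<open>One copy of \<open>mu l r k\<close> is kept back, which
      \<open>D i \<ge> 1\<close> permits; the other vertices appear as differences with
      \<open>g\<close>, which lie in \<open>S\<close>, and the height of \<open>g\<close> above the
      edge accounts for the last summand.\<close>
    have "g - mu l r k = smul (D i - 1) (mu l r k - g) + smul (- D k) (mu l r i - g) + smul (K * (pr g (v i) - 1)) g"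
    proof -
      have "smul (D i - 1) (mu l r k - g) + smul (- D k) (mu l r i - g) + smul (K * (pr g (v i) - 1)) g
        = (smul (- D k) (mu l r i) + smul (D i) (mu l r k)) - smul K g + smul (K * pr g (v i) - (D i - D k)) g + (g - mu l r k)"
        by (simp add: smul_def prod_eq_iff algebra_simps)
      also have "\<dots> = g - mu l r k" unfolding eq K by (simp add: smul_def prod_eq_iff)
      finally show ?thesis by simp
    qed
    moreover have "smul (D i - 1) (mu l r k - g) \<in> S" "smul (- D k) (mu l r i - g) \<in> S"
      using submonoid_smul[OF S(1)] S(3) mu_Gam[of l k r] mu_Gam[of l i r] i k lr Dk by auto
    moreover have "smul (K * (pr g (v i) - 1)) g \<in> S"
      using submonoid_smul[OF S(1), of g "K * (pr g (v i) - 1)"] g S(2) K0 gi by auto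
    ultimately have "g - mu l r k \<in> S" using submonoid_add[OF S(1)] by metis
    then show ?thesis using i k by auto
  qed
qed

end

section \<open>Cones and fans\<close>

lemma real_vec_inner: "real_vec m \<bullet> real_vec u = of_int (pr m u)"
  by (simp add: real_vec_def pr_def inner_prod_def)

lemma dual_semigroup_cone_of: "dual_semigroup (cone_of F) = {m. \<forall>u\<in>F. 0 \<le> pr m u}"
proof (intro Set.set_eqI iffI)
  fix m assume m: "m \<in> dual_semigroup (cone_of F)"
  have "0 \<le> pr m u" if "u \<in> F" for u
  proof -
    have "real_vec u \<in> cone_of F" using that unfolding cone_of_def by (simp add: hull_inc)
    then have "0 \<le> real_vec m \<bullet> real_vec u" using m by (simp add: dual_semigroup_def)
    then show ?thesis by (simp add: real_vec_inner)
  qed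
  then show "m \<in> {m. \<forall>u\<in>F. 0 \<le> pr m u}" by simp
next
  fix m assume m: "m \<in> {m. \<forall>u\<in>F. 0 \<le> pr m u}"
  have "convex_cone hull (real_vec ` F) \<subseteq> {x. real_vec m \<bullet> x \<ge> 0}"
  proof (rule hull_minimal)
    show "real_vec ` F \<subseteq> {x. real_vec m \<bullet> x \<ge> 0}" using m by (auto simp: real_vec_inner)
    show "convex_cone {x. real_vec m \<bullet> x \<ge> 0}" by (rule convex_cone_halfspace_ge)
  qed
  then show "m \<in> dual_semigroup (cone_of F)" by (auto simp: dual_semigroup_def cone_of_def)
qed

lemma dual_semigroup_cone_of_pair: "dual_semigroup (cone_of {u, w}) = dual2 u w"
  by (auto simp: dual_semigroup_cone_of dual2_def)

lemma smul_mem_cone: "real_vec u \<in> cone_of F \<Longrightarrow> 0 < k \<Longrightarrow> smul k w = u \<Longrightarrow> real_vec w \<in> cone_of F"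
proof -
  assume h: "real_vec u \<in> cone_of F" "0 < k" "smul k w = u"
  have "real_vec w = (1 / of_int k) *\<^sub>R real_vec u"
    using h(2) unfolding h(3)[symmetric] by (simp add: real_vec_def smul_def)
  then show ?thesis using h convex_cone_hull_mul[of "real_vec u" "real_vec ` F" "1 / of_int k"]
    by (simp add: cone_of_def)
qed

lemma nonneg_mem_cone:
  assumes "u \<in> F" "w \<in> F" "0 \<le> x" "0 \<le> y"
  shows "real_vec (smul x u + smul y w) \<in> cone_of F"
proof -
  have "real_vec (smul x u + smul y w) = of_int x *\<^sub>R real_vec u + of_int y *\<^sub>R real_vec w"
    by (simp add: real_vec_def smul_def)
  then show ?thesis
    using assms by (auto simp: cone_of_def hull_inc intro!: convex_cone_hull_add convex_cone_hull_mul)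
qed

section \<open>Faces of a cone as principal open subsets\<close>

definition dual1 :: "int \<times> int \<Rightarrow> (int \<times> int) set" where
  "dual1 u = {m. 0 \<le> pr m u}"

lemma submonoid_dual1: "submonoid (dual1 u)" and submonoid_UNIV: "submonoid UNIV"
  by (auto simp: submonoid_def dual1_def pr_add)

text \<open>The hypotheses say that the larger monoid arises from the smaller by inverting the
  single element \<open>g\<close>; its spectrum is therefore the open set where the character of
  \<open>g\<close> is a unit.\<close>

lemma Spec_face:
  assumes G: "submonoid \<Gamma>" "submonoid \<Gamma>'" "\<Gamma> \<subseteq> \<Gamma>'" and g: "g \<in> \<Gamma>" "- g \<in> \<Gamma>'"
    and K: "\<And>m. m \<in> \<Gamma>' \<Longrightarrow> \<exists>K. m + scale K g \<in> \<Gamma>"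
  shows "T \<in> Spec (mon_alg \<Gamma>') \<longleftrightarrow> T \<in> Spec (mon_alg \<Gamma>) \<and> character g \<in> units_in T"
proof -
  note k = k_subalgebra_mon_alg[OF G(1)] and k' = k_subalgebra_mon_alg[OF G(2)]
  have char: "character m = character (m + scale K g) / character g ^ K" for m K
    by (simp add: character_add character_scale)
  show ?thesis
  proof (intro iffI conjI)
    assume T: "T \<in> Spec (mon_alg \<Gamma>')"
    note T' = SpecD[OF k' T]
    have "character g \<in> T" "character (- g) \<in> T" using T'(2) g G(3) character_mon_alg_iff by blast+
    then show u: "character g \<in> units_in T" by (simp add: units_in_def character_minus)
    have sub: "mon_alg \<Gamma> \<subseteq> T" using T'(2) mon_alg_mono[OF G(3)] by blast
    note F = fraction_set_props[OF k sub T'(1)]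
    have "mon_alg \<Gamma>' \<subseteq> fraction_set T (mon_alg \<Gamma>)"
    proof (rule mon_alg_subset[OF F(1)], rule subsetI)
      fix x :: "'a ratfun" assume "x \<in> character ` \<Gamma>'"
      then obtain m where m: "m \<in> \<Gamma>'" "x = character m" by blast
      obtain K where K': "m + scale K g \<in> \<Gamma>" using K m by blast
      have "x = character (m + scale K g) / character g ^ K" using char m by simp
      moreover have "character g ^ K \<in> mon_alg \<Gamma> \<inter> units_in T"
        using units_in_power[OF T'(1) u] k_subalgebraD(8)[OF k, of "character g"] g(1) character_mon_alg_iff by blast
      ultimately show "x \<in> fraction_set T (mon_alg \<Gamma>)"
        unfolding fraction_set_def using K' character_mon_alg_iff by blast
    qed
    then show "T \<in> Spec (mon_alg \<Gamma>)"
      unfolding Spec_iff[OF k] using T' fractions_over_trans[OF T'(4) T'(1) k sub] by blast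
  next
    assume h: "T \<in> Spec (mon_alg \<Gamma>) \<and> character g \<in> units_in T"
    note T' = SpecD[OF k, of T]
    have "mon_alg \<Gamma>' \<subseteq> T"
    proof (rule mon_alg_subset)
      show "k_subalgebra T" using T' h by blast
      show "character ` \<Gamma>' \<subseteq> T"
      proof
        fix x :: "'a ratfun" assume "x \<in> character ` \<Gamma>'"
        then obtain m where m: "m \<in> \<Gamma>'" "x = character m" by blast
        obtain K where K': "m + scale K g \<in> \<Gamma>" using K m by blast
        have "x = character (m + scale K g) / character g ^ K" using char m by simp
        moreover have "character (m + scale K g) \<in> T" using K' T'(2) h character_mon_alg_iff by blast
        ultimately show "x \<in> T" using units_in_divide[OF T'(1)] units_in_power[OF T'(1)] h by simp
      qed
    qed
    then show "T \<in> Spec (mon_alg \<Gamma>')"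
      unfolding Spec_iff[OF k'] using T' h fractions_over_mono[OF _ mon_alg_mono[OF G(3)]] by blast
  qed
qed

lemma shift_nonneg: "0 < c \<Longrightarrow> nat \<bar>x\<bar> \<le> K \<Longrightarrow> 0 \<le> x + int K * c"
proof -
  assume h: "0 < c" "nat \<bar>x\<bar> \<le> K"
  then have "int K * 1 \<le> int K * c" by (intro mult_left_mono) auto
  then show ?thesis using h by linarith
qed

text \<open>\<open>sgn\<close> orients the normal so that it is positive on \<open>w\<close>, since
  no order of the two rays is assumed.\<close>

lemma Spec_ray:
  assumes "dt u w \<noteq> 0"
  shows "T \<in> Spec (mon_alg (dual1 u)) \<longleftrightarrow> T \<in> Spec (mon_alg (dual2 u w)) \<and> character (smul (sgn (dt u w)) (nn u)) \<in> units_in T"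
proof (rule Spec_face[OF submonoid_dual2 submonoid_dual1])
  let ?g = "smul (sgn (dt u w)) (nn u)"
  have p: "pr ?g u = 0" "0 < pr ?g w"
    using assms by (auto simp: pr_smul pr_nn sgn_if)
  show "dual2 u w \<subseteq> dual1 u" "?g \<in> dual2 u w" "- ?g \<in> dual1 u" using p by (auto simp: dual1_def dual2_def)
  fix m assume m: "m \<in> dual1 u"
  show "\<exists>K. m + scale K ?g \<in> dual2 u w"
    using m p shift_nonneg[OF p(2) order_refl, of "pr m w"] by (intro exI[of _ "nat \<bar>pr m w\<bar>"]) (auto simp: dual1_def dual2_def pr_add pr_scale)
qed

lemma Spec_torus:
  assumes "dt u w \<noteq> 0" "0 < pr g u" "0 < pr g w"
  shows "T \<in> Spec (mon_alg UNIV) \<longleftrightarrow> T \<in> Spec (mon_alg (dual2 u w)) \<and> character g \<in> units_in T"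
proof (rule Spec_face[OF submonoid_dual2 submonoid_UNIV])
  show "g \<in> dual2 u w" using assms by (auto simp: dual2_def)
  fix m
  let ?K = "nat \<bar>pr m u\<bar> + nat \<bar>pr m w\<bar>"
  show "\<exists>K. m + scale K g \<in> dual2 u w"
    using shift_nonneg[OF assms(2), of "pr m u" ?K] shift_nonneg[OF assms(3), of "pr m w" ?K]
    by (intro exI[of _ ?K]) (auto simp: dual2_def pr_add pr_scale)
qed auto

lemma Spec_torus_ray:
  assumes "0 < pr g u"
  shows "T \<in> Spec (mon_alg UNIV) \<longleftrightarrow> T \<in> Spec (mon_alg (dual1 u)) \<and> character g \<in> units_in T"
proof (rule Spec_face[OF submonoid_dual1 submonoid_UNIV])
  show "g \<in> dual1 u" using assms by (auto simp: dual1_def)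
  fix m
  show "\<exists>K. m + scale K g \<in> dual1 u"
    using shift_nonneg[OF assms order_refl, of "pr m u"] by (intro exI[of _ "nat \<bar>pr m u\<bar>"]) (auto simp: dual1_def pr_add pr_scale)
qed auto

lemma dual2_commute: "dual2 u w = dual2 w u"
  by (auto simp: dual2_def)

text \<open>A nonzero exponent vanishes on at most one of the two rays. If it vanishes on one,
  inverting it leaves the chart of that ray; if on none, it leaves the torus, which is contained in
  either.\<close>

lemma Spec_off_vertex:
  assumes d: "dt u w \<noteq> 0" and T: "T \<in> Spec (mon_alg (dual2 u w))"
    and g: "g \<in> dual2 u w" "g \<noteq> 0" "character g \<in> units_in T"
  shows "T \<in> Spec (mon_alg (dual1 u)) \<or> T \<in> Spec (mon_alg (dual1 w))"
proof -
  have d': "dt w u \<noteq> 0" using d dt_swap[of w u] by simp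
  have face: "T \<in> Spec (mon_alg (dual1 u))"
    if d: "dt u w \<noteq> 0" and T: "T \<in> Spec (mon_alg (dual2 u w))" and g: "pr g u = 0" "0 < pr g w" "character g \<in> units_in T" for u w
  proof (rule iffD2[OF Spec_face[OF submonoid_dual2 submonoid_dual1]])
    show "T \<in> Spec (mon_alg (dual2 u w)) \<and> character g \<in> units_in T" using that by blast
    show "dual2 u w \<subseteq> dual1 u" "g \<in> dual2 u w" "- g \<in> dual1 u" using g by (auto simp: dual1_def dual2_def)
    fix m assume m: "m \<in> dual1 u"
    show "\<exists>K. m + scale K g \<in> dual2 u w"
      using m g shift_nonneg[OF g(2) order_refl, of "pr m w"] by (intro exI[of _ "nat \<bar>pr m w\<bar>"]) (auto simp: dual1_def dual2_def pr_add pr_scale)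
  qed
  have "\<not> (pr g u = 0 \<and> pr g w = 0)" using eq_if_pr_eq[OF d, of g 0] g by auto
  then consider "pr g u = 0" "0 < pr g w" | "pr g w = 0" "0 < pr g u" | "0 < pr g u" "0 < pr g w"
    using g(1) by (fastforce simp: dual2_def)
  then show ?thesis
  proof cases
    case 1 then show ?thesis using face[OF d T] g by blast
  next
    case 2 then show ?thesis using face[OF d'] T g dual2_commute by metis
  next
    case 3
    then have "T \<in> Spec (mon_alg UNIV)" using Spec_torus[OF d] T g by blast
    then show ?thesis using Spec_torus_ray[OF 3(1)] by blast
  qed
qed

lemma adjacent_next:
  assumes "a \<in> I" "a < n" "n \<in> I" shows "\<exists>b. adjacent_in I a b"
proof -
  define b where "b = (LEAST b. b \<in> I \<and> a < b)"
  have "b \<in> I \<and> a < b" unfolding b_def by (rule LeastI[of _ n]) (use assms in auto)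
  moreover have "b \<le> j" if "j \<in> I" "a < j" for j unfolding b_def by (rule Least_le) (use that in auto)
  ultimately show ?thesis using assms unfolding adjacent_in_def by (meson not_le)
qed

lemma adjacent_prev:
  assumes "b \<in> I" "n < b" "n \<in> I" shows "\<exists>a. adjacent_in I a b"
proof -
  define a where "a = (GREATEST a. a \<in> I \<and> a < b)"
  have "a \<in> I \<and> a < b" unfolding a_def by (rule GreatestI_nat[of _ n b]) (use assms in auto)
  moreover have "j \<le> a" if "j \<in> I" "j < b" for j unfolding a_def by (rule Greatest_le_nat[of _ _ b]) (use that in auto)
  ultimately show ?thesis using assms unfolding adjacent_in_def by (meson not_le)
qed

section \<open>Subdivisions indexed by positions in the chain\<close>

context chain
begin

text \<open>Glued from the maximal cones only; the charts of rays and of the torus are open in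
  these.\<close>

definition TV :: "nat set \<Rightarrow> 'k::field ratfun set set" where
  "TV I = {T. \<exists>a b. adjacent_in I a b \<and> T \<in> Spec (mon_alg (Gam a b))}"

definition index_set :: "nat set \<Rightarrow> bool" where
  "index_set I \<longleftrightarrow> 0 \<in> I \<and> N \<in> I \<and> I \<subseteq> {..N} \<and> 0 < N"

lemma Spec_ray_pair:
  assumes "T \<in> Spec (mon_alg (dual1 (v a)))" "a \<noteq> c" "a \<le> N" "c \<le> N"
  shows "T \<in> Spec (mon_alg (Gam a c))" "T \<in> Spec (mon_alg (Gam c a))"
proof -
  have "dt (v a) (v c) \<noteq> 0" using dt_pos'[of a c] dt_pos'[of c a] dt_swap[of "v a" "v c"] assms by (cases "a < c") auto
  then show "T \<in> Spec (mon_alg (Gam a c))" using assms(1) Spec_ray by blast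
  then show "T \<in> Spec (mon_alg (Gam c a))" using dual2_commute by metis
qed

lemma ray_in_TV:
  assumes "index_set I" "a \<in> I" "T \<in> Spec (mon_alg (dual1 (v a)))"
  shows "T \<in> TV I"
proof (cases "a < N")
  case True
  then obtain b where b: "adjacent_in I a b" using adjacent_next[of a I N] assms by (auto simp: index_set_def)
  then have "T \<in> Spec (mon_alg (Gam a b))"
    using Spec_ray_pair(1)[OF assms(3), of b] assms(1) True by (auto simp: adjacent_in_def index_set_def subset_iff)
  then show ?thesis using b by (auto simp: TV_def)
next
  case False
  then have "a = N" "0 < a" using assms by (auto simp: index_set_def subset_iff)
  then obtain b where b: "adjacent_in I b a" using adjacent_prev[of a I 0] assms by (auto simp: index_set_def)
  then have "T \<in> Spec (mon_alg (Gam b a))"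
    using Spec_ray_pair(2)[OF assms(3), of b] \<open>a = N\<close> by (auto simp: adjacent_in_def)
  then show ?thesis using b by (auto simp: TV_def)
qed

lemma mem_cone_iff:
  assumes "a < b" "b \<le> N" "j \<le> N"
  shows "real_vec (v j) \<in> cone_of {v a, v b} \<longleftrightarrow> a \<le> j \<and> j \<le> b"
proof
  assume m: "real_vec (v j) \<in> cone_of {v a, v b}"
  have pos: "0 \<le> pr g (v j)" if "g \<in> Gam a b" for g
  proof -
    have "g \<in> dual_semigroup (cone_of {v a, v b})" using that by (simp add: dual_semigroup_cone_of_pair)
    then have "0 \<le> real_vec g \<bullet> real_vec (v j)" using m by (simp add: dual_semigroup_def)
    then show ?thesis by (simp add: real_vec_inner)
  qed
  have "nn (v a) \<in> Gam a b" "- nn (v b) \<in> Gam a b"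
    using dt_pos'[of a b] dt_swap[of "v b" "v a"] assms by (auto simp: dual2_def pr_nn)
  from this[THEN pos] have "0 \<le> dt (v a) (v j)" "0 \<le> dt (v j) (v b)"
    using dt_swap[of "v b" "v j"] by (auto simp: pr_nn)
  then show "a \<le> j \<and> j \<le> b" using dt_sgn assms by auto
next
  assume j: "a \<le> j \<and> j \<le> b"
  have "0 \<le> dt (v a) (v j)" "0 \<le> dt (v j) (v b)" using dt_sgn j assms by auto
  then have "real_vec (smul (dt (v a) (v b)) (v j)) \<in> cone_of {v a, v b}"
    unfolding between[of a b j] by (intro nonneg_mem_cone) auto
  then show "real_vec (v j) \<in> cone_of {v a, v b}" using smul_mem_cone dt_pos'[of a b] assms by blast
qed

lemma adjacent_cone_in_fan:
  assumes "index_set I" "adjacent_in I a b"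
  shows "cone_of {v a, v b} \<in> fan_of (v ` I)"
  unfolding fan_of_def
proof (intro CollectI exI[of _ "{v a, v b}"] conjI ballI impI refl)
  show "{v a, v b} \<subseteq> v ` I" using assms by (auto simp: adjacent_in_def)
  show "card {v a, v b} \<le> 2" by (simp add: card_insert_if)
  fix u assume u: "u \<in> v ` I" "real_vec u \<in> cone_of {v a, v b}"
  then obtain j where j: "j \<in> I" "u = v j" by blast
  then have "a \<le> j \<and> j \<le> b" using mem_cone_iff[of a b j] u assms by (auto simp: adjacent_in_def index_set_def subset_iff)
  then show "u \<in> {v a, v b}" using assms(2) j by (auto simp: adjacent_in_def)
qed simp

text \<open>In \<open>fan_of\<close> a pair of generators passes the test exactly when no ray lies
  strictly between them, that is, when the indices are adjacent. Cones with one generator or none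
  give open subsets of the charts already present.\<close>

lemma toric_variety_fan:
  assumes I: "index_set I"
  shows "toric_variety (fan_of (v ` I)) = TV I"
proof (intro Set.set_eqI iffI)
  fix T :: "'k::field ratfun set" assume "T \<in> TV I"
  then obtain a b where ab: "adjacent_in I a b" "T \<in> Spec (mon_alg (Gam a b))" by (auto simp: TV_def)
  then have "T \<in> affine_toric (cone_of {v a, v b})"
    unfolding affine_toric_def toric_algebra_eq dual_semigroup_cone_of_pair by blast
  then show "T \<in> toric_variety (fan_of (v ` I))"
    unfolding toric_variety_def using adjacent_cone_in_fan[OF I ab(1)] by blast
next
  fix T :: "'k::field ratfun set" assume "T \<in> toric_variety (fan_of (v ` I))"
  then obtain F where F: "F \<subseteq> v ` I" "finite F" "card F \<le> 2" "\<forall>u\<in>v ` I. real_vec u \<in> cone_of F \<longrightarrow> u \<in> F"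
    and T: "T \<in> Spec (mon_alg {m. \<forall>u\<in>F. 0 \<le> pr m u})"
    unfolding toric_variety_def fan_of_def affine_toric_def toric_algebra_eq
    by (auto simp: dual_semigroup_cone_of)
  consider "card F = 0" | "card F = 1" | "card F = 2" using F(3) by linarith
  then show "T \<in> TV I"
  proof cases
    case 1
    then have "T \<in> Spec (mon_alg UNIV)" using T F(2) by simp
    moreover have "0 < pr (v 0) (v 0)"
    proof -
      have "v 0 \<noteq> 0" using det1[of 0] I by (auto simp: dt_def index_set_def)
      then have "fst (v 0) \<noteq> 0 \<or> snd (v 0) \<noteq> 0" by (simp add: prod_eq_iff)
      then show ?thesis by (auto simp: pr_def zero_less_mult_iff sum_squares_gt_zero_iff)
    qed
    ultimately have "T \<in> Spec (mon_alg (dual1 (v 0)))" using Spec_torus_ray by blast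
    then show ?thesis using ray_in_TV[OF I] I by (auto simp: index_set_def)
  next
    case 2
    then obtain a where a: "F = {v a}" "a \<in> I" using F(1) by (auto simp: card_1_singleton_iff)
    then have "{m. \<forall>u\<in>F. 0 \<le> pr m u} = dual1 (v a)" by (auto simp: dual1_def)
    then show ?thesis using ray_in_TV[OF I a(2)] T by simp
  next
    case 3
    then obtain u w where uw: "F = {u, w}" "u \<noteq> w" by (auto simp: card_2_iff)
    obtain a' b' where ab': "u = v a'" "w = v b'" "a' \<in> I" "b' \<in> I" "a' \<noteq> b'" using uw F(1) by auto
    obtain a b where ab: "F = {v a, v b}" "a \<in> I" "b \<in> I" "a < b"
    proof (cases "a' < b'")
      case True then show ?thesis using that[of a' b'] ab' uw by auto
    next
      case False
      have "F = {v b', v a'}" using uw ab' by auto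
      then show ?thesis using that[of b' a'] ab' uw False by auto
    qed
    have le: "b \<le> N" using ab I by (auto simp: index_set_def)
    have "adjacent_in I a b"
      unfolding adjacent_in_def
    proof (intro conjI ballI ab(2-4))
      fix j assume j: "j \<in> I"
      show "j \<le> a \<or> b \<le> j"
      proof (rule ccontr)
        assume n: "\<not> (j \<le> a \<or> b \<le> j)"
        then have "real_vec (v j) \<in> cone_of F" using mem_cone_iff[of a b j] ab le by auto
        then have "v j \<in> F" using F(4) j by blast
        then show False using ab n v_inj[of j a] v_inj[of j b] le by auto
      qed
    qed
    moreover have "{m. \<forall>u\<in>F. 0 \<le> pr m u} = Gam a b" using ab(1) by (auto simp: dual2_def)
    ultimately show ?thesis using T unfolding TV_def by auto
  qed
qed

end

section \<open>Blow-ups at vertices\<close>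

text \<open>Compares a blow-up chart given by generators with a simpler algebra \<open>A\<close>:
  locally at \<open>T\<close> they agree once the generators are fractions over \<open>A\<close>
  with denominators invertible in \<open>T\<close>.\<close>

lemma Spec_hullD:
  assumes A: "k_subalgebra A" "A \<subseteq> T" and S: "S \<subseteq> fraction_set T A" and T: "T \<in> Spec (k_subalgebra hull S)"
  shows "T \<in> Spec A"
proof -
  note T' = SpecD[OF k_subalgebra_hull T]
  have "k_subalgebra hull S \<subseteq> fraction_set T A"
    using fraction_set_props(1)[OF A T'(1)] S by (rule hull_minimal[rotated])
  then show ?thesis
    unfolding Spec_iff[OF A(1)] using fractions_over_trans[OF T'(4) T'(1) A] T' by blast
qed

lemma Spec_hullI:
  assumes A: "k_subalgebra A" and S: "S \<subseteq> T" "A \<subseteq> k_subalgebra hull S" and T: "T \<in> Spec A"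
  shows "T \<in> Spec (k_subalgebra hull S)"
proof -
  note T' = SpecD[OF A T]
  have "k_subalgebra hull S \<subseteq> T" using S T' by (intro hull_minimal)
  then show ?thesis
    unfolding Spec_iff[OF k_subalgebra_hull] using T' fractions_over_mono[OF T'(4) S(2)] by blast
qed

lemma mem_blowup_at_iff:
  "T \<in> blowup_at X P \<longleftrightarrow>
     (\<exists>R\<in>X. R \<noteq> P \<and> (\<exists>f\<in>R - {0}. T \<in> Spec (k_subalgebra hull (R \<union> {g / f | g. g \<in> R})))) \<or>
     (P \<in> X \<and> (\<exists>f\<in>P - units_in P - {0}. T \<in> Spec (k_subalgebra hull (P \<union> {g / f | g. g \<in> P - units_in P}))))"
  unfolding blowup_at_def blowup_def nonunits_ring_of
  by (auto split: if_splits)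

text \<open>Off the centre the ideal is the unit ideal, and \<open>f = 1\<close> yields the local
  ring itself as chart.\<close>

lemma blowup_at_elsewhere:
  assumes "T \<in> X" "T \<noteq> P" "local_subalgebra T"
  shows "T \<in> blowup_at X P"
proof -
  have k: "k_subalgebra T" using assms(3) by (simp add: local_subalgebra_def)
  have "k_subalgebra hull (T \<union> {g / 1 | g. g \<in> T}) = T" by (rule hull_unique) (use k in auto)
  then have "T \<in> Spec (k_subalgebra hull (T \<union> {g / 1 | g. g \<in> T}))" using Spec_self[OF assms(3)] by simp
  moreover have "1 \<in> T - {0}" using k by (simp add: k_subalgebraD)
  ultimately show ?thesis unfolding mem_blowup_at_iff using assms by blast
qed

text \<open>The stalk of the ideal is all of \<open>R\<close>, so \<open>1 / f\<close> is among the
  generators; \<open>f\<close> becomes a unit and the chart is a principal open subset of the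
  spectrum of \<open>R\<close>.\<close>

lemma blowup_chart_elsewhere:
  assumes R: "local_subalgebra R" and f: "f \<in> R - {0}" and T: "T \<in> Spec (k_subalgebra hull (R \<union> {g / f | g. g \<in> R}))"
  shows "T \<in> Spec R"
proof -
  note T' = SpecD[OF k_subalgebra_hull T]
  have k: "k_subalgebra R" using R by (simp add: local_subalgebra_def)
  have S: "R \<union> {g / f | g. g \<in> R} \<subseteq> T" using order_trans[OF hull_subset T'(2)] .
  have "1 / f \<in> T" using S k_subalgebraD(3)[OF k] by blast
  then have u: "f \<in> R \<inter> units_in T" using S f by (auto simp: units_in_def inverse_eq_divide)
  have "R \<subseteq> fraction_set T R" using fraction_set_props(2)[OF k _ T'(1)] S by blast
  moreover have "{g / f | g. g \<in> R} \<subseteq> fraction_set T R" unfolding fraction_set_def using u by blast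
  ultimately show ?thesis using Spec_hullD[OF k _ _ T] S by blast
qed

lemma adjacent_cover:
  assumes "l \<in> I" "r \<in> I" "l \<le> i" "i < r"
  shows "\<exists>a b. adjacent_in I a b \<and> a \<le> i \<and> i < b"
proof -
  define a where "a = (GREATEST a. a \<in> I \<and> a \<le> i)"
  define b where "b = (LEAST b. b \<in> I \<and> i < b)"
  have a: "a \<in> I \<and> a \<le> i" unfolding a_def by (rule GreatestI_nat[of _ l i]) (use assms in auto)
  have b: "b \<in> I \<and> i < b" unfolding b_def by (rule LeastI[of _ r]) (use assms in auto)
  have "j \<le> a" if "j \<in> I" "j \<le> i" for j unfolding a_def by (rule Greatest_le_nat[of _ _ i]) (use that in auto)
  moreover have "b \<le> j" if "j \<in> I" "i < j" for j unfolding b_def by (rule Least_le) (use that in auto)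
  ultimately have "adjacent_in I a b" using a b unfolding adjacent_in_def by (meson not_le le_less_trans)
  then show ?thesis using a b by blast
qed

context chain
begin

lemma Ins_subset: "Suc l < r \<Longrightarrow> Ins l r \<subseteq> {l..r}"
  by (auto simp: Ins_def)

lemma adjacent_Un_Ins:
  assumes lr: "adjacent_in I l r" "Suc l < r"
  shows "adjacent_in (I \<union> Ins l r) a b \<longleftrightarrow> adjacent_in (Ins l r) a b \<or> (adjacent_in I a b \<and> (a, b) \<noteq> (l, r))"
proof -
  have end': "l \<in> Ins l r" "r \<in> Ins l r" "l \<in> I" "r \<in> I" using lr by (auto simp: Ins_def adjacent_in_def)
  have I: "j \<le> l \<or> r \<le> j" if "j \<in> I" for j using lr that by (auto simp: adjacent_in_def)
  have J: "l \<le> j \<and> j \<le> r" if "j \<in> Ins l r" for j using Ins_subset[OF lr(2)] that by auto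
  have J1: "Suc l \<in> Ins l r" "l < r" using lr by (auto simp: Ins_def)
  show ?thesis
  proof
    assume h: "adjacent_in (I \<union> Ins l r) a b"
    have lr': "l \<le> a \<or> b \<le> l" "r \<le> a \<or> b \<le> r" using h end' by (auto simp: adjacent_in_def)
    show "adjacent_in (Ins l r) a b \<or> (adjacent_in I a b \<and> (a, b) \<noteq> (l, r))"
    proof (cases "l \<le> a \<and> b \<le> r")
      case True
      then have "a \<in> Ins l r" "b \<in> Ins l r" using h I[of a] I[of b] end' by (auto simp: adjacent_in_def)
      then show ?thesis using h by (auto simp: adjacent_in_def)
    next
      case False
      then consider "b \<le> l" | "r \<le> a" using lr' by linarith
      then have "a \<in> I \<and> b \<in> I"
      proof cases
        case 1
        then have "a \<notin> Ins l r" "b \<in> Ins l r \<Longrightarrow> b = l" using J[of a] J[of b] h by (auto simp: adjacent_in_def)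
        then show ?thesis using h end' by (auto simp: adjacent_in_def)
      next
        case 2
        then have "b \<notin> Ins l r" "a \<in> Ins l r \<Longrightarrow> a = r" using J[of a] J[of b] h by (auto simp: adjacent_in_def)
        then show ?thesis using h end' by (auto simp: adjacent_in_def)
      qed
      then show ?thesis using h False by (auto simp: adjacent_in_def)
    qed
  next
    assume h: "adjacent_in (Ins l r) a b \<or> (adjacent_in I a b \<and> (a, b) \<noteq> (l, r))"
    then show "adjacent_in (I \<union> Ins l r) a b"
    proof
      assume h: "adjacent_in (Ins l r) a b"
      then have "l \<le> a" "b \<le> r" using J by (auto simp: adjacent_in_def)
      then have "j \<le> a \<or> b \<le> j" if "j \<in> I" for j using I[OF that] by auto
      then show ?thesis using h by (auto simp: adjacent_in_def)
    next
      assume h: "adjacent_in I a b \<and> (a, b) \<noteq> (l, r)"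
      then have "b \<le> l \<or> r \<le> a" using end' I[of a] I[of b] by (auto simp: adjacent_in_def)
      then have "j \<le> a \<or> b \<le> j" if "j \<in> Ins l r" for j using J[OF that] by auto
      then show ?thesis using h by (auto simp: adjacent_in_def)
    qed
  qed
qed

lemma index_set_Un_Ins: "index_set I \<Longrightarrow> adjacent_in I l r \<Longrightarrow> Suc l < r \<Longrightarrow> index_set (I \<union> Ins l r)"
  using Ins_subset[of l r] by (fastforce simp: index_set_def adjacent_in_def subset_iff)

lemma adjacent_le: "index_set I \<Longrightarrow> adjacent_in I a b \<Longrightarrow> a < b \<and> b \<le> N"
  by (auto simp: index_set_def adjacent_in_def)

text \<open>Separates the points of a chart into two kinds: the vertex itself, and points where some
  nontrivial character is a unit and which therefore lie on the chart of a ray.\<close>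

lemma vertex_ring_unique:
  assumes lr: "l < r" "r \<le> N" and R: "R \<in> Spec (mon_alg (Gam l r))"
    and n: "\<And>g. g \<in> Gam l r - {0} \<Longrightarrow> character g \<notin> units_in R"
  shows "R = vertex_ring (Gam l r)"
proof (rule dominates_eqI[of R "mon_alg (Gam l r)" _ "mon_alg (Gam l r)" R])
  note p = pointed_Gam[OF lr] and k = k_subalgebra_mon_alg[OF submonoid_dual2]
  note V = vertex_ring_props[OF p] and R' = SpecD[OF k R]
  show "R \<in> Spec (mon_alg (Gam l r))" "vertex_ring (Gam l r) \<in> Spec (mon_alg (Gam l r))" by fact+
  show "mon_alg (Gam l r) \<subseteq> vertex_ring (Gam l r)" "mon_alg (Gam l r) \<subseteq> R" using V R' by blast+
  show "dominates R R" by (auto simp: dominates_iff)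
  show "dominates R (vertex_ring (Gam l r))"
    unfolding dominates_iff using vertex_ring_subset[OF p R'(3,2) n] by blast
qed (rule k_subalgebra_mon_alg[OF submonoid_dual2])+

lemma vertex_ring_in_TV: "index_set I \<Longrightarrow> adjacent_in I l r \<Longrightarrow> vertex_ring (Gam l r) \<in> TV I"
  unfolding TV_def using vertex_ring_props(2)[OF pointed_Gam[of l r]] adjacent_le by blast

lemma vertex_ring_in_Spec_iff:
  assumes "l < r" "r \<le> N" "a < b" "b \<le> N" "vertex_ring (Gam l r) \<in> Spec (mon_alg (Gam a b) :: 'k::field ratfun set)"
  shows "a \<le> l \<and> r \<le> b"
proof -
  have "character ` Gam a b \<subseteq> (vertex_ring (Gam l r) :: 'k ratfun set)"
    using SpecD(2)[OF k_subalgebra_mon_alg[OF submonoid_dual2] assms(5)] character_mon_alg_iff by blast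
  then have "Gam a b \<subseteq> Gam l r" using character_vertex_ring_iff[OF pointed_Gam[OF assms(1,2)]] by blast
  then show ?thesis using Gam_subsetD assms by blast
qed

lemma blowup_subset:
  assumes I: "index_set I" and ad: "adjacent_in I l r" "Suc l < r"
  shows "blowup_at (TV I) (vertex_ring (Gam l r)) \<subseteq> (TV (I \<union> Ins l r) :: 'k::field ratfun set set)"
proof
  fix T :: "'k ratfun set"
  let ?P = "vertex_ring (Gam l r) :: 'k ratfun set" and ?J = "I \<union> Ins l r"
  assume T: "T \<in> blowup_at (TV I) ?P"
  have lr: "l < r" "r \<le> N" using adjacent_le[OF I ad(1)] by auto
  note p = pointed_Gam[OF lr] and k = k_subalgebra_mon_alg[OF submonoid_dual2]
  note V = vertex_ring_props[OF p]
  have J: "index_set ?J" using index_set_Un_Ins[OF I ad] .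
  from T consider (other) R f where "R \<in> TV I" "R \<noteq> ?P" "f \<in> R - {0}" "T \<in> Spec (k_subalgebra hull (R \<union> {g / f | g. g \<in> R}))"
    | (vertex) f where "f \<in> ?P - units_in ?P - {0}" "T \<in> Spec (k_subalgebra hull (?P \<union> {g / f | g. g \<in> ?P - units_in ?P}))"
    unfolding mem_blowup_at_iff by blast
  then show "T \<in> TV ?J"
  proof cases
    case other
    obtain a b where ab: "adjacent_in I a b" "R \<in> Spec (mon_alg (Gam a b))" using other(1) by (auto simp: TV_def)
    note R' = SpecD[OF k ab(2)]
    have TR: "T \<in> Spec R" using blowup_chart_elsewhere[OF R'(3)] other by blast
    have TA: "T \<in> Spec (mon_alg (Gam a b))" using Spec_trans[OF k ab(2) TR] .
    show ?thesis
    proof (cases "(a, b) = (l, r)")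
      case False
      then show ?thesis unfolding TV_def using TA ab(1) adjacent_Un_Ins[OF ad] by blast
    next
      case True
      then have RA: "R \<in> Spec (mon_alg (Gam l r))" and TA: "T \<in> Spec (mon_alg (Gam l r))" using ab TA by auto
      \<comment> \<open>A point of the subdivided chart other than its vertex lies on a boundary
        ray, and the refinement keeps both boundary rays.\<close>
      obtain g where g: "g \<in> Gam l r - {0}" "character g \<in> units_in R"
        using vertex_ring_unique[OF lr RA] other(2) by blast
      have "character g \<in> units_in T" using g(2) units_in_mono[OF SpecD(2)[OF R'(1) TR]] by blast
      moreover have "dt (v l) (v r) \<noteq> 0" using dt_pos'[OF lr] by simp
      ultimately have "T \<in> Spec (mon_alg (dual1 (v l))) \<or> T \<in> Spec (mon_alg (dual1 (v r)))"
        using Spec_off_vertex[OF _ TA] g(1) by blast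
      moreover have "l \<in> ?J" "r \<in> ?J" using ad by (auto simp: adjacent_in_def)
      ultimately show ?thesis using ray_in_TV[OF J] by blast
    qed
  next
    case vertex
    let ?m = "?P - units_in ?P"
    let ?S = "?P \<union> {g / f | g. g \<in> ?m}"
    note T' = SpecD[OF k_subalgebra_hull vertex(2)]
    have ST: "?S \<subseteq> T" using order_trans[OF hull_subset T'(2)] .
    have PT: "?P \<subseteq> T" using ST by blast
    have mT: "g / f \<in> T" if "g \<in> ?m" for g using ST that by blast
    have f0: "f \<noteq> 0" using vertex(1) by auto
    have cm: "character h \<in> ?m" if "h \<in> Gam l r - {0}" for h
      using that character_vertex_ring_iff[OF p] character_not_unit[OF p] by blast
    obtain r0 S0 where S0: "finite S0" "S0 \<subseteq> Gam l r - {0}" "\<And>g. g \<in> S0 \<Longrightarrow> r0 g \<in> ?P" "f = (\<Sum>g\<in>S0. r0 g * character g)"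
      using nonunit_vertex_ring[OF p, of f] vertex(1) by blast
    have "\<exists>h\<in>S0. r0 h * (character h / f) \<in> units_in T"
    proof (rule ccontr)
      assume n: "\<not> (\<exists>h\<in>S0. r0 h * (character h / f) \<in> units_in T)"
      have "r0 h * (character h / f) \<in> T" if "h \<in> S0" for h
        using that S0 PT mT[OF cm, of h] T'(1) by (blast intro: k_subalgebraD(6))
      then have "(\<Sum>h\<in>S0. r0 h * (character h / f)) \<in> T - units_in T"
        using n by (intro ideal_in_sum[OF ideal_in_nonunits[OF T'(3)]]) blast
      moreover have "(\<Sum>h\<in>S0. r0 h * (character h / f)) = 1"
        using S0(4) f0 by (simp add: sum_divide_distrib[symmetric])
      moreover have "1 \<in> units_in T" using T'(1) by (simp add: units_in_def k_subalgebraD)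
      ultimately show False by simp
    qed
    then obtain h where h: "h \<in> S0" "r0 h * (character h / f) \<in> units_in T" by blast
    have hG: "h \<in> Gam l r - {0}" using h S0 by blast
    have hu: "character h / f \<in> units_in T"
      using units_in_multD[OF T'(1), of "character h / f" "r0 h"] h S0(3) PT mT[OF cm[OF hG]]
      by (simp add: mult.commute subset_iff)
    \<comment> \<open>From here on only exponents count. \<open>Sh\<close> says that the character
      of \<open>h\<close> divides every nontrivial character in \<open>T\<close>; the Newton polygon
      then replaces \<open>h\<close> by a vertex.\<close>
    define S where "S = {m. character m \<in> T}"
    have S: "submonoid S" "Gam l r \<subseteq> S"
      using T'(1) PT character_vertex_ring_iff[OF p] by (auto simp: S_def submonoid_def character_add k_subalgebraD)
    have Sh: "g - h \<in> S" if "g \<in> Gam l r - {0}" for g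
    proof -
      have "character (g - h) = (character g / f) / (character h / f)" using f0 by (simp add: character_diff)
      then show ?thesis using units_in_divide[OF T'(1) mT[OF cm[OF that]] hu] by (simp add: S_def)
    qed
    obtain i where i: "l \<le> i" "i < r" "h - mu l r i \<in> S"
      using newton_vertex[OF ad(2) lr(2) hG S Sh] by blast
    have lrI: "l \<in> Ins l r" "r \<in> Ins l r" by (auto simp: Ins_def)
    obtain a b where ab: "adjacent_in (Ins l r) a b" "a \<le> i" "i < b"
      using adjacent_cover[OF lrI i(1,2)] by blast
    define m where "m = mu l r a"
    have mi: "mu l r i = m" unfolding m_def using mu_run(1)[OF ab(1) ad(2) lr(2) ab(2,3)] .
    have mG: "m \<in> Gam l r - {0}" using mu_Gam[OF i(1,2) ad(2) lr(2)] mi by simp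
    have Sm: "g - m \<in> S" if "g \<in> Gam l r - {0}" for g
      using submonoid_add[OF S(1) Sh[OF that] i(3)] mi by simp
    have GS: "Gam a b \<subseteq> S" using chart_generated[OF ab(1) ad(2) lr(2) S] Sm m_def by blast
    let ?A = "mon_alg (Gam a b) :: 'k ratfun set"
    have AT: "?A \<subseteq> T" using GS by (intro mon_alg_subset[OF T'(1)]) (auto simp: S_def)
    note F = fraction_set_props[OF k AT T'(1)]
    have Gab: "Gam l r \<subseteq> Gam a b" using Gam_mono[of l a b r] adjacent_Ins(1-3)[OF ab(1) ad(2)] lr by blast
    have PF: "?P \<subseteq> fraction_set T ?A"
    proof
      fix x assume "x \<in> ?P"
      then obtain c s where cs: "x = c / s" "c \<in> mon_alg (Gam l r)" "s \<in> mon_alg (Gam l r)" "s \<in> units_in ?P"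
        by (rule vertex_ring_rep[OF p]) blast
      then show "x \<in> fraction_set T ?A"
        unfolding fraction_set_def using mon_alg_mono[OF Gab] units_in_mono[OF PT] by blast
    qed
    have mF: "g / character m \<in> fraction_set T ?A" if g: "g \<in> ?m" for g
    proof -
      obtain r1 S1 where S1: "finite S1" "S1 \<subseteq> Gam l r - {0}" "\<And>h. h \<in> S1 \<Longrightarrow> r1 h \<in> ?P" "g = (\<Sum>h\<in>S1. r1 h * character h)"
        using nonunit_vertex_ring[OF p g] by blast
      have "g / character m = (\<Sum>h\<in>S1. r1 h * character (h - m))"
        unfolding S1(4) by (simp add: sum_divide_distrib character_diff)
      also have "\<dots> \<in> fraction_set T ?A"
      proof (rule subring_set_sum[OF subring_set_k_subalgebra[OF F(1)]], rule k_subalgebraD(6)[OF F(1)])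
        fix h assume h: "h \<in> S1"
        show "r1 h \<in> fraction_set T ?A" using S1(3)[OF h] PF by blast
        have "h - m \<in> Gam a b" using chart_ge[OF ab(1) ad(2) lr(2)] h S1(2) m_def by blast
        then show "character (h - m) \<in> fraction_set T ?A" using F(2) character_mon_alg_iff by blast
      qed
      finally show ?thesis .
    qed
    \<comment> \<open>The characters of \<open>h\<close> and \<open>m\<close> divide each other in
      \<open>T\<close>, so \<open>f\<close> and the character of \<open>m\<close> generate the same
      ideal and quotients by one can be traded for quotients by the other.\<close>
    have fu: "f / character m \<in> units_in T"
    proof -
      have "character (h - m) \<in> T" "inverse (character (h - m)) \<in> T"
        using i(3) mi Sh[OF mG] by (simp_all add: S_def flip: character_minus)
      then have "character (h - m) \<in> units_in T" by (simp add: units_in_def)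
      moreover have "f / character m = character (h - m) * inverse (character h / f)"
        using f0 by (simp add: character_diff field_simps)
      ultimately show ?thesis using units_in_mult[OF T'(1) _ units_in_inverse[OF hu]] by metis
    qed
    have "{g / f | g. g \<in> ?m} \<subseteq> fraction_set T ?A"
    proof
      fix x assume "x \<in> {g / f | g. g \<in> ?m}"
      then obtain g where g: "g \<in> ?m" "x = g / f" by blast
      have "x = (g / character m) * inverse (f / character m)" using g(2) f0 by (simp add: field_simps)
      moreover have "inverse (f / character m) \<in> fraction_set T ?A" using F(4)[OF mF fu] vertex(1) by blast
      ultimately show "x \<in> fraction_set T ?A" using mF[OF g(1)] k_subalgebraD(6)[OF F(1)] by metis
    qed
    then have "T \<in> Spec ?A" using Spec_hullD[OF k AT _ vertex(2)] PF by blast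
    then show ?thesis unfolding TV_def using ab(1) adjacent_Un_Ins[OF ad] by blast
  qed
qed

lemma blowup_superset:
  assumes I: "index_set I" and ad: "adjacent_in I l r" "Suc l < r"
  shows "(TV (I \<union> Ins l r) :: 'k::field ratfun set set) \<subseteq> blowup_at (TV I) (vertex_ring (Gam l r))"
proof
  fix T :: "'k ratfun set"
  let ?P = "vertex_ring (Gam l r) :: 'k ratfun set" and ?J = "I \<union> Ins l r"
  assume T: "T \<in> TV ?J"
  have lr: "l < r" "r \<le> N" using adjacent_le[OF I ad(1)] by auto
  note p = pointed_Gam[OF lr] and k = k_subalgebra_mon_alg[OF submonoid_dual2]
  note V = vertex_ring_props[OF p]
  obtain a b where ab: "adjacent_in ?J a b" "T \<in> Spec (mon_alg (Gam a b))" using T by (auto simp: TV_def)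
  note T' = SpecD[OF k ab(2)]
  show "T \<in> blowup_at (TV I) ?P"
  proof (cases "adjacent_in I a b \<and> (a, b) \<noteq> (l, r)")
    case True
    have "T \<noteq> ?P"
    proof
      assume "T = ?P"
      then have "a \<le> l \<and> r \<le> b" using vertex_ring_in_Spec_iff[OF lr] ab(2) adjacent_le[OF I] True by blast
      then show False using True ad by (auto simp: adjacent_in_def)
    qed
    moreover have "T \<in> TV I" unfolding TV_def using True ab(2) by blast
    ultimately show ?thesis by (intro blowup_at_elsewhere T'(3))
  next
    case False
    then have ad': "adjacent_in (Ins l r) a b" using adjacent_Un_Ins[OF ad] ab(1) by blast
    define m where "m = mu l r a"
    have a: "l \<le> a" "a < r" using adjacent_Ins(1-3)[OF ad' ad(2)] by auto
    have mG: "m \<in> Gam l r - {0}" using mu_Gam[OF a ad(2) lr(2)] m_def by simp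
    have Gab: "Gam l r \<subseteq> Gam a b" using Gam_mono[of l a b r] adjacent_Ins(1-3)[OF ad' ad(2)] lr by blast
    let ?B = "mon_alg (Gam l r) :: 'k ratfun set"
    have BT: "?B \<subseteq> T" using mon_alg_mono[OF Gab] T'(2) by blast
    \<comment> \<open>Stated for an arbitrary algebra, because it is applied both to the fractions
      over the old chart and to the blow-up chart at the vertex.\<close>
    have chart: "mon_alg (Gam a b) \<subseteq> A"
      if A: "k_subalgebra A" "?B \<subseteq> A" "\<And>g. g \<in> Gam l r - {0} \<Longrightarrow> character (g - m) \<in> A" for A :: "'k ratfun set"
    proof -
      have S: "submonoid {m. character m \<in> A}" using A(1) by (simp add: submonoid_def character_add k_subalgebraD)
      have "Gam l r \<subseteq> {m. character m \<in> A}" using A(2) character_mon_alg_iff by blast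
      then have "Gam a b \<subseteq> {m. character m \<in> A}"
        using chart_generated[OF ad' ad(2) lr(2) S] A(3) m_def by blast
      then show ?thesis by (intro mon_alg_subset[OF A(1)]) blast
    qed
    \<comment> \<open>If the character of \<open>m\<close> is a unit, the blow-up changes nothing at
      \<open>T\<close>, which is a point of the old chart. Otherwise no nontrivial character of the
      old chart is a unit, since \<open>m\<close> divides them all, and \<open>T\<close> lies over
      the vertex.\<close>
    show ?thesis
    proof (cases "character m \<in> units_in T")
      case True
      note F = fraction_set_props[OF k BT T'(1)]
      have "character (g - m) \<in> fraction_set T ?B" if "g \<in> Gam l r - {0}" for g
        unfolding fraction_set_def character_diff using True mG that character_mon_alg_iff by blast
      then have "mon_alg (Gam a b) \<subseteq> fraction_set T ?B" using chart[OF F(1,2)] by blast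
      then have "fractions_over T ?B" using fractions_over_trans[OF T'(4,1) k BT] by blast
      then have "T \<in> Spec ?B" using T'(3) Spec_iff[OF k] by blast
      moreover have "T \<noteq> ?P" using True character_not_unit[OF p, of m] mG by blast
      moreover have "T \<in> TV I" unfolding TV_def using calculation(1) ad(1) by blast
      ultimately show ?thesis by (intro blowup_at_elsewhere T'(3))
    next
      case False
      have ge: "character (g - m) \<in> T" if "g \<in> Gam l r - {0}" for g
        using chart_ge[OF ad' ad(2) lr(2) that] T'(2) character_mon_alg_iff m_def by blast
      have nu: "character g \<notin> units_in T" if "g \<in> Gam l r - {0}" for g
      proof
        assume "character g \<in> units_in T"
        moreover have "character g = character m * character (g - m)" by (simp add: character_diff)
        moreover have "character m \<in> T" using mG BT character_mon_alg_iff by blast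
        ultimately show False using units_in_multD[OF T'(1), of "character m"] ge[OF that] False by metis
      qed
      have PT: "?P \<subseteq> T" using vertex_ring_subset(1)[OF p T'(3) BT nu] .
      let ?m = "?P - units_in ?P"
      let ?S = "?P \<union> {g / character m | g. g \<in> ?m}"
      have cm: "character h \<in> ?m" if "h \<in> Gam l r - {0}" for h
        using that character_vertex_ring_iff[OF p] character_not_unit[OF p] by blast
      have "g / character m \<in> T" if g: "g \<in> ?m" for g
      proof -
        obtain r1 S1 where S1: "finite S1" "S1 \<subseteq> Gam l r - {0}" "\<And>h. h \<in> S1 \<Longrightarrow> r1 h \<in> ?P" "g = (\<Sum>h\<in>S1. r1 h * character h)"
          using nonunit_vertex_ring[OF p g] by blast
        have "g / character m = (\<Sum>h\<in>S1. r1 h * character (h - m))"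
          unfolding S1(4) by (simp add: sum_divide_distrib character_diff)
        also have "\<dots> \<in> T"
          using S1 PT ge by (intro subring_set_sum[OF subring_set_k_subalgebra[OF T'(1)]] k_subalgebraD(6)[OF T'(1)]) blast+
        finally show ?thesis .
      qed
      then have ST: "?S \<subseteq> T" using PT by blast
      have "mon_alg (Gam a b) \<subseteq> k_subalgebra hull ?S"
      proof (rule chart[OF k_subalgebra_hull])
        show "?B \<subseteq> k_subalgebra hull ?S" using V(5) hull_subset[of ?S k_subalgebra] by blast
        fix g assume "g \<in> Gam l r - {0}"
        then have "character (g - m) \<in> ?S" unfolding character_diff using cm by blast
        then show "character (g - m) \<in> k_subalgebra hull ?S" by (rule hull_inc)
      qed
      then have "T \<in> Spec (k_subalgebra hull ?S)" using Spec_hullI[OF k ST _ ab(2)] by blast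
      moreover have "character m \<in> ?m - {0}" using cm[OF mG] by simp
      ultimately show ?thesis unfolding mem_blowup_at_iff using vertex_ring_in_TV[OF I ad(1)] by blast
    qed
  qed
qed

theorem blowup_at_vertex:
  assumes "index_set I" "adjacent_in I l r" "Suc l < r"
  shows "blowup_at (TV I) (vertex_ring (Gam l r)) = TV (I \<union> Ins l r)"
  using blowup_subset[OF assms] blowup_superset[OF assms] by blast

end

section \<open>Prime ideals of polynomial rings\<close>

lemma subring_set_UNIV: "subring_set UNIV"
  by (simp add: subring_set_def)

text \<open>Contraction of an ideal to the coefficient ring; \<open>coeffs_in\<close> is the
  extension in the opposite direction.\<close>

definition const_part :: "'a::comm_ring_1 poly set \<Rightarrow> 'a set" where
  "const_part Q = {a. [:a:] \<in> Q}"

definition coeffs_in :: "'a::comm_ring_1 set \<Rightarrow> 'a poly set" where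
  "coeffs_in J = {f. \<forall>i. Polynomial.coeff f i \<in> J}"

lemma prime_const_part: "prime_in Q UNIV \<Longrightarrow> prime_in (const_part Q) UNIV"
proof -
  assume Q: "prime_in Q UNIV"
  then have id: "ideal_in Q UNIV" by (simp add: prime_in_def)
  have "ideal_in (const_part Q) UNIV"
    unfolding ideal_in_def const_part_def
  proof (intro conjI ballI CollectI subset_UNIV)
    show "[:0:] \<in> Q" using ideal_inD(1)[OF id] by simp
    fix x y assume x: "x \<in> {a. [:a:] \<in> Q}"
    show "[:x + y:] \<in> Q" if "y \<in> {a. [:a:] \<in> Q}"
      using ideal_inD(2)[OF id, of "[:x:]" "[:y:]"] x that by simp
    show "[:y * x:] \<in> Q" using ideal_inD(3)[OF id, of "[:y:]" "[:x:]"] x by (simp add: mult.commute)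
  qed
  moreover have "1 \<notin> const_part Q" using Q by (simp add: const_part_def prime_in_def flip: one_pCons)
  moreover have "a \<in> const_part Q \<or> b \<in> const_part Q" if "a * b \<in> const_part Q" for a b
  proof -
    have "[:a:] * [:b:] \<in> Q" using that by (simp add: const_part_def mult.commute)
    then show ?thesis using Q by (auto simp: prime_in_def const_part_def)
  qed
  ultimately show ?thesis by (auto simp: prime_in_def)
qed

lemma smult_in_ideal: "ideal_in I (UNIV :: 'a::comm_ring_1 poly set) \<Longrightarrow> f \<in> I \<Longrightarrow> Polynomial.smult c f \<in> I"
  using ideal_inD(3)[of I UNIV "[:c:]" f] by simp

lemma coeffs_in_subset:
  assumes I: "ideal_in I (UNIV :: 'a::comm_ring_1 poly set)" and f: "f \<in> coeffs_in (const_part I)"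
  shows "f \<in> I"
proof -
  have "f = (\<Sum>i\<le>degree f. [:Polynomial.coeff f i:] * Polynomial.monom 1 i)"
    by (subst poly_as_sum_of_monoms[of f, symmetric]) (simp add: smult_monom)
  also have "\<dots> \<in> I"
    using f by (intro ideal_in_sum[OF I] ideal_inD(4)[OF I]) (auto simp: coeffs_in_def const_part_def)
  finally show ?thesis .
qed

lemma ideal_coeffs_in:
  assumes J: "ideal_in J UNIV" shows "ideal_in (coeffs_in J) UNIV"
  using ideal_inD[OF J] by (auto simp: ideal_in_def coeffs_in_def coeff_mult intro!: ideal_in_sum[OF J])

lemma smult_coeffs_in_prime:
  assumes "prime_in J UNIV" "Polynomial.smult c f \<in> coeffs_in J" "c \<notin> J"
  shows "f \<in> coeffs_in J"
  using assms by (auto simp: coeffs_in_def prime_in_def)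

text \<open>An ideal meeting the coefficient ring in \<open>J\<close> is, up to denominators outside \<open>J\<close>, generated
  modulo \<open>J\<close> by an element of minimal degree.\<close>

definition min_elt :: "'a::comm_ring_1 poly set \<Rightarrow> 'a set \<Rightarrow> 'a poly \<Rightarrow> bool" where
  "min_elt I J g \<longleftrightarrow> g \<in> I - coeffs_in J \<and> (\<forall>f\<in>I - coeffs_in J. degree g \<le> degree f)"

lemma min_elt_ex: "f \<in> I - coeffs_in J \<Longrightarrow> \<exists>g. min_elt I J g"
  unfolding min_elt_def using ex_has_least_nat[of "\<lambda>g. g \<in> I - coeffs_in J" f degree] by blast

lemma monom_mult_degree:
  fixes a b :: "'a::comm_ring_1 poly"
  assumes "degree b \<le> degree a"
  shows "degree (Polynomial.smult (lead_coeff b) a - Polynomial.monom (lead_coeff a) (degree a - degree b) * b) < degree a \<or>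
     Polynomial.smult (lead_coeff b) a - Polynomial.monom (lead_coeff a) (degree a - degree b) * b = 0"
proof -
  let ?r = "Polynomial.smult (lead_coeff b) a - Polynomial.monom (lead_coeff a) (degree a - degree b) * b"
  have "Polynomial.coeff ?r i = 0" if "degree a \<le> i" for i
  proof (cases "i = degree a")
    case True
    then show ?thesis using assms by (simp only: coeff_diff coeff_smult coeff_monom_mult) (simp add: mult.commute)
  next
    case False
    then have "degree a < i" "degree b < i - (degree a - degree b)" using that assms by auto
    then show ?thesis by (simp add: coeff_monom_mult coeff_eq_0)
  qed
  then show ?thesis
    by (metis leading_coeff_0_iff not_le)
qed

text \<open>A leading coefficient in \<open>J\<close> could be stripped, since its monomial lies in
  \<open>I\<close>, leaving an element of smaller degree; a constant in \<open>I\<close> would lie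
  in \<open>J\<close>.\<close>

lemma min_elt_lead:
  assumes I: "ideal_in I UNIV" and J: "J = const_part I" "prime_in J UNIV" and g: "min_elt I J g"
  shows "lead_coeff g \<notin> J" "0 < degree g"
proof -
  have gI: "g \<in> I" "g \<notin> coeffs_in J" using g by (auto simp: min_elt_def)
  have idJ: "ideal_in J UNIV" using J by (simp add: prime_in_def)
  show "0 < degree g"
  proof (rule ccontr)
    assume "\<not> 0 < degree g"
    then obtain c where c: "g = [:c:]" using degree_eq_zeroE by blast
    then have "c \<in> J" using gI J by (simp add: const_part_def)
    then have "g \<in> coeffs_in J" using c ideal_inD(1)[OF idJ] by (auto simp: coeffs_in_def coeff_pCons split: nat.splits)
    then show False using gI by simp
  qed
  then have d: "0 < degree g" .
  show "lead_coeff g \<notin> J"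
  proof
    assume l: "lead_coeff g \<in> J"
    let ?m = "Polynomial.monom (lead_coeff g) (degree g)"
    have mJ: "?m \<in> coeffs_in J" using l ideal_inD(1)[OF idJ] by (auto simp: coeffs_in_def)
    then have "?m \<in> I" using coeffs_in_subset[OF I] J by simp
    then have "g - ?m \<in> I" using ideal_in_diff[OF subring_set_UNIV I gI(1)] by simp
    moreover have "g - ?m \<notin> coeffs_in J"
    proof
      assume "g - ?m \<in> coeffs_in J"
      then have "(g - ?m) + ?m \<in> coeffs_in J" using mJ ideal_inD(2)[OF ideal_coeffs_in[OF idJ]] by blast
      then show False using gI by simp
    qed
    moreover have "degree (g - ?m) < degree g"
    proof -
      have "degree (g - ?m) \<le> degree g - 1"
      proof (rule degree_le, intro allI impI)
        fix i assume "degree g - 1 < i"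
        then show "Polynomial.coeff (g - ?m) i = 0" using d by (cases "i = degree g") (simp_all add: coeff_eq_0)
      qed
      then show ?thesis using d by linarith
    qed
    ultimately show False using g unfolding min_elt_def by (metis DiffI not_le)
  qed
qed

text \<open>Division by \<open>g\<close> after multiplication by powers of its leading coefficient,
  which stay outside the prime \<open>J\<close>. The remainder has degree below that of
  \<open>g\<close>, so minimality puts it into the extension of \<open>J\<close>. The degree bound
  on \<open>q\<close> serves \<open>prime_over_unique\<close>.\<close>

lemma pseudo_division:
  assumes I: "ideal_in I UNIV" and J: "J = const_part I" "prime_in J UNIV" and g: "min_elt I J g" and f: "f \<in> I"
  shows "\<exists>c q. c \<notin> J \<and> Polynomial.smult c f - q * g \<in> coeffs_in J \<and> (q = 0 \<or> degree q + degree g \<le> degree f)"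
  using f
proof (induction "degree f" arbitrary: f rule: less_induct)
  case less
  have gI: "g \<in> I" "g \<notin> coeffs_in J" using g by (auto simp: min_elt_def)
  have idJ: "ideal_in J UNIV" using J by (simp add: prime_in_def)
  note L = min_elt_lead[OF I J g]
  show ?case
  proof (cases "f \<in> coeffs_in J")
    case True
    moreover have "1 \<notin> J" using J by (simp add: prime_in_def)
    ultimately show ?thesis by (intro exI[of _ 1] exI[of _ 0]) simp
  next
    case False
    then have d: "degree g \<le> degree f" using g less.prems by (auto simp: min_elt_def)
    let ?k = "Polynomial.monom (lead_coeff f) (degree f - degree g)"
    let ?f = "Polynomial.smult (lead_coeff g) f - ?k * g"
    have kd: "degree ?k \<le> degree f - degree g" by (rule degree_monom_le)
    have fI: "?f \<in> I"
      using ideal_in_diff[OF subring_set_UNIV I smult_in_ideal[OF I less.prems] ideal_inD(3)[OF I UNIV_I gI(1)]] .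
    have "\<exists>c q. c \<notin> J \<and> Polynomial.smult c ?f - q * g \<in> coeffs_in J \<and> (q = 0 \<or> degree q + degree g \<le> degree f)"
    proof (cases "?f = 0")
      case True
      have "1 \<notin> J" using J by (simp add: prime_in_def)
      then show ?thesis using True ideal_inD(1)[OF ideal_coeffs_in[OF idJ]] by (intro exI[of _ 1] exI[of _ 0]) simp
    next
      case False
      then have "degree ?f < degree f" using monom_mult_degree[OF d] by blast
      then obtain c q where "c \<notin> J" "Polynomial.smult c ?f - q * g \<in> coeffs_in J" "q = 0 \<or> degree q + degree g \<le> degree ?f"
        using less.hyps fI by blast
      moreover have "q = 0 \<or> degree q + degree g \<le> degree f" using calculation(3) \<open>degree ?f < degree f\<close> by linarith
      ultimately show ?thesis by blast
    qed
    then obtain c q where cq: "c \<notin> J" "Polynomial.smult c ?f - q * g \<in> coeffs_in J" "q = 0 \<or> degree q + degree g \<le> degree f"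
      by blast
    let ?q = "Polynomial.smult c ?k + q"
    have "c * lead_coeff g \<notin> J" using cq(1) L(1) J(2) by (auto simp: prime_in_def)
    moreover have "Polynomial.smult (c * lead_coeff g) f - ?q * g = Polynomial.smult c ?f - q * g"
      by (simp add: algebra_simps smult_diff_right smult_add_right)
    moreover have "degree ?q \<le> degree f - degree g"
    proof (rule degree_add_le)
      show "degree (Polynomial.smult c ?k) \<le> degree f - degree g" using kd degree_smult_le[of c ?k] by linarith
      show "degree q \<le> degree f - degree g" using cq(3) by auto
    qed
    ultimately show ?thesis using cq(2) d by (intro exI[of _ "c * lead_coeff g"] exI[of _ ?q]) auto
  qed
qed

text \<open>The fibre over \<open>J\<close> is the spectrum of a polynomial ring in one variable
  over the fraction field modulo \<open>J\<close>, where nonzero primes are maximal. Pseudo-division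
  replaces passing to that field.\<close>

lemma prime_over_unique:
  assumes Q: "prime_in Q UNIV" and Q': "prime_in Q' UNIV" "Q' \<subseteq> Q" "const_part Q' = const_part Q"
    "Q' \<noteq> coeffs_in (const_part Q)"
  shows "Q' = Q"
proof -
  define J where "J = const_part Q"
  have J: "prime_in J UNIV" unfolding J_def using Q by (rule prime_const_part)
  have id: "ideal_in Q UNIV" "ideal_in Q' UNIV" using Q Q' by (auto simp: prime_in_def)
  have J': "J = const_part Q'" using Q' J_def by simp
  have sub: "coeffs_in J \<subseteq> Q'" using coeffs_in_subset[OF id(2)] J' by blast
  then obtain f0 where "f0 \<in> Q' - coeffs_in J" using Q'(4) J_def by blast
  then obtain g g' where g: "min_elt Q J g" and g': "min_elt Q' J g'" using min_elt_ex Q'(2) by (metis DiffD1 DiffD2 DiffI subsetD)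
  have g'Q: "g' \<in> Q'" "g' \<in> Q" using g' Q'(2) by (auto simp: min_elt_def)
  obtain c q where cq: "c \<notin> J" "Polynomial.smult c g' - q * g \<in> coeffs_in J" "q = 0 \<or> degree q + degree g \<le> degree g'"
    using pseudo_division[OF id(1) J_def J g g'Q(2)] by blast
  have "q * g = Polynomial.smult c g' - (Polynomial.smult c g' - q * g)" by simp
  also have "\<dots> \<in> Q'" using subsetD[OF sub cq(2)] by (rule ideal_in_diff[OF subring_set_UNIV id(2) smult_in_ideal[OF id(2) g'Q(1)]])
  finally have "q \<in> Q' \<or> g \<in> Q'" using Q'(1) by (auto simp: prime_in_def)
  \<comment> \<open>Since \<open>g\<close> has positive degree, \<open>q\<close> has smaller degree
    than \<open>g'\<close>; membership would put \<open>q\<close>, then \<open>c\<close> times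
    \<open>g'\<close>, and finally \<open>g'\<close> into the extension of \<open>J\<close>.\<close>
  moreover have "q \<notin> Q'"
  proof
    assume q: "q \<in> Q'"
    have "q \<in> coeffs_in J"
    proof (rule ccontr)
      assume "q \<notin> coeffs_in J"
      then have "degree g' \<le> degree q" using q g' by (auto simp: min_elt_def)
      moreover have "q \<noteq> 0" using \<open>q \<notin> coeffs_in J\<close> J by (auto simp: coeffs_in_def prime_in_def ideal_in_def)
      ultimately show False using cq(3) min_elt_lead(2)[OF id(1) J_def J g] by auto
    qed
    moreover have "ideal_in (coeffs_in J) UNIV" using J by (intro ideal_coeffs_in) (simp add: prime_in_def)
    ultimately have "Polynomial.smult c g' \<in> coeffs_in J"
      using cq(2) ideal_inD(2)[of "coeffs_in J" UNIV "Polynomial.smult c g' - q * g" "q * g"] ideal_inD(4)[of "coeffs_in J" UNIV g q] by simp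
    then have "g' \<in> coeffs_in J" using smult_coeffs_in_prime[OF J _ cq(1)] by blast
    then show False using g' by (auto simp: min_elt_def)
  qed
  ultimately have gQ: "g \<in> Q'" by blast
  have "f \<in> Q'" if "f \<in> Q" for f
  proof -
    obtain c q where cq: "c \<notin> J" "Polynomial.smult c f - q * g \<in> coeffs_in J"
      using pseudo_division[OF id(1) J_def J g \<open>f \<in> Q\<close>] by blast
    have "[:c:] * f = (Polynomial.smult c f - q * g) + q * g" by simp
    also have "\<dots> \<in> Q'" using cq(2) sub gQ by (intro ideal_inD(2)[OF id(2)] ideal_inD(3)[OF id(2)]) auto
    finally have "[:c:] \<in> Q' \<or> f \<in> Q'" using Q'(1) by (auto simp: prime_in_def)
    then show ?thesis using cq(1) J' by (auto simp: const_part_def)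
  qed
  then show ?thesis using Q'(2) by blast
qed

section \<open>Ideals of polynomial rings are finitely generated\<close>

text \<open>Generation is expressed by minimality among ideals, as in \<open>genideal\<close>, so
  that it transports along localisation without explicit linear combinations.\<close>

definition fg_ideal :: "'a::comm_ring_1 set \<Rightarrow> 'a set \<Rightarrow> bool" where
  "fg_ideal I A \<longleftrightarrow> (\<exists>F. finite F \<and> F \<subseteq> I \<and> (\<forall>J. ideal_in J A \<longrightarrow> F \<subseteq> J \<longrightarrow> I \<subseteq> J))"

lemma principal_ideal_poly:
  assumes I: "ideal_in I (UNIV :: 'k::field poly set)"
  shows "\<exists>a\<in>I. \<forall>f\<in>I. a dvd f"
proof (cases "I \<subseteq> {0}")
  case True
  then show ?thesis using ideal_inD(1)[OF I] by (intro bexI[of _ 0]) auto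
next
  case False
  then obtain a where a: "a \<in> I" "a \<noteq> 0" "\<And>f. f \<in> I \<Longrightarrow> f \<noteq> 0 \<Longrightarrow> degree a \<le> degree f"
    using ex_has_least_nat[of "\<lambda>f. f \<in> I \<and> f \<noteq> 0" _ degree] by blast
  have "a dvd f" if "f \<in> I" for f
  proof -
    have "f mod a = f - (f div a) * a" by (simp add: minus_div_mult_eq_mod)
    also have "\<dots> \<in> I" using that a(1) by (intro ideal_in_diff[OF subring_set_UNIV I] ideal_inD(3)[OF I]) auto
    finally have "f mod a \<in> I" .
    then have "f mod a = 0" using a(3)[of "f mod a"] degree_mod_less[OF a(2), of f] by linarith
    then show ?thesis by (simp add: mod_eq_0_iff_dvd)
  qed
  then show ?thesis using a(1) by blast
qed

text \<open>Hilbert's argument with principality of the ideals of \<open>k[x]\<close> in place of an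
  ascending chain condition: the union of the leading-coefficient ideals is principal, so its
  generator already occurs in some \<open>L N\<close>.\<close>

theorem hilbert_basis_poly:
  assumes I: "ideal_in I (UNIV :: 'k::field poly poly set)"
  shows "fg_ideal I UNIV"
proof -
  \<comment> \<open>Coefficients at \<open>n\<close> of elements of degree at most \<open>n\<close>;
    allowing smaller degree brings in 0 and makes these sets ideals.\<close>
  define L where "L n = {Polynomial.coeff f n | f. f \<in> I \<and> degree f \<le> n}" for n
  have Lid: "ideal_in (L n) UNIV" for n
    unfolding ideal_in_def
  proof (intro conjI ballI)
    show "0 \<in> L n" unfolding L_def using ideal_inD(1)[OF I] by force
    fix x y assume "x \<in> L n"
    then obtain f where f: "x = Polynomial.coeff f n" "f \<in> I" "degree f \<le> n" by (auto simp: L_def)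
    show "x + y \<in> L n" if y: "y \<in> L n"
    proof -
      obtain h where h: "y = Polynomial.coeff h n" "h \<in> I" "degree h \<le> n" using y by (auto simp: L_def)
      have "x + y = Polynomial.coeff (f + h) n \<and> f + h \<in> I \<and> degree (f + h) \<le> n"
        using f h ideal_inD(2)[OF I] by (simp add: degree_add_le)
      then show ?thesis unfolding L_def by blast
    qed
    have "y * x = Polynomial.coeff (Polynomial.smult y f) n \<and> Polynomial.smult y f \<in> I \<and> degree (Polynomial.smult y f) \<le> n"
      using f smult_in_ideal[OF I] degree_smult_le[of y f] by simp
    then show "y * x \<in> L n" unfolding L_def by blast
  qed auto
  have Lmono: "L n \<subseteq> L (Suc n)" for n
  proof
    fix x assume "x \<in> L n"
    then obtain f where f: "x = Polynomial.coeff f n" "f \<in> I" "degree f \<le> n" by (auto simp: L_def)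
    have "Polynomial.monom 1 1 * f \<in> I" using ideal_inD(3)[OF I] f by blast
    moreover have "degree (Polynomial.monom 1 1 * f) \<le> Suc n"
      using degree_mult_le[of "Polynomial.monom 1 1" f] degree_monom_le[of "1 :: 'k poly" 1] f by linarith
    moreover have "x = Polynomial.coeff (Polynomial.monom 1 1 * f) (Suc n)" using f by (simp add: coeff_monom_mult)
    ultimately show "x \<in> L (Suc n)" unfolding L_def by blast
  qed
  then have mono: "L m \<subseteq> L n" if "m \<le> n" for m n using that lift_Suc_mono_le by metis
  define U where "U = (\<Union>n. L n)"
  have "ideal_in U UNIV"
    unfolding ideal_in_def
  proof (intro conjI ballI)
    show "0 \<in> U" using ideal_inD(1)[OF Lid] U_def by blast
    fix x y assume "x \<in> U"
    then obtain m where m: "x \<in> L m" by (auto simp: U_def)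
    show "y * x \<in> U" using ideal_inD(3)[OF Lid _ m] U_def by blast
    assume "y \<in> U"
    then obtain n where n: "y \<in> L n" by (auto simp: U_def)
    have "x \<in> L (max m n)" "y \<in> L (max m n)" using m n mono[of m "max m n"] mono[of n "max m n"] by auto
    then show "x + y \<in> U" using ideal_inD(2)[OF Lid] U_def by blast
  qed auto
  then obtain u where u: "u \<in> U" "\<And>f. f \<in> U \<Longrightarrow> u dvd f" using principal_ideal_poly by blast
  then obtain N where N: "u \<in> L N" by (auto simp: U_def)
  have "\<forall>n. \<exists>a\<in>L n. \<forall>f\<in>L n. a dvd f" using principal_ideal_poly[OF Lid] by blast
  then obtain a where a: "\<And>n. a n \<in> L n" "\<And>n f. f \<in> L n \<Longrightarrow> a n dvd f" by metis
  then have "\<forall>n. \<exists>f. a n = Polynomial.coeff f n \<and> f \<in> I \<and> degree f \<le> n" by (auto simp: L_def)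
  then obtain F where F: "\<And>n. a n = Polynomial.coeff (F n) n" "\<And>n. F n \<in> I" "\<And>n. degree (F n) \<le> n" by metis
  have aN: "a N dvd x" if "x \<in> U" for x using u(2)[OF that] a(2)[OF N] dvd_trans by blast
  show ?thesis
    unfolding fg_ideal_def
  proof (intro exI[of _ "F ` {..N}"] conjI allI impI subsetI)
    fix J f assume J: "ideal_in J UNIV" "F ` {..N} \<subseteq> J" and f: "f \<in> I"
    have "\<forall>f\<in>I. (\<forall>i\<ge>n. Polynomial.coeff f i = 0) \<longrightarrow> f \<in> J" for n
    proof (induction n)
      case 0
      have "f = 0" if "\<forall>i\<ge>0. Polynomial.coeff f i = 0" for f :: "'k poly poly" using that by (intro poly_eqI) simp
      then show ?case using ideal_inD(1)[OF J(1)] by blast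
    next
      case (Suc n)
      show ?case
      proof (intro ballI impI)
        fix f assume f: "f \<in> I" "\<forall>i\<ge>Suc n. Polynomial.coeff f i = 0"
        \<comment> \<open>From degree \<open>N\<close> on all leading coefficients are multiples of
          \<open>a N\<close>, so \<open>F N\<close> times a monomial suffices.\<close>
        define k where "k = min n N"
        have "degree f \<le> n" using f(2) by (intro degree_le) auto
        then have "Polynomial.coeff f n \<in> L n" using f(1) by (auto simp: L_def)
        then have "a k dvd Polynomial.coeff f n" using aN a(2)[of "Polynomial.coeff f n" n] by (auto simp: k_def min_def U_def)
        then obtain c where c: "Polynomial.coeff f n = a k * c" by (elim dvdE)
        let ?h = "Polynomial.monom c (n - k) * F k"
        have "F k \<in> J" using J(2) by (auto simp: k_def)
        then have hJ: "?h \<in> J" "?h \<in> I" using F(2) ideal_inD(3)[OF I] ideal_inD(3)[OF J(1)] by blast+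
        have "Polynomial.coeff (f - ?h) i = 0" if "n \<le> i" for i
        proof (cases "i = n")
          case True
          then show ?thesis using c F(1)[of k] by (simp add: coeff_monom_mult k_def)
        next
          case False
          then have "Suc n \<le> i" "degree (F k) < i - (n - k)" using that F(3)[of k] by (auto simp: k_def)
          then show ?thesis using f(2) by (simp add: coeff_monom_mult coeff_eq_0)
        qed
        then have "f - ?h \<in> J" using Suc.IH ideal_in_diff[OF subring_set_UNIV I f(1) hJ(2)] by blast
        then have "(f - ?h) + ?h \<in> J" using hJ(1) by (rule ideal_inD(2)[OF J(1)])
        then show "f \<in> J" by simp
      qed
    qed
    from this[of "Suc (degree f)"] f show "f \<in> J" by (auto simp: coeff_eq_0)
  qed (use F in auto)
qed

section \<open>Chains of prime ideals\<close>

definition prime_chain :: "'a::comm_ring_1 set \<Rightarrow> nat \<Rightarrow> (nat \<Rightarrow> 'a set) \<Rightarrow> bool" where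
  "prime_chain A n P \<longleftrightarrow> (\<forall>i\<le>n. prime_in (P i) A) \<and> (\<forall>i<n. P i \<subset> P (Suc i))"

lemma krull_dim_ring_of:
  assumes "subring_set A"
  shows "krull_dim (ring_of A) = (SUP n\<in>{n. \<exists>P. prime_chain A n P}. enat n)"
  unfolding krull_dim_def prime_chain_def primeideal_ring_of_iff[OF assms] ..

lemma prime_chain_le: "prime_chain A n P \<Longrightarrow> m \<le> n \<Longrightarrow> prime_chain A m P"
  by (auto simp: prime_chain_def)

lemma prime_chain_shift: "prime_chain A (m + n) P \<Longrightarrow> prime_chain A n (\<lambda>i. P (m + i))"
  by (auto simp: prime_chain_def)

lemma krull_dim_le:
  assumes "subring_set A" "\<nexists>P. prime_chain A (Suc n) P"
  shows "krull_dim (ring_of A) \<le> enat n"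
  unfolding krull_dim_ring_of[OF assms(1)]
proof (rule SUP_least)
  fix m assume "m \<in> {n. \<exists>P. prime_chain A n P}"
  then obtain P where "prime_chain A m P" by blast
  then have "\<not> Suc n \<le> m" using assms(2) prime_chain_le by blast
  then show "enat m \<le> enat n" by simp
qed

lemma krull_dim_eq:
  assumes "subring_set A" "prime_chain A n P" "\<nexists>P. prime_chain A (Suc n) P"
  shows "krull_dim (ring_of A) = enat n"
proof (rule antisym)
  show "krull_dim (ring_of A) \<le> enat n" using krull_dim_le assms by blast
  show "enat n \<le> krull_dim (ring_of A)"
    unfolding krull_dim_ring_of[OF assms(1)] using assms(2) by (intro SUP_upper) blast
qed

text \<open>With generators \<open>a = a' * b\<close>, primality puts \<open>a'\<close> or
  \<open>b\<close> into \<open>P\<close>; the second would make \<open>a'\<close> a unit.\<close>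

lemma prime_poly_maximal:
  assumes "prime_in P (UNIV :: 'k::field poly set)" "prime_in P' UNIV" "P \<subseteq> P'" "P \<noteq> {0}"
  shows "P = P'"
proof -
  have id: "ideal_in P UNIV" "ideal_in P' UNIV" using assms by (auto simp: prime_in_def)
  obtain a a' where a: "a \<in> P" "\<And>f. f \<in> P \<Longrightarrow> a dvd f" and a': "a' \<in> P'" "\<And>f. f \<in> P' \<Longrightarrow> a' dvd f"
    using principal_ideal_poly[OF id(1)] principal_ideal_poly[OF id(2)] by blast
  obtain b where b: "a = a' * b" using a'(2)[of a] a(1) assms(3) by (auto elim: dvdE)
  have a0: "a \<noteq> 0" using a(2) assms(4) ideal_inD(1)[OF id(1)] by fastforce
  have "a' \<in> P"
  proof (rule ccontr)
    assume "a' \<notin> P"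
    then have "b \<in> P" using assms(1) a(1) b by (auto simp: prime_in_def)
    then have "a dvd b" using a(2) by blast
    then have "a' * b dvd 1 * b" using b by simp
    then have "a' dvd 1" using a0 b by (metis dvd_mult_cancel_right mult_zero_right)
    then have "1 \<in> P'" using ideal_inD(4)[OF id(2) UNIV_I a'(1)] by (metis dvd_def)
    then show False using assms(2) by (simp add: prime_in_def)
  qed
  then have "P' \<subseteq> P" using a'(2) ideal_inD(4)[OF id(1)] by (auto elim!: dvdE)
  then show ?thesis using assms(3) by blast
qed

text \<open>Descent on the degree in \<open>x\<close> of the leading coefficient: an element of
  \<open>Q\<close> in the extension of \<open>J\<close> is divisible by the generator
  \<open>a\<close> of \<open>J\<close>, and the quotient is again in \<open>Q\<close> because
  \<open>a\<close> is not.\<close>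

lemma prime_over_0_not_in_coeffs:
  assumes Q: "prime_in Q (UNIV :: 'k::field poly poly set)" "const_part Q = {0}" "Q \<noteq> {0}"
    and J: "prime_in J (UNIV :: 'k poly set)" "J \<noteq> {0}"
  shows "\<not> Q \<subseteq> coeffs_in J"
proof
  assume sub: "Q \<subseteq> coeffs_in J"
  have id: "ideal_in J UNIV" "ideal_in Q UNIV" using J Q by (auto simp: prime_in_def)
  obtain a where a: "a \<in> J" "\<And>f. f \<in> J \<Longrightarrow> a dvd f" using principal_ideal_poly[OF id(1)] by blast
  have a0: "a \<noteq> 0" using a(2) J(2) ideal_inD(1)[OF id(1)] by fastforce
  have da: "0 < degree a"
  proof (rule ccontr)
    assume "\<not> 0 < degree a"
    then have "is_unit a" using a0 by (simp add: is_unit_iff_degree)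
    then have "1 \<in> J" using ideal_inD(4)[OF id(1) UNIV_I a(1)] by (metis dvd_def)
    then show False using J by (simp add: prime_in_def)
  qed
  obtain f where f: "f \<in> Q" "f \<noteq> 0" "\<And>g. g \<in> Q \<Longrightarrow> g \<noteq> 0 \<Longrightarrow> degree (lead_coeff f) \<le> degree (lead_coeff g)"
    using ex_has_least_nat[of "\<lambda>f. f \<in> Q \<and> f \<noteq> 0" _ "\<lambda>f. degree (lead_coeff f)"] Q(3) ideal_inD(1)[OF id(2)] by blast
  have "\<forall>i. a dvd Polynomial.coeff f i" using sub f(1) a(2) by (auto simp: coeffs_in_def)
  then have "[:a:] dvd f" by (simp add: const_poly_dvd_iff)
  then obtain g where g: "f = [:a:] * g" by (elim dvdE)
  have "g \<in> Q"
  proof -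
    have "[:a:] \<notin> Q" using Q(2) a0 by (auto simp: const_part_def)
    then show ?thesis using Q(1) f(1) unfolding g prime_in_def by blast
  qed
  moreover have g0: "g \<noteq> 0" using f(2) g by auto
  moreover have "degree (lead_coeff f) = degree a + degree (lead_coeff g)"
    using g a0 g0 by (simp add: lead_coeff_mult degree_mult_eq)
  ultimately show False using f(3)[of g] da by auto
qed

lemma coeffs_in_0 [simp]: "coeffs_in {0} = {0}"
  by (auto simp: coeffs_in_def poly_eq_iff)

lemma const_part_mono: "Q \<subseteq> Q' \<Longrightarrow> const_part Q \<subseteq> const_part Q'"
  by (auto simp: const_part_def)

lemma const_part_cases:
  assumes "prime_chain (UNIV :: 'k::field poly poly set) n P" "i < j" "j \<le> n"
  shows "const_part (P i) = const_part (P j) \<or> const_part (P i) = {0}" "P i \<subset> P j"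
proof -
  have "P i \<subset> P j" using assms(2,3)
  proof (induction j)
    case (Suc j)
    have "P j \<subset> P (Suc j)" using assms(1) Suc by (auto simp: prime_chain_def)
    then show ?case using Suc by (cases "i = j") auto
  qed simp
  then show "P i \<subset> P j" .
  then have "const_part (P i) \<subseteq> const_part (P j)" by (intro const_part_mono) auto
  then show "const_part (P i) = const_part (P j) \<or> const_part (P i) = {0}"
    using prime_poly_maximal[of "const_part (P i)" "const_part (P j)"]
      prime_const_part[of "P i"] prime_const_part[of "P j"] assms by (auto simp: prime_chain_def)
qed

text \<open>The smallest of the three primes contains the extension of the common contraction, so
  the middle one strictly contains it and, by uniqueness in the fibre, equals the largest.\<close>

lemma no_three_over:
  assumes c: "prime_chain (UNIV :: 'k::field poly poly set) 2 P"
  shows "\<not> (const_part (P 0) = const_part (P 2))"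
proof
  assume eq: "const_part (P 0) = const_part (P 2)"
  have pr: "prime_in (P 0) UNIV" "prime_in (P 1) UNIV" "prime_in (P 2) UNIV" using c by (auto simp: prime_chain_def)
  have sub: "P 0 \<subset> P 1" "P 1 \<subset> P 2"
    using const_part_cases(2)[OF c, of 0 1] const_part_cases(2)[OF c, of 1 2] by auto
  then have eq1: "const_part (P 1) = const_part (P 2)"
    using eq const_part_mono[of "P 0" "P 1"] const_part_mono[of "P 1" "P 2"] by blast
  have "coeffs_in (const_part (P 2)) \<subseteq> P 0" using coeffs_in_subset[of "P 0"] pr(1) eq by (auto simp: prime_in_def)
  then have "P 1 \<noteq> coeffs_in (const_part (P 2))" using sub by blast
  then show False using prime_over_unique[OF pr(3,2) _ eq1] sub by blast
qed

lemma height_one_over_0: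
  assumes c: "prime_chain (UNIV :: 'k::field poly poly set) 2 P" shows "const_part (P 2) \<noteq> {0}"
proof
  assume 0: "const_part (P 2) = {0}"
  have "prime_in (P 0) UNIV" using c by (simp add: prime_chain_def)
  then have "0 \<in> const_part (P 0)" by (simp add: const_part_def prime_in_def ideal_in_def)
  then have "const_part (P 0) = {0}"
    using const_part_mono[of "P 0" "P 2"] const_part_cases(2)[OF c, of 0 2] 0 by auto
  then show False using no_three_over[OF c] 0 by simp
qed

text \<open>The extension of a nonzero prime of \<open>k[x]\<close> has height at most one: the
  middle prime of a chain inside it either contracts to 0, which the descent excludes, or contracts
  to \<open>J\<close> and then already contains the extension.\<close>

lemma height_one_coeffs_in:
  assumes c: "prime_chain (UNIV :: 'k::field poly poly set) 2 P" and J: "prime_in J UNIV" "J \<noteq> {0}"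
  shows "\<not> P 2 \<subseteq> coeffs_in J"
proof
  assume sub: "P 2 \<subseteq> coeffs_in J"
  have pr: "prime_in (P 0) UNIV" "prime_in (P 1) UNIV" "prime_in (P 2) UNIV" using c by (auto simp: prime_chain_def)
  have sub': "P 0 \<subset> P 1" "P 1 \<subset> P 2"
    using const_part_cases(2)[OF c, of 0 1] const_part_cases(2)[OF c, of 1 2] by auto
  have n0: "P 1 \<noteq> {0}" using sub'(1) pr(1) by (auto simp: prime_in_def ideal_in_def)
  have cJ: "const_part (P 1) \<subseteq> J"
  proof
    fix a assume "a \<in> const_part (P 1)"
    then have "[:a:] \<in> coeffs_in J" using sub sub'(2) by (auto simp: const_part_def)
    then have "Polynomial.coeff [:a:] 0 \<in> J" unfolding coeffs_in_def by blast
    then show "a \<in> J" by simp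
  qed
  show False
  proof (cases "const_part (P 1) = {0}")
    case True
    show False using prime_over_0_not_in_coeffs[OF pr(2) True n0 J]
        order_trans[OF psubset_imp_subset[OF sub'(2)] sub] by (rule notE)
  next
    case False
    then have "const_part (P 1) = J" using prime_poly_maximal[OF prime_const_part[OF pr(2)] J(1) cJ] by blast
    then have "coeffs_in J \<subseteq> P 1" using coeffs_in_subset[of "P 1"] pr(2) by (auto simp: prime_in_def)
    then have "P 2 \<subseteq> P 1" using sub by (rule order_trans[rotated])
    then show False using sub'(2) by (simp add: less_le_not_le)
  qed
qed

text \<open>The dimension of \<open>k[x, y]\<close> is at most 2. In a chain of four primes the last
  two share a nonzero contraction and \<open>P 1\<close> contracts to 0; hence \<open>P 2\<close> is
  the extension of its contraction, too small for the chain below it.\<close>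

lemma no_chain_3: "\<not> prime_chain (UNIV :: 'k::field poly poly set) 3 P"
proof
  assume c: "prime_chain (UNIV :: 'k poly poly set) 3 P"
  have c2: "prime_chain UNIV 2 P" using prime_chain_le[OF c] by simp
  have c2': "prime_chain UNIV 2 (\<lambda>i. P (1 + i))" using prime_chain_shift[of UNIV 1 2 P] c by (simp add: numeral_eq_Suc)
  have pr: "prime_in (P 1) UNIV" "prime_in (P 2) UNIV" "prime_in (P 3) UNIV" using c by (auto simp: prime_chain_def)
  have "const_part (P 2) = const_part (P 3)"
    using const_part_cases(1)[OF c, of 2 3] height_one_over_0[OF c2] by auto
  moreover have "const_part (P 1) = const_part (P 3) \<or> const_part (P 1) = {0}"
    using const_part_cases(1)[OF c, of 1 3] by auto
  ultimately have 0: "const_part (P 1) = {0}" and n0: "const_part (P 2) \<noteq> {0}"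
    using no_three_over[OF c2'] height_one_over_0[OF c2] by (auto simp: numeral_eq_Suc)
  have sub: "P 0 \<subset> P 1" "P 1 \<subset> P 2" "P 2 \<subset> P 3"
    using const_part_cases(2)[OF c, of 0 1] const_part_cases(2)[OF c, of 1 2] const_part_cases(2)[OF c, of 2 3] by auto
  have "P 2 = coeffs_in (const_part (P 3))"
    using prime_over_unique[OF pr(3,2)] \<open>const_part (P 2) = const_part (P 3)\<close> sub by blast
  then have "P 2 \<subseteq> coeffs_in (const_part (P 2))" using \<open>const_part (P 2) = const_part (P 3)\<close> by simp
  then show False using height_one_coeffs_in[OF c2 prime_const_part[OF pr(2)] n0] by blast
qed

section \<open>Linear dependence modulo a prime ideal\<close>

text \<open>Fraction-free Gaussian elimination over the domain modulo \<open>p\<close>. It is used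
  with a contracted prime for incomparability, and with \<open>{0}\<close> in \<open>k\<close> for
  the tangent space.\<close>

lemma dependent_mod_prime:
  fixes w :: "'i \<Rightarrow> nat \<Rightarrow> 'a::comm_ring_1"
  assumes p: "prime_in p UNIV" and I: "finite I" "n < card I"
  shows "\<exists>c. (\<exists>i\<in>I. c i \<notin> p) \<and> (\<forall>j<n. (\<Sum>i\<in>I. c i * w i j) \<in> p)"
  using I
proof (induction n arbitrary: I w)
  case 0
  then obtain i where "i \<in> I" by (metis card_gt_0_iff equals0I)
  moreover have "1 \<notin> p" using p by (simp add: prime_in_def)
  ultimately show ?case by (intro exI[of _ "\<lambda>_. 1"]) auto
next
  case (Suc n)
  have id: "ideal_in p UNIV" using p by (simp add: prime_in_def)
  show ?case
  proof (cases "\<forall>i\<in>I. w i n \<in> p")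
    case True
    obtain c where c: "\<exists>i\<in>I. c i \<notin> p" "\<forall>j<n. (\<Sum>i\<in>I. c i * w i j) \<in> p"
      using Suc.IH[of I w] Suc.prems by (meson Suc_lessD)
    have "(\<Sum>i\<in>I. c i * w i n) \<in> p" using True by (intro ideal_in_sum[OF id] ideal_inD(3)[OF id]) auto
    then show ?thesis using c less_Suc_eq by metis
  next
    case False
    then obtain k where k: "k \<in> I" "w k n \<notin> p" by blast
    have card: "n < card (I - {k})" "finite (I - {k})" using Suc.prems k by (auto simp: card_Diff_singleton)
    obtain c where c: "\<exists>i\<in>I - {k}. c i \<notin> p" "\<forall>j<n. (\<Sum>i\<in>I - {k}. c i * (w k n * w i j - w i n * w k j)) \<in> p"
      using Suc.IH[OF card(2,1), of "\<lambda>i j. w k n * w i j - w i n * w k j"] by blast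
    \<comment> \<open>The other coefficients are multiplied by the pivot \<open>w k n\<close>, and
      the coefficient of row \<open>k\<close> is chosen so that column \<open>n\<close> cancels
      exactly.\<close>
    define d where "d i = (if i = k then - (\<Sum>i\<in>I - {k}. c i * w i n) else c i * w k n)" for i
    have sum: "(\<Sum>i\<in>I. d i * w i j) = (\<Sum>i\<in>I - {k}. c i * (w k n * w i j - w i n * w k j))" for j
    proof -
      have "(\<Sum>i\<in>I. d i * w i j) = d k * w k j + (\<Sum>i\<in>I - {k}. d i * w i j)"
        using Suc.prems k by (simp add: sum.remove)
      also have "(\<Sum>i\<in>I - {k}. d i * w i j) = (\<Sum>i\<in>I - {k}. c i * w k n * w i j)"
        by (intro sum.cong) (auto simp: d_def)
      also have "d k * w k j = - (\<Sum>i\<in>I - {k}. c i * w i n * w k j)"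
        by (simp add: d_def sum_distrib_right)
      finally show ?thesis by (simp add: sum_subtractf algebra_simps)
    qed
    have "\<exists>i\<in>I. d i \<notin> p"
      using c(1) k p by (auto simp: d_def prime_in_def)
    moreover have "(\<Sum>i\<in>I. d i * w i j) \<in> p" if "j < Suc n" for j
    proof (cases "j = n")
      case True
      have "(\<Sum>i\<in>I - {k}. c i * (w k n * w i n - w i n * w k n)) = 0" by (simp add: mult.commute)
      then show ?thesis unfolding sum True using ideal_inD(1)[OF id] by simp
    next
      case False
      then show ?thesis unfolding sum using c(2) that by auto
    qed
    ultimately show ?thesis by blast
  qed
qed

section \<open>Regularity of the points of a smooth chart\<close>

text \<open>Gauss's argument: multiply the lowest coefficients of \<open>f\<close> and
  \<open>g\<close> that lie outside \<open>J\<close>.\<close>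

lemma prime_coeffs_in:
  assumes J: "prime_in J UNIV" shows "prime_in (coeffs_in J) UNIV"
proof -
  have id: "ideal_in J UNIV" using J by (simp add: prime_in_def)
  have "f \<in> coeffs_in J \<or> g \<in> coeffs_in J" if fg: "f * g \<in> coeffs_in J" for f g
  proof (rule ccontr)
    assume n: "\<not> (f \<in> coeffs_in J \<or> g \<in> coeffs_in J)"
    define i where "i = (LEAST i. Polynomial.coeff f i \<notin> J)"
    define j where "j = (LEAST j. Polynomial.coeff g j \<notin> J)"
    have i: "Polynomial.coeff f i \<notin> J" unfolding i_def by (rule LeastI_ex) (use n in \<open>auto simp: coeffs_in_def\<close>)
    have j: "Polynomial.coeff g j \<notin> J" unfolding j_def by (rule LeastI_ex) (use n in \<open>auto simp: coeffs_in_def\<close>)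
    have lt: "Polynomial.coeff f k \<in> J" if "k < i" for k using not_less_Least[of k] that unfolding i_def by blast
    have lt': "Polynomial.coeff g k \<in> J" if "k < j" for k using not_less_Least[of k] that unfolding j_def by blast
    have "(\<Sum>k\<in>{..i + j} - {i}. Polynomial.coeff f k * Polynomial.coeff g (i + j - k)) \<in> J"
    proof (rule ideal_in_sum[OF id])
      fix k assume "k \<in> {..i + j} - {i}"
      then have "k < i \<or> i + j - k < j" by auto
      then show "Polynomial.coeff f k * Polynomial.coeff g (i + j - k) \<in> J"
        using ideal_inD(3,4)[OF id UNIV_I] lt lt' by blast
    qed
    moreover have "Polynomial.coeff (f * g) (i + j) \<in> J" using fg unfolding coeffs_in_def by blast
    moreover have "Polynomial.coeff (f * g) (i + j) =
        Polynomial.coeff f i * Polynomial.coeff g j + (\<Sum>k\<in>{..i + j} - {i}. Polynomial.coeff f k * Polynomial.coeff g (i + j - k))"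
      by (simp add: coeff_mult sum.remove[of _ i])
    ultimately have "Polynomial.coeff f i * Polynomial.coeff g j \<in> J"
      using ideal_in_diff[OF subring_set_UNIV id] by (metis add_diff_cancel_right')
    then show False using i j J by (auto simp: prime_in_def)
  qed
  moreover have "1 \<notin> coeffs_in J"
    using J by (auto simp: coeffs_in_def prime_in_def intro!: exI[of _ 0])
  ultimately show ?thesis using ideal_coeffs_in[OF id] by (auto simp: prime_in_def)
qed

lemma prime_0: "prime_in {0} (UNIV :: 'a::idom set)"
  by (auto simp: prime_in_def ideal_in_def)

text \<open>An embedding of \<open>k[x][y]\<close> into the function field. Its image is the whole
  chart for a smooth cone, and a subring over which the chart is finite for a cone of type
  A.\<close>

locale poly_chart =
  fixes h :: "'k::field poly poly \<Rightarrow> 'k ratfun"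
  assumes h_add: "h (p + q) = h p + h q" and h_mult: "h (p * q) = h p * h q"
    and h_const: "h [:[:c:]:] = const c" and h_inj: "h p = 0 \<Longrightarrow> p = 0"
begin

lemma h_0: "h 0 = 0" and h_1: "h 1 = 1"
  using h_const[of 0] h_const[of 1] by (simp_all add: one_pCons)

lemma h_minus: "h (- p) = - h p"
  using h_add[of p "- p"] h_0 by (simp add: eq_neg_iff_add_eq_0 add.commute)

lemma h_sum: "h (sum f S) = (\<Sum>i\<in>S. h (f i))"
  by (induction S rule: infinite_finite_induct) (auto simp: h_0 h_add)

lemma inj_h: "inj h"
proof (rule injI)
  fix p q assume "h p = h q"
  then have "h (p + - q) = 0" by (simp only: h_add h_minus) simp
  then show "p = q" using h_inj[of "p + - q"] by simp
qed

lemma k_subalgebra_range: "k_subalgebra (range h)"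
  unfolding k_subalgebra_def
proof (intro conjI ballI)
  show "range const \<subseteq> range h" using h_const by (metis image_subsetI rangeI)
  fix a b assume "a \<in> range h" "b \<in> range h"
  then show "a + b \<in> range h" "a * b \<in> range h" by (auto simp flip: h_add h_mult)
qed

lemma pull_ideal: "ideal_in J T \<Longrightarrow> range h \<subseteq> T \<Longrightarrow> ideal_in {f. h f \<in> J} UNIV"
proof -
  assume J: "ideal_in J T" and sub: "range h \<subseteq> T"
  have "h a * h x \<in> J" if "h x \<in> J" for a x using ideal_inD(3)[OF J _ that] sub by blast
  then show ?thesis using ideal_inD(1,2)[OF J] unfolding ideal_in_def by (simp add: h_0 h_add h_mult)
qed

lemma pull_prime: "prime_in P T \<Longrightarrow> range h \<subseteq> T \<Longrightarrow> prime_in {f. h f \<in> P} UNIV"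
proof -
  assume P: "prime_in P T" "range h \<subseteq> T"
  then have "h a \<in> P \<or> h b \<in> P" if "h (a * b) \<in> P" for a b
    using that unfolding prime_in_def h_mult by (meson rangeI subsetD)
  then show ?thesis using pull_ideal[of P T] P unfolding prime_in_def by (auto simp: h_1)
qed

section \<open>The local ring at a point of a plane chart\<close>

context
  fixes T assumes T: "T \<in> Spec (range h)"
begin

lemmas TD = SpecD[OF k_subalgebra_range T]

definition Q where "Q = {f. h f \<notin> units_in T}"

lemma prime_Q: "prime_in Q UNIV"
proof -
  have "prime_in (range h - units_in T) (range h)"
    using prime_in_center[OF TD(3) k_subalgebra_range] TD(2) by blast
  then have "prime_in {f. h f \<in> range h - units_in T} UNIV" by (rule pull_prime) simp
  then show ?thesis by (simp add: Q_def)
qed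

lemma T_rep: "t \<in> T \<Longrightarrow> \<exists>a s. t = h a / h s \<and> s \<notin> Q"
  using TD(4) unfolding fractions_over_def Q_def by blast

lemma h_in_T: "h f \<in> T"
  using TD(2) by blast

lemma h_frac_in: "ideal_in J T \<Longrightarrow> h a \<in> J \<Longrightarrow> s \<notin> Q \<Longrightarrow> h a / h s \<in> J"
  using ideal_inD(4)[of J T "inverse (h s)" "h a"] by (auto simp: Q_def units_in_def divide_inverse)

lemma h_frac_in_iff: "ideal_in J T \<Longrightarrow> s \<notin> Q \<Longrightarrow> h a / h s \<in> J \<longleftrightarrow> h a \<in> J"
  using ideal_inD(4)[of J T "h s" "h a / h s"] h_frac_in[of J a s] h_in_T by (auto simp: Q_def units_in_def)

lemma pull_strict:
  assumes "prime_in P T" "prime_in P' T" "P \<subset> P'"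
  shows "{f. h f \<in> P} \<subset> {f. h f \<in> P'}"
proof -
  obtain t where t: "t \<in> P'" "t \<notin> P" using assms by blast
  have id: "ideal_in P T" "ideal_in P' T" using assms by (auto simp: prime_in_def)
  obtain a s where as: "t = h a / h s" "s \<notin> Q" using T_rep ideal_inD(5)[OF id(2) t(1)] by blast
  then have "h a \<in> P'" "h a \<notin> P" using t h_frac_in_iff id by auto
  then show ?thesis using assms(3) by blast
qed

lemma prime_nonunit: "prime_in P T \<Longrightarrow> {f. h f \<in> P} \<subseteq> Q"
proof
  fix f assume P: "prime_in P T" and f: "f \<in> {f. h f \<in> P}"
  show "f \<in> Q"
  proof (rule ccontr)
    assume "f \<notin> Q"
    then have "inverse (h f) \<in> T" "h f \<noteq> 0" by (auto simp: Q_def units_in_def)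
    then have "inverse (h f) * h f \<in> P" using P f ideal_inD(3)[of P T "inverse (h f)" "h f"] by (simp only: prime_in_def mem_Collect_eq)
    moreover have "inverse (h f) * h f = 1" using \<open>h f \<noteq> 0\<close> by simp
    ultimately show False using P by (simp add: prime_in_def)
  qed
qed

text \<open>The extension of \<open>q\<close> to \<open>T\<close>. A prime inside \<open>Q\<close>
  is recovered from it by contraction, so chains of primes can be moved both ways.\<close>

definition ext where "ext q = {h a / h s | a s. a \<in> q \<and> s \<notin> Q}"

lemma ext_iff:
  assumes q: "prime_in q UNIV" "q \<subseteq> Q" and s: "s \<notin> Q"
  shows "h a / h s \<in> ext q \<longleftrightarrow> a \<in> q"
proof
  assume "h a / h s \<in> ext q"
  then obtain b u where b: "b \<in> q" "u \<notin> Q" "h a / h s = h b / h u" by (auto simp: ext_def)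
  have "h s \<noteq> 0" "h u \<noteq> 0" using s b by (auto simp: Q_def units_in_def)
  then have "h (a * u) = h (b * s)" using b(3) by (simp add: h_mult field_simps)
  then have "a * u = b * s" using inj_h by (simp add: inj_def)
  then have "a * u \<in> q" using q(1) b(1) ideal_inD(4)[of q UNIV s b] by (simp add: prime_in_def)
  then show "a \<in> q" using q b(2) by (auto simp: prime_in_def)
qed (use s in \<open>auto simp: ext_def\<close>)

lemma prime_ext:
  assumes q: "prime_in q UNIV" "q \<subseteq> Q" shows "prime_in (ext q) T"
proof -
  have id: "ideal_in q UNIV" using q by (simp add: prime_in_def)
  have nz: "h s \<noteq> 0" if "s \<notin> Q" for s using that by (auto simp: Q_def units_in_def)
  have mQ: "s * u \<notin> Q" if "s \<notin> Q" "u \<notin> Q" for s u using prime_Q that by (auto simp: prime_in_def)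
  have 1: "1 \<notin> Q" using prime_Q by (simp add: prime_in_def)
  have m: "(h a / h s) * (h b / h u) = h (a * b) / h (s * u)" for a b s u by (simp add: h_mult)
  show ?thesis
    unfolding prime_in_def ideal_in_def
  proof (intro conjI ballI impI subsetI)
    fix t assume "t \<in> ext q"
    then obtain a s where "t = h a / h s" "s \<notin> Q" by (auto simp: ext_def)
    then show "t \<in> T" using units_in_divide[OF TD(1) h_in_T, of "h s" a] by (simp add: Q_def)
  next
    show "0 \<in> ext q" unfolding ext_def using ideal_inD(1)[OF id] 1 h_0 by force
  next
    fix x y assume x: "x \<in> ext q"
    then obtain a s where as: "x = h a / h s" "a \<in> q" "s \<notin> Q" by (auto simp: ext_def)
    show "x + y \<in> ext q" if "y \<in> ext q"
    proof -
      from that obtain b u where bu: "y = h b / h u" "b \<in> q" "u \<notin> Q" by (auto simp: ext_def)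
      have "x + y = h (u * a + s * b) / h (s * u)" using as bu nz by (simp add: h_mult h_add add_frac_eq algebra_simps)
      moreover have "u * a + s * b \<in> q" using as bu by (intro ideal_inD(2)[OF id] ideal_inD(3)[OF id]) auto
      ultimately show ?thesis using ext_iff[OF q mQ] as bu by simp
    qed
    show "y * x \<in> ext q" if "y \<in> T"
    proof -
      obtain b u where bu: "y = h b / h u" "u \<notin> Q" using T_rep[OF \<open>y \<in> T\<close>] by blast
      show ?thesis using ext_iff[OF q mQ, of u s "b * a"] as bu m ideal_inD(3)[OF id, of b a] by simp
    qed
  next
    show "1 \<notin> ext q" using ext_iff[OF q 1, of 1] q(1) by (simp add: h_1 prime_in_def)
  next
    fix x y assume xy: "x \<in> T" "y \<in> T" "x * y \<in> ext q"
    obtain a s where as: "x = h a / h s" "s \<notin> Q" using T_rep[OF xy(1)] by blast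
    obtain b u where bu: "y = h b / h u" "u \<notin> Q" using T_rep[OF xy(2)] by blast
    have "a * b \<in> q" using ext_iff[OF q mQ, of s u "a * b"] xy(3) as bu m by simp
    then have "a \<in> q \<or> b \<in> q" using q by (auto simp: prime_in_def)
    then show "x \<in> ext q \<or> y \<in> ext q" using as bu by (auto simp: ext_def)
  qed
qed

lemma ext_strict:
  assumes "prime_in q UNIV" "prime_in q' UNIV" "q \<subset> q'" "q' \<subseteq> Q"
  shows "ext q \<subset> ext q'"
proof -
  obtain f where f: "f \<in> q'" "f \<notin> q" using assms by blast
  have 1: "1 \<notin> Q" using prime_Q by (simp add: prime_in_def)
  have "h f / h 1 \<in> ext q'" "h f / h 1 \<notin> ext q" using ext_iff[OF _ _ 1, of _ f] f assms by auto
  moreover have "ext q \<subseteq> ext q'" using assms(3) by (auto simp: ext_def)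
  ultimately show ?thesis by blast
qed

text \<open>Generation is needed only up to a factor \<open>c\<close> outside \<open>Q\<close>,
  which is a unit in \<open>T\<close>; this is exactly what pseudo-division provides.\<close>

lemma nonunits_generated:
  assumes F: "F \<subseteq> Q" and gen: "\<And>f. f \<in> Q \<Longrightarrow> \<exists>c. c \<notin> Q \<and> (\<forall>J. ideal_in J UNIV \<longrightarrow> F \<subseteq> J \<longrightarrow> c * f \<in> J)"
  shows "genideal (ring_of T) (h ` F) = nonunits (ring_of T)"
proof (rule genideal_ring_of_eqI)
  show "subring_set T" using TD(1) by (rule subring_set_k_subalgebra)
  show "h ` F \<subseteq> nonunits (ring_of T)" using F TD(2) by (auto simp: nonunits_ring_of Q_def)
  show "ideal_in (nonunits (ring_of T)) T" unfolding nonunits_ring_of using TD(3) by (rule ideal_in_nonunits)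
  fix J assume J: "ideal_in J T" "h ` F \<subseteq> J"
  show "nonunits (ring_of T) \<subseteq> J"
  proof
    fix t assume t: "t \<in> nonunits (ring_of T)"
    then have "t \<in> T" by (simp add: nonunits_ring_of)
    then obtain a s where as: "t = h a / h s" "s \<notin> Q" using T_rep by blast
    have "a \<in> Q"
    proof (rule ccontr)
      assume "a \<notin> Q"
      then have "t \<in> units_in T" using as units_in_mult[OF TD(1) _ units_in_inverse]
        by (simp add: Q_def divide_inverse)
      then show False using t by (simp add: nonunits_ring_of)
    qed
    then obtain c where c: "c \<notin> Q" "\<And>J. ideal_in J UNIV \<Longrightarrow> F \<subseteq> J \<Longrightarrow> c * a \<in> J" using gen by blast
    have "c * a \<in> {f. h f \<in> J}" by (rule c(2)[OF pull_ideal[OF J(1) TD(2)]]) (use J(2) in auto)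
    then have "h (c * a) / h (c * s) \<in> J"
      using h_frac_in[OF J(1), of "c * a" "c * s"] prime_Q c(1) as(2) by (auto simp: prime_in_def)
    moreover have "h c \<noteq> 0" using c(1) by (auto simp: Q_def units_in_def)
    ultimately show "t \<in> J" using as(1) by (simp add: h_mult)
  qed
qed

text \<open>An ideal of \<open>T\<close> is generated by its contraction to the polynomial ring,
  which is finitely generated.\<close>

lemma noetherian_T: "noetherian_ring (ring_of T)"
proof (rule ring.noetherian_ringI)
  have sr: "subring_set T" using TD(1) by (rule subring_set_k_subalgebra)
  then show "ring (ring_of T)" by (rule ring_ring_of)
  fix I assume "ideal I (ring_of T)"
  then have I: "ideal_in I T" using ideal_ring_of_iff[OF sr] by blast
  have "fg_ideal {f. h f \<in> I} UNIV" using hilbert_basis_poly[OF pull_ideal[OF I TD(2)]] .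
  then obtain F where F: "finite F" "F \<subseteq> {f. h f \<in> I}" "\<And>J. ideal_in J UNIV \<Longrightarrow> F \<subseteq> J \<Longrightarrow> {f. h f \<in> I} \<subseteq> J"
    unfolding fg_ideal_def by blast
  have "genideal (ring_of T) (h ` F) = I"
  proof (rule genideal_ring_of_eqI[OF sr _ I])
    show "h ` F \<subseteq> I" using F by auto
    fix J assume J: "ideal_in J T" "h ` F \<subseteq> J"
    have sub: "{f. h f \<in> I} \<subseteq> {f. h f \<in> J}" by (rule F(3)[OF pull_ideal[OF J(1) TD(2)]]) (use J(2) in auto)
    show "I \<subseteq> J"
    proof
      fix t assume t: "t \<in> I"
      then obtain a s where as: "t = h a / h s" "s \<notin> Q" using T_rep ideal_inD(5)[OF I] by blast
      then have "h a \<in> I" using t h_frac_in_iff[OF I] by auto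
      then show "t \<in> J" using sub as h_frac_in[OF J(1)] by blast
    qed
  qed
  then show "\<exists>A\<subseteq>carrier (ring_of T). finite A \<and> I = Idl\<^bsub>ring_of T\<^esub> A"
    using F(1) TD(2) by (intro exI[of _ "h ` F"]) auto
qed

lemma pull_chain:
  assumes "prime_chain T n P"
  shows "prime_chain UNIV n (\<lambda>i. {f. h f \<in> P i})" "i \<le> n \<Longrightarrow> {f. h f \<in> P i} \<subseteq> Q"
  using assms pull_prime[OF _ TD(2)] pull_strict prime_nonunit unfolding prime_chain_def by (auto simp del: subset_iff)

lemma ext_chain:
  assumes "prime_chain UNIV n P" "P n = Q"
  shows "prime_chain T n (\<lambda>i. ext (P i))"
proof -
  have sub: "P i \<subseteq> P n" if "i \<le> n" for i
    using that
  proof (induction i rule: inc_induct)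
    case (step i)
    then show ?case using assms(1) by (auto simp: prime_chain_def)
  qed simp
  then have "P i \<subseteq> Q" if "i \<le> n" for i using that assms(2) by blast
  then show ?thesis
    using assms(1) unfolding prime_chain_def by (meson Suc_leI less_imp_le_nat prime_ext ext_strict)
qed

text \<open>The dimension is bounded below by extending the given chain to \<open>T\<close>, and
  above by contracting chains of \<open>T\<close> to chains below \<open>Q\<close>.\<close>

lemma regular_if:
  assumes F: "finite F" "F \<subseteq> Q" "card F = n"
    and gen: "\<And>f. f \<in> Q \<Longrightarrow> \<exists>c. c \<notin> Q \<and> (\<forall>J. ideal_in J UNIV \<longrightarrow> F \<subseteq> J \<longrightarrow> c * f \<in> J)"
    and chain: "prime_chain UNIV n P" "P n = Q"
    and no: "\<And>P. prime_chain UNIV (Suc n) P \<Longrightarrow> P (Suc n) \<subseteq> Q \<Longrightarrow> False"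
  shows "regular_local_ring (ring_of T)"
proof -
  have "krull_dim (ring_of T) = enat n"
  proof (rule krull_dim_eq[OF subring_set_k_subalgebra[OF TD(1)] ext_chain[OF chain]])
    show "\<nexists>P. prime_chain T (Suc n) P"
    proof
      assume "\<exists>P. prime_chain T (Suc n) P"
      then obtain P where P: "prime_chain T (Suc n) P" by blast
      show False using no[OF pull_chain(1)[OF P] pull_chain(2)[OF P order_refl]] .
    qed
  qed
  moreover have "card (h ` F) = n" using F(3) card_image[of h F] inj_h by (simp add: inj_on_def inj_def)
  moreover have "genideal (ring_of T) (h ` F) = nonunits (ring_of T)" using nonunits_generated[OF F(2) gen] .
  moreover have "h ` F \<subseteq> carrier (ring_of T)" using TD(2) by auto
  ultimately show ?thesis
    unfolding regular_local_ring_def using noetherian_T local_ring_ring_of[OF TD(3)] F(1)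
    by (metis finite_imageI)
qed

text \<open>The cases are the heights of \<open>Q\<close>: zero; a curve dominating the
  \<open>x\<close>-line, generated by \<open>g\<close> up to denominators; a vertical curve,
  generated by a polynomial \<open>a\<close> in \<open>x\<close>; and a closed point, generated by
  both.\<close>

theorem regular_T: "regular_local_ring (ring_of T)"
proof -
  have id: "ideal_in Q UNIV" using prime_Q by (simp add: prime_in_def)
  note J = prime_const_part[OF prime_Q]
  have notQ: "[:c:] \<notin> Q" if "c \<notin> const_part Q" for c using that by (simp add: const_part_def)
  have one: "1 \<notin> Q" using prime_Q by (simp add: prime_in_def)
  consider "Q = {0}" | "Q \<noteq> {0}" "const_part Q = {0}" | "const_part Q \<noteq> {0}" "Q = coeffs_in (const_part Q)"
    | "const_part Q \<noteq> {0}" "Q \<noteq> coeffs_in (const_part Q)" by metis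
  then show ?thesis
  proof cases
    case 1
    show ?thesis
    proof (rule regular_if[of "{}" 0 "\<lambda>_. Q"])
      show "\<exists>c. c \<notin> Q \<and> (\<forall>J. ideal_in J UNIV \<longrightarrow> {} \<subseteq> J \<longrightarrow> c * f \<in> J)" if "f \<in> Q" for f
        using that 1 one by (intro exI[of _ 1]) (auto simp: ideal_in_def)
      show "prime_chain UNIV 0 (\<lambda>_. Q)" using prime_Q by (simp add: prime_chain_def)
      fix P assume "prime_chain UNIV (Suc 0) P" "P (Suc 0) \<subseteq> Q"
      then show False using 1 by (auto simp: prime_chain_def prime_in_def ideal_in_def)
    qed auto
  next
    case 2
    obtain f0 where "f0 \<in> Q - coeffs_in (const_part Q)" using 2 ideal_inD(1)[OF id] by auto
    then obtain g where g: "min_elt Q (const_part Q) g" using min_elt_ex by blast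
    show ?thesis
    proof (rule regular_if[of "{g}" 1 "\<lambda>i. if i = 0 then {0} else Q"])
      show "{g} \<subseteq> Q" using g by (simp add: min_elt_def)
      fix f assume f: "f \<in> Q"
      obtain c q where cq: "c \<notin> const_part Q" "Polynomial.smult c f - q * g \<in> coeffs_in (const_part Q)"
        using pseudo_division[OF id refl J g f] by blast
      then have "[:c:] * f = q * g" using 2 by simp
      then show "\<exists>c. c \<notin> Q \<and> (\<forall>J. ideal_in J UNIV \<longrightarrow> {g} \<subseteq> J \<longrightarrow> c * f \<in> J)"
        using notQ[OF cq(1)] ideal_inD(3) by (metis UNIV_I insert_subset)
    next
      show "prime_chain UNIV 1 (\<lambda>i. if i = 0 then {0} else Q)"
        using prime_Q prime_0 2 ideal_inD(1)[OF id] by (auto simp: prime_chain_def)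
      fix P assume P: "prime_chain UNIV (Suc 1) P" "P (Suc 1) \<subseteq> Q"
      then have P': "prime_chain UNIV 2 P" "P 2 \<subseteq> Q" by (simp_all add: numeral_2_eq_2)
      then have "prime_in (P 2) UNIV" by (simp add: prime_chain_def)
      then have "0 \<in> const_part (P 2)" by (simp add: const_part_def prime_in_def ideal_in_def)
      then have "const_part (P 2) = {0}" using const_part_mono[OF P'(2)] 2 by blast
      then show False using height_one_over_0[OF P'(1)] by blast
    qed auto
  next
    case 3
    obtain a where a: "a \<in> const_part Q" "\<And>f. f \<in> const_part Q \<Longrightarrow> a dvd f"
      using principal_ideal_poly[of "const_part Q"] J by (auto simp: prime_in_def)
    show ?thesis
    proof (rule regular_if[of "{[:a:]}" 1 "\<lambda>i. if i = 0 then {0} else Q"])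
      show "{[:a:]} \<subseteq> Q" using a(1) by (simp add: const_part_def)
      fix f assume "f \<in> Q"
      then have "\<forall>i. a dvd Polynomial.coeff f i" using 3(2) a(2) unfolding coeffs_in_def by blast
      then have "[:a:] dvd f" by (simp add: const_poly_dvd_iff)
      then obtain g where "f = [:a:] * g" by (elim dvdE)
      then have "1 * f \<in> J" if "ideal_in J UNIV" "{[:a:]} \<subseteq> J" for J
        using ideal_inD(4)[OF that(1), of g "[:a:]"] that(2) by simp
      then show "\<exists>c. c \<notin> Q \<and> (\<forall>J. ideal_in J UNIV \<longrightarrow> {[:a:]} \<subseteq> J \<longrightarrow> c * f \<in> J)" using one by blast
    next
      have "const_part {0 :: 'k poly poly} = {0}" by (simp add: const_part_def)
      then have "Q \<noteq> {0}" using 3(1) by metis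
      then show "prime_chain UNIV 1 (\<lambda>i. if i = 0 then {0} else Q)"
        using prime_Q prime_0 ideal_inD(1)[OF id] by (auto simp: prime_chain_def)
      fix P assume P: "prime_chain UNIV (Suc 1) P" "P (Suc 1) \<subseteq> Q"
      then have "prime_chain UNIV 2 P" "P 2 \<subseteq> coeffs_in (const_part Q)" using 3(2) by (simp_all add: numeral_2_eq_2)
      then show False using height_one_coeffs_in[OF _ J 3(1)] by blast
    qed auto
  next
    case 4
    have sub: "coeffs_in (const_part Q) \<subseteq> Q" using coeffs_in_subset[OF id] by blast
    then obtain f0 where "f0 \<in> Q - coeffs_in (const_part Q)" using 4 by blast
    then obtain g where g: "min_elt Q (const_part Q) g" using min_elt_ex by blast
    obtain a where a: "a \<in> const_part Q" "\<And>f. f \<in> const_part Q \<Longrightarrow> a dvd f"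
      using principal_ideal_poly[of "const_part Q"] J by (auto simp: prime_in_def)
    have "0 \<in> const_part Q" using J by (simp add: prime_in_def ideal_in_def)
    then have "Polynomial.coeff [:a:] i \<in> const_part Q" for i using a(1) by (cases i) simp_all
    then have aC: "[:a:] \<in> coeffs_in (const_part Q)" by (simp add: coeffs_in_def)
    have gQ: "g \<in> Q" "g \<notin> coeffs_in (const_part Q)" using g by (auto simp: min_elt_def)
    show ?thesis
    proof (rule regular_if[of "{[:a:], g}" 2 "\<lambda>i. if i = 0 then {0} else if i = 1 then coeffs_in (const_part Q) else Q"])
      show "{[:a:], g} \<subseteq> Q" using aC sub gQ by blast
      have "[:a:] \<noteq> g" using aC gQ by blast
      then show "card {[:a:], g} = 2" unfolding card_2_iff by blast
      fix f assume f: "f \<in> Q"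
      obtain c q where cq: "c \<notin> const_part Q" "Polynomial.smult c f - q * g \<in> coeffs_in (const_part Q)"
        using pseudo_division[OF id refl J g f] by blast
      then have "\<forall>i. a dvd Polynomial.coeff (Polynomial.smult c f - q * g) i" using a(2) unfolding coeffs_in_def by blast
      then have "[:a:] dvd Polynomial.smult c f - q * g" by (simp add: const_poly_dvd_iff)
      then obtain u where u: "Polynomial.smult c f - q * g = [:a:] * u" by (elim dvdE)
      have "[:c:] * f \<in> J" if "ideal_in J UNIV" "{[:a:], g} \<subseteq> J" for J
      proof -
        have "[:c:] * f = [:a:] * u + q * g" using u by (simp add: algebra_simps)
        moreover have "[:a:] * u + q * g \<in> J"
          using that by (intro ideal_inD(2)[OF that(1)] ideal_inD(4)[OF that(1)] ideal_inD(3)[OF that(1)]) auto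
        ultimately show ?thesis by simp
      qed
      then show "\<exists>c. c \<notin> Q \<and> (\<forall>J. ideal_in J UNIV \<longrightarrow> {[:a:], g} \<subseteq> J \<longrightarrow> c * f \<in> J)" using notQ[OF cq(1)] by blast
    next
      have n0: "coeffs_in (const_part Q) \<noteq> {0}"
      proof
        assume "coeffs_in (const_part Q) = {0}"
        then have "[:a:] = 0" using aC by blast
        then have "const_part Q \<subseteq> {0}" using a(2) by auto
        then show False using 4(1) a(1) by blast
      qed
      have pc: "prime_in (coeffs_in (const_part Q)) UNIV" using prime_coeffs_in[OF J] .
      then have "{0} \<subset> coeffs_in (const_part Q)" using n0 by (auto simp: prime_in_def ideal_in_def)
      moreover have "coeffs_in (const_part Q) \<subset> Q" using sub 4 by blast
      ultimately show "prime_chain UNIV 2 (\<lambda>i. if i = 0 then {0} else if i = 1 then coeffs_in (const_part Q) else Q)"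
        using prime_Q prime_0 pc by (auto simp: prime_chain_def less_2_cases_iff)
      fix P assume "prime_chain UNIV (Suc 2) P" "P (Suc 2) \<subseteq> Q"
      then show False using no_chain_3[of P] by (simp add: numeral_3_eq_3)
    qed auto
  qed
qed

end

end

section \<open>Evaluation of polynomials at characters\<close>

lemma poly_map_poly_sum:
  fixes f :: "'a::comm_ring_1 \<Rightarrow> 'b::comm_ring_1"
  assumes "f 0 = 0" "degree p \<le> n"
  shows "poly (map_poly f p) c = (\<Sum>j\<le>n. f (Polynomial.coeff p j) * c ^ j)"
proof -
  have "degree (map_poly f p) \<le> n"
    using assms by (intro degree_le) (auto simp: coeff_map_poly coeff_eq_0)
  then have "poly (map_poly f p) c = (\<Sum>j\<le>n. Polynomial.coeff (map_poly f p) j * c ^ j)"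
    unfolding poly_altdef by (intro sum.mono_neutral_left) (auto simp: coeff_eq_0)
  then show ?thesis using assms(1) by (simp add: coeff_map_poly)
qed

lemma poly_map_poly_hom:
  fixes f :: "'a::comm_ring_1 \<Rightarrow> 'b::comm_ring_1"
  assumes f: "f 0 = 0" "\<And>a b. f (a + b) = f a + f b" "\<And>a b. f (a * b) = f a * f b"
  shows "poly (map_poly f (p + q)) c = poly (map_poly f p) c + poly (map_poly f q) c"
    "poly (map_poly f (p * q)) c = poly (map_poly f p) c * poly (map_poly f q) c"
proof -
  have "map_poly f (p + q) = map_poly f p + map_poly f q"
    by (rule poly_eqI) (simp add: coeff_map_poly f)
  then show "poly (map_poly f (p + q)) c = poly (map_poly f p) c + poly (map_poly f q) c" by simp
  have fs: "f (sum g S) = (\<Sum>i\<in>S. f (g i))" for g and S :: "nat set"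
    by (induction S rule: infinite_finite_induct) (simp_all add: f)
  have "map_poly f (p * q) = map_poly f p * map_poly f q"
    by (rule poly_eqI) (simp add: coeff_map_poly coeff_mult fs f)
  then show "poly (map_poly f (p * q)) c = poly (map_poly f p) c * poly (map_poly f q) c" by simp
qed

definition ev1 :: "'k::field ratfun \<Rightarrow> 'k poly \<Rightarrow> 'k ratfun" where
  "ev1 X p = poly (map_poly const p) X"

definition ev2 :: "'k::field ratfun \<Rightarrow> 'k ratfun \<Rightarrow> 'k poly poly \<Rightarrow> 'k ratfun" where
  "ev2 X Y p = poly (map_poly (ev1 X) p) Y"

lemma ev1_hom: "ev1 X 0 = 0" "ev1 X (p + q) = ev1 X p + ev1 X q" "ev1 X (p * q) = ev1 X p * ev1 X q"
  unfolding ev1_def using poly_map_poly_hom[of const] by (simp_all add: const_add const_mult)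

lemma ev2_hom: "ev2 X Y (p + q) = ev2 X Y p + ev2 X Y q" "ev2 X Y (p * q) = ev2 X Y p * ev2 X Y q"
  "ev2 X Y [:[:c:]:] = const c"
  unfolding ev2_def using poly_map_poly_hom[of "ev1 X"]
  by (simp_all add: ev1_hom) (simp add: map_poly_pCons ev1_def)

lemma dt_scale: "dt (scale i x + scale j y) y = int i * dt x y" "dt x (scale i x + scale j y) = int j * dt x y"
  by (simp_all add: dt_def scale_def algebra_simps)

lemma scale_indep:
  assumes "dt x y \<noteq> 0" "scale i x + scale j y = scale i' x + scale j' y"
  shows "i = i' \<and> j = j'"
  using dt_scale(1)[of i x j y] dt_scale(1)[of i' x j' y] dt_scale(2)[of x i j y] dt_scale(2)[of x i' j' y] assms
  by simp

lemma scale_add: "scale (i + j) m = scale i m + scale j m"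
  by (simp add: scale_def prod_eq_iff algebra_simps)

lemma scale_0 [simp]: "scale 0 m = 0" and scale_1: "scale (Suc 0) m = m"
  by (simp_all add: scale_def prod_eq_iff)

lemma scale_scale: "scale i (scale j m) = scale (i * j) m"
  by (simp add: scale_def)

lemma scale_distrib: "scale i (m + n) = scale i m + scale i n"
  by (simp add: scale_def prod_eq_iff algebra_simps)

lemma ev2_expand:
  "\<exists>n. ev2 (character x) (character y) p =
      (\<Sum>(i, j)\<in>{..n} \<times> {..n}. const (Polynomial.coeff (Polynomial.coeff p j) i) * character (scale i x + scale j y)) \<and>
    (\<forall>i j. n < i \<or> n < j \<longrightarrow> Polynomial.coeff (Polynomial.coeff p j) i = 0)"
proof -
  define n where "n = degree p + (\<Sum>j\<le>degree p. degree (Polynomial.coeff p j))"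
  have d: "degree (Polynomial.coeff p j) \<le> n" for j
  proof (cases "j \<le> degree p")
    case True
    then have "degree (Polynomial.coeff p j) \<le> (\<Sum>j\<le>degree p. degree (Polynomial.coeff p j))"
      by (intro member_le_sum) auto
    then show ?thesis by (simp add: n_def)
  qed (simp add: coeff_eq_0)
  have "ev2 (character x) (character y) p = (\<Sum>j\<le>n. ev1 (character x) (Polynomial.coeff p j) * character y ^ j)"
    unfolding ev2_def by (intro poly_map_poly_sum) (simp_all add: ev1_hom n_def)
  also have "\<dots> = (\<Sum>j\<le>n. \<Sum>i\<le>n. const (Polynomial.coeff (Polynomial.coeff p j) i) * character (scale i x + scale j y))"
    unfolding ev1_def by (intro sum.cong refl)
      (simp add: poly_map_poly_sum[where f = const, OF const_0 d] sum_distrib_right sum_distrib_left character_add character_scale mult_ac)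
  also have "\<dots> = (\<Sum>i\<le>n. \<Sum>j\<le>n. const (Polynomial.coeff (Polynomial.coeff p j) i) * character (scale i x + scale j y))"
    by (rule sum.swap)
  also have "\<dots> = (\<Sum>(i, j)\<in>{..n} \<times> {..n}. const (Polynomial.coeff (Polynomial.coeff p j) i) * character (scale i x + scale j y))"
    by (rule sum.cartesian_product)
  finally show ?thesis
  proof (intro exI[of _ n] conjI allI impI)
    fix i j assume "n < i \<or> n < j"
    then show "Polynomial.coeff (Polynomial.coeff p j) i = 0"
      using d[of j] by (auto simp: coeff_eq_0 n_def)
  qed
qed

lemma ev2_monomial: "ev2 (character x) (character y) (Polynomial.monom (Polynomial.monom 1 i) j) = character (scale i x + scale j y)"
proof -
  have "ev1 X (Polynomial.monom 1 i) = X ^ i" for X :: "'a ratfun"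
    unfolding ev1_def by (simp add: map_poly_monom poly_monom)
  then show ?thesis
    unfolding ev2_def by (simp add: map_poly_monom ev1_hom poly_monom character_add character_scale)
qed

text \<open>Distinct pairs \<open>i\<close>, \<open>j\<close> give distinct exponents because
  \<open>x\<close> and \<open>y\<close> are linearly independent, even if they do not span the
  lattice; so the polynomial can be read back.\<close>

lemma cf_ev2:
  assumes "dt x y \<noteq> 0"
  shows "cf (ev2 (character x) (character y) p) (scale i x + scale j y) = Polynomial.coeff (Polynomial.coeff p j) i"
proof -
  obtain n where n: "ev2 (character x) (character y) p =
      (\<Sum>(i, j)\<in>{..n} \<times> {..n}. const (Polynomial.coeff (Polynomial.coeff p j) i) * character (scale i x + scale j y))"
    "\<And>i j. n < i \<or> n < j \<Longrightarrow> Polynomial.coeff (Polynomial.coeff p j) i = 0"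
    using ev2_expand[of x y p] by blast
  have "cf (ev2 (character x) (character y) p) (scale i x + scale j y) =
     (\<Sum>q\<in>{..n} \<times> {..n}. cf (case q of (i, j) \<Rightarrow> const (Polynomial.coeff (Polynomial.coeff p j) i) * character (scale i x + scale j y)) (scale i x + scale j y))"
    unfolding n(1) by (subst cf_sum[THEN conjunct2]) (auto simp: cf_monomial)
  also have "\<dots> = (\<Sum>q\<in>{..n} \<times> {..n}. if q = (i, j) then Polynomial.coeff (Polynomial.coeff p j) i else 0)"
  proof (rule sum.cong[OF refl])
    fix q assume "q \<in> {..n} \<times> {..n}"
    have "scale i x + scale j y = scale a x + scale b y \<longleftrightarrow> (a, b) = (i, j)" for a b
      using scale_indep[OF assms, of i j a b] by auto
    then show "cf (case q of (i, j) \<Rightarrow> const (Polynomial.coeff (Polynomial.coeff p j) i) * character (scale i x + scale j y)) (scale i x + scale j y) =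
        (if q = (i, j) then Polynomial.coeff (Polynomial.coeff p j) i else 0)"
      by (cases q) (simp add: cf_monomial)
  qed
  also have "\<dots> = Polynomial.coeff (Polynomial.coeff p j) i"
    using n(2)[of i j] by (auto simp: not_less)
  finally show ?thesis .
qed

lemma poly_chart_ev2: "dt x y \<noteq> 0 \<Longrightarrow> poly_chart (ev2 (character x) (character y))"
proof unfold_locales
  fix p assume d: "dt x y \<noteq> 0" and 0: "ev2 (character x) (character y) p = 0"
  have "Polynomial.coeff (Polynomial.coeff p j) i = 0" for i j
    using cf_ev2[OF d, of p i j] by (simp add: 0)
  then show "p = 0" by (simp add: poly_eq_iff)
qed (rule ev2_hom)+

section \<open>The monoids of type A\<close>

text \<open>With \<open>d = 1\<close> the locale also covers smooth cones: \<open>z\<close> is then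
  \<open>x + y\<close> and the algebra is a polynomial ring. For this reason \<open>irr\<close>,
  which makes \<open>x\<close>, \<open>y\<close>, \<open>z\<close> minimal generators, is
  conditioned on \<open>2 \<le> d\<close>.\<close>

locale A_monoid =
  fixes \<Gamma> :: "(int \<times> int) set" and w x y z :: "int \<times> int" and d :: nat
  assumes pointed: "pointed w \<Gamma>" and indep: "dt x y \<noteq> 0"
    and mem: "x \<in> \<Gamma>" "y \<in> \<Gamma>" "z \<in> \<Gamma>" and d0: "0 < d"
    and rel: "x + y = scale d z"
    and nf: "m \<in> \<Gamma> \<Longrightarrow> \<exists>a b i. i < d \<and> m = scale a x + scale b y + scale i z"
    and irr: "2 \<le> d \<Longrightarrow> m \<in> \<Gamma> - {0} \<Longrightarrow> n \<in> \<Gamma> - {0} \<Longrightarrow> m + n \<noteq> x \<and> m + n \<noteq> y \<and> m + n \<noteq> z"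
begin

abbreviation A :: "'k::field ratfun set" where "A \<equiv> mon_alg \<Gamma>"
abbreviation hh :: "'k::field poly poly \<Rightarrow> 'k ratfun" where "hh \<equiv> ev2 (character x) (character y)"

lemmas kA = k_subalgebra_mon_alg[OF pointed_submonoid[OF pointed]]

sublocale poly_chart hh
  by (rule poly_chart_ev2[OF indep])

lemma scale_mem: "m \<in> \<Gamma> \<Longrightarrow> scale i m \<in> \<Gamma>"
  using submonoid_scale pointed_submonoid[OF pointed] by blast

lemma add_mem: "m \<in> \<Gamma> \<Longrightarrow> n \<in> \<Gamma> \<Longrightarrow> m + n \<in> \<Gamma>"
  using submonoid_add pointed_submonoid[OF pointed] by blast

text \<open>Multiplication by \<open>d\<close> turns \<open>i\<close> copies of \<open>z\<close>
  into \<open>i\<close> copies of \<open>x + y\<close>; the coefficients \<open>d * a + i\<close>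
  and \<open>d * b + i\<close> then reveal \<open>i\<close> as remainder and \<open>a\<close>,
  \<open>b\<close> as quotients.\<close>

lemma nf_unique:
  assumes "i < d" "i' < d" "scale a x + scale b y + scale i z = scale a' x + scale b' y + scale i' z"
  shows "a = a' \<and> b = b' \<and> i = i'"
proof -
  have e: "scale d (scale a x + scale b y + scale i z) = scale (d * a + i) x + scale (d * b + i) y" for a b i
  proof -
    have "fst x + fst y = int d * fst z" "snd x + snd y = int d * snd z" using rel by (simp_all add: scale_def prod_eq_iff)
    then have "int d * (int i * fst z) = int i * (fst x + fst y)" "int d * (int i * snd z) = int i * (snd x + snd y)" by simp_all
    then show ?thesis by (simp add: scale_def prod_eq_iff algebra_simps)
  qed
  have "d * a + i = d * a' + i' \<and> d * b + i = d * b' + i'"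
    using scale_indep[OF indep] e assms(3) by metis
  moreover have "(d * a + i) mod d = i" "(d * a' + i') mod d = i'" using assms by auto
  ultimately show ?thesis using d0 by auto
qed

lemma range_hh: "range hh \<subseteq> (A :: 'k::field ratfun set)"
proof
  fix t :: "'k ratfun" assume "t \<in> range hh"
  then obtain p where p: "t = hh p" by blast
  obtain n where n: "hh p = (\<Sum>(i, j)\<in>{..n} \<times> {..n}. const (Polynomial.coeff (Polynomial.coeff p j) i) * character (scale i x + scale j y))"
    using ev2_expand[of x y p] by blast
  have "character (scale i x + scale j y) \<in> (A :: 'k ratfun set)" for i j
    using mem by (simp add: character_mon_alg_iff add_mem scale_mem)
  then show "t \<in> A"
    unfolding p n by (intro subring_set_sum[OF subring_set_k_subalgebra[OF kA]])
      (auto intro!: k_subalgebraD(6)[OF kA] k_subalgebraD(1)[OF kA])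
qed

text \<open>Finiteness over the image of \<open>k[x, y]\<close>: by the normal form the powers of
  \<open>z\<close> below \<open>d\<close> span.\<close>

lemma A_expand:
  assumes a: "a \<in> (A :: 'k::field ratfun set)"
  shows "\<exists>b. a = (\<Sum>i<d. hh (b i) * character z ^ i)"
proof -
  define W where "W = {a :: 'k ratfun. \<exists>b. a = (\<Sum>i<d. hh (b i) * character z ^ i)}"
  have 0: "0 \<in> W" unfolding W_def by (intro CollectI exI[of _ "\<lambda>_. 0"]) (simp add: h_0)
  have add: "u + u' \<in> W" if uu: "u \<in> W" "u' \<in> W" for u u'
  proof -
    obtain b b' where "u = (\<Sum>i<d. hh (b i) * character z ^ i)" "u' = (\<Sum>i<d. hh (b' i) * character z ^ i)"
      using uu unfolding W_def by blast
    then have "u + u' = (\<Sum>i<d. hh (b i + b' i) * character z ^ i)" by (simp add: h_add sum.distrib algebra_simps)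
    then show ?thesis unfolding W_def by (intro CollectI exI[of _ "\<lambda>i. b i + b' i"])
  qed
  have sum: "sum f S \<in> W" if "\<And>s. s \<in> S \<Longrightarrow> f s \<in> W" for f and S :: "(int \<times> int) set"
    using that by (induction S rule: infinite_finite_induct) (auto simp: 0 add)
  have mono: "const c * character m \<in> W" if m: "m \<in> \<Gamma>" for c m
  proof -
    obtain a b i where ab: "i < d" "m = scale a x + scale b y + scale i z" using nf[OF m] by blast
    let ?p = "[:[:c:]:] * Polynomial.monom (Polynomial.monom 1 a) b"
    have "const c * character m = hh ?p * character z ^ i"
      by (simp only: h_mult h_const ev2_monomial ab(2) character_add[of "scale a x + scale b y"] character_scale mult.assoc)
    also have "\<dots> = (\<Sum>j<d. hh (if j = i then ?p else 0) * character z ^ j)"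
      using ab(1) by (simp add: if_distrib[of hh] h_0 if_distrib[of "\<lambda>t. t * _"] sum.delta cong: if_cong)
    finally show ?thesis unfolding W_def by (intro CollectI exI[of _ "\<lambda>j. if j = i then ?p else 0"])
  qed
  have "a \<in> W"
    by (subst mon_alg_expand[OF a], rule sum, rule mono) (use mon_alg_cf(3)[OF a] in blast)
  then show ?thesis unfolding W_def by blast
qed

text \<open>Incomparability for the finite extension of \<open>k[x, y]\<close> by \<open>A\<close>: the \<open>d + 1\<close> powers of an
  element of \<open>A\<close> are linearly dependent modulo the contraction of a prime ideal.\<close>

lemma contraction_strict:
  assumes T: "T \<in> Spec (A :: 'k::field ratfun set)"
    and P: "prime_in P T" "prime_in P' T" "P \<subset> P'"
  shows "{f. hh f \<in> P} \<subset> {f. hh f \<in> P'}"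
proof -
  note TD = SpecD[OF kA T]
  note sr = subring_set_k_subalgebra[OF TD(1)]
  have RT: "range hh \<subseteq> T" using range_hh TD(2) by blast
  have id: "ideal_in P T" "ideal_in P' T" using P by (auto simp: prime_in_def)
  let ?p = "{f. hh f \<in> P}"
  have p: "prime_in ?p UNIV" using pull_prime[OF P(1) RT] .
  obtain t where t: "t \<in> P'" "t \<notin> P" using P by blast
  obtain a s where as: "a \<in> A" "s \<in> A \<inter> units_in T" "t = a / s"
    using TD(4) ideal_inD(5)[OF id(2) t(1)] unfolding fractions_over_def by blast
  have s: "s \<in> T" "inverse s \<in> T" "s \<noteq> 0" using as(2) by (auto simp: units_in_def)
  have aP': "a \<in> P'" using ideal_inD(4)[OF id(2) s(1) t(1)] as(3) s by simp
  have aP: "a \<notin> P" using ideal_inD(4)[OF id(1) s(2), of a] as(3) t(2) by (auto simp: divide_inverse)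
  have aT: "a \<in> T" using as(1) TD(2) by blast
  have "\<forall>k. \<exists>b. a ^ k = (\<Sum>i<d. hh (b i) * character z ^ i)"
    using A_expand k_subalgebraD(8)[OF kA as(1)] by blast
  then obtain W where W: "\<And>k. a ^ k = (\<Sum>i<d. hh (W k i) * character z ^ i)" by metis
  obtain c where c: "\<exists>k\<in>{..d}. c k \<notin> ?p" "\<forall>j<d. (\<Sum>k\<in>{..d}. c k * W k j) \<in> ?p"
    using dependent_mod_prime[OF p, of "{..d}" d W] by auto
  have hT: "hh f \<in> T" for f using RT by blast
  have zT: "character z ^ j \<in> T" for j
  proof -
    have "character z \<in> T" using TD(2) mem(3) character_mon_alg_iff by blast
    then show ?thesis by (rule k_subalgebraD(8)[OF TD(1)])
  qed
  have tot: "(\<Sum>k\<in>{..d}. hh (c k) * a ^ k) \<in> P"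
  proof -
    have "(\<Sum>k\<in>{..d}. hh (c k) * a ^ k) = (\<Sum>k\<in>{..d}. \<Sum>j<d. hh (c k * W k j) * character z ^ j)"
      by (subst W) (simp add: sum_distrib_left h_mult mult.assoc)
    also have "\<dots> = (\<Sum>j<d. \<Sum>k\<in>{..d}. hh (c k * W k j) * character z ^ j)" by (rule sum.swap)
    also have "\<dots> = (\<Sum>j<d. hh (\<Sum>k\<in>{..d}. c k * W k j) * character z ^ j)"
      by (simp only: h_sum sum_distrib_right)
    also have "\<dots> \<in> P"
      using c(2) by (intro ideal_in_sum[OF id(1)] ideal_inD(4)[OF id(1) zT]) auto
    finally show ?thesis .
  qed
  \<comment> \<open>Terms below \<open>k0\<close> lie in \<open>P\<close>, so a power of
    \<open>a\<close>, which is not in \<open>P\<close>, can be split off the relation. What remains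
    is \<open>hh (c k0)\<close> plus a multiple of \<open>a\<close>, hence \<open>hh (c k0)\<close>
    lies in \<open>P'\<close> but not in \<open>P\<close>.\<close>
  define k0 where "k0 = (LEAST k. k \<le> d \<and> c k \<notin> ?p)"
  have k0: "k0 \<le> d \<and> c k0 \<notin> ?p" unfolding k0_def by (rule LeastI_ex) (use c(1) in auto)
  have lt: "hh (c k) \<in> P" if "k < k0" for k
    using not_less_Least[of k "\<lambda>k. k \<le> d \<and> c k \<notin> ?p"] that k0 unfolding k0_def[symmetric] by auto
  define r where "r = (\<Sum>k\<in>{Suc k0..d}. hh (c k) * a ^ (k - Suc k0))"
  have rT: "r \<in> T"
    unfolding r_def by (intro subring_set_sum[OF sr] subring_setD(5)[OF sr] hT subring_setD(7)[OF sr] aT)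
  have "(\<Sum>k\<in>{..d}. hh (c k) * a ^ k) = (\<Sum>k<k0. hh (c k) * a ^ k) + (\<Sum>k\<in>{k0..d}. hh (c k) * a ^ k)"
  proof -
    have "{..d} = {..<k0} \<union> {k0..d}" "{..<k0} \<inter> {k0..d} = {}" using k0 by auto
    then show ?thesis using sum.union_disjoint[OF finite_lessThan[of k0] finite_atLeastAtMost[of k0 d], of "\<lambda>k. hh (c k) * a ^ k"] by simp
  qed
  also have "(\<Sum>k\<in>{k0..d}. hh (c k) * a ^ k) = hh (c k0) * a ^ k0 + (\<Sum>k\<in>{Suc k0..d}. hh (c k) * a ^ k)"
    using k0 by (intro sum.atLeast_Suc_atMost) auto
  also have "(\<Sum>k\<in>{Suc k0..d}. hh (c k) * a ^ k) = (\<Sum>k\<in>{Suc k0..d}. a ^ k0 * (a * (hh (c k) * a ^ (k - Suc k0))))"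
  proof (rule sum.cong[OF refl])
    fix k assume "k \<in> {Suc k0..d}"
    then have "a ^ k = a ^ k0 * (a * a ^ (k - Suc k0))" by (simp flip: power_Suc power_add)
    then show "hh (c k) * a ^ k = a ^ k0 * (a * (hh (c k) * a ^ (k - Suc k0)))" by (simp add: mult_ac)
  qed
  also have "\<dots> = a ^ k0 * (a * r)" by (simp add: r_def sum_distrib_left)
  finally have split: "(\<Sum>k\<in>{..d}. hh (c k) * a ^ k) = (\<Sum>k<k0. hh (c k) * a ^ k) + a ^ k0 * (hh (c k0) + a * r)"
    by (simp add: algebra_simps)
  have "(\<Sum>k<k0. hh (c k) * a ^ k) \<in> P"
    using lt by (intro ideal_in_sum[OF id(1)] ideal_inD(4)[OF id(1) subring_setD(7)[OF sr aT]]) auto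
  then have "a ^ k0 * (hh (c k0) + a * r) \<in> P"
    using ideal_in_diff[OF sr id(1) tot] unfolding split by fastforce
  moreover have "hh (c k0) + a * r \<in> T" by (intro subring_setD(3,5)[OF sr] hT aT rT)
  moreover have "a ^ k \<notin> P" for k
  proof (induction k)
    case 0
    show ?case using P(1) by (simp add: prime_in_def)
  next
    case (Suc k)
    then show ?case using P(1) aP aT subring_setD(7)[OF sr aT] by (auto simp: prime_in_def)
  qed
  ultimately have "hh (c k0) + a * r \<in> P"
    using P(1) subring_setD(7)[OF sr aT] unfolding prime_in_def by blast
  then have "hh (c k0) + a * r \<in> P'" using P(3) by blast
  then have "(hh (c k0) + a * r) - a * r \<in> P'"
    using ideal_in_diff[OF sr id(2)] ideal_inD(4)[OF id(2) rT aP'] by blast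
  then have "hh (c k0) \<in> P'" by simp
  moreover have "hh (c k0) \<notin> P" using k0 by simp
  ultimately show ?thesis using P(3) by blast
qed

lemma krull_dim_A_le_2:
  assumes T: "T \<in> Spec (A :: 'k::field ratfun set)"
  shows "krull_dim (ring_of T) \<le> enat 2"
proof (rule krull_dim_le)
  note TD = SpecD[OF kA T]
  show "subring_set T" by (rule subring_set_k_subalgebra[OF TD(1)])
  have RT: "range hh \<subseteq> T" using range_hh TD(2) by blast
  show "\<nexists>P. prime_chain T (Suc 2) P"
  proof
    assume "\<exists>P. prime_chain T (Suc 2) P"
    then obtain P where P: "prime_chain T 3 P" by (auto simp: numeral_3_eq_3)
    have "prime_chain UNIV 3 (\<lambda>i. {f. hh f \<in> P i})"
      using P pull_prime[OF _ RT] contraction_strict[OF T] unfolding prime_chain_def by (meson Suc_leI less_imp_le_nat)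
    then show False using no_chain_3 by blast
  qed
qed

section \<open>Failure of regularity for \<open>d\<close> at least 2\<close>

text \<open>The decomposable exponents, which support the square of the augmentation ideal.\<close>

definition Sq :: "(int \<times> int) set" where
  "Sq = {m + n | m n. m \<in> \<Gamma> - {0} \<and> n \<in> \<Gamma> - {0}}"

lemma not_regular:
  assumes d2: "2 \<le> d"
  shows "\<not> regular_local_ring (ring_of (vertex_ring \<Gamma> :: 'k::field ratfun set))"
proof
  let ?T = "vertex_ring \<Gamma> :: 'k ratfun set"
  let ?m = "?T - units_in ?T"
  note V = vertex_ring_props[OF pointed]
  note sr = subring_set_k_subalgebra[OF V(3)]
  assume "regular_local_ring (ring_of ?T)"
  then obtain S where S: "S \<subseteq> ?T" "finite S" "enat (card S) = krull_dim (ring_of ?T)" "genideal (ring_of ?T) S = ?m"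
    unfolding regular_local_ring_def nonunits_ring_of by auto
  have "card S \<le> 2" using krull_dim_A_le_2[OF V(2)] S(3) by (metis enat_ord_simps(1))
  \<comment> \<open>Contains all products of two nonunits, in a form where coefficients can be read:
    the numerator is supported in \<open>Sq\<close> and the denominator has nonzero constant
    term.\<close>
  define M2 where "M2 = {u / s | u s. u \<in> (mon_alg Sq :: 'k ratfun set) \<and> s \<in> mon_alg \<Gamma> \<and> cf s 0 \<noteq> 0}"
  have SqG: "Sq \<subseteq> \<Gamma> - {0}" using pointed_sum_0[OF pointed] add_mem by (auto simp: Sq_def)
  have Sq_add: "g + h \<in> Sq" if gh: "g \<in> Sq" "h \<in> \<Gamma>" for g h
  proof -
    obtain m n where mn: "g = m + n" "m \<in> \<Gamma> - {0}" "n \<in> \<Gamma> - {0}" using gh(1) unfolding Sq_def by blast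
    have "n + h \<in> \<Gamma> - {0}" using add_mem[of n h] pointed_sum_0[OF pointed, of n h] mn gh(2) by auto
    moreover have "g + h = m + (n + h)" using mn by (simp add: add.assoc)
    ultimately show ?thesis using mn(2) unfolding Sq_def by blast
  qed
  have Sq_mult: "u * s \<in> mon_alg Sq" if "u \<in> mon_alg Sq" "s \<in> mon_alg \<Gamma>" for u s :: "'k ratfun"
    using that Sq_add by (rule mon_alg_mult)
  have cf0: "cf (s * s') 0 \<noteq> 0" if "s \<in> A" "s' \<in> A" "cf s 0 \<noteq> 0" "cf s' 0 \<noteq> 0" for s s' :: "'k ratfun"
    using cf_mult_0[OF pointed that(1,2)] that by simp
  have nz: "s \<noteq> 0" if "cf s 0 \<noteq> 0" for s :: "'k ratfun" using that by auto
  have M2_add: "t + t' \<in> M2" if tt: "t \<in> M2" "t' \<in> M2" for t t'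
  proof -
    obtain u s u' s' where *: "t = u / s" "u \<in> mon_alg Sq" "s \<in> A" "cf s 0 \<noteq> 0"
      "t' = u' / s'" "u' \<in> mon_alg Sq" "s' \<in> A" "cf s' 0 \<noteq> 0" using tt unfolding M2_def by blast
    have "t + t' = (u * s' + u' * s) / (s * s')" using * nz by (simp add: add_frac_eq)
    moreover have "u * s' + u' * s \<in> mon_alg Sq" using Sq_mult * by (intro mon_alg_add) blast+
    ultimately show ?thesis unfolding M2_def using k_subalgebraD(6)[OF kA] cf0 * by blast
  qed
  have M2_0: "0 \<in> M2" unfolding M2_def
    by (intro CollectI exI[of _ 0] exI[of _ 1]) (simp add: k_subalgebraD(3)[OF kA] cf_1)
  have M2_sum: "sum f S \<in> M2" if "\<And>s. s \<in> S \<Longrightarrow> f s \<in> M2" for f and S :: "'k ratfun set"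
    using that by (induction S rule: infinite_finite_induct) (auto simp: M2_0 M2_add)
  note m_rep = vertex_ring_nonunit_rep[OF pointed]
  have mm: "t * t' \<in> M2" if tt: "t \<in> ?m" "t' \<in> ?m" for t t'
  proof -
    obtain u s where us: "t = u / s" "u \<in> aug \<Gamma>" "s \<in> A" "cf s 0 \<noteq> 0" using m_rep[OF tt(1)] by blast
    obtain u' s' where us': "t' = u' / s'" "u' \<in> aug \<Gamma>" "s' \<in> A" "cf s' 0 \<noteq> 0" using m_rep[OF tt(2)] by blast
    have "g + h \<in> Sq" if "g \<in> \<Gamma> - {0}" "h \<in> \<Gamma> - {0}" for g h using that unfolding Sq_def by blast
    then have "u * u' \<in> mon_alg Sq"
      by (rule mon_alg_mult[OF aug_mon_alg[OF us(2)] aug_mon_alg[OF us'(2)]])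
    moreover have "t * t' = (u * u') / (s * s')" using us us' by simp
    ultimately show ?thesis unfolding M2_def using k_subalgebraD(6)[OF kA] cf0 us us' by blast
  qed
  \<comment> \<open>Modulo \<open>M2\<close> the coefficients of a combination of the generators
    \<open>S\<close> may be replaced by their residues in \<open>k\<close>.\<close>
  have gen: "\<exists>c. t - (\<Sum>g\<in>S. const (c g) * g) \<in> M2" if t: "t \<in> ?m" for t
  proof -
    let ?J = "{\<Sum>g\<in>S. r g * g | r. \<forall>g\<in>S. r g \<in> ?T}"
    have "ideal_in ?J ?T"
      unfolding ideal_in_def
    proof (intro conjI ballI subsetI)
      fix u assume "u \<in> ?J"
      then show "u \<in> ?T" using S(1) by (auto intro!: subring_set_sum[OF sr] subring_setD(5)[OF sr])
    next
      show "0 \<in> ?J" by (intro CollectI exI[of _ "\<lambda>_. 0"]) (simp add: subring_setD[OF sr])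
    next
      fix u u' assume "u \<in> ?J" "u' \<in> ?J"
      then obtain r r' where r: "u = (\<Sum>g\<in>S. r g * g)" "\<forall>g\<in>S. r g \<in> ?T" "u' = (\<Sum>g\<in>S. r' g * g)" "\<forall>g\<in>S. r' g \<in> ?T" by blast
      have "u + u' = (\<Sum>g\<in>S. (r g + r' g) * g)" using r by (simp add: sum.distrib distrib_right)
      then show "u + u' \<in> ?J" using r subring_setD(3)[OF sr] by (intro CollectI exI[of _ "\<lambda>g. r g + r' g"]) auto
    next
      fix u' u assume "u' \<in> ?T" "u \<in> ?J"
      then obtain r where r: "u = (\<Sum>g\<in>S. r g * g)" "\<forall>g\<in>S. r g \<in> ?T" by blast
      have "u' * u = (\<Sum>g\<in>S. (u' * r g) * g)" using r by (simp add: sum_distrib_left mult.assoc)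
      then show "u' * u \<in> ?J" using r \<open>u' \<in> ?T\<close> subring_setD(5)[OF sr] by (intro CollectI exI[of _ "\<lambda>g. u' * r g"]) auto
    qed
    moreover have "S \<subseteq> ?J"
    proof
      fix g assume g: "g \<in> S"
      have "g = (\<Sum>g'\<in>S. (if g' = g then 1 else 0) * g')" using S(2) g by (simp add: if_distrib[of "\<lambda>t. t * _"] cong: if_cong)
      then show "g \<in> ?J" using subring_setD(1,2)[OF sr] by (intro CollectI exI[of _ "\<lambda>g'. if g' = g then 1 else 0"]) auto
    qed
    ultimately have "genideal (ring_of ?T) S \<subseteq> ?J" by (rule genideal_ring_of(3)[OF sr S(1)])
    then have "t \<in> ?J" using t unfolding S(4) by (rule subsetD)
    then obtain r where r: "t = (\<Sum>g\<in>S. r g * g)" "\<forall>g\<in>S. r g \<in> ?T" by blast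
    have "\<forall>g\<in>S. \<exists>c. r g - const c \<in> ?m" using vertex_ring_residue[OF pointed] r(2) by blast
    from bchoice[OF this] obtain c where c: "\<And>g. g \<in> S \<Longrightarrow> r g - const (c g) \<in> ?m" by blast
    have Sm: "S \<subseteq> ?m" using genideal_ring_of(2)[OF sr S(1)] S(4) by simp
    have "t - (\<Sum>g\<in>S. const (c g) * g) = (\<Sum>g\<in>S. (r g - const (c g)) * g)"
      unfolding r(1) by (simp add: sum_subtractf algebra_simps)
    also have "\<dots> \<in> M2" using c Sm by (intro M2_sum mm) auto
    finally show ?thesis by blast
  qed
  define G where "G = {x, y, z}"
  have xyz: "x \<noteq> 0" "y \<noteq> 0" "z \<noteq> 0" "x \<noteq> y" "z \<noteq> x" "z \<noteq> y"
  proof -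
    show 0: "x \<noteq> 0" "y \<noteq> 0" "x \<noteq> y" using indep by (auto simp: dt_def)
    have "(1::nat) < d" using d2 by simp
    have "scale 0 x + scale 0 y + scale 1 z \<noteq> scale a x + scale b y + scale 0 z" for a b
      using nf_unique[of 1 0 0 0 a b] \<open>1 < d\<close> d0 by auto
    from this[of 1 0] this[of 0 1] this[of 0 0]
    show "z \<noteq> x" "z \<noteq> y" "z \<noteq> 0" by (simp_all add: scale_1)
  qed
  have cardG: "card G = 3" using xyz by (simp add: G_def)
  have GG: "G \<subseteq> \<Gamma> - {0}" using mem xyz by (auto simp: G_def)
  have "character g \<in> ?m" if "g \<in> G" for g
    using that GG character_vertex_ring_iff[OF pointed] character_not_unit[OF pointed] by blast
  then have "\<forall>g\<in>G. \<exists>c. character g - (\<Sum>s\<in>S. const (c s) * s) \<in> M2" using gen by blast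
  from bchoice[OF this] obtain C where C: "\<And>g. g \<in> G \<Longrightarrow> character g - (\<Sum>s\<in>S. const (C g s) * s) \<in> M2" by blast
  obtain f where f: "bij_betw f {0..<card S} S" using ex_bij_betw_nat_finite[OF S(2)] by blast
  \<comment> \<open>Three rows of coefficients in at most two columns are linearly dependent over
    \<open>k\<close>.\<close>
  obtain al where al: "\<exists>g\<in>G. al g \<notin> {0}" "\<forall>j<card S. (\<Sum>g\<in>G. al g * C g (f j)) \<in> {0}"
    using dependent_mod_prime[OF prime_0, of G "card S" "\<lambda>g j. C g (f j)"] cardG \<open>card S \<le> 2\<close>
    by (auto simp: G_def)
  have rel0: "(\<Sum>g\<in>G. al g * C g s) = 0" if "s \<in> S" for s
  proof -
    have "s \<in> f ` {0..<card S}" using f that by (simp add: bij_betw_def)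
    then obtain j where "j < card S" "s = f j" by auto
    then show ?thesis using al(2) by simp
  qed
  have M2_smult: "const c * t \<in> M2" if t: "t \<in> M2" for c t
  proof -
    obtain u s where us: "t = u / s" "u \<in> mon_alg Sq" "s \<in> A" "cf s 0 \<noteq> 0" using t unfolding M2_def by blast
    have "const c * t = (u * const c) / s" using us by simp
    then show ?thesis unfolding M2_def using Sq_mult[OF us(2) k_subalgebraD(1)[OF kA]] us by blast
  qed
  have finG: "finite G" by (simp add: G_def)
  have "(\<Sum>g\<in>G. const (al g) * (character g - (\<Sum>s\<in>S. const (C g s) * s))) \<in> M2"
    using finG C by (induction G rule: finite_induct) (auto simp: M2_0 M2_add M2_smult)
  also have "(\<Sum>g\<in>G. const (al g) * (character g - (\<Sum>s\<in>S. const (C g s) * s))) =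
      (\<Sum>g\<in>G. const (al g) * character g) - (\<Sum>g\<in>G. \<Sum>s\<in>S. const (al g * C g s) * s)"
    by (simp add: right_diff_distrib sum_subtractf sum_distrib_left const_mult mult.assoc)
  also have "(\<Sum>g\<in>G. \<Sum>s\<in>S. const (al g * C g s) * s) = (\<Sum>s\<in>S. const (\<Sum>g\<in>G. al g * C g s) * s)"
    by (subst sum.swap) (simp add: const_sum sum_distrib_right)
  also have "\<dots> = 0" by (intro sum.neutral) (simp add: rel0)
  finally have "(\<Sum>g\<in>G. const (al g) * character g) \<in> M2" by simp
  then obtain u s where us: "(\<Sum>g\<in>G. const (al g) * character g) = u / s" "u \<in> mon_alg Sq" "s \<in> A" "cf s 0 \<noteq> 0"
    unfolding M2_def by blast
  have u: "u = (\<Sum>g\<in>G. const (al g) * character g * s)"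
  proof -
    have "u = (\<Sum>g\<in>G. const (al g) * character g) * s" using us(1) nz[OF us(4)] by simp
    then show ?thesis by (simp only: sum_distrib_right)
  qed
  obtain g0 where g0: "g0 \<in> G" "al g0 \<noteq> 0" using al(1) by auto
  have sU: "s \<in> mon_alg UNIV" using us(3) mon_alg_UNIV by blast
  have "cf u g0 = (\<Sum>g\<in>G. cf (const (al g) * character g * s) g0)"
    unfolding u by (subst cf_sum[THEN conjunct2]) (auto simp: cf_shift[OF sU])
  also have "\<dots> = (\<Sum>g\<in>G. if g = g0 then al g0 * cf s 0 else 0)"
  proof (rule sum.cong[OF refl])
    fix g assume g: "g \<in> G"
    \<comment> \<open>A further contribution would split \<open>g0\<close> as the sum of
      \<open>g\<close> and \<open>g0 - g\<close>, against irreducibility.\<close>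
    have "cf s (g0 - g) = 0" if "g \<noteq> g0"
    proof (rule ccontr)
      assume "cf s (g0 - g) \<noteq> 0"
      then have "g0 - g \<in> \<Gamma> - {0}" using mon_alg_cf(3)[OF us(3)] that by auto
      then have "g + (g0 - g) \<noteq> g0" using irr[OF d2, of g "g0 - g"] g g0 GG by (auto simp: G_def)
      then show False by simp
    qed
    then show "cf (const (al g) * character g * s) g0 = (if g = g0 then al g0 * cf s 0 else 0)"
      by (auto simp: cf_shift(2)[OF sU])
  qed
  also have "\<dots> = al g0 * cf s 0" using g0 finG by simp
  finally have "cf u g0 \<noteq> 0" using g0 us by simp
  then have "g0 \<in> Sq" using mon_alg_cf(3)[OF us(2)] by blast
  then show False using irr[OF d2] g0 by (auto simp: Sq_def G_def)
qed

end

section \<open>Truncated evaluation of power series\<close>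

text \<open>The assumptions on \<open>\<phi>\<close> and the conclusions about \<open>\<Phi>\<close>
  have the same shape, so the lemma can be applied once for each of the three nested
  variables.\<close>

lemma truncation_hom:
  fixes \<phi> :: "'a::comm_ring_1 \<Rightarrow> 'b::comm_ring_1"
  assumes R: "subring_set R" and J: "ideal_in J R"
    and \<phi>: "\<And>a. \<phi> a \<in> R" "\<And>a b. \<phi> (a + b) = \<phi> a + \<phi> b" "\<phi> 0 = 0" "\<And>a b. \<phi> (a * b) - \<phi> a * \<phi> b \<in> J"
    and z: "z \<in> R" "z ^ n \<in> J"
  defines "\<Phi> \<equiv> \<lambda>F. \<Sum>j<n. \<phi> (fps_nth F j) * z ^ j"
  shows "\<Phi> F \<in> R" "\<Phi> (F + G) = \<Phi> F + \<Phi> G" "\<Phi> 0 = 0" "\<Phi> (F * G) - \<Phi> F * \<Phi> G \<in> J"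
proof -
  note RD = subring_setD[OF R]
  show "\<Phi> F \<in> R" unfolding \<Phi>_def by (intro subring_set_sum[OF R] RD(5) \<phi>(1) RD(7) z(1))
  show "\<Phi> (F + G) = \<Phi> F + \<Phi> G" by (simp add: \<Phi>_def \<phi>(2) distrib_right sum.distrib)
  show "\<Phi> 0 = 0" by (simp add: \<Phi>_def \<phi>(3))
  have \<phi>s: "\<phi> (sum f S) = (\<Sum>i\<in>S. \<phi> (f i))" for f and S :: "nat set"
    by (induction S rule: infinite_finite_induct) (simp_all add: \<phi>)
  \<comment> \<open>The product of the truncations runs over the box, the truncation of the product
    over the triangle; every term in the difference carries a factor \<open>z ^ n\<close>.\<close>
  let ?B = "{..<n} \<times> {..<n}" and ?L = "{(i, j). i + j < n}"
  have L: "?L \<subseteq> ?B" "finite ?B" by auto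
  have "\<Phi> (F * G) = (\<Sum>k<n. \<Sum>i\<le>k. \<phi> (fps_nth F i * fps_nth G (k - i)) * z ^ (i + (k - i)))"
    unfolding \<Phi>_def fps_mult_nth by (intro sum.cong refl) (simp add: \<phi>s sum_distrib_right atMost_atLeast0)
  also have "\<dots> = (\<Sum>(i, j)\<in>?L. \<phi> (fps_nth F i * fps_nth G j) * z ^ (i + j))"
    by (rule sum.triangle_reindex[symmetric])
  finally have 1: "\<Phi> (F * G) = (\<Sum>q\<in>?L. \<phi> (fps_nth F (fst q) * fps_nth G (snd q)) * z ^ (fst q + snd q))"
    by (simp add: case_prod_beta)
  have "\<Phi> F * \<Phi> G = (\<Sum>(i, j)\<in>?B. (\<phi> (fps_nth F i) * z ^ i) * (\<phi> (fps_nth G j) * z ^ j))"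
    unfolding \<Phi>_def by (simp add: sum_product sum.cartesian_product)
  then have "\<Phi> F * \<Phi> G = (\<Sum>q\<in>?B. \<phi> (fps_nth F (fst q)) * \<phi> (fps_nth G (snd q)) * z ^ (fst q + snd q))"
    by (simp add: case_prod_beta power_add mult_ac)
  also have "\<dots> = (\<Sum>q\<in>?B - ?L. \<phi> (fps_nth F (fst q)) * \<phi> (fps_nth G (snd q)) * z ^ (fst q + snd q)) +
      (\<Sum>q\<in>?L. \<phi> (fps_nth F (fst q)) * \<phi> (fps_nth G (snd q)) * z ^ (fst q + snd q))"
    by (rule sum.subset_diff[OF L])
  finally have 2: "\<Phi> F * \<Phi> G = \<dots>" .
  have "\<Phi> (F * G) - \<Phi> F * \<Phi> G =
      (\<Sum>q\<in>?L. (\<phi> (fps_nth F (fst q) * fps_nth G (snd q)) - \<phi> (fps_nth F (fst q)) * \<phi> (fps_nth G (snd q))) * z ^ (fst q + snd q)) -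
      (\<Sum>q\<in>?B - ?L. \<phi> (fps_nth F (fst q)) * \<phi> (fps_nth G (snd q)) * z ^ (fst q + snd q))"
    unfolding 1 2 by (simp add: left_diff_distrib sum_subtractf)
  also have "\<dots> \<in> J"
  proof (intro ideal_in_diff[OF R J] ideal_in_sum[OF J])
    fix q assume "q \<in> ?L"
    show "(\<phi> (fps_nth F (fst q) * fps_nth G (snd q)) - \<phi> (fps_nth F (fst q)) * \<phi> (fps_nth G (snd q))) * z ^ (fst q + snd q) \<in> J"
      by (intro ideal_inD(4)[OF J] \<phi>(4) RD(7) z(1))
  next
    fix q assume "q \<in> ?B - ?L"
    then have "n \<le> fst q + snd q" by (auto simp: case_prod_beta not_less)
    then have "z ^ (fst q + snd q) = z ^ (fst q + snd q - n) * z ^ n" by (simp flip: power_add)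
    then have "z ^ (fst q + snd q) \<in> J" using ideal_inD(3)[OF J RD(7)[OF z(1)] z(2)] by simp
    then show "\<phi> (fps_nth F (fst q)) * \<phi> (fps_nth G (snd q)) * z ^ (fst q + snd q) \<in> J"
      by (intro ideal_inD(3)[OF J] RD(5) \<phi>(1))
  qed
  finally show "\<Phi> (F * G) - \<Phi> F * \<Phi> G \<in> J" .
qed

definition tr1 :: "nat \<Rightarrow> 'k::field ratfun \<Rightarrow> 'k fps \<Rightarrow> 'k ratfun" where
  "tr1 n X F = (\<Sum>a<n. const (fps_nth F a) * X ^ a)"

definition tr2 :: "nat \<Rightarrow> 'k::field ratfun \<Rightarrow> 'k ratfun \<Rightarrow> 'k fps fps \<Rightarrow> 'k ratfun" where
  "tr2 n X Y F = (\<Sum>b<n. tr1 n X (fps_nth F b) * Y ^ b)"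

definition tr3 :: "nat \<Rightarrow> 'k::field ratfun \<Rightarrow> 'k ratfun \<Rightarrow> 'k ratfun \<Rightarrow> 'k fps fps fps \<Rightarrow> 'k ratfun" where
  "tr3 n X Y Z F = (\<Sum>j<n. tr2 n X Y (fps_nth F j) * Z ^ j)"

lemma tr3_hom:
  assumes R: "k_subalgebra R" and J: "ideal_in J R"
    and X: "X \<in> R" "X ^ n \<in> J" and Y: "Y \<in> R" "Y ^ n \<in> J" and Z: "Z \<in> R" "Z ^ n \<in> J"
  shows "tr3 n X Y Z F \<in> R" "tr3 n X Y Z (F + G) = tr3 n X Y Z F + tr3 n X Y Z G"
    "tr3 n X Y Z (F * G) - tr3 n X Y Z F * tr3 n X Y Z G \<in> J"
proof -
  note sr = subring_set_k_subalgebra[OF R]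
  have 0: "const (a * b) - const a * const b \<in> J" for a b :: 'a using ideal_inD(1)[OF J] by (simp add: const_mult)
  note h1 = truncation_hom[OF sr J k_subalgebraD(1)[OF R] const_add const_0 0 X, folded tr1_def]
  note h2 = truncation_hom[OF sr J h1 Y, folded tr2_def]
  note h3 = truncation_hom[OF sr J h2 Z, folded tr3_def]
  show "tr3 n X Y Z F \<in> R" "tr3 n X Y Z (F + G) = tr3 n X Y Z F + tr3 n X Y Z G"
    "tr3 n X Y Z (F * G) - tr3 n X Y Z F * tr3 n X Y Z G \<in> J" using h3 by blast+
qed

text \<open>The outermost variable of the nested series is \<open>z\<close> and the innermost
  \<open>x\<close>; triples list the exponents in the order \<open>x\<close>, \<open>y\<close>,
  \<open>z\<close>.\<close>

definition fc :: "'k::field fps fps fps \<Rightarrow> nat \<times> nat \<times> nat \<Rightarrow> 'k" where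
  "fc F t = (case t of (a, b, j) \<Rightarrow> fps_nth (fps_nth (fps_nth F j) b) a)"

lemma tr3_box:
  "tr3 n X Y Z F = (\<Sum>(a, b, j)\<in>{..<n} \<times> {..<n} \<times> {..<n}. const (fc F (a, b, j)) * (X ^ a * Y ^ b * Z ^ j))"
proof -
  have "tr3 n X Y Z F = (\<Sum>j<n. \<Sum>b<n. \<Sum>a<n. const (fc F (a, b, j)) * (X ^ a * Y ^ b * Z ^ j))"
    unfolding tr3_def tr2_def tr1_def by (simp add: sum_distrib_left fc_def mult_ac)
  also have "\<dots> = (\<Sum>b<n. \<Sum>j<n. \<Sum>a<n. const (fc F (a, b, j)) * (X ^ a * Y ^ b * Z ^ j))" by (rule sum.swap)
  also have "\<dots> = (\<Sum>b<n. \<Sum>a<n. \<Sum>j<n. const (fc F (a, b, j)) * (X ^ a * Y ^ b * Z ^ j))"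
    by (rule sum.cong[OF refl], rule sum.swap)
  also have "\<dots> = (\<Sum>a<n. \<Sum>b<n. \<Sum>j<n. const (fc F (a, b, j)) * (X ^ a * Y ^ b * Z ^ j))" by (rule sum.swap)
  finally show ?thesis by (simp add: sum.cartesian_product)
qed

lemma fps3_eqI: "(\<And>t. fc F t = fc G t) \<Longrightarrow> F = G"
proof (intro fps_ext)
  fix j b a assume h: "\<And>t. fc F t = fc G t"
  show "fps_nth (fps_nth (fps_nth F j) b) a = fps_nth (fps_nth (fps_nth G j) b) a"
    using h[of "(a, b, j)"] by (simp add: fc_def)
qed

section \<open>Division by the equation of a rational double point\<close>

lemma fc_A_equation_mult:
  "fc (A_equation c * G) (a, b, j) =
     (if a = 0 \<or> b = 0 then 0 else fc G (a - 1, b - 1, j)) - (if j < c + 1 then 0 else fc G (a, b, j - (c + 1)))"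
proof -
  have "A_equation c * G = fps_const (fps_const fps_X) * (fps_const fps_X * G) - fps_X ^ (c + 1) * G"
    by (simp add: A_equation_def algebra_simps)
  then show ?thesis
    unfolding fc_def by (simp add: fps_mult_left_const_nth fps_X_power_mult_nth del: power_Suc)
qed

text \<open>Division by \<open>x y - z^(c+1)\<close>: each \<open>z^(c+1)\<close> is replaced by
  \<open>x y\<close> until the degree in \<open>z\<close> is at most \<open>c\<close>. Only finitely
  many coefficients of \<open>F\<close> feed into one of \<open>G\<close>, so no convergence
  question arises.\<close>

lemma A_equation_division:
  "\<exists>G. \<forall>a b j. c + 1 \<le> j \<longrightarrow> fc (F - A_equation c * G) (a, b, j) = 0"
proof -
  \<comment> \<open>The unrolled solution of
    \<open>G(a,b,j) = G(a-1,b-1,j+c+1) - F(a,b,j+c+1)\<close>, which stops when \<open>a\<close> or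
    \<open>b\<close> reaches 0.\<close>
  define g where "g a b j = - (\<Sum>l\<le>min a b. fc F (a - l, b - l, j + (l + 1) * (c + 1)))" for a b j
  define G where "G = Abs_fps (\<lambda>j. Abs_fps (\<lambda>b. Abs_fps (\<lambda>a. g a b j)))"
  have fG: "fc G (a, b, j) = g a b j" for a b j by (simp add: fc_def G_def)
  have sub: "fc (F - H) t = fc F t - fc H t" for H t by (simp add: fc_def split: prod.splits)
  have "fc (F - A_equation c * G) (a, b, j) = 0" if "c + 1 \<le> j" for a b j
  proof -
    have gj: "g a b (j - (c + 1)) = - (\<Sum>l\<le>min a b. fc F (a - l, b - l, j + l * (c + 1)))"
      unfolding g_def using that by (intro arg_cong[of _ _ uminus] sum.cong refl) (simp add: algebra_simps)
    show ?thesis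
    proof (cases "a = 0 \<or> b = 0")
      case True
      then have "min a b = 0" by auto
      then show ?thesis using that True gj by (simp add: sub fc_A_equation_mult fG)
    next
      case False
      then obtain k where k: "min a b = Suc k" "min (a - 1) (b - 1) = k" by (cases a; cases b) auto
      have "g a b (j - (c + 1)) = - (fc F (a, b, j) + (\<Sum>l\<le>k. fc F (a - Suc l, b - Suc l, j + Suc l * (c + 1))))"
        unfolding gj k(1) by (subst sum.atMost_Suc_shift) simp
      moreover have "g (a - 1) (b - 1) j = - (\<Sum>l\<le>k. fc F (a - Suc l, b - Suc l, j + Suc l * (c + 1)))"
        unfolding g_def k(2) by simp
      ultimately show ?thesis using that False unfolding sub fc_A_equation_mult fG by simp
    qed
  qed
  then show ?thesis by blast
qed

lemma genideal_principal:
  "genideal (ring_of UNIV) {u} = {u * G | G. True}" for u :: "'a::comm_ring_1"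
proof (rule genideal_ring_of_eqI[OF subring_set_UNIV])
  show "{u} \<subseteq> {u * G | G. True}" using mult_1_right[of u] by (metis (mono_tags, lifting) empty_subsetI insert_subset mem_Collect_eq)
  show "ideal_in {u * G | G. True} UNIV"
    unfolding ideal_in_def
  proof (intro conjI ballI subset_UNIV)
    show "0 \<in> {u * G | G. True}" using mult_zero_right[of u] by (metis (mono_tags, lifting) mem_Collect_eq)
    fix s t assume "s \<in> {u * G | G. True}"
    then obtain G where G: "s = u * G" by blast
    show "s + t \<in> {u * G | G. True}" if t: "t \<in> {u * G | G. True}"
    proof -
      obtain H where "t = u * H" using t by blast
      then have "s + t = u * (G + H)" using G by (simp add: distrib_left)
      then show ?thesis by blast
    qed
    have "t * s = u * (t * G)" using G by (simp add: mult_ac)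
    then show "t * s \<in> {u * G | G. True}" by blast
  qed
  fix J assume "ideal_in J (UNIV :: 'a set)" "{u} \<subseteq> J"
  then show "{u * G | G. True} \<subseteq> J" by (auto intro: ideal_inD(4))
qed

section \<open>Quotients and completions\<close>

lemma coset_ring_of: "I +>\<^bsub>ring_of A\<^esub> a = {h + a | h. h \<in> I}"
  by (auto simp: a_r_coset_def')

lemma coset_eq_iff:
  assumes A: "subring_set A" and I: "ideal_in I A" and ab: "a \<in> A" "b \<in> A"
  shows "I +>\<^bsub>ring_of A\<^esub> a = I +>\<^bsub>ring_of A\<^esub> b \<longleftrightarrow> a - b \<in> I"
proof
  assume "I +>\<^bsub>ring_of A\<^esub> a = I +>\<^bsub>ring_of A\<^esub> b"
  moreover have "0 + a \<in> I +>\<^bsub>ring_of A\<^esub> a" unfolding coset_ring_of using ideal_inD(1)[OF I] by blast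
  ultimately obtain h where "h \<in> I" "a = h + b" unfolding coset_ring_of by auto
  then show "a - b \<in> I" by simp
next
  assume d: "a - b \<in> I"
  have sub: "{h + a | h. h \<in> I} \<subseteq> {h + b | h. h \<in> I}" if "a - b \<in> I" for a b
  proof
    fix t assume "t \<in> {h + a | h. h \<in> I}"
    then obtain h where "h \<in> I" "t = h + a" by blast
    then have "t = (h + (a - b)) + b" "h + (a - b) \<in> I" using ideal_inD(2)[OF I _ that] by auto
    then show "t \<in> {h + b | h. h \<in> I}" by blast
  qed
  have "b - a \<in> I" using ideal_in_minus[OF A I d] by simp
  then show "I +>\<^bsub>ring_of A\<^esub> a = I +>\<^bsub>ring_of A\<^esub> b" unfolding coset_ring_of using sub d by (intro equalityI)
qed

lemma quot_ring_of:
  assumes A: "subring_set A" and I: "ideal_in I A"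
  shows "carrier (ring_of A Quot I) = {I +>\<^bsub>ring_of A\<^esub> a | a. a \<in> A}"
    "a \<in> A \<Longrightarrow> b \<in> A \<Longrightarrow> (I +>\<^bsub>ring_of A\<^esub> a) \<otimes>\<^bsub>ring_of A Quot I\<^esub> (I +>\<^bsub>ring_of A\<^esub> b) = I +>\<^bsub>ring_of A\<^esub> (a * b)"
    "a \<in> A \<Longrightarrow> b \<in> A \<Longrightarrow> (I +>\<^bsub>ring_of A\<^esub> a) \<oplus>\<^bsub>ring_of A Quot I\<^esub> (I +>\<^bsub>ring_of A\<^esub> b) = I +>\<^bsub>ring_of A\<^esub> (a + b)"
    "\<one>\<^bsub>ring_of A Quot I\<^esub> = I +>\<^bsub>ring_of A\<^esub> 1"
proof -
  have id: "ideal I (ring_of A)" using I ideal_ring_of_iff[OF A] by blast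
  note hom = ideal.rcos_ring_hom[OF id]
  show "carrier (ring_of A Quot I) = {I +>\<^bsub>ring_of A\<^esub> a | a. a \<in> A}"
    by (auto simp: FactRing_def A_RCOSETS_def')
  show "a \<in> A \<Longrightarrow> b \<in> A \<Longrightarrow> (I +>\<^bsub>ring_of A\<^esub> a) \<otimes>\<^bsub>ring_of A Quot I\<^esub> (I +>\<^bsub>ring_of A\<^esub> b) = I +>\<^bsub>ring_of A\<^esub> (a * b)"
    using ring_hom_mult[OF hom, of a b] by simp
  show "a \<in> A \<Longrightarrow> b \<in> A \<Longrightarrow> (I +>\<^bsub>ring_of A\<^esub> a) \<oplus>\<^bsub>ring_of A Quot I\<^esub> (I +>\<^bsub>ring_of A\<^esub> b) = I +>\<^bsub>ring_of A\<^esub> (a + b)"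
    using ring_hom_add[OF hom, of a b] by simp
  show "\<one>\<^bsub>ring_of A Quot I\<^esub> = I +>\<^bsub>ring_of A\<^esub> 1" by (simp add: FactRing_def)
qed

lemma ideal_in_pow:
  assumes A: "subring_set A" and m: "ideal_in m A"
  shows "ideal_in (ideal_pow (ring_of A) m n) A"
    "ideal_pow (ring_of A) m (Suc n) \<subseteq> ideal_pow (ring_of A) m n"
proof -
  have m': "ideal m (ring_of A)" using m ideal_ring_of_iff[OF A] by blast
  have 1: "ideal (ideal_pow (ring_of A) m n) (ring_of A)" for n
  proof (induction n)
    case 0
    show ?case using ring.oneideal[OF ring_ring_of[OF A]] by simp
  next
    case (Suc n)
    then show ?case using ring.ideal_prod_is_ideal[OF ring_ring_of[OF A] m'] by simp
  qed
  then show "ideal_in (ideal_pow (ring_of A) m n) A" using ideal_ring_of_iff[OF A] by blast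
  show "ideal_pow (ring_of A) m (Suc n) \<subseteq> ideal_pow (ring_of A) m n"
    using ring.ideal_prod_inter[OF ring_ring_of[OF A] m' 1[of n]] by auto
qed

lemma ideal_pow_mult: "a \<in> m \<Longrightarrow> b \<in> ideal_pow (ring_of A) m n \<Longrightarrow> a * b \<in> ideal_pow (ring_of A) m (Suc n)"
  using ideal_prod.prod[of a m b "ideal_pow (ring_of A) m n" "ring_of A"] by simp

lemma ideal_pow_induct [consumes 1, case_names prod sum]:
  assumes "t \<in> ideal_pow (ring_of A) m (Suc n)"
    "\<And>a b. a \<in> m \<Longrightarrow> b \<in> ideal_pow (ring_of A) m n \<Longrightarrow> Pr (a * b)"
    "\<And>s t. Pr s \<Longrightarrow> Pr t \<Longrightarrow> Pr (s + t)"
  shows "Pr t"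
proof -
  have "t \<in> ideal_prod (ring_of A) m (ideal_pow (ring_of A) m n)" using assms(1) by simp
  then show ?thesis by (induction rule: ideal_prod.induct) (use assms(2,3) in auto)
qed

section \<open>Powers of the maximal ideal at a vertex\<close>

definition vertex_pow :: "(int \<times> int) set \<Rightarrow> nat \<Rightarrow> 'k::field ratfun set" where
  "vertex_pow \<Gamma> n = ideal_pow (ring_of (vertex_ring \<Gamma>)) (vertex_ring \<Gamma> - units_in (vertex_ring \<Gamma>)) n"

context A_monoid
begin

abbreviation R :: "'k::field ratfun set" where "R \<equiv> vertex_ring \<Gamma>"
abbreviation mR :: "'k::field ratfun set" where "mR \<equiv> R - units_in R"
abbreviation mono :: "nat \<Rightarrow> nat \<Rightarrow> nat \<Rightarrow> 'k::field ratfun" where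
  "mono a b j \<equiv> character x ^ a * character y ^ b * character z ^ j"

lemmas V = vertex_ring_props[OF pointed]
lemmas kR = V(3)
lemmas srR = subring_set_k_subalgebra[OF kR]
lemmas idm = ideal_in_nonunits[OF V(1)]
lemmas idp = ideal_in_pow(1)[OF srR idm, folded vertex_pow_def]
lemmas pow_dec = ideal_in_pow(2)[OF srR idm, folded vertex_pow_def]

lemma pow_0: "vertex_pow \<Gamma> 0 = R"
  by (simp add: vertex_pow_def)

lemma pow_mult: "a \<in> mR \<Longrightarrow> b \<in> vertex_pow \<Gamma> n \<Longrightarrow> a * b \<in> vertex_pow \<Gamma> (Suc n)"
  unfolding vertex_pow_def by (rule ideal_pow_mult)

lemma pow_antimono: "n \<le> n' \<Longrightarrow> vertex_pow \<Gamma> n' \<subseteq> vertex_pow \<Gamma> n"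
proof (induction n' rule: dec_induct)
  case (step n') then show ?case using pow_dec[of n'] by blast
qed simp

lemma pow_power: "u \<in> mR \<Longrightarrow> t \<in> vertex_pow \<Gamma> n \<Longrightarrow> u ^ a * t \<in> vertex_pow \<Gamma> (a + n)"
proof (induction a)
  case (Suc a)
  then show ?case using pow_mult[of u "u ^ a * t" "a + n"] by (simp add: mult.assoc)
qed simp

lemma mono_character: "mono a b j = character (scale a x + scale b y + scale j z)"
  by (simp add: character_add character_scale)

lemma xyz_nonzero: "x \<noteq> 0" "y \<noteq> 0" "z \<noteq> 0"
proof -
  show "x \<noteq> 0" "y \<noteq> 0" using indep by (auto simp: dt_def)
  show "z \<noteq> 0"
  proof
    assume "z = 0"
    then have "x + y = 0" using rel by (simp add: scale_def prod_eq_iff)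
    then have "y = - x" by (simp add: eq_neg_iff_add_eq_0 add.commute)
    then show False using indep by (simp add: dt_def)
  qed
qed

lemma xyz_mR: "character x \<in> mR" "character y \<in> mR" "character z \<in> mR"
  using character_vertex_ring_iff[OF pointed] character_not_unit[OF pointed] mem xyz_nonzero by blast+

lemma mono_in_pow: "n \<le> a + b + j \<Longrightarrow> mono a b j \<in> vertex_pow \<Gamma> n"
proof -
  assume n: "n \<le> a + b + j"
  have "1 \<in> vertex_pow \<Gamma> 0" using k_subalgebraD(3)[OF kR] by (simp add: pow_0)
  then have "character x ^ a * (character y ^ b * (character z ^ j * 1)) \<in> vertex_pow \<Gamma> (a + (b + (j + 0)))"
    using xyz_mR by (intro pow_power)
  then show ?thesis using pow_antimono[OF n] by (auto simp: mult.assoc add.assoc)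
qed

text \<open>Nonzero exponents have weight at least 1 with respect to \<open>w\<close>, so an
  \<open>n\<close>-th power of the maximal ideal has numerators of weight at least \<open>n\<close>.
  This one-sided comparison of filtrations is enough to force coefficients to vanish.\<close>

lemma pow_weight:
  "t \<in> vertex_pow \<Gamma> n \<Longrightarrow> \<exists>u s. t = u / s \<and> u \<in> mon_alg {m \<in> \<Gamma>. int n \<le> pr m w} \<and> s \<in> A \<and> cf s 0 \<noteq> 0"
proof (induction n arbitrary: t)
  case 0
  have "\<Gamma> \<subseteq> {m \<in> \<Gamma>. int 0 \<le> pr m w}" using pointed unfolding pointed_def by (metis (mono_tags, lifting) int_ops(1) less_imp_le mem_Collect_eq order_refl pr_simps(1) subsetI)
  moreover obtain u s where "t = u / s" "u \<in> A" "s \<in> A" "cf s 0 \<noteq> 0"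
    using 0 unfolding pow_0 by (elim vertex_ring_rep[OF pointed]) blast
  ultimately show ?case using mon_alg_mono by blast
next
  case (Suc n)
  let ?G = "\<lambda>n. {m \<in> \<Gamma>. int n \<le> pr m w}"
  have pw: "0 \<le> pr m w" if "m \<in> \<Gamma>" for m using pointed that unfolding pointed_def by (cases "m = 0") force+
  have "t \<in> ideal_pow (ring_of R) mR (Suc n)" using Suc.prems by (simp add: vertex_pow_def del: ideal_pow.simps)
  then show ?case
  proof (induction rule: ideal_pow_induct)
    case (prod a b)
    obtain u s where us: "a = u / s" "u \<in> aug \<Gamma>" "s \<in> A" "cf s 0 \<noteq> 0"
      using vertex_ring_nonunit_rep[OF pointed prod(1)] by blast
    obtain u' s' where us': "b = u' / s'" "u' \<in> mon_alg (?G n)" "s' \<in> A" "cf s' 0 \<noteq> 0"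
      using Suc.IH prod(2) unfolding vertex_pow_def by blast
    have "g + h \<in> ?G (Suc n)" if "g \<in> \<Gamma> - {0}" "h \<in> ?G n" for g h
    proof -
      have "0 < pr g w" "g \<in> \<Gamma>" using pointed that(1) unfolding pointed_def by blast+
      then show ?thesis using that(2) add_mem by (simp add: pr_add)
    qed
    then have "u * u' \<in> mon_alg (?G (Suc n))"
      by (rule mon_alg_mult[OF aug_mon_alg[OF us(2)] us'(2)])
    moreover have "cf (s * s') 0 \<noteq> 0" using cf_mult_0[OF pointed us(3) us'(3)] us us' by simp
    moreover have "s * s' \<in> A" using k_subalgebraD(6)[OF kA us(3) us'(3)] .
    moreover have "a * b = (u * u') / (s * s')" using us us' by simp
    ultimately show ?case by blast
  next
    case (sum a b)
    then obtain u s u' s' where *: "a = u / s" "u \<in> mon_alg (?G (Suc n))" "s \<in> A" "cf s 0 \<noteq> 0"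
      "b = u' / s'" "u' \<in> mon_alg (?G (Suc n))" "s' \<in> A" "cf s' 0 \<noteq> 0" by blast
    have nz: "s \<noteq> 0" "s' \<noteq> 0" using * by auto
    have G: "g + h \<in> ?G (Suc n)" if "g \<in> ?G (Suc n)" "h \<in> \<Gamma>" for g h
      using that pw[of h] add_mem[of g h] by (auto simp: pr_add)
    have "u * s' + u' * s \<in> mon_alg (?G (Suc n))"
      by (intro mon_alg_add mon_alg_mult[OF *(2,7) G] mon_alg_mult[OF *(6,3) G])
    moreover have "a + b = (u * s' + u' * s) / (s * s')" using * nz by (simp add: add_frac_eq)
    moreover have "cf (s * s') 0 \<noteq> 0" using cf_mult_0[OF pointed *(3,7)] * by simp
    moreover have "s * s' \<in> A" using k_subalgebraD(6)[OF kA *(3,7)] .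
    ultimately show ?case by blast
  qed
qed

text \<open>Makes the powers of the maximal ideal separate elements of \<open>A\<close>, by letting
  \<open>n\<close> exceed the weight of a given exponent.\<close>

lemma pow_coeff:
  assumes p: "q \<in> A" "q \<in> vertex_pow \<Gamma> n" and g: "pr g w < int n"
  shows "cf q g = 0"
proof (rule ccontr)
  assume "cf q g \<noteq> 0"
  obtain u s where us: "q = u / s" "u \<in> mon_alg {m \<in> \<Gamma>. int n \<le> pr m w}" "s \<in> A" "cf s 0 \<noteq> 0"
    using pow_weight[OF p(2)] by blast
  have u: "u = q * s" using us(1,4) by (cases "s = 0") auto
  have w0: "0 \<le> pr m w" if "m \<in> \<Gamma>" for m using pointed that unfolding pointed_def by (cases "m = 0") force+
  \<comment> \<open>An exponent of least weight cannot cancel in \<open>q * s\<close>: the only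
    contribution at \<open>k\<close> pairs it with the constant term of \<open>s\<close>.\<close>
  obtain k where k: "cf q k \<noteq> 0" "\<And>k'. cf q k' \<noteq> 0 \<Longrightarrow> nat (pr k w) \<le> nat (pr k' w)"
    using ex_has_least_nat[of "\<lambda>k. cf q k \<noteq> 0" g "\<lambda>k. nat (pr k w)"] \<open>cf q g \<noteq> 0\<close> by blast
  have G: "h \<in> \<Gamma>" if "cf q h \<noteq> 0" for h using mon_alg_cf(3)[OF p(1) that] .
  have "cf u k = (\<Sum>h | cf q h \<noteq> 0. cf q h * cf s (k - h))"
    unfolding u using cf_mult(2)[OF p(1)[THEN mon_alg_UNIV] us(3)[THEN mon_alg_UNIV]] .
  also have "\<dots> = (\<Sum>h | cf q h \<noteq> 0. if h = k then cf q k * cf s 0 else 0)"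
  proof (rule sum.cong[OF refl])
    fix h assume h: "h \<in> {h. cf q h \<noteq> 0}"
    have "cf s (k - h) = 0" if "h \<noteq> k"
    proof (rule ccontr)
      assume "cf s (k - h) \<noteq> 0"
      then have "k - h \<in> \<Gamma>" "k - h \<noteq> 0" using mon_alg_cf(3)[OF us(3)] that by auto
      then have "0 < pr (k - h) w" using pointed unfolding pointed_def by blast
      then show False using k(2)[of h] h w0[OF G[of h]] by (auto simp: pr_diff)
    qed
    then show "cf q h * cf s (k - h) = (if h = k then cf q k * cf s 0 else 0)" by auto
  qed
  also have "\<dots> = cf q k * cf s 0" using k(1) mon_alg_cf(1)[OF p(1)] by simp
  finally have "cf u k \<noteq> 0" using k(1) us(4) by simp
  then have "int n \<le> pr k w" using mon_alg_cf(3)[OF us(2)] by blast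
  then show False using k(2)[OF \<open>cf q g \<noteq> 0\<close>] g w0[OF G[OF k(1)]] w0[OF G[OF \<open>cf q g \<noteq> 0\<close>]] by linarith
qed

text \<open>By the normal form every nontrivial exponent has \<open>x\<close>, \<open>y\<close> or
  \<open>z\<close> as a summand.\<close>

lemma mR_generated:
  assumes J: "ideal_in J R" and "character x \<in> J" "character y \<in> J" "character z \<in> J"
  shows "mR \<subseteq> (J :: 'k::field ratfun set)"
proof
  fix t :: "'k ratfun" assume t: "t \<in> mR"
  obtain r S where S: "finite S" "S \<subseteq> \<Gamma> - {0}" "\<And>g. g \<in> S \<Longrightarrow> r g \<in> R" "t = (\<Sum>g\<in>S. r g * character g)"
    using nonunit_vertex_ring[OF pointed t] by blast
  have "character g \<in> J" if g: "g \<in> S" for g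
  proof -
    obtain a b i where ab: "g = scale a x + scale b y + scale i z" using nf[of g] S(2) g by blast
    have mon: "mono a b i \<in> R" for a b i using mono_in_pow[of 0 a b i] by (simp add: pow_0)
    have "a \<noteq> 0 \<or> b \<noteq> 0 \<or> i \<noteq> 0" using ab S(2) g by auto
    then consider k where "a = Suc k" | k where "b = Suc k" | k where "i = Suc k" by (metis not0_implies_Suc)
    then have "\<exists>a' b' i'. character g = mono a' b' i' * character x \<or> character g = mono a' b' i' * character y \<or>
       character g = mono a' b' i' * character z"
    proof cases
      case (1 k)
      then have "character g = mono k b i * character x" unfolding ab mono_character[symmetric] by (simp add: mult_ac)
      then show ?thesis by blast
    next
      case (2 k)
      then have "character g = mono a k i * character y" unfolding ab mono_character[symmetric] by (simp add: mult_ac)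
      then show ?thesis by blast
    next
      case (3 k)
      then have "character g = mono a b k * character z" unfolding ab mono_character[symmetric] by (simp add: mult_ac)
      then show ?thesis by blast
    qed
    then show ?thesis using ideal_inD(3)[OF J mon] assms by metis
  qed
  then show "t \<in> J" unfolding S(4) using S(3) by (intro ideal_in_sum[OF J] ideal_inD(3)[OF J])
qed

section \<open>Homogeneous forms in the three generators\<close>

definition Dg :: "nat \<Rightarrow> (nat \<times> nat \<times> nat) set" where
  "Dg n = {(a, b, j). a + b + j = n}"

definition tmono :: "nat \<times> nat \<times> nat \<Rightarrow> 'k::field ratfun" where
  "tmono q = (case q of (a, b, j) \<Rightarrow> mono a b j)"

text \<open>The value of a ternary form of degree \<open>n\<close> at the three characters. Because
  of the relation between them, different coefficients may give the same value.\<close>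

definition form :: "nat \<Rightarrow> (nat \<times> nat \<times> nat \<Rightarrow> 'k::field) \<Rightarrow> 'k ratfun" where
  "form n c = (\<Sum>q\<in>Dg n. const (c q) * tmono q)"

lemma finite_Dg: "finite (Dg n)"
  by (rule finite_subset[of _ "{..n} \<times> {..n} \<times> {..n}"]) (auto simp: Dg_def)

lemma tmono_pow: "q \<in> Dg n \<Longrightarrow> tmono q \<in> vertex_pow \<Gamma> n"
proof -
  assume q: "q \<in> Dg n"
  obtain a b j where abj: "q = (a, b, j)" by (cases q)
  then have "n \<le> a + b + j" using q by (simp add: Dg_def)
  then show ?thesis unfolding abj tmono_def by (simp add: mono_in_pow)
qed

lemma form_add: "form n c + form n c' = form n (\<lambda>q. c q + c' q)"
  by (simp add: form_def const_add distrib_right sum.distrib)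

lemma form_sum: "(\<Sum>i\<in>S. form n (c i)) = form n (\<lambda>q. \<Sum>i\<in>S. c i q)" for S :: "(nat \<times> nat \<times> nat) set"
proof (induction S rule: infinite_finite_induct)
qed (simp_all add: form_add, simp_all add: form_def)

lemma form_monomial: "q \<in> Dg n \<Longrightarrow> const k * tmono q = form n (\<lambda>q'. if q' = q then k else 0)"
proof -
  assume q: "q \<in> Dg n"
  have "form n (\<lambda>q'. if q' = q then k else 0) = (\<Sum>q'\<in>Dg n. if q' = q then const k * tmono q else 0)"
    unfolding form_def by (intro sum.cong) auto
  then show ?thesis using q finite_Dg by simp
qed

lemma form_shift:
  assumes "\<And>q. q \<in> Dg n \<Longrightarrow> \<exists>q'\<in>Dg (Suc n). u * tmono q = tmono q'"
  shows "\<exists>c'. u * form n c = form (Suc n) c'"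
proof -
  obtain s where s: "\<And>q. q \<in> Dg n \<Longrightarrow> s q \<in> Dg (Suc n) \<and> u * tmono q = tmono (s q)" using assms by metis
  have "u * form n c = (\<Sum>q\<in>Dg n. const (c q) * tmono (s q))"
    unfolding form_def sum_distrib_left using s by (intro sum.cong refl) (simp add: mult.left_commute)
  also have "\<dots> = (\<Sum>q\<in>Dg n. form (Suc n) (\<lambda>q'. if q' = s q then c q else 0))"
    using s by (intro sum.cong refl form_monomial) blast
  finally show ?thesis unfolding form_sum by blast
qed

text \<open>The associated graded ring is spanned over \<open>k\<close> by monomials in the three
  generators; this supplies the successive approximation of elements of the completion.\<close>

lemma pow_homogeneous:
  fixes t :: "'k::field ratfun"
  shows "t \<in> vertex_pow \<Gamma> n \<Longrightarrow> \<exists>c. t - form n c \<in> vertex_pow \<Gamma> (Suc n)"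
proof (induction n arbitrary: t)
  case 0
  then obtain k where k: "t - const k \<in> mR" using vertex_ring_residue[OF pointed] pow_0 by blast
  have "t - const k \<in> vertex_pow \<Gamma> (Suc 0)"
    using pow_mult[OF k, of 1 0] k_subalgebraD(3)[OF kR] by (simp add: pow_0)
  moreover have "const k = form 0 (\<lambda>q'. if q' = (0, 0, 0) then k else 0)"
    using form_monomial[of "(0, 0, 0)" 0 k] by (simp add: Dg_def tmono_def)
  ultimately show ?case by metis
next
  case (Suc n)
  let ?W = "{t :: 'k ratfun. t \<in> R \<and> (\<exists>c. t - form (Suc n) c \<in> vertex_pow \<Gamma> (Suc (Suc n)))}"
  have add: "s + t \<in> ?W" if st: "s \<in> ?W" "t \<in> ?W" for s t
  proof -
    obtain c c' where c: "s - form (Suc n) c \<in> vertex_pow \<Gamma> (Suc (Suc n))" "t - form (Suc n) c' \<in> vertex_pow \<Gamma> (Suc (Suc n))"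
      using st by blast
    have "(s + t) - form (Suc n) (\<lambda>q. c q + c' q) = (s - form (Suc n) c) + (t - form (Suc n) c')"
      by (simp flip: form_add)
    then have "(s + t) - form (Suc n) (\<lambda>q. c q + c' q) \<in> vertex_pow \<Gamma> (Suc (Suc n))"
      using ideal_inD(2)[OF idp c] by metis
    then show ?thesis using st k_subalgebraD(4)[OF kR] by blast
  qed
  have 0: "0 \<in> ?W"
    using ideal_inD(1)[OF idp] k_subalgebraD(2)[OF kR] by (auto intro!: exI[of _ "\<lambda>_. 0"] simp: form_def)
  \<comment> \<open>The multipliers taking the \<open>n\<close>-th power into \<open>?W\<close> form
    an ideal, so it is enough that the three generators belong to it.\<close>
  let ?J = "{a \<in> R. \<forall>b\<in>vertex_pow \<Gamma> n. a * b \<in> ?W}"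
  have J: "ideal_in ?J R"
    unfolding ideal_in_def
  proof (intro conjI ballI)
    show "?J \<subseteq> R" by blast
    show "0 \<in> ?J" using 0 k_subalgebraD(2)[OF kR] by simp
    fix a assume a: "a \<in> ?J"
    show "a + a' \<in> ?J" if a': "a' \<in> ?J" for a'
    proof -
      have "(a + a') * b \<in> ?W" if "b \<in> vertex_pow \<Gamma> n" for b
        unfolding distrib_right by (rule add) (use a a' that in blast)+
      moreover have "a + a' \<in> R" using a a' k_subalgebraD(4)[OF kR] by blast
      ultimately show ?thesis by blast
    qed
    show "r * a \<in> ?J" if r: "r \<in> R" for r
    proof -
      have "(r * a) * b \<in> ?W" if b: "b \<in> vertex_pow \<Gamma> n" for b
      proof -
        have "r * b \<in> vertex_pow \<Gamma> n" using ideal_inD(3)[OF idp r b] .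
        then have "a * (r * b) \<in> ?W" using a by blast
        then show ?thesis by (simp add: mult_ac)
      qed
      then show ?thesis using k_subalgebraD(6)[OF kR r] a by blast
    qed
  qed
  have gen: "u \<in> ?J" if u: "u \<in> mR" and sh: "\<And>q. q \<in> Dg n \<Longrightarrow> \<exists>q'\<in>Dg (Suc n). u * tmono q = tmono q'" for u
  proof -
    have "u * b \<in> ?W" if b: "b \<in> vertex_pow \<Gamma> n" for b
    proof -
      obtain c where c: "b - form n c \<in> vertex_pow \<Gamma> (Suc n)" using Suc.IH[OF b] by blast
      obtain c' where c': "u * form n c = form (Suc n) c'" using form_shift[OF sh] by blast
      have "u * (b - form n c) \<in> vertex_pow \<Gamma> (Suc (Suc n))" using pow_mult[OF u c] .
      then have "u * b - form (Suc n) c' \<in> vertex_pow \<Gamma> (Suc (Suc n))" using c' by (simp add: right_diff_distrib)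
      moreover have "u * b \<in> R" using u b ideal_inD(5)[OF idp] k_subalgebraD(6)[OF kR] by blast
      ultimately show ?thesis by blast
    qed
    then show ?thesis using u by blast
  qed
  have "mR \<subseteq> ?J"
  proof (rule mR_generated[OF J])
    show "character x \<in> ?J"
    proof (rule gen[OF xyz_mR(1)])
      fix q assume q: "q \<in> Dg n"
      obtain a b j where "q = (a, b, j)" by (cases q)
      then have "(Suc a, b, j) \<in> Dg (Suc n)" "character x * tmono q = tmono (Suc a, b, j)"
        using q by (simp_all add: Dg_def tmono_def mult_ac)
      then show "\<exists>q'\<in>Dg (Suc n). character x * tmono q = tmono q'" by blast
    qed
    show "character y \<in> ?J"
    proof (rule gen[OF xyz_mR(2)])
      fix q assume q: "q \<in> Dg n"
      obtain a b j where "q = (a, b, j)" by (cases q)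
      then have "(a, Suc b, j) \<in> Dg (Suc n)" "character y * tmono q = tmono (a, Suc b, j)"
        using q by (simp_all add: Dg_def tmono_def mult_ac)
      then show "\<exists>q'\<in>Dg (Suc n). character y * tmono q = tmono q'" by blast
    qed
    show "character z \<in> ?J"
    proof (rule gen[OF xyz_mR(3)])
      fix q assume q: "q \<in> Dg n"
      obtain a b j where "q = (a, b, j)" by (cases q)
      then have "(a, b, Suc j) \<in> Dg (Suc n)" "character z * tmono q = tmono (a, b, Suc j)"
        using q by (simp_all add: Dg_def tmono_def mult_ac)
      then show "\<exists>q'\<in>Dg (Suc n). character z * tmono q = tmono q'" by blast
    qed
  qed
  have "t \<in> ideal_pow (ring_of R) mR (Suc n)" using Suc.prems by (simp add: vertex_pow_def del: ideal_pow.simps)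
  then have "t \<in> ?W"
  proof (induction rule: ideal_pow_induct)
    case (prod a b)
    then show ?case using \<open>mR \<subseteq> ?J\<close> unfolding vertex_pow_def by blast
  next
    case (sum s t)
    then show ?case by (rule add)
  qed
  then show ?case by blast
qed

section \<open>The completed local ring at a vertex of type A\<close>

definition TR :: "nat \<Rightarrow> 'k::field fps fps fps \<Rightarrow> 'k ratfun" where
  "TR n = tr3 n (character x) (character y) (character z)"

lemma TR_hom:
  fixes F G :: "'a::field fps fps fps"
  shows "TR n F \<in> R" "TR n (F + G) = TR n F + TR n G" "TR n (F * G) - TR n F * TR n G \<in> vertex_pow \<Gamma> n"
proof -
  have p: "u ^ n \<in> vertex_pow \<Gamma> n" if "u \<in> mR" for u :: "'a ratfun"
    using pow_power[OF that, of 1 0 n] k_subalgebraD(3)[OF kR] by (simp add: pow_0)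
  have xR: "character x \<in> (R :: 'a ratfun set)" "character y \<in> (R :: 'a ratfun set)" "character z \<in> (R :: 'a ratfun set)"
    using xyz_mR by blast+
  note h = tr3_hom[OF kR idp xR(1) p[OF xyz_mR(1)] xR(2) p[OF xyz_mR(2)] xR(3) p[OF xyz_mR(3)], folded TR_def]
  show "TR n F \<in> R" "TR n (F + G) = TR n F + TR n G" "TR n (F * G) - TR n F * TR n G \<in> vertex_pow \<Gamma> n"
    by (rule h)+
qed

lemma TR_box: "TR n F = (\<Sum>q\<in>{..<n} \<times> {..<n} \<times> {..<n}. const (fc F q) * tmono q)"
  unfolding TR_def tr3_box tmono_def by (intro sum.cong) auto

lemma TR_A: "TR n F \<in> A"
proof -
  have "tmono q \<in> A" for q :: "nat \<times> nat \<times> nat"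
    using mem by (auto simp: tmono_def mono_character character_mon_alg_iff intro!: add_mem scale_mem split: prod.splits)
  then show ?thesis
    unfolding TR_box by (intro subring_set_sum[OF subring_set_k_subalgebra[OF kA]] k_subalgebraD(6)[OF kA] k_subalgebraD(1)[OF kA])
qed

text \<open>Truncation variable by variable keeps a box of monomials, whereas the filtration counts
  total degree; the box contains all degrees below \<open>n\<close>, and its other monomials lie in
  the \<open>n\<close>-th power.\<close>

lemma TR_graded:
  "TR n F - (\<Sum>i<n. form i (fc F)) \<in> vertex_pow \<Gamma> n"
proof -
  let ?B = "{..<n} \<times> {..<n} \<times> {..<n}"
  have "(\<Sum>i<n. form i (fc F)) = (\<Sum>q\<in>(\<Union>i<n. Dg i). const (fc F q) * tmono q)"
    unfolding form_def by (rule sum.UNION_disjoint[symmetric]) (use finite_Dg in \<open>auto simp: Dg_def\<close>)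
  moreover have "(\<Union>i<n. Dg i) \<subseteq> ?B" by (auto simp: Dg_def)
  ultimately have "TR n F - (\<Sum>i<n. form i (fc F)) = (\<Sum>q\<in>?B - (\<Union>i<n. Dg i). const (fc F q) * tmono q)"
    unfolding TR_box by (simp add: sum_diff)
  also have "\<dots> \<in> vertex_pow \<Gamma> n"
  proof (intro ideal_in_sum[OF idp] ideal_inD(3)[OF idp] k_subalgebraD(1)[OF kR])
    fix q :: "nat \<times> nat \<times> nat" assume q: "q \<in> ?B - (\<Union>i<n. Dg i)"
    obtain a b j where abj: "q = (a, b, j)" by (cases q)
    then have "\<not> a + b + j < n" using q by (auto simp: Dg_def)
    then show "tmono q \<in> vertex_pow \<Gamma> n" unfolding abj tmono_def prod.case by (intro mono_in_pow) simp
  qed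
  finally show ?thesis .
qed

lemma TR_step: "TR (Suc n) F - TR n F \<in> vertex_pow \<Gamma> n"
proof -
  have 1: "TR (Suc n) F - (\<Sum>i<Suc n. form i (fc F)) \<in> vertex_pow \<Gamma> n"
    using TR_graded[of "Suc n" F] pow_dec[of n] by blast
  have 2: "form n (fc F) \<in> vertex_pow \<Gamma> n"
    unfolding form_def by (intro ideal_in_sum[OF idp] ideal_inD(3)[OF idp] k_subalgebraD(1)[OF kR] tmono_pow)
  have "TR (Suc n) F - TR n F = (TR (Suc n) F - (\<Sum>i<Suc n. form i (fc F))) + form n (fc F) - (TR n F - (\<Sum>i<n. form i (fc F)))"
    by simp
  also have "\<dots> \<in> vertex_pow \<Gamma> n"
    by (intro ideal_in_diff[OF srR idp ideal_inD(2)[OF idp 1 2] TR_graded])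
  finally show ?thesis .
qed

text \<open>A compatible sequence is approximated degree by degree, and the chosen forms of all
  degrees are the coefficients of the series.\<close>

lemma TR_surj:
  fixes r :: "nat \<Rightarrow> 'k::field ratfun"
  assumes r: "\<And>n. r n \<in> R" "\<And>n. r (Suc n) - r n \<in> vertex_pow \<Gamma> n"
  shows "\<exists>F. \<forall>n. TR n F - r n \<in> vertex_pow \<Gamma> n"
proof -
  define C where "C n t = (SOME c. t - form n c \<in> vertex_pow \<Gamma> (Suc n))" for n and t :: "'k ratfun"
  have C: "t - form n (C n t) \<in> vertex_pow \<Gamma> (Suc n)" if "t \<in> vertex_pow \<Gamma> n" for n t
    unfolding C_def using pow_homogeneous[OF that] by (rule someI_ex)
  \<comment> \<open>\<open>s n\<close> is the sum of the forms of degree below \<open>n\<close>; the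
    next form represents \<open>r (Suc n) - s n\<close> modulo the next power.\<close>
  define s where "s = rec_nat 0 (\<lambda>n s. s + form n (C n (r (Suc n) - s)))"
  have s: "s 0 = 0" "\<And>n. s (Suc n) = s n + form n (C n (r (Suc n) - s n))" by (simp_all add: s_def)
  have rs: "r n - s n \<in> vertex_pow \<Gamma> n" for n
  proof (induction n)
    case 0
    show ?case using r(1) by (simp add: s pow_0)
  next
    case (Suc n)
    have "r (Suc n) - s n = (r (Suc n) - r n) + (r n - s n)" by simp
    also have "\<dots> \<in> vertex_pow \<Gamma> n" by (intro ideal_inD(2)[OF idp] r(2) Suc)
    finally have "(r (Suc n) - s n) - form n (C n (r (Suc n) - s n)) \<in> vertex_pow \<Gamma> (Suc n)" by (rule C)
    then show ?case by (simp add: s algebra_simps)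
  qed
  define c where "c q = (case q of (a, b, j) \<Rightarrow> C (a + b + j) (r (Suc (a + b + j)) - s (a + b + j)) q)" for q
  define F where "F = Abs_fps (\<lambda>j. Abs_fps (\<lambda>b. Abs_fps (\<lambda>a. c (a, b, j))))"
  have fF: "fc F = c" by (auto simp: fc_def F_def fun_eq_iff)
  have "form n c = form n (C n (r (Suc n) - s n))" for n
    unfolding form_def by (intro sum.cong refl) (auto simp: Dg_def c_def)
  then have "s n = (\<Sum>i<n. form i (fc F))" for n by (induction n) (simp_all add: s fF)
  then have g: "TR n F - s n \<in> vertex_pow \<Gamma> n" for n using TR_graded[of n F] by simp
  have "TR n F - r n = (TR n F - s n) - (r n - s n)" for n by simp
  then have "TR n F - r n \<in> vertex_pow \<Gamma> n" for n using ideal_in_diff[OF srR idp g rs] by metis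
  then show ?thesis by blast
qed

end

context A_monoid
begin

lemma TR_diff: "TR n (F - G) = TR n F - TR n G"
  using TR_hom(2)[of n "F - G" G] by simp

lemma cf_const_tmono: "cf (const k * tmono (a, b, j)) g = (if g = scale a x + scale b y + scale j z then k else 0)"
  unfolding tmono_def prod.case mono_character by (simp add: cf_monomial)

lemma TR_indicator:
  assumes "\<And>q. fc F q = (if q = q0 then k else 0)"
  shows "TR n F = (if q0 \<in> {..<n} \<times> {..<n} \<times> {..<n} then const k * tmono q0 else 0)"
proof -
  have "TR n F = (\<Sum>q\<in>{..<n} \<times> {..<n} \<times> {..<n}. if q = q0 then const k * tmono q0 else 0)"
    unfolding TR_box assms by (intro sum.cong) auto
  then show ?thesis by simp
qed

lemma TR_const: "TR n (fps_const (fps_const (fps_const k))) = (if n = 0 then 0 else const k)"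
proof -
  have "fc (fps_const (fps_const (fps_const k))) q = (if q = (0, 0, 0) then k else 0)" for q
    by (cases q) (auto simp: fc_def)
  from TR_indicator[OF this, of n] show ?thesis by (simp add: tmono_def)
qed

lemma fc_1: "fc 1 (a, b, j) = (if (a, b, j) = (0, 0, 0) then 1 else 0)"
  by (auto simp: fc_def)

lemma fc_A_equation:
  "fc (A_equation c) q = (if q = (1, 1, 0) then 1 else 0) - (if q = (0, 0, Suc c) then 1 else 0)"
proof -
  obtain a b j where q: "q = (a, b, j)" by (cases q)
  have "fc (A_equation c * 1) (a, b, j) = (if q = (1, 1, 0) then 1 else 0) - (if q = (0, 0, Suc c) then 1 else 0)"
    unfolding fc_A_equation_mult fc_1 q by auto
  then show ?thesis by (simp add: q)
qed

text \<open>The two monomials of the equation have the same value and cancel if both survive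
  truncation. If only \<open>x y\<close> survives, then \<open>n \<le> c + 1\<close> and the value
  of \<open>z^(c+1)\<close> is in the \<open>n\<close>-th power.\<close>

lemma TR_A_equation:
  assumes d: "d = Suc c" "1 \<le> c"
  shows "TR n (A_equation c) \<in> vertex_pow \<Gamma> n"
proof -
  let ?B = "{..<n} \<times> {..<n} \<times> {..<n}"
  have "TR n (A_equation c) = (\<Sum>q\<in>?B. (if q = (1, 1, 0) then tmono q else 0) - (if q = (0, 0, Suc c) then tmono q else 0))"
    unfolding TR_box fc_A_equation
    by (intro sum.cong) (auto simp: const_minus simp del: Suc_eq_plus1)
  also have "\<dots> = (if (1, 1, 0) \<in> ?B then tmono (1, 1, 0) else 0) - (if (0, 0, Suc c) \<in> ?B then tmono (0, 0, Suc c) else 0)"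
    unfolding sum_subtractf by (simp add: sum.delta')
  also have "tmono (1, 1, 0) = tmono (0, 0, Suc c)"
    using rel d(1) unfolding tmono_def prod.case mono_character by (simp add: scale_1)
  also have "(if (1, 1, 0) \<in> ?B then tmono (0, 0, Suc c) else 0) - (if (0, 0, Suc c) \<in> ?B then tmono (0, 0, Suc c) else 0) \<in> vertex_pow \<Gamma> n"
  proof (cases "1 < n \<and> \<not> Suc c < n")
    case True
    then have "tmono (0, 0, Suc c) \<in> vertex_pow \<Gamma> n" unfolding tmono_def prod.case by (intro mono_in_pow) simp
    then show ?thesis using True by auto
  next
    case False
    then have "(1, 1, 0) \<in> ?B \<longleftrightarrow> (0, 0, Suc c) \<in> ?B" using d(2) by auto
    then show ?thesis by (simp only: diff_self ideal_inD(1)[OF idp])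
  qed
  finally show ?thesis .
qed

text \<open>Division leaves a remainder of degree below \<open>d\<close> in \<open>z\<close>; its
  monomials have distinct exponents by \<open>nf_unique\<close>, so its coefficients can be read off
  from the truncations and must vanish.\<close>

lemma TR_kernel:
  assumes d: "d = Suc c" "1 \<le> c"
  shows "(\<forall>n. TR n F \<in> vertex_pow \<Gamma> n) \<longleftrightarrow> (\<exists>G. F = A_equation c * G)"
proof
  assume "\<exists>G. F = A_equation c * G"
  then obtain G where F: "F = A_equation c * G" by blast
  show "\<forall>n. TR n F \<in> vertex_pow \<Gamma> n"
  proof
    fix n
    have "TR n F = (TR n (A_equation c * G) - TR n (A_equation c) * TR n G) + TR n (A_equation c) * TR n G" by (simp add: F)
    also have "\<dots> \<in> vertex_pow \<Gamma> n"
      by (intro ideal_inD(2)[OF idp] TR_hom(3) ideal_inD(4)[OF idp] TR_hom(1) TR_A_equation[OF d])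
    finally show "TR n F \<in> vertex_pow \<Gamma> n" .
  qed
next
  assume F: "\<forall>n. TR n F \<in> vertex_pow \<Gamma> n"
  obtain G where G: "\<And>a b j. c + 1 \<le> j \<Longrightarrow> fc (F - A_equation c * G) (a, b, j) = 0"
    using A_equation_division[of c F] by blast
  define H where "H = F - A_equation c * G"
  have HT: "TR n H \<in> vertex_pow \<Gamma> n" for n
  proof -
    have "TR n (A_equation c * G) = (TR n (A_equation c * G) - TR n (A_equation c) * TR n G) + TR n (A_equation c) * TR n G" by simp
    also have "\<dots> \<in> vertex_pow \<Gamma> n"
      by (intro ideal_inD(2)[OF idp] TR_hom(3) ideal_inD(4)[OF idp] TR_hom(1) TR_A_equation[OF d])
    finally show ?thesis unfolding H_def TR_diff using F ideal_in_diff[OF srR idp] by blast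
  qed
  have "fc H (a, b, j) = 0" for a b j
  proof (cases "j < d")
    case True
    let ?g = "scale a x + scale b y + scale j z"
    \<comment> \<open>Large enough for the box to contain the triple and to exceed the weight of
      \<open>?g\<close>, as \<open>pow_coeff\<close> requires.\<close>
    define n where "n = Suc (a + b + j + nat (pr ?g w))"
    have "cf (TR n H) ?g = 0" by (rule pow_coeff[OF TR_A HT]) (simp add: n_def)
    moreover have "cf (TR n H) ?g = (\<Sum>q\<in>{..<n} \<times> {..<n} \<times> {..<n}. cf (const (fc H q) * tmono q) ?g)"
    proof -
      have "const (fc H q) * tmono q \<in> mon_alg UNIV" for q
        by (cases q) (simp only: tmono_def prod.case mono_character cf_monomial(1))
      then show ?thesis unfolding TR_box by (subst cf_sum[THEN conjunct2]) auto
    qed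
    moreover have "\<dots> = (\<Sum>q\<in>{..<n} \<times> {..<n} \<times> {..<n}. if q = (a, b, j) then fc H (a, b, j) else 0)"
    proof (rule sum.cong[OF refl])
      fix q :: "nat \<times> nat \<times> nat"
      obtain a' b' j' where q: "q = (a', b', j')" by (cases q)
      show "cf (const (fc H q) * tmono q) ?g = (if q = (a, b, j) then fc H (a, b, j) else 0)"
      proof (cases "j' < d")
        case True
        then have "?g = scale a' x + scale b' y + scale j' z \<longleftrightarrow> q = (a, b, j)"
          using nf_unique[of j j' a b a' b'] \<open>j < d\<close> q by auto
        then show ?thesis by (auto simp: q cf_const_tmono)
      next
        case False
        then have "fc H q = 0" using G[of j' a' b'] d(1) unfolding q H_def by simp
        moreover have "q \<noteq> (a, b, j)" using False \<open>j < d\<close> q by auto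
        ultimately show ?thesis by simp
      qed
    qed
    moreover have "\<dots> = fc H (a, b, j)" by (simp add: n_def)
    ultimately show ?thesis by simp
  next
    case False
    then show ?thesis using G[of j a b] d(1) unfolding H_def by simp
  qed
  then have "H = 0" by (intro fps3_eqI) (auto simp: fc_def)
  then show "\<exists>G. F = A_equation c * G" unfolding H_def by auto
qed

text \<open>Evaluation of a power series at the three characters, as an element of the inverse
  limit.\<close>

definition psi :: "'k::field fps fps fps \<Rightarrow> nat \<Rightarrow> 'k ratfun set" where
  "psi F n = vertex_pow \<Gamma> n +>\<^bsub>ring_of R\<^esub> TR n F"

lemma completion_vertex:
  "carrier (completion (ring_of R) mR) = {f. \<forall>n. f n \<in> carrier (ring_of R Quot vertex_pow \<Gamma> n) \<and> f (Suc n) \<subseteq> f n}"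
  "f \<otimes>\<^bsub>completion (ring_of R) mR\<^esub> g = (\<lambda>n. f n \<otimes>\<^bsub>ring_of R Quot vertex_pow \<Gamma> n\<^esub> g n)"
  "f \<oplus>\<^bsub>completion (ring_of R) mR\<^esub> g = (\<lambda>n. f n \<oplus>\<^bsub>ring_of R Quot vertex_pow \<Gamma> n\<^esub> g n)"
  "\<one>\<^bsub>completion (ring_of R) mR\<^esub> = (\<lambda>n. \<one>\<^bsub>ring_of R Quot vertex_pow \<Gamma> n\<^esub>)"
  unfolding completion_def Let_def vertex_pow_def by simp_all

lemma psi_mem: "psi F \<in> carrier (completion (ring_of R) mR)"
  unfolding completion_vertex quot_ring_of(1)[OF srR idp]
proof (intro CollectI allI conjI)
  fix n
  show "\<exists>a. psi F n = vertex_pow \<Gamma> n +>\<^bsub>ring_of R\<^esub> a \<and> a \<in> R" unfolding psi_def using TR_hom(1) by blast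
  show "psi F (Suc n) \<subseteq> psi F n"
  proof
    fix t assume "t \<in> psi F (Suc n)"
    then obtain h where h: "h \<in> vertex_pow \<Gamma> (Suc n)" "t = h + TR (Suc n) F" unfolding psi_def coset_ring_of by blast
    then have "h + (TR (Suc n) F - TR n F) \<in> vertex_pow \<Gamma> n" using pow_dec ideal_inD(2)[OF idp _ TR_step] by blast
    moreover have "t = (h + (TR (Suc n) F - TR n F)) + TR n F" using h by simp
    ultimately show "t \<in> psi F n" unfolding psi_def coset_ring_of by blast
  qed
qed

lemma psi_surj:
  fixes f :: "nat \<Rightarrow> 'k::field ratfun set"
  assumes f: "f \<in> carrier (completion (ring_of R) mR)" shows "\<exists>F. psi F = f"
proof -
  have "\<forall>n. \<exists>a. f n = vertex_pow \<Gamma> n +>\<^bsub>ring_of R\<^esub> a \<and> a \<in> R" and sub: "\<And>n. f (Suc n) \<subseteq> f n"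
    using f unfolding completion_vertex quot_ring_of(1)[OF srR idp] by blast+
  from choice[OF this(1)] obtain r where r: "\<And>n. f n = vertex_pow \<Gamma> n +>\<^bsub>ring_of R\<^esub> r n" "\<And>n. r n \<in> R" by blast
  have "r (Suc n) - r n \<in> vertex_pow \<Gamma> n" for n
  proof -
    have "0 + r (Suc n) \<in> f (Suc n)" unfolding r(1) coset_ring_of using ideal_inD(1)[OF idp] by blast
    then have "r (Suc n) \<in> f n" using sub by auto
    then show ?thesis unfolding r(1) coset_ring_of by auto
  qed
  then obtain F where F: "\<And>n. TR n F - r n \<in> vertex_pow \<Gamma> n" using TR_surj[of r] r(2) by blast
  have "psi F n = f n" for n
    unfolding psi_def r(1) using coset_eq_iff[OF srR idp TR_hom(1) r(2)] F by blast
  then show ?thesis by blast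
qed

lemma psi_eq_iff:
  assumes d: "d = Suc c" "1 \<le> c"
  shows "psi F = psi G \<longleftrightarrow> (\<exists>H. F - G = A_equation c * H)"
  unfolding TR_kernel[OF d, symmetric] TR_diff fun_eq_iff psi_def coset_eq_iff[OF srR idp TR_hom(1) TR_hom(1)] ..

lemma psi_hom:
  "psi (F * G) = psi F \<otimes>\<^bsub>completion (ring_of R) mR\<^esub> psi G"
  "psi (F + G) = psi F \<oplus>\<^bsub>completion (ring_of R) mR\<^esub> psi G"
  "psi (fps_const (fps_const (fps_const k))) = (\<lambda>n. ideal_pow (ring_of R) mR n +>\<^bsub>ring_of R\<^esub> const k)"
proof -
  show "psi (F * G) = psi F \<otimes>\<^bsub>completion (ring_of R) mR\<^esub> psi G"
  proof
    fix n
    have "vertex_pow \<Gamma> n +>\<^bsub>ring_of R\<^esub> TR n (F * G) = vertex_pow \<Gamma> n +>\<^bsub>ring_of R\<^esub> (TR n F * TR n G)"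
      by (rule iffD2[OF coset_eq_iff[OF srR idp TR_hom(1) k_subalgebraD(6)[OF kR TR_hom(1) TR_hom(1)]] TR_hom(3)])
    then show "psi (F * G) n = (psi F \<otimes>\<^bsub>completion (ring_of R) mR\<^esub> psi G) n"
      unfolding completion_vertex psi_def quot_ring_of(2)[OF srR idp TR_hom(1) TR_hom(1)] .
  qed
  show "psi (F + G) = psi F \<oplus>\<^bsub>completion (ring_of R) mR\<^esub> psi G"
    unfolding completion_vertex fun_eq_iff psi_def quot_ring_of(3)[OF srR idp TR_hom(1) TR_hom(1)] TR_hom(2) by blast
  show "psi (fps_const (fps_const (fps_const k))) = (\<lambda>n. ideal_pow (ring_of R) mR n +>\<^bsub>ring_of R\<^esub> const k)"
  proof
    fix n
    have "vertex_pow \<Gamma> n +>\<^bsub>ring_of R\<^esub> TR n (fps_const (fps_const (fps_const k))) = vertex_pow \<Gamma> n +>\<^bsub>ring_of R\<^esub> const k"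
    proof (rule iffD2[OF coset_eq_iff[OF srR idp TR_hom(1) k_subalgebraD(1)[OF kR]]])
      show "TR n (fps_const (fps_const (fps_const k))) - const k \<in> vertex_pow \<Gamma> n"
        by (simp add: TR_const pow_0 ideal_inD(1)[OF idp] k_subalgebraD(7)[OF kR k_subalgebraD(1)[OF kR]])
    qed
    then show "psi (fps_const (fps_const (fps_const k))) n = ideal_pow (ring_of R) mR n +>\<^bsub>ring_of R\<^esub> const k"
      unfolding psi_def by (simp add: vertex_pow_def)
  qed
qed

theorem rdp_type_A_vertex:
  assumes d: "d = Suc c" "1 \<le> c"
  shows "rdp_type_A c (vertex_ring \<Gamma> :: 'k::field ratfun set)"
proof -
  let ?C = "completion (ring_of (R :: 'k ratfun set)) mR"
  let ?S = "ring_of (UNIV :: 'k fps fps fps set)"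
  define J where "J = genideal ?S {A_equation c}"
  have J: "J = {A_equation c * G | G. True}" unfolding J_def by (rule genideal_principal)
  have idJ: "ideal_in J UNIV" unfolding J_def by (intro genideal_ring_of(1)[OF subring_set_UNIV]) simp
  \<comment> \<open>The isomorphism has to start at the completion. The fibres of \<open>psi\<close>
    are the cosets of \<open>J\<close>, so taking fibres is the required map.\<close>
  define h where "h f = {F :: 'k fps fps fps. psi F = f}" for f
  have h: "h (psi F) = J +>\<^bsub>?S\<^esub> F" for F
  proof (intro Set.set_eqI iffI)
    fix G assume "G \<in> h (psi F)"
    then obtain H where "G - F = A_equation c * H" using psi_eq_iff[OF d, of G F] by (auto simp: h_def)
    then have "G = A_equation c * H + F" by (simp add: diff_eq_eq)
    then show "G \<in> J +>\<^bsub>?S\<^esub> F" unfolding coset_ring_of J by blast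
  next
    fix G assume "G \<in> J +>\<^bsub>?S\<^esub> F"
    then obtain H where "G = A_equation c * H + F" unfolding coset_ring_of J by blast
    then have "G - F = A_equation c * H" by simp
    then show "G \<in> h (psi F)" using psi_eq_iff[OF d, of G F] by (auto simp: h_def)
  qed
  note Q = quot_ring_of[OF subring_set_UNIV idJ]
  have inj: "psi F = psi G" if "J +>\<^bsub>?S\<^esub> F = J +>\<^bsub>?S\<^esub> G" for F G
  proof -
    have "F - G \<in> J" using coset_eq_iff[OF subring_set_UNIV idJ] that by blast
    then show ?thesis using psi_eq_iff[OF d, of F G] J by blast
  qed
  have one: "psi (1 :: 'k fps fps fps) = \<one>\<^bsub>?C\<^esub>"
  proof -
    have 1: "(1 :: 'k fps fps fps) = fps_const (fps_const (fps_const 1))" by simp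
    show ?thesis
      unfolding 1 psi_hom(3) completion_vertex(4) quot_ring_of(4)[OF srR idp] by (simp add: vertex_pow_def)
  qed
  have hom: "h \<in> ring_hom ?C (?S Quot J)"
  proof (rule ring_hom_memI)
    fix f assume "f \<in> carrier ?C"
    then obtain F where "f = psi F" using psi_surj by metis
    then show "h f \<in> carrier (?S Quot J)" unfolding Q(1) using h by auto
  next
    fix f g assume "f \<in> carrier ?C" "g \<in> carrier ?C"
    then obtain F G where "f = psi F" "g = psi G" using psi_surj by metis
    then show "h (f \<otimes>\<^bsub>?C\<^esub> g) = h f \<otimes>\<^bsub>?S Quot J\<^esub> h g" "h (f \<oplus>\<^bsub>?C\<^esub> g) = h f \<oplus>\<^bsub>?S Quot J\<^esub> h g"
      by (simp_all add: h Q flip: psi_hom)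
  next
    show "h \<one>\<^bsub>?C\<^esub> = \<one>\<^bsub>?S Quot J\<^esub>" unfolding one[symmetric] h Q(4) ..
  qed
  have "bij_betw h (carrier ?C) (carrier (?S Quot J))"
    unfolding bij_betw_def
  proof
    show "inj_on h (carrier ?C)"
    proof (rule inj_onI)
      fix f g assume "f \<in> carrier ?C" "g \<in> carrier ?C" and eq: "h f = h g"
      then obtain F G where FG: "f = psi F" "g = psi G" using psi_surj by metis
      then show "f = g" using eq inj unfolding FG h by blast
    qed
    show "h ` carrier ?C = carrier (?S Quot J)"
    proof
      show "h ` carrier ?C \<subseteq> carrier (?S Quot J)" using ring_hom_closed[OF hom] by blast
      show "carrier (?S Quot J) \<subseteq> h ` carrier ?C"
      proof
        fix u assume "u \<in> carrier (?S Quot J)"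
        then obtain F where "u = J +>\<^bsub>?S\<^esub> F" unfolding Q(1) by blast
        then show "u \<in> h ` carrier ?C" using h[of F] psi_mem[of F] by (intro image_eqI[of _ _ "psi F"]) auto
      qed
    qed
  qed
  then have iso: "h \<in> ring_iso ?C (?S Quot J)" using hom by (simp add: ring_iso_def)
  have "\<forall>k. h (\<lambda>n. ideal_pow (ring_of R) mR n +>\<^bsub>ring_of R\<^esub> const k) = J +>\<^bsub>?S\<^esub> fps_const (fps_const (fps_const k))"
    unfolding psi_hom(3)[symmetric] h by blast
  then show ?thesis
    unfolding rdp_type_A_def Let_def nonunits_ring_of
    using iso d(2) local_ring_ring_of[OF V(1)] unfolding J_def by blast
qed

end

section \<open>Singular points of a subdivision\<close>

context chain
begin

text \<open>All pairings are affine along the run: with \<open>d = r - l\<close>, the values of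
  \<open>x\<close> are 0, 1, ..., \<open>d\<close>, those of \<open>y\<close> are \<open>d\<close>,
  ..., 1, 0, and \<open>z\<close> is constantly 1. This is the relation
  \<open>x + y = d z\<close>.\<close>

lemma A_monoid_run:
  assumes lr: "l < r" "r \<le> N" and two: "\<And>j. l < j \<Longrightarrow> j < r \<Longrightarrow> e j = 2"
  shows "A_monoid (Gam l r) (v l + v r) (nn (v l)) (- nn (v r)) (nn (v l) - nn (v (Suc l))) (r - l)"
proof -
  let ?x = "nn (v l)" and ?y = "- nn (v r)" and ?z = "nn (v l) - nn (v (Suc l))"
  have d1: "dt (v l) (v (Suc l)) = 1" "dt (v (Suc l)) (v l) = - 1"
    using det1[of l] dt_swap[of "v l" "v (Suc l)"] lr by auto
  have lin: "pr m (v j) = pr m (v l) + int (j - l) * (pr m (v (Suc l)) - pr m (v l))" if "l \<le> j" "j \<le> r" for m j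
    using run_linear[of l r j m] two lr that by auto
  have xv: "pr ?x (v j) = int (j - l)" if "l \<le> j" "j \<le> r" for j
    using lin[OF that, of ?x] d1 by (simp add: pr_nn)
  have zv: "pr ?z (v j) = 1" if "l \<le> j" "j \<le> r" for j
    using lin[OF that, of ?z] d1 by (simp add: pr_nn pr_diff)
  have dlr: "dt (v l) (v r) = int (r - l)" using xv[of r] lr by (simp add: pr_nn)
  have yv: "pr ?y (v j) = int (r - l) - int (j - l)" if "l \<le> j" "j \<le> r" for j
  proof -
    have yl: "pr ?y (v l) = int (r - l)" using dlr dt_swap[of "v l" "v r"] by (simp add: pr_nn)
    have yr: "pr ?y (v r) = 0" by (simp add: pr_nn)
    have "0 = int (r - l) + int (r - l) * (pr ?y (v (Suc l)) - int (r - l))"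
      using lin[OF less_imp_le[OF lr(1)] order_refl, of ?y] unfolding yl yr .
    then have "int (r - l) * (pr ?y (v (Suc l)) - int (r - l) + 1) = 0" by (simp only: distrib_left mult_1_right add.commute)
    then have "pr ?y (v (Suc l)) - int (r - l) = - 1" using lr by (simp only: mult_eq_0_iff) linarith
    then show ?thesis using lin[OF that, of ?y] unfolding yl by simp
  qed
  have rel: "?x + ?y = scale (r - l) ?z"
    by (rule eq_if_pr_eq[of "v l" "v (Suc l)"])
      (use d1 xv[of l] xv[of "Suc l"] yv[of l] yv[of "Suc l"] zv[of l] zv[of "Suc l"] lr in \<open>auto simp: pr_add pr_diff pr_scale pr_nn\<close>)
  have ss: "smul k m = scale (nat k) m" if "0 \<le> k" for k m using that by (simp add: smul_def scale_def)
  have mem: "?x \<in> Gam l r" "?y \<in> Gam l r" "?z \<in> Gam l r"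
    using xv[of l] xv[of r] yv[of l] yv[of r] zv[of l] zv[of r] lr by (auto simp: dual2_def)
  show ?thesis
  proof
    show "pointed (v l + v r) (Gam l r)" using pointed_Gam lr by blast
    show "dt ?x ?y \<noteq> 0" using dlr lr by (simp add: dt_def nn_def algebra_simps)
    show "?x \<in> Gam l r" "?y \<in> Gam l r" "?z \<in> Gam l r" by fact+
    show "0 < r - l" using lr by simp
    show "?x + ?y = scale (r - l) ?z" by fact
  next
    fix m assume m: "m \<in> Gam l r"
    \<comment> \<open>The sign of the slope decides whether \<open>m\<close> is a multiple of
      \<open>z\<close> plus a multiple of \<open>x\<close> or of \<open>y\<close>.\<close>
    define \<delta> where "\<delta> = pr m (v (Suc l)) - pr m (v l)"
    have ge: "0 \<le> pr m (v l)" "0 \<le> pr m (v r)" using m by (auto simp: dual2_def)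
    \<comment> \<open>Surplus copies of \<open>z\<close> are traded in groups of
      \<open>r - l\<close> for \<open>x + y\<close>, which brings the coefficient of
      \<open>z\<close> below \<open>r - l\<close>.\<close>
    have split: "scale k ?z = scale (k div (r - l)) ?x + scale (k div (r - l)) ?y + scale (k mod (r - l)) ?z" for k
    proof -
      have "scale k ?z = scale (k div (r - l) * (r - l) + k mod (r - l)) ?z" by (simp only: div_mult_mod_eq)
      also have "\<dots> = scale (k div (r - l)) (?x + ?y) + scale (k mod (r - l)) ?z"
        unfolding rel scale_add scale_scale ..
      finally show ?thesis unfolding scale_distrib .
    qed
    have lt: "k mod (r - l) < r - l" for k using lr by simp
    show "\<exists>a b i. i < r - l \<and> m = scale a ?x + scale b ?y + scale i ?z"
    proof (cases "0 \<le> \<delta>")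
      case True
      have "m = smul (pr m (v l)) ?z + smul \<delta> ?x"
        by (rule eq_if_pr_eq[of "v l" "v (Suc l)"])
          (use d1 xv[of l] xv[of "Suc l"] zv[of l] zv[of "Suc l"] lr in \<open>auto simp: pr_add pr_smul \<delta>_def\<close>)
      then have "m = scale (nat (pr m (v l))) ?z + scale (nat \<delta>) ?x" using ss ge True by simp
      then have "m = scale (nat (pr m (v l)) div (r - l) + nat \<delta>) ?x + scale (nat (pr m (v l)) div (r - l)) ?y + scale (nat (pr m (v l)) mod (r - l)) ?z"
        unfolding scale_add using split[of "nat (pr m (v l))"] by (simp only: add_ac)
      then show ?thesis using lt by blast
    next
      case False
      define D where "D = int (r - l)"
      have mr: "pr m (v r) = pr m (v l) + D * \<delta>" using lin[of r m] lr by (simp add: \<delta>_def D_def)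
      have y1: "pr ?y (v l) = D" "pr ?y (v (Suc l)) = D - 1" using yv[of l] yv[of "Suc l"] lr by (simp_all add: D_def)
      have z1: "pr ?z (v l) = 1" "pr ?z (v (Suc l)) = 1" using zv[of l] zv[of "Suc l"] lr by simp_all
      have "m = smul (pr m (v r)) ?z + smul (- \<delta>) ?y"
      proof (rule eq_if_pr_eq[of "v l" "v (Suc l)"])
        show "pr m (v l) = pr (smul (pr m (v r)) ?z + smul (- \<delta>) ?y) (v l)"
          unfolding pr_add pr_smul y1 z1 mr by (simp add: algebra_simps)
        show "pr m (v (Suc l)) = pr (smul (pr m (v r)) ?z + smul (- \<delta>) ?y) (v (Suc l))"
          unfolding pr_add pr_smul y1 z1 mr by (simp add: algebra_simps \<delta>_def)
      qed (use d1 in simp)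
      then have "m = scale (nat (pr m (v r))) ?z + scale (nat (- \<delta>)) ?y" using ss ge False by simp
      then have "m = scale (nat (pr m (v r)) div (r - l)) ?x + scale (nat (pr m (v r)) div (r - l) + nat (- \<delta>)) ?y + scale (nat (pr m (v r)) mod (r - l)) ?z"
        unfolding scale_add using split[of "nat (pr m (v r))"] by (simp only: add_ac)
      then show ?thesis using lt by blast
    qed
  next
    \<comment> \<open>A sum of two nonzero exponents is at least 2 at every interior vector, while
      \<open>x\<close> and \<open>z\<close> are 1 at the first of these and \<open>y\<close> is 1 at
      the last.\<close>
    fix m n assume d2: "2 \<le> r - l" and mn: "m \<in> Gam l r - {0}" "n \<in> Gam l r - {0}"
    have "2 \<le> pr (m + n) (v j)" if "l < j" "j < r" for j
      using Gam_between_pos[of m l r j] Gam_between_pos[of n l r j] mn that lr by (auto simp: pr_add)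
    from this[of "Suc l"] this[of "r - 1"]
    have "2 \<le> pr (m + n) (v (Suc l))" "2 \<le> pr (m + n) (v (r - 1))" using d2 by auto
    moreover have "pr ?x (v (Suc l)) = 1" "pr ?z (v (Suc l)) = 1" "pr ?y (v (r - 1)) = 1"
      using xv[of "Suc l"] zv[of "Suc l"] yv[of "r - 1"] lr d2 by auto
    ultimately show "m + n \<noteq> ?x \<and> m + n \<noteq> ?y \<and> m + n \<noteq> ?z" by auto
  qed
qed

text \<open>For a cone spanned by neighbours \<open>d\<close> is 1, only the zeroth power of
  \<open>z\<close> occurs in the expansion, and the chart is the whole image of the polynomial
  ring.\<close>

lemma regular_smooth:
  assumes "a < N" "T \<in> Spec (mon_alg (Gam a (Suc a)) :: 'k::field ratfun set)"
  shows "regular_local_ring (ring_of T)"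
proof -
  interpret A_monoid "Gam a (Suc a)" "v a + v (Suc a)" "nn (v a)" "- nn (v (Suc a))" "nn (v a) - nn (v (Suc a))" "Suc a - a"
    using assms(1) by (intro A_monoid_run) auto
  have "range hh = (A :: 'k ratfun set)"
  proof
    show "range hh \<subseteq> (A :: 'k ratfun set)" by (rule range_hh)
    show "(A :: 'k ratfun set) \<subseteq> range hh"
    proof
      fix t :: "'k ratfun" assume "t \<in> A"
      from A_expand[OF this] show "t \<in> range hh" by auto
    qed
  qed
  then show ?thesis using regular_T[of T] assms(2) by simp
qed

definition runs_in :: "nat set \<Rightarrow> bool" where
  "runs_in I \<longleftrightarrow> (\<forall>a b j. adjacent_in I a b \<longrightarrow> a < j \<longrightarrow> j < b \<longrightarrow> e j = 2)"

lemma rdp_run: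
  assumes "l < r" "r \<le> N" "\<And>j. l < j \<Longrightarrow> j < r \<Longrightarrow> e j = 2" "Suc l < r"
  shows "rdp_type_A (r - l - 1) (vertex_ring (Gam l r) :: 'k::field ratfun set)"
    "\<not> regular_local_ring (ring_of (vertex_ring (Gam l r) :: 'k::field ratfun set))"
proof -
  interpret A_monoid "Gam l r" "v l + v r" "nn (v l)" "- nn (v r)" "nn (v l) - nn (v (Suc l))" "r - l"
    using assms by (intro A_monoid_run)
  show "rdp_type_A (r - l - 1) (vertex_ring (Gam l r) :: 'k ratfun set)" using assms(4) by (intro rdp_type_A_vertex) auto
  show "\<not> regular_local_ring (ring_of (vertex_ring (Gam l r) :: 'k ratfun set))" using assms(4) by (intro not_regular) auto
qed

text \<open>A point off the vertices lies on the chart of a ray. That chart is also open in the cone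
  spanned by the ray and its neighbour in the full chain, which is smooth whether or not it belongs
  to the subdivision.\<close>

lemma singular_points_TV:
  assumes I: "index_set I" and runs: "runs_in I"
  shows "singular_points (TV I :: 'k::field ratfun set set) = {vertex_ring (Gam l r) | l r. adjacent_in I l r \<and> Suc l < r}"
proof (intro Set.set_eqI iffI)
  fix T :: "'k ratfun set" assume "T \<in> singular_points (TV I)"
  then obtain l r where lr: "adjacent_in I l r" "T \<in> Spec (mon_alg (Gam l r))" and nr: "\<not> regular_local_ring (ring_of T)"
    by (auto simp: singular_points_def TV_def)
  have b: "l < r" "r \<le> N" using adjacent_le[OF I lr(1)] by auto
  have "Suc l < r"
  proof (rule ccontr)
    assume "\<not> Suc l < r"
    then have "r = Suc l" using b by simp
    then show False using regular_smooth[of l T] lr b nr by simp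
  qed
  moreover have "T = vertex_ring (Gam l r)"
  proof (rule vertex_ring_unique[OF b lr(2)])
    fix g assume g: "g \<in> Gam l r - {0}"
    show "character g \<notin> units_in T"
    proof
      assume u: "character g \<in> units_in T"
      have "dt (v l) (v r) \<noteq> 0" using dt_pos'[OF b] by simp
      then have "T \<in> Spec (mon_alg (dual1 (v l))) \<or> T \<in> Spec (mon_alg (dual1 (v r)))"
        using Spec_off_vertex[OF _ lr(2)] g u by blast
      then show False
      proof
        assume "T \<in> Spec (mon_alg (dual1 (v l)))"
        then have "T \<in> Spec (mon_alg (Gam l (Suc l)))" using b by (intro Spec_ray_pair) auto
        moreover have "l < N" using b by linarith
        ultimately show False using regular_smooth nr by blast
      next
        assume "T \<in> Spec (mon_alg (dual1 (v r)))"
        then have "T \<in> Spec (mon_alg (Gam (r - 1) r))" using b by (intro Spec_ray_pair) auto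
        then have "T \<in> Spec (mon_alg (Gam (r - 1) (Suc (r - 1))))" using b by simp
        moreover have "r - 1 < N" using b by linarith
        ultimately show False using regular_smooth nr by blast
      qed
    qed
  qed
  ultimately show "T \<in> {vertex_ring (Gam l r) | l r. adjacent_in I l r \<and> Suc l < r}" using lr(1) by blast
next
  fix T :: "'k ratfun set" assume "T \<in> {vertex_ring (Gam l r) | l r. adjacent_in I l r \<and> Suc l < r}"
  then obtain l r where lr: "T = vertex_ring (Gam l r)" "adjacent_in I l r" "Suc l < r" by blast
  have b: "l < r" "r \<le> N" using adjacent_le[OF I lr(2)] by auto
  have "\<And>j. l < j \<Longrightarrow> j < r \<Longrightarrow> e j = 2" using runs lr(2) unfolding runs_in_def by blast
  then have "\<not> regular_local_ring (ring_of T)" unfolding lr(1) using rdp_run(2)[OF b _ lr(3)] by blast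
  then show "T \<in> singular_points (TV I)" using vertex_ring_in_TV[OF I lr(2)] by (simp add: singular_points_def lr(1))
qed

end

section \<open>Toric modifications\<close>

text \<open>The dominated point is the localisation of \<open>A\<close> at the centre of
  \<open>S\<close>.\<close>

lemma center_dominated:
  assumes A: "k_subalgebra A" "A \<subseteq> S" and S: "local_subalgebra S"
  shows "\<exists>R\<in>Spec A. dominates S R"
proof -
  let ?P = "A - units_in S"
  have P: "prime_in ?P A" using prime_in_center[OF S A] .
  let ?R = "localization A ?P"
  have k: "k_subalgebra S" using S by (simp add: local_subalgebra_def)
  note L = localization_props[OF A(1) P]
  have "?R \<in> Spec A" using Spec_iff[OF A(1)] L by blast
  moreover have "dominates S ?R"
    unfolding dominates_iff
  proof (intro conjI subsetI)
    fix t assume "t \<in> ?R"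
    then show "t \<in> S" unfolding localization_def using A k by (auto simp: units_in_divide subset_iff)
  next
    fix t assume t: "t \<in> ?R \<inter> units_in S"
    then obtain a s where as: "t = a / s" "a \<in> A" "s \<in> A - ?P" unfolding localization_def by blast
    then have "s \<in> units_in S" by blast
    then have "a = t * s" using as by (auto simp: units_in_def)
    then have "a \<in> units_in S" using t \<open>s \<in> units_in S\<close> units_in_mult[OF k] by blast
    then show "t \<in> units_in ?R" using units_in_localization[OF A(1) P as(2,3)] as(1) by simp
  qed
  ultimately show ?thesis by blast
qed

text \<open>If \<open>x / y\<close> lies in \<open>W\<close>, then \<open>y\<close> divides
  \<open>x + y\<close>, so \<open>y\<close> is a unit whenever the sum is.\<close>

lemma local_valuation_ring:
  assumes W: "valuation_ring W" shows "local_subalgebra W"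
  unfolding local_subalgebra_def
proof (intro conjI ballI impI)
  show k: "k_subalgebra W" using W by (simp add: valuation_ring_def)
  fix x y assume xy: "x \<in> W" "y \<in> W" "x + y \<in> units_in W"
  have one: "y \<in> units_in W" if "x / y \<in> W" "y \<noteq> 0" "y \<in> W" "x + y \<in> units_in W" for x y
  proof -
    have "y * (1 + x / y) = x + y" using that by (simp add: field_simps)
    moreover have "1 + x / y \<in> W" using k that by (intro k_subalgebraD(4)[OF k] k_subalgebraD(3)[OF k])
    ultimately show ?thesis using units_in_multD[OF k that(3)] that(4) by metis
  qed
  show "x \<in> units_in W \<or> y \<in> units_in W"
  proof (cases "x = 0 \<or> y = 0")
    case True
    then show ?thesis using xy(3) by auto
  next
    case False
    have "x / y \<in> W \<or> y / x \<in> W" using W unfolding valuation_ring_def by (metis inverse_divide)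
    then show ?thesis using one[of x y] one[of y x] xy False by (auto simp: add.commute)
  qed
qed

lemma emb_mon_alg: "emb p \<in> mon_alg UNIV"
proof -
  note k = k_subalgebra_mon_alg[OF submonoid_UNIV]
  have xy: "coord_x \<in> mon_alg UNIV" "coord_y \<in> mon_alg UNIV"
    using cf_character(1)[of "(1, 0)"] cf_character(1)[of "(0, 1)"] by (simp_all add: character_def)
  have 1: "emb [:q:] \<in> mon_alg UNIV" for q :: "'a poly"
  proof (induction q)
    case 0
    then show ?case using k_subalgebraD(2)[OF k] by (simp add: Zero_fract_def)
  next
    case (pCons c q)
    have "[:pCons c q:] = [:[:c:]:] + [:[:0, 1:]:] * [:q:]" by simp
    then have "emb [:pCons c q:] = const c + coord_x * emb [:q:]" by (simp add: const_def coord_x_def)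
    then show ?case using k_subalgebraD(4)[OF k k_subalgebraD(1)[OF k] k_subalgebraD(6)[OF k xy(1) pCons.IH]] by simp
  qed
  show ?thesis
  proof (induction p)
    case 0
    then show ?case using k_subalgebraD(2)[OF k] by (simp add: Zero_fract_def)
  next
    case (pCons q p)
    have "pCons q p = [:q:] + [:0, 1:] * p" by simp
    then have "emb (pCons q p) = emb [:q:] + coord_y * emb p" by (simp add: coord_y_def)
    then show ?case using k_subalgebraD(4)[OF k 1 k_subalgebraD(6)[OF k xy(2) pCons.IH]] by simp
  qed
qed

text \<open>The sum of the individual shifts works for all of the finitely many exponents at once.
  Having every larger shift available as well lets numerator and denominator share one.\<close>

lemma clear_denominators:
  assumes K: "\<And>m. \<exists>K. m + scale K g \<in> \<Gamma>" and g: "g \<in> \<Gamma>" and G: "submonoid \<Gamma>"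
    and u: "u \<in> mon_alg UNIV"
  shows "\<exists>K. \<forall>n\<ge>K. character (scale n g) * u \<in> mon_alg \<Gamma>"
proof -
  obtain k where k: "\<And>m. m + scale (k m) g \<in> \<Gamma>" using K by metis
  have fin: "finite {m. cf u m \<noteq> 0}" using mon_alg_cf(1)[OF u] .
  let ?K = "\<Sum>m | cf u m \<noteq> 0. k m"
  have "character (scale n g) * u \<in> mon_alg \<Gamma>" if n: "?K \<le> n" for n
  proof (rule mon_algI)
    show "character (scale n g) * u \<in> mon_alg UNIV" using cf_shift(1)[OF u, of 1] by simp
    fix h assume "cf (character (scale n g) * u) h \<noteq> 0"
    then have h: "cf u (h - scale n g) \<noteq> 0" using cf_shift(2)[OF u, of 1] by simp
    let ?m = "h - scale n g"
    have "k ?m \<le> ?K" using fin h by (intro member_le_sum) auto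
    then have "h = (?m + scale (k ?m) g) + scale (n - k ?m) g"
      using n scale_add[of "k ?m" "n - k ?m" g] by (simp add: add.assoc)
    then show "h \<in> \<Gamma>" using submonoid_add[OF G k[of ?m] submonoid_scale[OF G g, of "n - k ?m"]] by metis
  qed
  then show ?thesis by blast
qed

lemma fractions_of_mon_alg:
  assumes K: "\<And>m. \<exists>K. m + scale K g \<in> \<Gamma>" and g: "g \<in> \<Gamma>" and G: "submonoid \<Gamma>"
  shows "\<exists>a\<in>mon_alg \<Gamma>. \<exists>s\<in>mon_alg \<Gamma> - {0}. z = a / s"
proof -
  obtain p q where pq: "z = Fraction_Field.Fract p q" "q \<noteq> 0" by (cases z)
  have z: "z = emb p / emb q" using pq by simp
  have q0: "emb q \<noteq> 0" using pq(2) by (simp add: Zero_fract_def eq_fract)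
  obtain K1 K2 where "\<forall>n\<ge>K1. character (scale n g) * emb p \<in> mon_alg \<Gamma>" "\<forall>n\<ge>K2. character (scale n g) * emb q \<in> mon_alg \<Gamma>"
    using clear_denominators[OF K g G emb_mon_alg] by meson
  then have "character (scale (K1 + K2) g) * emb p \<in> mon_alg \<Gamma>" "character (scale (K1 + K2) g) * emb q \<in> mon_alg \<Gamma> - {0}"
    using q0 by auto
  moreover have "z = (character (scale (K1 + K2) g) * emb p) / (character (scale (K1 + K2) g) * emb q)"
    unfolding z by simp
  ultimately show ?thesis by blast
qed

text \<open>Gordan's lemma: the ray generators and the elements of bounded height generate.\<close>

lemma mon_alg_finitely_generated:
  assumes d: "0 < dt u w"
  shows "\<exists>F. finite F \<and> (mon_alg (dual2 u w) :: 'k::field ratfun set) = k_subalgebra hull F"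
proof -
  define D where "D = dt u w"
  define G where "G = {m \<in> dual2 u w. pr m u \<le> D \<and> pr m w \<le> D}"
  have nu: "pr (nn u) u = 0" "pr (nn u) w = D" "pr (- nn w) u = D" "pr (- nn w) w = 0"
    using dt_swap[of u w] by (simp_all add: pr_nn D_def)
  have "inj_on (\<lambda>m. (pr m u, pr m w)) G" using eq_if_pr_eq[of u w] d by (auto intro!: inj_onI)
  moreover have "(\<lambda>m. (pr m u, pr m w)) ` G \<subseteq> {0..D} \<times> {0..D}" by (auto simp: G_def dual2_def)
  ultimately have fin: "finite G" by (meson finite_SigmaI finite_atLeastAtMost_int finite_imageD finite_subset)
  let ?H = "k_subalgebra hull (character ` G) :: 'k ratfun set"
  have inc: "character m \<in> ?H" if "m \<in> G" for m using that by (intro hull_inc) blast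
  have gG: "nn u \<in> G" "- nn w \<in> G" using nu d by (auto simp: G_def dual2_def D_def)
  have "character m \<in> ?H" if "m \<in> dual2 u w" for m
    using that
  proof (induction "nat (pr m u + pr m w)" arbitrary: m rule: less_induct)
    case less
    have ge: "0 \<le> pr m u" "0 \<le> pr m w" using less.prems by (auto simp: dual2_def)
    have step: "character m \<in> ?H" if g: "g \<in> G" "m - g \<in> dual2 u w" "pr g u + pr g w = D" for g
    proof -
      have "character (m - g) \<in> ?H"
        using less.hyps[of "m - g"] g d ge by (simp add: pr_diff dual2_def D_def)
      then have "character g * character (m - g) \<in> ?H" using k_subalgebraD(6)[OF k_subalgebra_hull inc[OF g(1)]] by blast
      then show ?thesis by (simp add: character_diff)
    qed
    consider "pr m u \<le> D" "pr m w \<le> D" | "D < pr m w" | "D < pr m u" by linarith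
    then show ?case
    proof cases
      case 1
      then show ?thesis using inc less.prems by (simp add: G_def)
    next
      case 2
      then show ?thesis using step[OF gG(1)] nu ge by (simp add: dual2_def pr_diff)
    next
      case 3
      have "pr (m - (- nn w)) u = pr m u - D" "pr (m - (- nn w)) w = pr m w" unfolding pr_diff nu by simp_all
      then have "m - (- nn w) \<in> dual2 u w" using 3 ge by (simp add: dual2_def del: diff_minus_eq_add)
      then show ?thesis using step[OF gG(2)] nu by simp
    qed
  qed
  then have "mon_alg (dual2 u w) \<subseteq> ?H" by (intro mon_alg_subset[OF k_subalgebra_hull]) blast
  moreover have "?H \<subseteq> mon_alg (dual2 u w)"
  proof (rule hull_minimal)
    show "character ` G \<subseteq> (mon_alg (dual2 u w) :: 'k ratfun set)" using character_mon_alg_iff by (auto simp: G_def)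
  qed (rule k_subalgebra_mon_alg[OF submonoid_dual2])
  ultimately show ?thesis using fin by (intro exI[of _ "character ` G"]) blast
qed

context chain
begin

lemma interior_character:
  assumes "a < b" "b \<le> N"
  shows "nn (v a) - nn (v b) \<in> Gam a b" "\<exists>K. m + scale K (nn (v a) - nn (v b)) \<in> Gam a b"
proof -
  let ?g = "nn (v a) - nn (v b)"
  have p: "0 < pr ?g (v a)" "0 < pr ?g (v b)"
    using dt_pos'[OF assms] dt_swap[of "v b" "v a"] by (simp_all add: pr_diff pr_nn)
  then show "?g \<in> Gam a b" by (simp add: dual2_def)
  let ?K = "nat \<bar>pr m (v a)\<bar> + nat \<bar>pr m (v b)\<bar>"
  show "\<exists>K. m + scale K ?g \<in> Gam a b"
    using shift_nonneg[OF p(1), of "pr m (v a)" ?K] shift_nonneg[OF p(2), of "pr m (v b)" ?K]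
    by (intro exI[of _ ?K]) (auto simp: dual2_def pr_add pr_scale)
qed

lemma of_finite_type_TV:
  assumes I: "index_set I"
  shows "of_finite_type (TV I :: 'k::field ratfun set set)"
proof -
  let ?P = "{q \<in> {..N} \<times> {..N}. adjacent_in I (fst q) (snd q)}"
  define AA where "AA = (\<lambda>q. mon_alg (Gam (fst q) (snd q)) :: 'k ratfun set) ` ?P"
  have fin: "finite AA" by (simp add: AA_def)
  have un: "TV I = (\<Union>A\<in>AA. Spec A)"
  proof (intro Set.set_eqI iffI)
    fix T :: "'k ratfun set" assume "T \<in> TV I"
    then obtain a b where ab: "adjacent_in I a b" "T \<in> Spec (mon_alg (Gam a b))" by (auto simp: TV_def)
    then have "(a, b) \<in> ?P" using adjacent_le[OF I ab(1)] by auto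
    then show "T \<in> (\<Union>A\<in>AA. Spec A)" using ab(2) by (force simp: AA_def)
  next
    fix T :: "'k ratfun set" assume "T \<in> (\<Union>A\<in>AA. Spec A)"
    then show "T \<in> TV I" unfolding TV_def AA_def by blast
  qed
  have gen: "(\<exists>F. finite F \<and> A = k_subalgebra hull F) \<and> (\<forall>z. \<exists>a\<in>A. \<exists>s\<in>A - {0}. z = a / s)" if A: "A \<in> AA" for A
  proof -
    obtain a b where ab: "adjacent_in I a b" "A = mon_alg (Gam a b)" using A by (auto simp: AA_def)
    have b: "a < b" "b \<le> N" using adjacent_le[OF I ab(1)] by auto
    show ?thesis
      unfolding ab(2)
      using mon_alg_finitely_generated[OF dt_pos'[OF b]]
        fractions_of_mon_alg[OF interior_character(2)[OF b] interior_character(1)[OF b] submonoid_dual2] by blast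
  qed
  show ?thesis
    unfolding of_finite_type_def
  proof (intro exI[of _ AA] conjI ballI)
    fix A assume "A \<in> AA"
    from gen[OF this] show "\<exists>F. finite F \<and> A = k_subalgebra hull F" "\<forall>z. \<exists>a\<in>A. \<exists>s\<in>A - {0}. z = a / s"
      by (rule conjunct1, rule conjunct2)
  qed (rule fin, rule un)
qed

lemma adjacent_0_N: "0 < N \<Longrightarrow> adjacent_in {0, N} a b \<longleftrightarrow> a = 0 \<and> b = N"
  by (auto simp: adjacent_in_def)

lemma TV_0_N: "0 < N \<Longrightarrow> TV {0, N} = Spec (mon_alg (Gam 0 N))"
  by (auto simp: TV_def adjacent_0_N)

text \<open>On characters the valuation behaves like a vector of the cone: its sign on
  \<open>nn (v a)\<close> tells on which side of the ray \<open>a\<close> it lies, and the last ray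
  passed determines the chart.\<close>

lemma valuation_chart:
  assumes I: "index_set I" and W: "valuation_ring W" and A: "mon_alg (Gam 0 N) \<subseteq> W"
  shows "\<exists>a b. adjacent_in I a b \<and> mon_alg (Gam a b) \<subseteq> W"
proof -
  have k: "k_subalgebra W" using W by (simp add: valuation_ring_def)
  define C where "C = {m. character m \<in> W}"
  have C: "submonoid C" using k by (simp add: C_def submonoid_def character_add k_subalgebraD)
  have tot: "m \<in> C \<or> - m \<in> C" for m using W unfolding valuation_ring_def C_def by (simp add: character_minus)
  have GC: "Gam 0 N \<subseteq> C" using A character_mon_alg_iff unfolding C_def by blast
  have N0: "0 < N" "0 \<in> I" "N \<in> I" "I \<subseteq> {..N}" using I by (auto simp: index_set_def)
  have d0N: "0 < dt (v 0) (v N)" using dt_pos' N0 by blast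
  have "nn (v 0) \<in> Gam 0 N" "- nn (v N) \<in> Gam 0 N"
    using d0N dt_swap[of "v N" "v 0"] by (auto simp: dual2_def pr_nn)
  then have ends: "nn (v 0) \<in> C" "- nn (v N) \<in> C" using GC by blast+
  define a where "a = (GREATEST a. a \<in> I \<and> a < N \<and> nn (v a) \<in> C)"
  have a: "a \<in> I \<and> a < N \<and> nn (v a) \<in> C" unfolding a_def by (rule GreatestI_nat[of _ 0 N]) (use N0 ends in auto)
  have amax: "c \<le> a" if "c \<in> I" "c < N" "nn (v c) \<in> C" for c
    unfolding a_def by (rule Greatest_le_nat[of _ _ N]) (use that in auto)
  obtain b where ab: "adjacent_in I a b" using adjacent_next[of a I N] a N0 by blast
  then have b: "a < b" "b \<le> N" using adjacent_le[OF I] by auto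
  have nb: "- nn (v b) \<in> C"
  proof (cases "b = N")
    case False
    then show ?thesis using amax[of b] tot[of "nn (v b)"] b ab by (auto simp: adjacent_in_def)
  qed (use ends in simp)
  have "Gam a b \<subseteq> C"
  proof
    fix m assume m: "m \<in> Gam a b"
    let ?D = "nat (dt (v a) (v b))"
    have D: "0 < ?D" using dt_pos'[OF b] by simp
    have "scale ?D m = smul (pr m (v b)) (nn (v a)) + smul (pr m (v a)) (- nn (v b))"
      using cramer[of "v a" "v b" m] D by (simp add: scale_def smul_def)
    also have "\<dots> \<in> C" using m a nb by (intro submonoid_add[OF C] submonoid_smul[OF C]) (auto simp: dual2_def)
    finally have mD: "character m ^ ?D \<in> W" by (simp add: C_def character_scale)
    \<comment> \<open>Valuation rings admit roots: if \<open>m\<close> were missing from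
      \<open>C\<close>, then \<open>- m\<close> would be in it, and \<open>m\<close> is
      \<open>?D\<close> copies of \<open>m\<close> plus \<open>?D - 1\<close> copies of
      \<open>- m\<close>.\<close>
    show "m \<in> C"
    proof (rule ccontr)
      assume n: "m \<notin> C"
      then have "inverse (character m) \<in> W" using tot[of m] by (simp add: C_def character_minus)
      then have "character m ^ ?D * inverse (character m) ^ (?D - 1) \<in> W" using mD k by (simp only: k_subalgebraD)
      moreover obtain D' where "?D = Suc D'" using D gr0_implies_Suc by blast
      then have "character m ^ ?D * inverse (character m) ^ (?D - 1) = (character m :: 'a ratfun)"
        by (simp add: power_inverse field_simps)
      ultimately show False using n by (simp add: C_def)
    qed
  qed
  then have "mon_alg (Gam a b) \<subseteq> W" by (intro mon_alg_subset[OF k]) (auto simp: C_def)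
  then show ?thesis using ab by blast
qed

text \<open>Points of different cones dominated by the same \<open>W\<close> both lie on the chart
  of a common face: the shared ray, or the torus if no ray is shared.\<close>

lemma TV_separated:
  assumes I: "index_set I" and S: "S \<in> TV I" "S' \<in> TV I" and W: "dominates W S" "dominates W S'"
  shows "S = S'"
proof -
  note k = k_subalgebra_mon_alg[OF submonoid_dual2]
  have main: "S = S'"
    if ab: "adjacent_in I a b" "S \<in> Spec (mon_alg (Gam a b))" and ab': "adjacent_in I a' b'" "S' \<in> Spec (mon_alg (Gam a' b'))"
      and le: "b \<le> a'" and W: "dominates W S" "dominates W S'" for S S' a b a' b'
  proof -
    have b: "a < b" "b \<le> N" "a' < b'" "b' \<le> N" using adjacent_le[OF I] ab ab' by auto
    note SD = SpecD[OF k ab(2)] and SD' = SpecD[OF k ab'(2)]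
    \<comment> \<open>A character regular at \<open>S'\<close> whose inverse is regular at
      \<open>S\<close> is a unit of \<open>W\<close>, and domination makes it a unit at both
      points.\<close>
    have unit: "character g \<in> units_in S'" "character (- g) \<in> units_in S" if g: "g \<in> Gam a' b'" "- g \<in> Gam a b" for g
    proof -
      have S: "character g \<in> S'" "character (- g) \<in> S" using g SD(2) SD'(2) character_mon_alg_iff by blast+
      then have "character g \<in> W" "character (- g) \<in> W" using W unfolding dominates_iff by blast+
      then have "character g \<in> units_in W" "character (- g) \<in> units_in W" by (simp_all add: units_in_def character_minus)
      then show "character g \<in> units_in S'" "character (- g) \<in> units_in S" using S W unfolding dominates_iff by blast+
    qed
    have dn: "dt (v a) (v b) \<noteq> 0" "dt (v a') (v b') \<noteq> 0" using dt_pos'[of a b] dt_pos'[of a' b'] b by auto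
    show ?thesis
    proof (cases "b = a'")
      case True
      have sg: "sgn (dt (v b) (v a)) = - 1" "sgn (dt (v b) (v b')) = 1"
        using dt_pos'[of a b] dt_swap[of "v a" "v b"] dt_pos'[of b b'] b True by auto
      have "nn (v b) \<in> Gam a' b'" "- nn (v b) \<in> Gam a b"
        using dt_pos'[of b b'] dt_pos'[of a b] dt_swap[of "v a" "v b"] b True by (auto simp: dual2_def pr_nn)
      note u = unit[OF this]
      have m: "smul (- 1) (nn (v b)) = - nn (v b)" "smul 1 (nn (v b)) = nn (v b)" by (simp_all add: smul_def prod_eq_iff)
      have "S \<in> Spec (mon_alg (dual1 (v b)))"
        using Spec_ray[of "v b" "v a" S] ab(2) u(2) sg m dn dt_swap[of "v a" "v b"] by (simp add: dual2_commute)
      moreover have "S' \<in> Spec (mon_alg (dual1 (v b)))"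
        using Spec_ray[of "v b" "v b'" S'] ab'(2) u(1) sg m dn True by simp
      ultimately show ?thesis
        using k_subalgebra_mon_alg[OF submonoid_dual1] SpecD(2)[OF k_subalgebra_mon_alg[OF submonoid_dual1]] W dominates_eqI by metis
    next
      case False
      then have lt: "b < a'" using le by simp
      \<comment> \<open>Either normal alone vanishes on a boundary ray; their sum is strictly
        positive on the second cone and strictly negative on the first.\<close>
      let ?g = "nn (v b) + nn (v a')"
      have p: "0 < pr ?g (v a')" "0 < pr ?g (v b')" "0 < pr (- ?g) (v a)" "0 < pr (- ?g) (v b)"
        using dt_pos'[of b a'] dt_pos'[of b b'] dt_pos'[of a' b'] dt_pos'[of a b] dt_pos'[of a a']
          dt_swap[of "v a" "v b"] dt_swap[of "v a" "v a'"] dt_swap[of "v b" "v a'"] b lt by (auto simp: pr_add pr_diff pr_nn)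
      have "?g \<in> Gam a' b'" "- ?g \<in> Gam a b" using p by (simp_all add: dual2_def del: minus_add_distrib)
      note u = unit[OF this]
      have "S \<in> Spec (mon_alg UNIV)" using Spec_torus[OF dn(1) p(3,4)] ab(2) u(2) by blast
      moreover have "S' \<in> Spec (mon_alg UNIV)" using Spec_torus[OF dn(2) p(1,2)] ab'(2) u(1) by blast
      ultimately show ?thesis
        using k_subalgebra_mon_alg[OF submonoid_UNIV] SpecD(2)[OF k_subalgebra_mon_alg[OF submonoid_UNIV]] W dominates_eqI by metis
    qed
  qed
  obtain a b where ab: "adjacent_in I a b" "S \<in> Spec (mon_alg (Gam a b))" using S by (auto simp: TV_def)
  obtain a' b' where ab': "adjacent_in I a' b'" "S' \<in> Spec (mon_alg (Gam a' b'))" using S by (auto simp: TV_def)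
  consider "b \<le> a'" | "b' \<le> a" | "(a, b) = (a', b')"
    using ab(1) ab'(1) unfolding adjacent_in_def by (metis le_antisym)
  then show ?thesis
  proof cases
    case 1 then show ?thesis using main[OF ab ab'] W by blast
  next
    case 2 then show ?thesis using main[OF ab' ab] W by blast
  next
    case 3
    then show ?thesis using dominates_eqI[OF ab(2) ab'(2) k k] SpecD(2)[OF k ab(2)] SpecD(2)[OF k ab'(2)] W by simp
  qed
qed

theorem modification_TV:
  assumes I: "index_set I"
  shows "modification (TV I :: 'k::field ratfun set set) (Spec (mon_alg (Gam 0 N)))"
  unfolding modification_def
proof (intro conjI ballI allI impI)
  note k = k_subalgebra_mon_alg[OF submonoid_dual2]
  have N0: "0 < N" using I by (simp add: index_set_def)
  have I0: "index_set {0, N}" using N0 by (simp add: index_set_def)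
  show "of_finite_type (TV I :: 'k ratfun set set)" using of_finite_type_TV[OF I] .
  show "of_finite_type (Spec (mon_alg (Gam 0 N)) :: 'k ratfun set set)"
    using of_finite_type_TV[OF I0] TV_0_N[OF N0] by metis
  have sub: "mon_alg (Gam 0 N) \<subseteq> (mon_alg (Gam a b) :: 'k ratfun set)" if "adjacent_in I a b" for a b
    using adjacent_le[OF I that] by (intro mon_alg_mono Gam_mono) auto
  fix S :: "'k ratfun set" assume "S \<in> TV I"
  then obtain a b where ab: "adjacent_in I a b" "S \<in> Spec (mon_alg (Gam a b))" by (auto simp: TV_def)
  note SD = SpecD[OF k ab(2)]
  show "\<exists>R\<in>Spec (mon_alg (Gam 0 N)). dominates S R"
    using center_dominated[OF k _ SD(3)] sub[OF ab(1)] SD(2) by blast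
next
  note k = k_subalgebra_mon_alg[OF submonoid_dual2]
  fix W R :: "'k ratfun set"
  assume h: "valuation_ring W \<and> R \<in> Spec (mon_alg (Gam 0 N)) \<and> dominates W R"
  then have "mon_alg (Gam 0 N) \<subseteq> W" using SpecD(2)[OF k, of R] unfolding dominates_iff by blast
  then obtain a b where ab: "adjacent_in I a b" "mon_alg (Gam a b) \<subseteq> W" using valuation_chart[OF I] h by blast
  then obtain S where S: "S \<in> Spec (mon_alg (Gam a b))" "dominates W S"
    using center_dominated[OF k ab(2)] local_valuation_ring h by blast
  then have "S \<in> TV I" using ab(1) unfolding TV_def by blast
  then show "\<exists>!S. S \<in> TV I \<and> dominates W S" using S(2) TV_separated[OF I] by blast
qed

end

section \<open>The Hirzebruch--Jung chain\<close>

fun continuant :: "int list \<Rightarrow> int" where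
  "continuant [] = 1"
| "continuant [b] = b"
| "continuant (b # b' # bs) = b * continuant (b' # bs) - continuant bs"

text \<open>The denominator belonging to \<open>continuant\<close> in the continued fraction. The
  value 0 for the empty list makes the recursion of \<open>continuant_Cons\<close> uniform.\<close>

definition continuant' :: "int list \<Rightarrow> int" where
  "continuant' bs = (if bs = [] then 0 else continuant (tl bs))"

lemma continuant_Cons: "continuant (b # bs) = b * continuant bs - continuant' bs"
  by (cases bs) (simp_all add: continuant'_def)

lemma continuant_mono: "\<forall>e\<in>set bs. 2 \<le> e \<Longrightarrow> 0 \<le> continuant' bs \<and> continuant' bs < continuant bs"
proof (induction bs)
  case (Cons b bs)
  then have "0 \<le> continuant' bs" "continuant' bs < continuant bs" "2 \<le> b" by auto
  then have "2 * continuant bs \<le> b * continuant bs" by (intro mult_right_mono) auto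
  moreover have "continuant' (b # bs) = continuant bs" by (simp add: continuant'_def)
  ultimately show ?case using \<open>0 \<le> continuant' bs\<close> \<open>continuant' bs < continuant bs\<close>
    unfolding continuant_Cons by linarith
qed (simp add: continuant'_def)

lemma hj_fraction_continuant:
  "bs \<noteq> [] \<Longrightarrow> \<forall>e\<in>set bs. 2 \<le> e \<Longrightarrow> hj_fraction bs = of_int (continuant bs) / of_int (continuant' bs)"
proof (induction bs rule: hj_fraction.induct)
  case (3 b b' bs)
  have pos: "0 < continuant (b' # bs)" using continuant_mono[of "b' # bs"] "3.prems" by auto
  have IH: "hj_fraction (b' # bs) = of_int (continuant (b' # bs)) / of_int (continuant' (b' # bs))"
    using "3.IH" "3.prems" by auto
  show ?case
    using pos unfolding hj_fraction.simps IH continuant_Cons[of b "b' # bs"]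
    by (simp add: continuant'_def[of "b # _"] diff_divide_distrib)
qed (simp_all add: continuant'_def)

text \<open>The last term of the scalar recursion with initial terms \<open>x0\<close>,
  \<open>x1\<close>, to be used for each coordinate of \<open>hj_vec\<close>.\<close>

fun rec_end :: "int \<Rightarrow> int \<Rightarrow> int list \<Rightarrow> int" where
  "rec_end x0 x1 [] = x1"
| "rec_end x0 x1 (b # bs) = rec_end x1 (b * x1 - x0) bs"

lemma rec_end_continuant: "rec_end x0 x1 bs = x1 * continuant bs - x0 * continuant' bs"
proof (induction bs arbitrary: x0 x1)
  case (Cons b bs)
  then show ?case by (simp add: continuant_Cons continuant'_def[of "b # bs"] algebra_simps)
qed (simp add: continuant'_def)

lemma hj_vec_rec_end:
  assumes h: "\<And>j. j < length b \<Longrightarrow> h (Suc (Suc j)) = entry b (Suc j) * h (Suc j) - h j"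
  shows "h (Suc (length b)) = rec_end (h 0) (h 1) b"
proof -
  have "rec_end (h 0) (h 1) b = rec_end (h j) (h (Suc j)) (drop j b)" if "j \<le> length b" for j
    using that
  proof (induction j)
    case (Suc j)
    have "drop j b = b ! j # drop (Suc j) b" using Suc.prems by (simp add: Cons_nth_drop_Suc)
    then show ?case using Suc h[of j] by (simp add: entry_def)
  qed simp
  from this[of "length b"] show ?thesis by simp
qed

text \<open>The recursion is linear, so its end is determined by the initial values 1, 1 of the
  first coordinate and 0, 1 of the second.\<close>

lemma hj_vec_end:
  "snd (hj_vec b (Suc (length b))) = continuant b"
  "fst (hj_vec b (Suc (length b))) = continuant b - continuant' b"
  using hj_vec_rec_end[of b "\<lambda>j. snd (hj_vec b j)"] hj_vec_rec_end[of b "\<lambda>j. fst (hj_vec b j)"]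
  by (simp_all add: rec_end_continuant)

lemma dt_hj_vec: "dt (hj_vec b j) (hj_vec b (Suc j)) = 1"
proof (induction j)
  case (Suc j)
  then show ?case by (simp add: dt_def algebra_simps)
qed (simp add: dt_def)

text \<open>The continued fraction gives \<open>?Q / (?Q - ?P) = q / (q - p)\<close>. Both pairs are
  coprime, \<open>?P\<close> and \<open>?Q\<close> because consecutive vectors have determinant 1,
  so they agree.\<close>

lemma hj_vec_expansion_end:
  assumes p: "0 < p" "p < q" "coprime p q" and b: "hj_expansion b (of_int q / of_int (q - p))"
  shows "hj_vec b (Suc (length b)) = (p, q)"
proof -
  let ?Q = "continuant b" and ?P = "continuant b - continuant' b"
  have b': "b \<noteq> []" "\<forall>e\<in>set b. 2 \<le> e" "hj_fraction b = of_int q / of_int (q - p)"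
    using b by (auto simp: hj_expansion_def)
  have K: "0 \<le> continuant' b" "continuant' b < ?Q" using continuant_mono[OF b'(2)] by auto
  have "0 < continuant' b"
    using b' continuant_mono[of "tl b"] by (cases b) (auto simp: continuant'_def)
  then have "of_int ?Q * (of_int (q - p) :: rat) = of_int q * of_int (continuant' b)"
    using hj_fraction_continuant[OF b'(1,2)] b'(3) p by (simp add: field_simps)
  then have "?Q * (q - p) = q * continuant' b" by (metis of_int_eq_iff of_int_mult)
  then have eq: "q * ?P = ?Q * p" by (simp add: algebra_simps)
  have "coprime ?P ?Q"
  proof (rule coprimeI)
    fix c assume c: "c dvd ?P" "c dvd ?Q"
    have "c dvd dt (hj_vec b (length b)) (hj_vec b (Suc (length b)))"
      unfolding dt_def hj_vec_end by (intro dvd_diff[OF dvd_mult[OF c(2)] dvd_mult[OF c(1)]])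
    then show "is_unit c" by (simp add: dt_hj_vec)
  qed
  then have "?Q dvd q" using eq by (metis coprime_commute coprime_dvd_mult_left_iff dvd_triv_left)
  moreover have "q dvd ?Q" using eq p(3) by (metis coprime_commute coprime_dvd_mult_left_iff dvd_triv_left)
  ultimately have "?Q = q" using K p by (intro zdvd_antisym_nonneg) auto
  moreover have "?P = p" using eq \<open>?Q = q\<close> p by simp
  ultimately show ?thesis using hj_vec_end[of b] by (simp add: prod_eq_iff)
qed

lemma chain_hj_vec:
  assumes "\<forall>e\<in>set b. 2 \<le> e"
  shows "chain (hj_vec b) (entry b) (Suc (length b))"
proof
  show "dt (hj_vec b i) (hj_vec b (Suc i)) = 1" for i by (rule dt_hj_vec)
  show "hj_vec b (Suc (Suc i)) = smul (entry b (Suc i)) (hj_vec b (Suc i)) - hj_vec b i" for i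
    by (simp add: smul_def prod_eq_iff)
  fix i :: nat assume "0 < i" "i < Suc (length b)"
  then show "2 \<le> entry b i" using assms by (simp add: entry_def)
qed

section \<open>Singular cones\<close>

lemma lattice_basis_dt: "lattice_basis u w \<Longrightarrow> dt u w = 1 \<or> dt u w = - 1"
proof -
  assume "lattice_basis u w"
  then have ex: "\<exists>a b. z = (a * fst u + b * fst w, a * snd u + b * snd w)" for z
    unfolding lattice_basis_def by blast
  obtain a b where 1: "(1, 0) = (a * fst u + b * fst w, a * snd u + b * snd w)" using ex by blast
  obtain c d where 2: "(0, 1) = (c * fst u + d * fst w, c * snd u + d * snd w)" using ex by blast
  have "(a * d - b * c) * dt u w = (a * fst u + b * fst w) * (c * snd u + d * snd w) - (c * fst u + d * fst w) * (a * snd u + b * snd w)"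
    by (simp add: dt_def algebra_simps)
  also have "\<dots> = 1" using 1 2 by simp
  finally show ?thesis using zmult_eq_1_iff by blast
qed

text \<open>The determinant is 1 or -1, so Cramer's rule gives integers. Their signs, and their
  vanishing for a generator missing from \<open>F\<close>, are read off from functionals that are
  nonnegative on \<open>F\<close>.\<close>

lemma lattice_basis_combination:
  assumes b: "lattice_basis u w" and F: "F \<subseteq> {u, w}" and t: "real_vec t \<in> cone_of F"
  shows "\<exists>a c. 0 \<le> a \<and> 0 \<le> c \<and> t = smul a u + smul c w \<and> (0 < a \<longrightarrow> u \<in> F) \<and> (0 < c \<longrightarrow> w \<in> F)"
proof -
  define s where "s = dt u w"
  have s: "s = 1 \<or> s = - 1" using lattice_basis_dt[OF b] by (simp add: s_def)
  have pos: "0 \<le> pr m t" if "\<And>f. f \<in> F \<Longrightarrow> 0 \<le> pr m f" for m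
  proof -
    have "m \<in> dual_semigroup (cone_of F)" using that by (simp add: dual_semigroup_cone_of)
    then have "0 \<le> real_vec m \<bullet> real_vec t" using t by (simp add: dual_semigroup_def)
    then show ?thesis by (simp add: real_vec_inner)
  qed
  let ?a = "s * dt t w" and ?c = "s * dt u t"
  have m: "pr (smul (- s) (nn w)) f = s * dt f w" "pr (smul s (nn u)) f = s * dt u f" for f
    using dt_swap[of f w] by (simp_all add: pr_smul pr_nn)
  have F': "f = u \<or> f = w" if "f \<in> F" for f using F that by blast
  have ss: "s * s = 1" using s by auto
  have uw: "s * dt u w = 1" "s * dt w w = 0" "s * dt u u = 0" using ss by (simp_all add: s_def)
  have a: "0 \<le> ?a" using pos[of "smul (- s) (nn w)"] F' uw unfolding m by (metis order_refl zero_le_one)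
  have c: "0 \<le> ?c" using pos[of "smul s (nn u)"] F' uw unfolding m by (metis order_refl zero_le_one)
  have "?a \<le> 0" if "u \<notin> F"
  proof -
    have "0 \<le> pr (smul s (nn w)) t"
    proof (rule pos)
      fix f assume "f \<in> F"
      then have "f = w" using F' that by blast
      then show "0 \<le> pr (smul s (nn w)) f" by (simp add: pr_smul pr_nn)
    qed
    then show ?thesis using dt_swap[of t w] by (simp add: pr_smul pr_nn)
  qed
  moreover have "?c \<le> 0" if "w \<notin> F"
  proof -
    have "0 \<le> pr (smul (- s) (nn u)) t"
    proof (rule pos)
      fix f assume "f \<in> F"
      then have "f = u" using F' that by blast
      then show "0 \<le> pr (smul (- s) (nn u)) f" by (simp add: pr_smul pr_nn)
    qed
    then show ?thesis by (simp add: pr_smul pr_nn)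
  qed
  moreover have "t = smul ?a u + smul ?c w"
  proof -
    have "smul s (smul s t) = smul s (smul (dt t w) u + smul (dt u t) w)" using cramer'[of u w t] by (simp add: s_def)
    then show ?thesis using s by (auto simp: smul_def prod_eq_iff)
  qed
  ultimately have "(u \<notin> F \<longrightarrow> ?a \<le> 0) \<and> (w \<notin> F \<longrightarrow> ?c \<le> 0) \<and> t = smul ?a u + smul ?c w" by blast
  then show ?thesis using a c by (metis not_le)
qed

text \<open>\<open>simple_cone\<close> allows any presentation of the cone, even by fewer than two
  vectors. The given generators lie on its edges and, being primitive, must be basis vectors, which
  would bound the determinant by 1.\<close>

lemma not_simple_cone:
  assumes d: "2 \<le> dt u' w'" and prim: "\<And>k t. u' = smul k t \<Longrightarrow> 0 < k \<Longrightarrow> k = 1" "\<And>k t. w' = smul k t \<Longrightarrow> 0 < k \<Longrightarrow> k = 1"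
  shows "\<not> simple_cone (cone_of {u', w'})"
proof
  assume "simple_cone (cone_of {u', w'})"
  then obtain u w F where b: "lattice_basis u w" "F \<subseteq> {u, w}" "cone_of {u', w'} = cone_of F"
    unfolding simple_cone_def by blast
  have mem: "real_vec u' \<in> cone_of F" "real_vec w' \<in> cone_of F"
  proof -
    have "real_vec u' \<in> cone_of {u', w'}" "real_vec w' \<in> cone_of {u', w'}" by (simp_all add: cone_of_def hull_inc)
    then show "real_vec u' \<in> cone_of F" "real_vec w' \<in> cone_of F" using b(3) by simp_all
  qed
  obtain a c where ac: "0 \<le> a" "0 \<le> c" "u' = smul a u + smul c w" "0 < a \<longrightarrow> u \<in> F" "0 < c \<longrightarrow> w \<in> F"
    using lattice_basis_combination[OF b(1,2) mem(1)] by blast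
  obtain a' c' where ac': "0 \<le> a'" "0 \<le> c'" "w' = smul a' u + smul c' w" "0 < a' \<longrightarrow> u \<in> F" "0 < c' \<longrightarrow> w \<in> F"
    using lattice_basis_combination[OF b(1,2) mem(2)] by blast
  have sgn: "0 \<le> dt u' f \<and> 0 \<le> dt f w'" if "f \<in> F" for f
  proof -
    have "real_vec f \<in> cone_of F" using that by (simp add: cone_of_def hull_inc)
    then have f: "real_vec f \<in> cone_of {u', w'}" using b(3) by simp
    have "nn u' \<in> dual_semigroup (cone_of {u', w'})" "- nn w' \<in> dual_semigroup (cone_of {u', w'})"
      using d dt_swap[of u' w'] by (auto simp: dual_semigroup_cone_of pr_nn)
    then have "0 \<le> pr (nn u') f" "0 \<le> pr (- nn w') f"
      using f by (auto simp: dual_semigroup_def real_vec_inner)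
    then show ?thesis using dt_swap[of f w'] by (simp add: pr_nn)
  qed
  have uw: "dt u w = 1 \<or> dt u w = - 1" by (rule lattice_basis_dt[OF b(1)])
  have du: "dt u' w = a * dt u w" "dt u' u = - c * dt u w" "dt u w' = c' * dt u w" "dt w w' = - a' * dt u w"
    unfolding ac(3) ac'(3) by (simp_all add: dt_def smul_def algebra_simps)
  have z1: "a = 0 \<or> c = 0" using sgn[of u] sgn[of w] ac uw du by (metis less_le mult_minus_left mult_minus_right mult_1_right neg_0_le_iff_le not_le)
  have z2: "a' = 0 \<or> c' = 0" using sgn[of u] sgn[of w] ac' uw du by (metis less_le mult_minus_left mult_minus_right mult_1_right neg_0_le_iff_le not_le)
  have one: "a = 1 \<and> c = 0 \<or> a = 0 \<and> c = 1"
  proof (cases "c = 0")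
    case True
    then have "u' = smul a u" using ac(3) by (simp add: smul_simps)
    then show ?thesis using prim(1)[of a u] True ac(1) d by (cases "a = 0") (auto simp: dt_def smul_def)
  next
    case False
    then have "a = 0" using z1 by simp
    then have "u' = smul c w" using ac(3) by (simp add: smul_simps)
    then show ?thesis using prim(1)[of c w] False ac(2) \<open>a = 0\<close> by auto
  qed
  have one': "a' = 1 \<and> c' = 0 \<or> a' = 0 \<and> c' = 1"
  proof (cases "c' = 0")
    case True
    then have "w' = smul a' u" using ac'(3) by (simp add: smul_simps)
    then show ?thesis using prim(2)[of a' u] True ac'(1) d by (cases "a' = 0") (auto simp: dt_def smul_def)
  next
    case False
    then have "a' = 0" using z2 by simp
    then have "w' = smul c' w" using ac'(3) by (simp add: smul_simps)
    then show ?thesis using prim(2)[of c' w] False ac'(2) \<open>a' = 0\<close> by auto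
  qed
  have "dt u' w' = (a * c' - c * a') * dt u w" unfolding ac(3) ac'(3) by (simp add: dt_def smul_def algebra_simps)
  then show False using one one' uw d by auto
qed

context chain
begin

text \<open>A common factor of the coordinates divides the determinant with a neighbour, which is
  1.\<close>

lemma v_primitive: "i \<le> N \<Longrightarrow> 0 < N \<Longrightarrow> v i = smul k t \<Longrightarrow> 0 < k \<Longrightarrow> k = 1"
proof -
  assume h: "i \<le> N" "0 < N" "v i = smul k t" "0 < k"
  have "\<exists>d. k * d = 1"
  proof (cases "i < N")
    case True
    then have "dt (smul k t) (v (Suc i)) = 1" using det1[of i] h(3) by simp
    then have "k * dt t (v (Suc i)) = 1" by (simp add: dt_def smul_def algebra_simps)
    then show ?thesis by blast
  next
    case False
    then have "i = Suc (i - 1)" "i - 1 < N" using h by auto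
    then have "dt (v (i - 1)) (smul k t) = 1" using det1[of "i - 1"] h(3) by metis
    then have "k * dt (v (i - 1)) t = 1" by (simp add: dt_def smul_def algebra_simps)
    then show ?thesis by blast
  qed
  then show "k = 1" using h(4) zmult_eq_1_iff by fastforce
qed

lemma not_simple_run:
  assumes "Suc l < r" "r \<le> N" shows "\<not> simple_cone (cone_of {v l, v r})"
proof (rule not_simple_cone)
  show "2 \<le> dt (v l) (v r)" using dt_pos[of l r] assms by simp
  show "k = 1" if "v l = smul k t" "0 < k" for k t using v_primitive[of l k t] that assms by simp
  show "k = 1" if "v r = smul k t" "0 < k" for k t using v_primitive[of r k t] that assms by simp
qed

lemma adjacent_unique:
  assumes "adjacent_in I a b" "adjacent_in I a' b'" "a < k" "k < b" "a' < k" "k < b'"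
  shows "a = a' \<and> b = b'"
  using assms unfolding adjacent_in_def by (meson le_antisym less_trans not_le)

lemma runs_in_iff:
  assumes I: "index_set I"
  shows "runs_in I \<longleftrightarrow> (\<forall>j\<le>N. j \<notin> I \<longrightarrow> e j = 2)"
proof
  assume r: "runs_in I"
  show "\<forall>j\<le>N. j \<notin> I \<longrightarrow> e j = 2"
  proof (intro allI impI)
    fix j assume j: "j \<le> N" "j \<notin> I"
    have "j < N" using j I by (cases "j = N") (auto simp: index_set_def)
    then obtain a b where ab: "adjacent_in I a b" "a \<le> j" "j < b"
      using adjacent_cover[of 0 I N j] I by (auto simp: index_set_def)
    then have "a < j" using j by (cases "a = j") (auto simp: adjacent_in_def)
    then show "e j = 2" using r ab unfolding runs_in_def by blast
  qed
next
  assume h: "\<forall>j\<le>N. j \<notin> I \<longrightarrow> e j = 2"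
  show "runs_in I"
    unfolding runs_in_def
  proof (intro allI impI)
    fix a b j assume ab: "adjacent_in I a b" "a < j" "j < b"
    then have "j \<notin> I" unfolding adjacent_in_def by auto
    moreover have "j \<le> N" using adjacent_le[OF I ab(1)] ab(3) by simp
    ultimately show "e j = 2" using h by blast
  qed
qed

lemma vertex_ring_eq_iff:
  assumes "l < r" "r \<le> N" "l' < r'" "r' \<le> N" "(vertex_ring (Gam l r) :: 'k::field ratfun set) = vertex_ring (Gam l' r')"
  shows "l = l' \<and> r = r'"
proof -
  have "vertex_ring (Gam l r) \<in> Spec (mon_alg (Gam l r) :: 'k ratfun set)" "vertex_ring (Gam l' r') \<in> Spec (mon_alg (Gam l' r') :: 'k ratfun set)"
    using assms(1-4) by (intro vertex_ring_props(2)[OF pointed_Gam]; simp)+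
  then show ?thesis
    using vertex_ring_in_Spec_iff[OF assms(1-4), where ?'k = 'k] vertex_ring_in_Spec_iff[OF assms(3,4,1,2), where ?'k = 'k] assms(5)
    by (metis le_antisym)
qed

text \<open>Serves to single out the singular points lying over the first centre of a run.\<close>

lemma vertex_ring_dominates_iff:
  assumes lr: "l < r" "r \<le> N" and ab: "a < b" "b \<le> N"
  shows "dominates (vertex_ring (Gam l r)) (vertex_ring (Gam a b) :: 'k::field ratfun set) \<longleftrightarrow> a \<le> l \<and> r \<le> b"
proof
  note p = pointed_Gam[OF lr] and p' = pointed_Gam[OF ab]
  assume "dominates (vertex_ring (Gam l r)) (vertex_ring (Gam a b) :: 'k ratfun set)"
  then have "vertex_ring (Gam a b) \<subseteq> (vertex_ring (Gam l r) :: 'k ratfun set)" unfolding dominates_iff by blast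
  then have "Gam a b \<subseteq> Gam l r" using character_vertex_ring_iff[OF p] character_vertex_ring_iff[OF p'] by blast
  then show "a \<le> l \<and> r \<le> b" using Gam_subsetD[OF _ ab lr] by blast
next
  note p = pointed_Gam[OF lr] and p' = pointed_Gam[OF ab]
  assume h: "a \<le> l \<and> r \<le> b"
  have G: "Gam a b \<subseteq> Gam l r" using Gam_mono[of a l r b] h lr ab by blast
  have sub: "mon_alg (Gam a b) \<subseteq> (vertex_ring (Gam l r) :: 'k ratfun set)"
    using mon_alg_mono[OF G] vertex_ring_props(5)[OF p] by blast
  have n: "character g \<notin> units_in (vertex_ring (Gam l r) :: 'k ratfun set)" if "g \<in> Gam a b - {0}" for g
    using that G character_not_unit[OF p] by blast
  show "dominates (vertex_ring (Gam l r)) (vertex_ring (Gam a b) :: 'k ratfun set)"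
    unfolding dominates_iff using vertex_ring_subset[OF p' vertex_ring_props(1)[OF p] sub n] by blast
qed

lemma orbit_point_pair: "l < r \<Longrightarrow> r \<le> N \<Longrightarrow> orbit_point (cone_of {v l, v r}) = vertex_ring (Gam l r)"
  using orbit_point_eq[of "v l + v r" "cone_of {v l, v r}"] pointed_Gam[of l r]
  by (simp add: dual_semigroup_cone_of_pair)

end

section \<open>Runs of twos\<close>

lemma blowups_append: "blowups X (Ps @ Qs) = blowups (blowups X Ps) Qs"
  by (simp add: blowups_def)

lemma ceiling_half: "nat \<lceil>real c / 2\<rceil> = (c + 1) div 2"
proof (cases "even c")
  case True
  then obtain k where "c = 2 * k" by blast
  then show ?thesis by simp
next
  case False
  then obtain k where k: "c = 2 * k + 1" by (rule oddE)
  have "\<lceil>real c / 2\<rceil> = int k + 1" by (rule ceiling_unique) (simp_all add: k field_simps)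
  then show ?thesis using k by simp
qed

locale hj_chain =
  fixes b :: "int list"
  assumes nonempty: "b \<noteq> []" and ge2: "\<forall>e\<in>set b. 2 \<le> e"
begin

abbreviation N :: nat where "N \<equiv> Suc (length b)"

sublocale chain "hj_vec b" "entry b" N
  by (rule chain_hj_vec[OF ge2])

abbreviation v :: "nat \<Rightarrow> int \<times> int" where "v \<equiv> hj_vec b"

definition I0 :: "nat set" where "I0 = Ins 0 N"

text \<open>The indices of the rays present once the runs in \<open>D\<close> have been resolved
  completely.\<close>

definition Jset :: "(nat \<times> nat) set \<Rightarrow> nat set" where
  "Jset D = I0 \<union> (\<Union>r\<in>D. run_indices r)"

lemma length_pos: "0 < length b"
  using nonempty by simp

lemma I0_eq: "I0 = {0, N} \<union> ({1, length b} \<union> {i. 1 < i \<and> i < length b \<and> entry b i \<noteq> 2})"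
  using length_pos by (auto simp: I0_def Ins_def)

lemma index_set_I0: "index_set I0"
  using length_pos by (auto simp: index_set_def I0_eq)

lemma ends_I0: "0 \<in> I0" "N \<in> I0"
  by (simp_all add: I0_eq)

lemma entry_not_I0: "j \<le> N \<Longrightarrow> j \<notin> I0 \<Longrightarrow> 1 < j \<and> j < length b \<and> entry b j = 2"
  by (auto simp: I0_eq)

lemma index_set_superset: "I0 \<subseteq> J \<Longrightarrow> J \<subseteq> {..N} \<Longrightarrow> index_set J"
  using ends_I0 by (auto simp: index_set_def)

lemma runs_in_superset: "I0 \<subseteq> J \<Longrightarrow> J \<subseteq> {..N} \<Longrightarrow> runs_in J"
  using index_set_superset entry_not_I0 by (subst runs_in_iff) auto

text \<open>A run of length \<open>c\<close> is a gap of \<open>I0\<close> with \<open>c\<close>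
  missing indices, bounded by \<open>i - 1\<close> and \<open>i + c\<close>; the difference of these
  bounds is the exponent \<open>c + 1\<close> in the equation of the singularity.\<close>

lemma two_runs_iff: "(i, c) \<in> two_runs b \<longleftrightarrow> 1 \<le> c \<and> 1 \<le> i \<and> adjacent_in I0 (i - 1) (i + c)"
proof
  assume r: "(i, c) \<in> two_runs b"
  then have h: "1 \<le> c" "2 \<le> i" "i + c \<le> length b" "\<And>l. i \<le> l \<Longrightarrow> l < i + c \<Longrightarrow> entry b l = 2"
    "i = 2 \<or> entry b (i - 1) \<noteq> 2" "i + c = length b \<or> entry b (i + c) \<noteq> 2"
    by (auto simp: two_runs_def)
  have "j \<le> i - 1 \<or> i + c \<le> j" if "j \<in> I0" for j
  proof (rule ccontr)
    assume "\<not> (j \<le> i - 1 \<or> i + c \<le> j)"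
    then have "entry b j = 2" "1 < j" "j < length b" using h(1-3) h(4)[of j] by auto
    then show False using that by (auto simp: I0_eq)
  qed
  moreover have "i - 1 \<in> I0" "i + c \<in> I0" using h by (auto simp: I0_eq)
  ultimately show "1 \<le> c \<and> 1 \<le> i \<and> adjacent_in I0 (i - 1) (i + c)" using h by (auto simp: adjacent_in_def)
next
  assume h: "1 \<le> c \<and> 1 \<le> i \<and> adjacent_in I0 (i - 1) (i + c)"
  have N: "Suc 0 < N" using length_pos by simp
  have "adjacent_in (Ins 0 N) (i - 1) (i + c)" using h by (simp add: I0_def)
  note A = adjacent_Ins[OF this N]
  have "Suc 0 \<le> i - 1 \<and> Suc (i + c) \<le> N" using A(5) h by auto
  moreover have "entry b l = 2" if "l \<in> {i..<i + c}" for l using A(4)[of l] h that by auto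
  ultimately show "(i, c) \<in> two_runs b" using A(6,7) h by (auto simp: two_runs_def)
qed

lemma two_runs_bounds: "(i, c) \<in> two_runs b \<Longrightarrow> 1 \<le> c \<and> 2 \<le> i \<and> i + c < N"
  by (auto simp: two_runs_def)

lemma run_indices_disjoint:
  assumes "r \<in> two_runs b" "r' \<in> two_runs b" "k \<in> run_indices r" "k \<in> run_indices r'"
  shows "r = r'"
proof -
  obtain i c i' c' where r: "r = (i, c)" "r' = (i', c')" by (cases r; cases r')
  have "i - 1 = i' - 1 \<and> i + c = i' + c'"
    by (rule adjacent_unique[of I0 _ _ _ _ k]) (use assms two_runs_iff in \<open>auto simp: r run_indices_def\<close>)
  then show ?thesis using assms(1,2) two_runs_iff by (auto simp: r)
qed

lemma run_indices_I0: "r \<in> two_runs b \<Longrightarrow> k \<in> run_indices r \<Longrightarrow> k \<notin> I0 \<and> k < N"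
proof -
  assume h: "r \<in> two_runs b" "k \<in> run_indices r"
  obtain i c where r: "r = (i, c)" by (cases r)
  have "1 \<le> c \<and> 2 \<le> i \<and> i + c < N" "adjacent_in I0 (i - 1) (i + c)" "i \<le> k" "k < i + c"
    using h two_runs_bounds[of i c] two_runs_iff[of i c] by (auto simp: r run_indices_def)
  then show "k \<notin> I0 \<and> k < N" unfolding adjacent_in_def by force
qed

lemma Jset_bounds: "D \<subseteq> two_runs b \<Longrightarrow> I0 \<subseteq> Jset D \<and> Jset D \<subseteq> {..N}"
  using index_set_I0 run_indices_I0 by (force simp: Jset_def index_set_def)

text \<open>An index missing from \<open>I0\<close> lies in a gap between adjacent elements, and
  such a gap is a run.\<close>

lemma Jset_all: "Jset (two_runs b) = {0, N} \<union> {1..length b}"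
proof
  show "Jset (two_runs b) \<subseteq> {0, N} \<union> {1..length b}" using Jset_bounds[of "two_runs b"] by fastforce
  show "{0, N} \<union> {1..length b} \<subseteq> Jset (two_runs b)"
  proof
    fix k assume k: "k \<in> {0, N} \<union> {1..length b}"
    show "k \<in> Jset (two_runs b)"
    proof (cases "k \<in> I0")
      case False
      then have kN: "k < N" using k ends_I0 by auto
      obtain a c where ac: "adjacent_in I0 a c" "a \<le> k" "k < c" using adjacent_cover[OF ends_I0, of k] kN by auto
      then have "a < k" using False by (cases "a = k") (auto simp: adjacent_in_def)
      then have "(Suc a, c - Suc a) \<in> two_runs b" "k \<in> run_indices (Suc a, c - Suc a)"
        using ac by (auto simp: two_runs_iff run_indices_def)
      then show ?thesis unfolding Jset_def by blast
    qed (simp add: Jset_def)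
  qed
qed

section \<open>One run, after the runs in \<open>D\<close> have been resolved\<close>

context
  fixes D i c
  assumes D: "D \<subseteq> two_runs b" and r: "(i, c) \<in> two_runs b" "(i, c) \<notin> D"
begin

text \<open>The state after \<open>j\<close> blow-ups of the run: its first \<open>j\<close> and
  last \<open>j\<close> vectors have been inserted.\<close>

definition Jstep :: "nat \<Rightarrow> nat set" where
  "Jstep j = Jset D \<union> {i..<i + j} \<union> {i + c - j..<i + c}"

lemmas ic = two_runs_bounds[OF r(1)]

lemma Jstep_bounds: "j \<le> c \<Longrightarrow> I0 \<subseteq> Jstep j \<and> Jstep j \<subseteq> {..N}"
  using Jset_bounds[OF D] ic by (auto simp: Jstep_def)

lemma Jstep_index: "j \<le> c \<Longrightarrow> index_set (Jstep j)" and Jstep_runs: "j \<le> c \<Longrightarrow> runs_in (Jstep j)"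
  by (simp_all add: Jstep_bounds index_set_superset runs_in_superset)

lemma run_not_in_Jset:
  assumes k: "i \<le> k" "k < i + c" shows "k \<notin> Jset D"
proof
  assume J: "k \<in> Jset D"
  have m: "k \<in> run_indices (i, c)" using k by (simp add: run_indices_def)
  have "k \<notin> I0" using run_indices_I0[OF r(1) m] by simp
  then obtain r' where r': "r' \<in> D" "k \<in> run_indices r'" using J by (auto simp: Jset_def)
  then have "(i, c) = r'" using D m by (intro run_indices_disjoint[OF r(1)]) auto
  then show False using r' r(2) by simp
qed

text \<open>The bound on \<open>j\<close> says \<open>2 * j < c\<close>, so at least one index is
  left between the vectors inserted at either end.\<close>

lemma Jstep_adjacent:
  assumes "j < (c + 1) div 2" shows "adjacent_in (Jstep j) (i + j - 1) (i + c - j)"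
proof -
  have e: "i - 1 \<in> I0" "i + c \<in> I0" using r(1) by (auto simp: two_runs_iff adjacent_in_def)
  have "i + j - 1 \<in> Jstep j" using e ic by (cases j) (auto simp: Jstep_def Jset_def)
  moreover have "i + c - j \<in> Jstep j" using e ic assms by (cases j) (auto simp: Jstep_def Jset_def)
  moreover have "k \<le> i + j - 1 \<or> i + c - j \<le> k" if k: "k \<in> Jstep j" for k
  proof (rule ccontr)
    assume n: "\<not> (k \<le> i + j - 1 \<or> i + c - j \<le> k)"
    then have "k \<notin> Jset D" using ic by (intro run_not_in_Jset) auto
    then show False using k n ic by (auto simp: Jstep_def)
  qed
  ultimately show ?thesis using assms ic by (auto simp: adjacent_in_def)
qed

lemma Jstep_gap: "j < (c + 1) div 2 \<Longrightarrow> Suc (i + j - 1) < i + c - j \<and> i + c - j \<le> N"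
  using ic by auto

lemma Jstep_two: "i + j - 1 < k \<Longrightarrow> k < i + c - j \<Longrightarrow> entry b k = 2"
proof -
  assume "i + j - 1 < k" "k < i + c - j"
  then have "k \<in> {i..<i + c}" using ic by auto
  then show "entry b k = 2" using r(1) unfolding two_runs_def by blast
qed

lemma Jstep_Suc:
  assumes "j < (c + 1) div 2" shows "Jstep j \<union> Ins (i + j - 1) (i + c - j) = Jstep (Suc j)"
proof -
  have "Ins (i + j - 1) (i + c - j) = {i + j - 1, i + j, i + c - j - 1, i + c - j}"
    using Jstep_two[of j] ic by (auto simp: Ins_def)
  moreover have "i + j - 1 \<in> Jstep j" "i + c - j \<in> Jstep j" using Jstep_adjacent[OF assms] by (auto simp: adjacent_in_def)
  moreover have "Jstep (Suc j) = Jstep j \<union> {i + j, i + c - j - 1}" using assms ic by (auto simp: Jstep_def)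
  ultimately show ?thesis by auto
qed

lemma Jstep_0: "Jstep 0 = Jset D"
  by (simp add: Jstep_def)

text \<open>The two halves cover the run, overlapping in the middle vector when \<open>c\<close> is
  odd.\<close>

lemma Jstep_last: "Jstep ((c + 1) div 2) = Jset (insert (i, c) D)"
  using ic by (auto simp: Jstep_def Jset_def run_indices_def)

lemma run_point:
  "j < (c + 1) div 2 \<Longrightarrow> orbit_point (run_cone b (i, c) j) = vertex_ring (Gam (i + j - 1) (i + c - j))"
  unfolding run_cone_def prod.case using Jstep_gap[of j] by (intro orbit_point_pair) auto

lemma run_blowups:
  "j \<le> (c + 1) div 2 \<Longrightarrow>
     blowups (TV (Jset D)) (map (\<lambda>j. orbit_point (run_cone b (i, c) j)) [0..<j]) = (TV (Jstep j) :: 'k::field ratfun set set)"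
proof (induction j)
  case 0
  then show ?case by (simp add: blowups_def Jstep_0)
next
  case (Suc j)
  then have j: "j < (c + 1) div 2" "j \<le> c" using ic by auto
  have "blowups (TV (Jset D)) (map (\<lambda>j. orbit_point (run_cone b (i, c) j)) [0..<Suc j]) =
      (blowup_at (TV (Jstep j)) (vertex_ring (Gam (i + j - 1) (i + c - j))) :: 'k ratfun set set)"
    using Suc.IH j(1) by (simp add: blowups_append run_point[OF j(1)] del: One_nat_def) (simp add: blowups_def)
  also have "\<dots> = TV (Jstep (Suc j))"
    using blowup_at_vertex[OF Jstep_index[OF j(2)] Jstep_adjacent[OF j(1)]] Jstep_gap[OF j(1)] Jstep_Suc[OF j(1)] by simp
  finally show ?case .
qed

text \<open>Domination confines the cone to that of the original run, where the only remaining gap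
  is the middle one.\<close>

lemma run_singular_points:
  assumes j: "j \<le> (c + 1) div 2"
  shows "{Q \<in> singular_points (TV (Jstep j) :: 'k::field ratfun set set). dominates Q (orbit_point (run_cone b (i, c) 0))} =
    (if j < (c + 1) div 2 then {orbit_point (run_cone b (i, c) j)} else {})"
proof -
  have jc: "j \<le> c" using j ic by auto
  have c0: "0 < (c + 1) div 2" using ic by auto
  note P0 = run_point[OF c0, where ?'a = 'k] and I = Jstep_index[OF jc]
  have i0: "i + 0 - 1 < i + c - 0" "i + c - 0 \<le> N" using ic by auto
  have "dominates Q (orbit_point (run_cone b (i, c) 0)) \<longleftrightarrow> j < (c + 1) div 2 \<and> l = i + j - 1 \<and> r = i + c - j"
    if Q: "Q = vertex_ring (Gam l r)" "adjacent_in (Jstep j) l r" "Suc l < r" for Q :: "'k ratfun set" and l r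
  proof -
    have lr: "l < r" "r \<le> N" using adjacent_le[OF I Q(2)] by auto
    have "dominates Q (orbit_point (run_cone b (i, c) 0)) \<longleftrightarrow> i - 1 \<le> l \<and> r \<le> i + c"
      unfolding P0 Q(1) using vertex_ring_dominates_iff[OF lr i0, where ?'k = 'k] by simp
    moreover have "j < (c + 1) div 2 \<and> l = i + j - 1 \<and> r = i + c - j" if h: "i - 1 \<le> l \<and> r \<le> i + c"
    proof -
      \<comment> \<open>The first interior index of the cone is not yet inserted; lying in the run,
        it lies in the middle gap and identifies the cone.\<close>
      have k: "Suc l \<notin> Jstep j" using Q(2,3) by (auto simp: adjacent_in_def)
      have kk: "i \<le> Suc l" "Suc l < i + c" using h Q(3) ic by auto
      then have "i + j \<le> Suc l" "Suc l < i + c - j" using k by (auto simp: Jstep_def)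
      then have jn: "j < (c + 1) div 2" by linarith
      then have "l = i + j - 1 \<and> r = i + c - j"
        using \<open>i + j \<le> Suc l\<close> \<open>Suc l < i + c - j\<close> Q(3) ic
        by (intro adjacent_unique[OF Q(2) Jstep_adjacent[OF jn], of "Suc l"]) auto
      then show ?thesis using jn by blast
    qed
    ultimately show ?thesis using ic by auto
  qed
  then have "{Q \<in> singular_points (TV (Jstep j) :: 'k ratfun set set). dominates Q (orbit_point (run_cone b (i, c) 0))} =
      {vertex_ring (Gam l r) | l r. (adjacent_in (Jstep j) l r \<and> Suc l < r) \<and> j < (c + 1) div 2 \<and> l = i + j - 1 \<and> r = i + c - j}"
    unfolding singular_points_TV[OF I Jstep_runs[OF jc]] by blast
  also have "\<dots> = (if j < (c + 1) div 2 then {orbit_point (run_cone b (i, c) j)} else {})"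
    using Jstep_adjacent[of j] Jstep_gap[of j] run_point[of j] by auto
  finally show ?thesis .
qed

lemma run_stage:
  assumes j: "j < (c + 1) div 2"
  shows "run_cone b (i, c) j \<in> fan_of (v ` Jstep j)" "\<not> simple_cone (run_cone b (i, c) j)"
    "rdp_type_A (c - 2 * j) (orbit_point (run_cone b (i, c) j) :: 'k::field ratfun set)"
    "v ` Jstep (Suc j) = v ` Jstep j \<union> {v (i + j), v (i + c - 1 - j)}"
    "card (v ` Jstep (Suc j) - v ` Jstep j) = (if c - 2 * j = 1 then 1 else 2)"
proof -
  have jc: "j \<le> c" "Suc j \<le> c" using j ic by auto
  note ad = Jstep_adjacent[OF j] and gap = Jstep_gap[OF j]
  show "run_cone b (i, c) j \<in> fan_of (v ` Jstep j)"
    unfolding run_cone_def prod.case by (rule adjacent_cone_in_fan[OF Jstep_index[OF jc(1)] ad])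
  show "\<not> simple_cone (run_cone b (i, c) j)"
    unfolding run_cone_def prod.case by (rule not_simple_run) (use gap in auto)
  \<comment> \<open>The number of chain vectors strictly inside the remaining cone, which is the
    index of its A-type.\<close>
  have eq: "c - 2 * j = i + c - j - (i + j - 1) - 1" using gap ic by linarith
  show "rdp_type_A (c - 2 * j) (orbit_point (run_cone b (i, c) j) :: 'k ratfun set)"
    unfolding run_point[OF j] eq by (rule rdp_run(1)) (use Jstep_two[of j] gap in auto)
  have J: "Jstep (Suc j) = Jstep j \<union> {i + j, i + c - 1 - j}" using j ic by (auto simp: Jstep_def)
  then show "v ` Jstep (Suc j) = v ` Jstep j \<union> {v (i + j), v (i + c - 1 - j)}" by auto
  have n: "k \<notin> Jstep j" if "i + j - 1 < k" "k < i + c - j" for k using ad that by (auto simp: adjacent_in_def)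
  have new: "i + j \<notin> Jstep j" "i + c - 1 - j \<notin> Jstep j" by (rule n; use gap ic in linarith)+
  have "v ` Jstep (Suc j) - v ` Jstep j = v ` (Jstep (Suc j) - Jstep j)"
    by (rule inj_on_image_set_diff[of v "{..N}", symmetric])
      (use v_inj Jstep_bounds[OF jc(1)] Jstep_bounds[OF jc(2)] in \<open>auto simp: inj_on_def\<close>)
  also have "Jstep (Suc j) - Jstep j = {i + j, i + c - 1 - j}" using J new by auto
  finally have eq: "v ` Jstep (Suc j) - v ` Jstep j = v ` {i + j, i + c - 1 - j}" .
  have "card (v ` {i + j, i + c - 1 - j}) = card {i + j, i + c - 1 - j}"
    using gap by (intro card_image inj_onI v_inj) auto
  also have "i + j = i + c - 1 - j \<longleftrightarrow> c - 2 * j = 1" using gap ic by linarith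
  then have "card {i + j, i + c - 1 - j} = (if c - 2 * j = 1 then 1 else 2)" by (simp add: card_insert_if)
  finally show "card (v ` Jstep (Suc j) - v ` Jstep j) = (if c - 2 * j = 1 then 1 else 2)" unfolding eq .
qed

end

text \<open>Each run sits in its own gap, so its centres remain points of the surface while other
  runs are treated, and the final index set does not depend on their order.\<close>

lemma all_run_blowups:
  assumes "distinct rs" "set rs \<subseteq> two_runs b"
  shows "blowups (TV I0) (concat (map (run_centres b) rs)) = (TV (Jset (set rs)) :: 'k::field ratfun set set)"
  using assms
proof (induction rs rule: rev_induct)
  case Nil
  then show ?case by (simp add: blowups_def Jset_def)
next
  case (snoc r rs)
  obtain i c where r: "r = (i, c)" by (cases r)
  have D: "set rs \<subseteq> two_runs b" "(i, c) \<in> two_runs b" "(i, c) \<notin> set rs" using snoc.prems r by auto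
  have centres: "run_centres b r = map (\<lambda>j. orbit_point (run_cone b (i, c) j)) [0..<(c + 1) div 2]"
    by (simp add: run_centres_def run_steps_def r ceiling_half)
  have "blowups (TV I0) (concat (map (run_centres b) (rs @ [r]))) = (blowups (TV (Jset (set rs))) (run_centres b r) :: 'k ratfun set set)"
    using snoc by (simp add: blowups_append)
  also have "\<dots> = TV (Jset (insert (i, c) (set rs)))"
    unfolding centres run_blowups[OF D order_refl] Jstep_last[OF D] ..
  finally show ?case by (simp add: r insert_commute)
qed

lemma vertex_blowup: "blowup_at (Spec (mon_alg (Gam 0 N))) (vertex_ring (Gam 0 N)) = (TV I0 :: 'k::field ratfun set set)"
proof -
  have I: "index_set {0, N}" by (simp add: index_set_def)
  have J: "{0, N} \<union> Ins 0 N = I0" using ends_I0 by (auto simp: I0_def)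
  have "blowup_at (TV {0, N}) (vertex_ring (Gam 0 N)) = (TV ({0, N} \<union> Ins 0 N) :: 'k ratfun set set)"
    by (rule blowup_at_vertex[OF I]) (use length_pos in \<open>simp_all add: adjacent_0_N\<close>)
  then show ?thesis unfolding J TV_0_N[OF zero_less_Suc] .
qed

lemma singular_points_I0:
  "bij_betw (\<lambda>r. orbit_point (run_cone b r 0)) (two_runs b) (singular_points (TV I0 :: 'k::field ratfun set set))"
proof -
  have pt: "orbit_point (run_cone b (i, c) 0) = (vertex_ring (Gam (i - 1) (i + c)) :: 'k ratfun set)" if "(i, c) \<in> two_runs b" for i c
    unfolding run_cone_def prod.case add_0_right diff_zero
    by (rule orbit_point_pair) (use two_runs_bounds[OF that] in auto)
  have sing: "singular_points (TV I0) = {(vertex_ring (Gam l r) :: 'k ratfun set) | l r. adjacent_in I0 l r \<and> Suc l < r}"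
    using singular_points_TV[OF index_set_I0 runs_in_superset] index_set_I0 by (auto simp: index_set_def)
  show ?thesis
    unfolding bij_betw_def sing
  proof
    show "inj_on (\<lambda>r. orbit_point (run_cone b r 0) :: 'k ratfun set) (two_runs b)"
    proof (rule inj_onI)
      fix r r' assume h: "r \<in> two_runs b" "r' \<in> two_runs b" "(orbit_point (run_cone b r 0) :: 'k ratfun set) = orbit_point (run_cone b r' 0)"
      obtain i c i' c' where r: "r = (i, c)" "r' = (i', c')" by (cases r; cases r')
      have "i - 1 = i' - 1 \<and> i + c = i' + c'"
        using h two_runs_bounds[of i c] two_runs_bounds[of i' c'] pt
        by (intro vertex_ring_eq_iff[where ?'k = 'k]) (auto simp: r)
      then show "r = r'" using h two_runs_bounds[of i c] two_runs_bounds[of i' c'] by (auto simp: r)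
    qed
    show "(\<lambda>r. orbit_point (run_cone b r 0)) ` two_runs b = {(vertex_ring (Gam l r) :: 'k ratfun set) | l r. adjacent_in I0 l r \<and> Suc l < r}"
    proof (intro equalityI subsetI)
      fix Q :: "'k ratfun set" assume "Q \<in> (\<lambda>r. orbit_point (run_cone b r 0)) ` two_runs b"
      then obtain i c where ic: "(i, c) \<in> two_runs b" "Q = orbit_point (run_cone b (i, c) 0)" by auto
      then have "Q = vertex_ring (Gam (i - 1) (i + c))" "adjacent_in I0 (i - 1) (i + c)" "Suc (i - 1) < i + c"
        using pt two_runs_iff two_runs_bounds by auto
      then show "Q \<in> {vertex_ring (Gam l r) | l r. adjacent_in I0 l r \<and> Suc l < r}" by blast
    next
      fix Q :: "'k ratfun set" assume "Q \<in> {vertex_ring (Gam l r) | l r. adjacent_in I0 l r \<and> Suc l < r}"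
      then obtain l r where lr: "Q = vertex_ring (Gam l r)" "adjacent_in I0 l r" "Suc l < r" by blast
      then have m: "(Suc l, r - Suc l) \<in> two_runs b" by (simp add: two_runs_iff)
      then have "Q = orbit_point (run_cone b (Suc l, r - Suc l) 0)" using pt[OF m] lr by simp
      then show "Q \<in> (\<lambda>r. orbit_point (run_cone b r 0)) ` two_runs b" using m by blast
    qed
  qed
qed

lemma two_runs_empty_iff: "two_runs b = {} \<longleftrightarrow> (\<forall>i. 1 < i \<and> i < length b \<longrightarrow> entry b i \<noteq> 2)"
proof
  assume e: "two_runs b = {}"
  show "\<forall>i. 1 < i \<and> i < length b \<longrightarrow> entry b i \<noteq> 2"
  proof (intro allI impI)
    fix i assume i: "1 < i \<and> i < length b"
    then have "i \<in> Jset (two_runs b)" unfolding Jset_all by auto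
    then show "entry b i \<noteq> 2" using e i by (auto simp: Jset_def I0_eq)
  qed
next
  assume h: "\<forall>i. 1 < i \<and> i < length b \<longrightarrow> entry b i \<noteq> 2"
  have False if "(i, c) \<in> two_runs b" for i c
    using that h[rule_format, of i] by (auto simp: two_runs_def)
  then show "two_runs b = {}" by auto
qed

end

theorem mainTheorem6:
  fixes p q :: int and b :: "int list" and s :: nat
    and \<sigma> :: "(real \<times> real) set"
    and V :: "'k::field_char_0 ratfun set set"
    and Orb :: "'k ratfun set"
    and v :: "nat \<Rightarrow> int \<times> int"
    and rays :: "nat set \<Rightarrow> (int \<times> int) set"
    and L :: "nat set"
  assumes "0 < p" and "p < q" and "coprime p q"
    and b: "hj_expansion b (of_int q / of_int (q - p))"
    and s: "s = length b"
    and \<sigma>: "\<sigma> = cone_of {(1, 0), (p, q)}"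
    and V: "V = affine_toric \<sigma>"
    and Orb: "Orb = orbit_point \<sigma>"
    and v: "v = hj_vec b"
    and rays: "rays = (\<lambda>M. {(1, 0), (p, q)} \<union> v ` M)"
    and L: "L = {1, s} \<union> {i. 1 < i \<and> i < s \<and> entry b i \<noteq> 2}"
  shows
    \<comment> \<open>The runs of 2's are treated in an arbitrary order \<open>rs\<close>. \<open>Y j\<close> is the surface after \<open>j\<close>
      blow-ups for the run \<open>(i, c)\<close>, and \<open>M j\<close> the set of indices of the vectors inserted so far.\<close>
    "blowup_at V Orb = toric_variety (fan_of (rays L)) \<and>
    bij_betw (\<lambda>r. orbit_point (run_cone b r 0)) (two_runs b) (singular_points (blowup_at V Orb)) \<and>
    (\<forall>(i, c)\<in>two_runs b. rdp_type_A c (orbit_point (run_cone b (i, c) 0) :: 'k ratfun set)) \<and>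
    (resolution (blowup_at V Orb) V \<longleftrightarrow> (\<forall>i. 1 < i \<and> i < s \<longrightarrow> entry b i \<noteq> 2)) \<and>
    (\<forall>rs rs' i c rs''. distinct rs \<and> set rs = two_runs b \<and> rs = rs' @ (i, c) # rs'' \<longrightarrow>
       (let X = blowups V (Orb # concat (map (run_centres b) rs'));
            P = (\<lambda>j. orbit_point (run_cone b (i, c) j));
            n = nat \<lceil>real c / 2\<rceil>;
            Y = (\<lambda>j. blowups X (map P [0..<j]));
            M = (\<lambda>j. L \<union> (\<Union>r\<in>set rs'. run_indices r) \<union> {i..<i + j} \<union> {i + c - j..<i + c})
        in (\<forall>j\<le>n. Y j = toric_variety (fan_of (rays (M j))) \<and>
              {Q \<in> singular_points (Y j). dominates Q (P 0)} = (if j < n then {P j} else {})) \<and>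
           (\<forall>j<n. run_cone b (i, c) j \<in> fan_of (rays (M j)) \<and>
              \<not> simple_cone (run_cone b (i, c) j) \<and>
              rdp_type_A (c - 2 * j) (P j) \<and>
              rays (M (Suc j)) = rays (M j) \<union> {v (i + j), v (i + c - 1 - j)} \<and>
              card (rays (M (Suc j)) - rays (M j)) = (if c - 2 * j = 1 then 1 else 2)))) \<and>
    (\<forall>rs. distinct rs \<and> set rs = two_runs b \<longrightarrow>
       blowups V (Orb # concat (map (run_centres b) rs)) = toric_variety (fan_of (rays {1..s}))) \<and>
    resolution (toric_variety (fan_of (rays {1..s}))) V"
proof -
  have nonempty: "b \<noteq> []" "\<forall>e\<in>set b. 2 \<le> e" using b by (auto simp: hj_expansion_def)
  interpret hj_chain b by unfold_locales (use nonempty in auto)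
  note [simp del] = One_nat_def
  let ?N = "Suc (length b)"
  have vN: "hj_vec b ?N = (p, q)"
    by (rule hj_vec_expansion_end[OF \<open>0 < p\<close> \<open>p < q\<close> \<open>coprime p q\<close> b])
  \<comment> \<open>\<open>rays\<close> adds the two edge vectors separately; here they become the
    indices 0 and \<open>?N\<close> of the chain.\<close>
  have raysM: "rays M = hj_vec b ` ({0, ?N} \<union> M)" for M
    unfolding rays v using vN by (simp del: hj_vec.simps(3))
  have sig: "\<sigma> = cone_of {hj_vec b 0, hj_vec b ?N}" unfolding \<sigma> vN by simp
  have Veq: "V = Spec (mon_alg (Gam 0 ?N))"
    unfolding V sig affine_toric_def toric_algebra_eq dual_semigroup_cone_of_pair ..
  have Oeq: "Orb = vertex_ring (Gam 0 ?N)" unfolding Orb sig by (rule orbit_point_pair) auto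
  have I0L: "{0, ?N} \<union> L = I0" unfolding L s I0_eq ..
  have blow: "blowup_at V Orb = TV I0" unfolding Veq Oeq by (rule vertex_blowup)
  have blows: "blowups V (Orb # Ps) = blowups (TV I0) Ps" for Ps by (simp add: blowups_def blow)
  have fan: "toric_variety (fan_of (rays M)) = (TV ({0, ?N} \<union> M) :: 'k ratfun set set)"
    if "index_set ({0, ?N} \<union> M)" for M
    unfolding raysM by (rule toric_variety_fan[OF that])

  have part1: "blowup_at V Orb = toric_variety (fan_of (rays L))"
    using fan[of L] index_set_I0 unfolding I0L blow by simp
  have part2: "bij_betw (\<lambda>r. orbit_point (run_cone b r 0)) (two_runs b) (singular_points (blowup_at V Orb))"
    unfolding blow by (rule singular_points_I0)
  have part3: "\<forall>(i, c)\<in>two_runs b. rdp_type_A c (orbit_point (run_cone b (i, c) 0) :: 'k ratfun set)"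
  proof clarify
    fix i c assume ic: "(i, c) \<in> two_runs b"
    then have "0 < (c + 1) div 2" using two_runs_bounds[OF ic] by auto
    from run_stage(3)[OF empty_subsetI ic _ this]
    show "rdp_type_A c (orbit_point (run_cone b (i, c) 0) :: 'k ratfun set)" by simp
  qed
  have part4: "resolution (blowup_at V Orb) V \<longleftrightarrow> (\<forall>i. 1 < i \<and> i < s \<longrightarrow> entry b i \<noteq> 2)"
  proof -
    have "singular_points (blowup_at V Orb) = {} \<longleftrightarrow> two_runs b = {}"
      using part2 unfolding bij_betw_def by blast
    moreover have "modification (blowup_at V Orb) V"
      unfolding blow unfolding Veq by (rule modification_TV[OF index_set_I0])
    ultimately show ?thesis unfolding resolution_def two_runs_empty_iff s by simp
  qed
  have part5: "let X = blowups V (Orb # concat (map (run_centres b) rs'));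
            P = (\<lambda>j. orbit_point (run_cone b (i, c) j));
            n = nat \<lceil>real c / 2\<rceil>;
            Y = (\<lambda>j. blowups X (map P [0..<j]));
            M = (\<lambda>j. L \<union> (\<Union>r\<in>set rs'. run_indices r) \<union> {i..<i + j} \<union> {i + c - j..<i + c})
        in (\<forall>j\<le>n. Y j = toric_variety (fan_of (rays (M j))) \<and>
              {Q \<in> singular_points (Y j). dominates Q (P 0)} = (if j < n then {P j} else {})) \<and>
           (\<forall>j<n. run_cone b (i, c) j \<in> fan_of (rays (M j)) \<and>
              \<not> simple_cone (run_cone b (i, c) j) \<and>
              rdp_type_A (c - 2 * j) (P j) \<and>
              rays (M (Suc j)) = rays (M j) \<union> {v (i + j), v (i + c - 1 - j)} \<and>
              card (rays (M (Suc j)) - rays (M j)) = (if c - 2 * j = 1 then 1 else 2))"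
    if rs: "distinct rs \<and> set rs = two_runs b \<and> rs = rs' @ (i, c) # rs''" for rs rs' i c rs''
  proof -
    let ?n = "(c + 1) div 2" and ?P = "\<lambda>j. orbit_point (run_cone b (i, c) j) :: 'k ratfun set"
    let ?M = "\<lambda>j. L \<union> (\<Union>r\<in>set rs'. run_indices r) \<union> {i..<i + j} \<union> {i + c - j..<i + c}"
    have rs': "two_runs b = set (rs' @ (i, c) # rs'')" "distinct (rs' @ (i, c) # rs'')" using rs by metis+
    have D: "set rs' \<subseteq> two_runs b" "(i, c) \<in> two_runs b" unfolding rs'(1) by auto
    have D: "set rs' \<subseteq> two_runs b" "(i, c) \<in> two_runs b" "(i, c) \<notin> set rs'" "distinct rs'"
      using D rs'(2) by simp_all
    have X: "blowups V (Orb # concat (map (run_centres b) rs')) = TV (Jset (set rs'))"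
      unfolding blows by (rule all_run_blowups[OF D(4,1)])
    \<comment> \<open>The runs listed before \<open>(i, c)\<close> play the part of the resolved set
      \<open>D\<close>.\<close>
    have MJ: "{0, ?N} \<union> ?M j = Jstep (set rs') i c j" for j
      unfolding Jstep_def[OF D(1-3)] Jset_def I0L[symmetric] by (simp only: Un_assoc)
    have rJ: "rays (?M j) = hj_vec b ` Jstep (set rs') i c j" for j unfolding raysM MJ ..
    have Y: "blowups (TV (Jset (set rs'))) (map ?P [0..<j]) = toric_variety (fan_of (rays (?M j)))"
      "{Q \<in> singular_points (blowups (TV (Jset (set rs'))) (map ?P [0..<j])). dominates Q (?P 0)} =
        (if j < ?n then {?P j} else {})" if j: "j \<le> ?n" for j
    proof -
      have jc: "j \<le> c" using j two_runs_bounds[OF D(2)] by auto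
      show "blowups (TV (Jset (set rs'))) (map ?P [0..<j]) = toric_variety (fan_of (rays (?M j)))"
        unfolding run_blowups[OF D(1-3) j] rJ
        by (rule toric_variety_fan[OF Jstep_index[OF D(1-3) jc], symmetric])
      show "{Q \<in> singular_points (blowups (TV (Jset (set rs'))) (map ?P [0..<j])). dominates Q (?P 0)} =
        (if j < ?n then {?P j} else {})"
        unfolding run_blowups[OF D(1-3) j] by (rule run_singular_points[OF D(1-3) j])
    qed
    show ?thesis unfolding Let_def X ceiling_half v rJ
      by (intro conjI allI impI; (rule Y[unfolded rJ] | rule run_stage[OF D(1-3)]); assumption)
  qed
  have part6: "blowups V (Orb # concat (map (run_centres b) rs)) = toric_variety (fan_of (rays {1..s}))"
    if rs: "distinct rs" "set rs = two_runs b" for rs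
  proof -
    have "index_set ({0, ?N} \<union> {1..s})" using s by (auto simp: index_set_def)
    then show ?thesis
      unfolding blows by (subst all_run_blowups) (use rs in \<open>simp_all add: fan Jset_all s\<close>)
  qed
  have part7: "resolution (toric_variety (fan_of (rays {1..s}))) V"
  proof -
    have I: "index_set ({0, ?N} \<union> {1..s})" using s by (auto simp: index_set_def)
    have r: "runs_in ({0, ?N} \<union> {1..s})" using I s by (subst runs_in_iff) auto
    \<comment> \<open>With every index present there is no gap, so no cone can carry a singular
      point.\<close>
    have "\<not> (adjacent_in ({0, ?N} \<union> {1..s}) l r \<and> Suc l < r)" for l r
    proof
      assume h: "adjacent_in ({0, ?N} \<union> {1..s}) l r \<and> Suc l < r"
      then have "r \<le> ?N" using adjacent_le[OF I] by blast
      then have "Suc l \<in> {0, ?N} \<union> {1..s}" using h s by auto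
      then have "Suc l \<le> l \<or> r \<le> Suc l"
        using h[THEN conjunct1, unfolded adjacent_in_def] by (elim conjE) (erule bspec)
      then show False using h by linarith
    qed
    then have "singular_points (TV ({0, ?N} \<union> {1..s}) :: 'k ratfun set set) = {}"
      unfolding singular_points_TV[OF I r] by blast
    then show ?thesis unfolding resolution_def fan[OF I] Veq using modification_TV[OF I] by blast
  qed
  show ?thesis
    by (intro conjI allI impI part1 part2 part3 part4 part5 part6 part7; blast)
qed

end
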